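(* Let $n\geq 1$ be an integer, let $t\geq 2$ be real, and let $\alpha,\beta,\gamma\in\mathbb{R}$ be such that $$n-2\alpha>0,\qquad n-\beta>0,\qquad n-t\gamma>0,\qquad \gamma=\frac{1+\alpha}{t}+\frac{\beta}{2t}.$$ Then the inequality $$\int_{\mathbb{R}^n}\frac{|\Delta u|^2}{|x|^{2\alpha}}\,dx\int_{\mathbb{R}^n}\frac{|\nabla u|^{2(t-1)}}{|x|^{\beta}}\,dx\;\geq\;\Big(\frac{n+t(1+2\alpha-\gamma)}{t}\Big)^2\Big(\int_{\mathbb{R}^n}\frac{|\nabla u|^t}{|x|^{t\gamma}}\,dx\Big)^2$$ holds for every radial function $u\in H^2_{\alpha,\beta}(\mathbb{R}^n)$. Moreover, if in addition $$(1+2\alpha)(t-2)+1+\alpha-\frac{\beta}{2}>0,\qquad t<3+\alpha-\frac{\beta}{2},\qquad n+2\alpha>0,$$ and $$n-\beta<\frac{2(t-1)}{t-2}\Big(1+\alpha-\frac{\beta}{2}\Big)$$ (for $t=2$ the right-hand side is understood as $+\infty$, so that this last condition is vacuous), then the constant $\frac{(n+t(1+2\alpha-\gamma))^2}{t^2}$ is sharp and is attained, only up to a dilation and a multiplicative constant, by the function $$U_1(x)=\int_{|x|}^\infty s^{1+2\alpha}\exp\Big(-\frac{s^{1+\alpha-\frac{\beta}{2}}}{1+\alpha-\frac{\beta}{2}}\Big)\,ds$$ if $t=2$, and by the function $$U_2(x)=\int_{|x|}^\infty r^{1+2\alpha}\Big(1+(t-2)\frac{r^{(1+2\alpha)(t-2)+1+\alpha-\frac{\beta}{2}}}{(1+2\alpha)(t-2)+1+\alpha-\frac{\beta}{2}}\Big)^{\frac{1}{2-t}}\,dr$$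 if $t>2$.
   Context: Functions are real-valued. For $\alpha,\beta\in\mathbb{R}$ with $n-2\alpha>0$ and $n-\beta>0$, $H^2_{\alpha,\beta}(\mathbb{R}^n)$ denotes the second order Sobolev space which is the completion of $C_0^\infty(\mathbb{R}^n)$ under the norm $$\|u\|_{H^2_{\alpha,\beta}(\mathbb{R}^n)}=\Big(\int_{\mathbb{R}^n}|\Delta u|^2|x|^{-2\alpha}\,dx+\int_{\mathbb{R}^n}|\nabla u|^2|x|^{-\beta}\,dx\Big)^{1/2},\qquad u\in C_0^\infty(\mathbb{R}^n).$$ "Sharp" means that the constant cannot be replaced by a larger one in the inequality for radial functions.
   Formalization: For t>2 the conditions do not force U_2 into H^2_{α,β} (e.g. n=2, t=4, α=0, β=-3: ∫|∇U_2|^2|x|^{-β}dx diverges); equality for U_2 is stated in full, but its membership in H^2_{α,β} only when ∫|∇U_2|^2|x|^{-β}dx is finite. *)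

theory Defs
  imports "HOL-Analysis.Analysis"
begin

definition partial_deriv :: "'a::euclidean_space \<Rightarrow> ('a \<Rightarrow> real) \<Rightarrow> 'a \<Rightarrow> real" where
  "partial_deriv b f x = frechet_derivative f (at x) b"

definition grad :: "('a::euclidean_space \<Rightarrow> real) \<Rightarrow> 'a \<Rightarrow> 'a" where
  "grad f x = (\<Sum>b\<in>Basis. partial_deriv b f x *\<^sub>R b)"

definition laplacian :: "('a::euclidean_space \<Rightarrow> real) \<Rightarrow> 'a \<Rightarrow> real" where
  "laplacian f x = (\<Sum>b\<in>Basis. partial_deriv b (partial_deriv b f) x)"

primrec C_k :: "nat \<Rightarrow> ('a::euclidean_space \<Rightarrow> real) \<Rightarrow> bool" where
  "C_k 0 f \<longleftrightarrow> continuous_on UNIV f"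
| "C_k (Suc k) f \<longleftrightarrow> (\<forall>x. f differentiable (at x)) \<and> (\<forall>b\<in>Basis. C_k k (partial_deriv b f))"

definition test_function :: "('a::euclidean_space \<Rightarrow> real) \<Rightarrow> bool" where
  "test_function \<phi> \<longleftrightarrow> (\<forall>k. C_k k \<phi>) \<and> compact (closure {x. \<phi> x \<noteq> 0})"

definition radial :: "('a::euclidean_space \<Rightarrow> real) \<Rightarrow> bool" where
  "radial u \<longleftrightarrow> (\<forall>x y. norm x = norm y \<longrightarrow> u x = u y)"

text \<open>The weighted integrals take values in the extended nonnegative reals, so that a divergent
  integral is \<open>\<infinity>\<close>.  The value of the integrands at the origin is irrelevant.\<close>

definition lap_int :: "real \<Rightarrow> ('a::euclidean_space \<Rightarrow> real) \<Rightarrow> ennreal" where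
  "lap_int \<alpha> f = (\<integral>\<^sup>+x. ennreal (\<bar>f x\<bar>\<^sup>2 / norm x powr (2 * \<alpha>)) \<partial>lborel)"

definition grad_int :: "real \<Rightarrow> real \<Rightarrow> ('a::euclidean_space \<Rightarrow> 'a) \<Rightarrow> ennreal" where
  "grad_int p a V = (\<integral>\<^sup>+x. ennreal (norm (V x) powr p / norm x powr a) \<partial>lborel)"

text \<open>The square of the norm of $H^2_{\alpha,\beta}$, as a functional of the gradient \<open>V\<close> and
  the Laplacian \<open>f\<close>.\<close>

definition H2_norm_sq :: "real \<Rightarrow> real \<Rightarrow> ('a::euclidean_space \<Rightarrow> 'a) \<Rightarrow> ('a \<Rightarrow> real) \<Rightarrow> ennreal" where
  "H2_norm_sq \<alpha> \<beta> V f = lap_int \<alpha> f + grad_int 2 \<beta> V"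

text \<open>\<open>V\<close> is the distributional gradient of \<open>u\<close> away from the origin.  The origin is left out
  because the weights may degenerate there, and then neither \<open>u\<close> nor \<open>V\<close> need be locally
  integrable at \<open>0\<close>.\<close>

definition weak_gradient :: "('a::euclidean_space \<Rightarrow> real) \<Rightarrow> ('a \<Rightarrow> 'a) \<Rightarrow> bool" where
  "weak_gradient u V \<longleftrightarrow>
     (\<forall>K. compact K \<and> 0 \<notin> K \<longrightarrow> set_integrable lborel K u \<and> set_integrable lborel K V) \<and>
     (\<forall>\<phi>. test_function \<phi> \<and> 0 \<notin> closure {x. \<phi> x \<noteq> 0} \<longrightarrow>
        (\<forall>b\<in>Basis. (\<integral>x. u x * partial_deriv b \<phi> x \<partial>lborel) = - (\<integral>x. (V x \<bullet> b) * \<phi> x \<partial>lborel)))"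

text \<open>\<open>H2 \<alpha> \<beta> u V f\<close>: the function \<open>u\<close> belongs to $H^2_{\alpha,\beta}$, with $\nabla u = $ \<open>V\<close> and
  $\Delta u = $ \<open>f\<close>.  The map $\varphi \mapsto (\nabla\varphi, \Delta\varphi)$ is an isometry of the test functions
  into a product of weighted $L^2$ spaces, so their completion is the closure of its image,
  i.e. the set of the pairs \<open>(V, f)\<close> below.  Each such \<open>V\<close> is the gradient of a function \<open>u\<close>,
  which is what makes the element a function.  The norm only sees \<open>V\<close> and \<open>f\<close>, so two functions
  are the same element of the completion iff these agree almost everywhere.\<close>

definition H2 :: "real \<Rightarrow> real \<Rightarrow> ('a::euclidean_space \<Rightarrow> real) \<Rightarrow> ('a \<Rightarrow> 'a) \<Rightarrow> ('a \<Rightarrow> real) \<Rightarrow> bool" where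
  "H2 \<alpha> \<beta> u V f \<longleftrightarrow>
     u \<in> borel_measurable lborel \<and> V \<in> borel_measurable lborel \<and> f \<in> borel_measurable lborel \<and>
     weak_gradient u V \<and>
     (\<exists>\<phi>. (\<forall>k. test_function (\<phi> k)) \<and>
        (\<lambda>k::nat. H2_norm_sq \<alpha> \<beta> (\<lambda>x. grad (\<phi> k) x - V x) (\<lambda>x. laplacian (\<phi> k) x - f x))
          \<longlonglongrightarrow> 0)"

definition U1 :: "real \<Rightarrow> real \<Rightarrow> 'a::euclidean_space \<Rightarrow> real" where
  "U1 \<alpha> \<beta> x = (LBINT s:{norm x..}.
     s powr (1 + 2 * \<alpha>) * exp (- (s powr (1 + \<alpha> - \<beta> / 2) / (1 + \<alpha> - \<beta> / 2))))"

definition U2 :: "real \<Rightarrow> real \<Rightarrow> real \<Rightarrow> 'a::euclidean_space \<Rightarrow> real" where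
  "U2 t \<alpha> \<beta> x = (LBINT r:{norm x..}.
     r powr (1 + 2 * \<alpha>) *
     (1 + (t - 2) * (r powr ((1 + 2 * \<alpha>) * (t - 2) + 1 + \<alpha> - \<beta> / 2)
                      / ((1 + 2 * \<alpha>) * (t - 2) + 1 + \<alpha> - \<beta> / 2))) powr (1 / (2 - t)))"

end

theory Submission
  imports Defs "HOL-Real_Asymp.Real_Asymp"
begin

text \<open>
  In the variable \<open>s = ln |x|\<close> a radial element has \<open>\<nabla>u = G(s) |x|\<^sup>-\<^sup>n x\<close> and \<open>\<Delta>u = G'(s) |x|\<^sup>-\<^sup>n\<close>, so
  that with \<open>2m = n + 2\<alpha>\<close> and \<open>q = G e\<^sup>-\<^sup>2\<^sup>m\<^sup>s\<close> the three integrals become, up to the area of the sphere,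
  \<open>\<integral>G'\<^sup>2 e\<^sup>-\<^sup>2\<^sup>m\<^sup>s ds\<close>, \<open>B = \<integral>Y\<^sup>2 ds\<close> with \<open>Y = sgn q |q|\<^sup>t\<^sup>-\<^sup>1 e\<^sup>(\<^sup>L\<^sup>-\<^sup>m\<^sup>)\<^sup>s\<close>, and \<open>D = \<integral>|q|\<^sup>t e\<^sup>L\<^sup>s ds\<close>,
  where \<open>(L / t)\<^sup>2\<close> is the constant.  The boundary terms vanish, so the first integral equals
  \<open>\<integral>X\<^sup>2 ds\<close> for \<open>X = q' e\<^sup>m\<^sup>s\<close>, and integrating the derivative of \<open>|q|\<^sup>t e\<^sup>L\<^sup>s\<close> gives
  \<open>- t \<integral>X Y ds = L D\<close>.  The inequality is then the Cauchy-Schwarz inequality for \<open>X\<close> and \<open>Y\<close>.  Equality means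
  \<open>X = - \<tau> Y\<close>, which is the differential equation \<open>q' = - \<tau> sgn q |q|\<^sup>t\<^sup>-\<^sup>1 e\<^sup>(\<^sup>L\<^sup>-\<^sup>2\<^sup>m\<^sup>)\<^sup>s\<close>; its solutions of
  finite energy are the multiples and translates of the profile of \<open>U1\<close> or \<open>U2\<close>, and a translation
  in \<open>s\<close> is a dilation in \<open>x\<close>.
\<close>

section \<open>Primitives of locally integrable functions\<close>

text \<open>An element of \<open>H2\<close> is a limit of test functions that need not be radial,
  with nothing prescribed at the origin, so neither the radial form of \<open>V\<close> and
  \<open>f\<close> nor a pointwise link between them is given. Averaging over spheres produces the
  profiles, and pairing with truncated logarithms, which survives the limit, shows that one is a
  primitive of the other. \<open>V\<close> is radial because \<open>u\<close> is. For
  \<open>f\<close> this is not known beforehand: averaging can only lower its weighted norm, which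
  suffices for the inequality, and equality leaves no room for a loss. \<open>G\<close> is only
  locally absolutely continuous, hence \<open>primitive_of\<close> in place of derivatives. The
  passage from \<open>G\<close> to \<open>q\<close> decides the constant: the same argument with
  \<open>G' e^(-m s)\<close> for \<open>X\<close> would give \<open>L - 2 m t\<close> instead of
  \<open>L\<close>. For \<open>t > 2\<close> the gradient of \<open>U\<close> decays like a power of
  \<open>|x|\<close> and \<open>U\<close> may fail to lie in \<open>H2\<close>; sharpness is
  therefore read off from test functions that approximate \<open>U\<close> in the three integrals
  separately. The upper bound on \<open>n - \<beta>\<close> is the condition
  \<open>m (t - 2) < \<delta>\<close>, under which these integrals converge at infinity.\<close>

definition primitive_of :: "(real \<Rightarrow> real) \<Rightarrow> (real \<Rightarrow> real) \<Rightarrow> bool" where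
  "primitive_of F G \<longleftrightarrow> (\<forall>a b. set_integrable lborel {a..b} F) \<and>
     (\<forall>a b. a \<le> b \<longrightarrow> G b - G a = (LBINT s:{a..b}. F s))"

lemma primitive_ofD:
  assumes "primitive_of F G"
  shows "set_integrable lborel {a..b} F" "a \<le> b \<Longrightarrow> G b - G a = (LBINT s:{a..b}. F s)"
  using assms by (auto simp: primitive_of_def)

lemma set_integral_singleton_lborel [simp]:
  "(LBINT s:{a}. F s) = (0::real)" for F :: "real \<Rightarrow> real"
  unfolding set_lebesgue_integral_def
proof (rule integral_eq_zero_AE)
  show "AE x in lborel. indicat_real {a} x *\<^sub>R F x = 0"
    using AE_lborel_singleton[of a] by eventually_elim simp
qed

lemma set_integral_Icc_combine:
  fixes F :: "real \<Rightarrow> real"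
  assumes F: "\<And>a b. set_integrable lborel {a..b} F" and "a \<le> b" "b \<le> c"
  shows "(LBINT s:{a..c}. F s) = (LBINT s:{a..b}. F s) + (LBINT s:{b..c}. F s)"
proof -
  have e: "(LBINT s:{x..y}. F s) = integral {x..y} F" "F integrable_on {x..y}" for x y
    using set_borel_integral_eq_integral[OF F[of x y]] by auto
  show ?thesis unfolding e(1)
    using Henstock_Kurzweil_Integration.integral_combine[OF assms(2,3) e(2)] by simp
qed

lemma set_integral_Icc_sum:
  fixes F :: "real \<Rightarrow> real" and p :: "nat \<Rightarrow> real"
  assumes F: "\<And>a b. set_integrable lborel {a..b} F" and p: "\<And>i. p i \<le> p (Suc i)"
  shows "(LBINT s:{p 0..p N}. F s) = (\<Sum>i<N. LBINT s:{p i..p (Suc i)}. F s)"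
proof (induction N)
  case 0
  then show ?case by simp
next
  case (Suc N)
  have "p 0 \<le> p N" using p by (simp add: lift_Suc_mono_le)
  then show ?case using set_integral_Icc_combine[OF F, of "p 0" "p N" "p (Suc N)"] p Suc by simp
qed

lemma primitive_ofI_local:
  fixes k Z M :: "real \<Rightarrow> real"
  assumes k: "\<And>a b. set_integrable lborel {a..b} k"
    and M: "\<And>a b. set_integrable lborel {a..b} M"
    and loc: "\<And>a b \<epsilon>. \<epsilon> > 0 \<Longrightarrow> a < b \<Longrightarrow> \<exists>\<delta>>0. \<forall>x y. a \<le> x \<and> x \<le> y \<and> y \<le> b \<and> y - x < \<delta> \<longrightarrow>
        \<bar>Z y - Z x - (LBINT s:{x..y}. k s)\<bar> \<le> \<epsilon> * (LBINT s:{x..y}. M s)"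
  shows "primitive_of k Z"
  unfolding primitive_of_def
proof (intro conjI allI impI)
  fix a b :: real show "set_integrable lborel {a..b} k" by fact
  assume "a \<le> b"
  show "Z b - Z a = (LBINT s:{a..b}. k s)"
  proof (cases "a = b")
    case True
    then show ?thesis by simp
  next
    case False
    then have ab: "a < b" using \<open>a \<le> b\<close> by simp
    let ?J = "LBINT s:{a..b}. M s"
    have main: "\<bar>Z b - Z a - (LBINT s:{a..b}. k s)\<bar> \<le> \<epsilon> * ?J" if e0: "\<epsilon> > 0" for \<epsilon>
    proof -
      obtain \<delta> where \<delta>: "\<delta> > 0" and d: "\<And>x y. a \<le> x \<Longrightarrow> x \<le> y \<Longrightarrow> y \<le> b \<Longrightarrow> y - x < \<delta> \<Longrightarrow>
        \<bar>Z y - Z x - (LBINT s:{x..y}. k s)\<bar> \<le> \<epsilon> * (LBINT s:{x..y}. M s)"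
        using loc[OF e0 ab] by blast
      obtain N :: nat where N: "(b - a) / \<delta> < real N" using reals_Archimedean2 by blast
      have N0: "N > 0" using N ab \<delta> by (metis divide_pos_pos diff_gt_0_iff_gt less_trans of_nat_0_less_iff)
      define h where "h = (b - a) / real N"
      have h: "0 < h" "h < \<delta>" using N N0 ab \<delta> by (auto simp: h_def field_simps)
      define p where "p i = a + h * real i" for i
      have p0: "p 0 = a" and pN: "p N = b" using N0 by (auto simp: p_def h_def)
      have pS: "p i \<le> p (Suc i)" "p (Suc i) - p i = h" for i using h by (auto simp: p_def algebra_simps)
      have pm: "mono p" using pS by (simp add: incseq_SucI)
      have pb: "a \<le> p i" "p (Suc i) \<le> b" if "i < N" for i
        using monoD[OF pm, of 0 i] monoD[OF pm, of "Suc i" N] that p0 pN by auto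
      have "Z b - Z a - (LBINT s:{a..b}. k s)
          = (\<Sum>i<N. Z (p (Suc i)) - Z (p i) - (LBINT s:{p i..p (Suc i)}. k s))"
        using set_integral_Icc_sum[where p=p and F=k, OF k pS(1), of N]
          sum_lessThan_telescope[of "\<lambda>i. Z (p i)" N]
        by (simp add: p0 pN sum_subtractf)
      also have "\<bar>\<dots>\<bar> \<le> (\<Sum>i<N. \<bar>Z (p (Suc i)) - Z (p i) - (LBINT s:{p i..p (Suc i)}. k s)\<bar>)"
        by (rule sum_abs)
      also have "\<dots> \<le> (\<Sum>i<N. \<epsilon> * (LBINT s:{p i..p (Suc i)}. M s))"
        using d pb pS h by (intro sum_mono) auto
      also have "\<dots> = \<epsilon> * ?J"
        using set_integral_Icc_sum[where p=p and F=M, OF M pS(1), of N] by (simp add: p0 pN sum_distrib_left)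
      finally show ?thesis .
    qed
    have "\<bar>Z b - Z a - (LBINT s:{a..b}. k s)\<bar> \<le> 0"
    proof (rule field_le_epsilon)
      fix e :: real assume e: "e > 0"
      have "\<bar>Z b - Z a - (LBINT s:{a..b}. k s)\<bar> \<le> e / (\<bar>?J\<bar> + 1) * ?J"
        using e by (intro main) auto
      also have "\<dots> \<le> e" using e by (simp add: field_simps) (smt (verit) mult_left_mono)
      finally show "\<bar>Z b - Z a - (LBINT s:{a..b}. k s)\<bar> \<le> 0 + e" by simp
    qed
    then show ?thesis by simp
  qed
qed

lemma primitive_of_continuous:
  assumes "primitive_of F G"
  shows "continuous_on UNIV G"
proof -
  have "isCont G x" for x
  proof -
    note P = primitive_ofD[OF assms]
    have e: "G y = G (x-1) + integral {x-1..y} F" if "y \<in> {x-1..x+1}" for y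
      using P(2)[of "x-1" y] that set_borel_integral_eq_integral(2)[OF P(1)] by simp
    have "F integrable_on {x-1..x+1}" using set_borel_integral_eq_integral(1)[OF P(1)] by simp
    then have "continuous_on {x-1..x+1} (\<lambda>y. G (x-1) + integral {x-1..y} F)"
      by (intro continuous_intros indefinite_integral_continuous_1)
    then have "continuous_on {x-1..x+1} G"
      by (subst continuous_on_cong[OF refl e]) auto
    then show ?thesis by (rule continuous_on_interior) (simp add: interior_atLeastAtMost_real)
  qed
  then show ?thesis by (simp add: continuous_at_imp_continuous_on)
qed

lemma set_integrable_mult_continuous:
  fixes F c :: "real \<Rightarrow> real"
  assumes F: "set_integrable lborel {a..b} F" and c: "continuous_on UNIV c"
  shows "set_integrable lborel {a..b} (\<lambda>s. c s * F s)"
proof -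
  have "compact (c ` {a..b})" by (rule compact_continuous_image[OF continuous_on_subset[OF c]]) auto
  then obtain B where B: "\<And>s. s \<in> {a..b} \<Longrightarrow> \<bar>c s\<bar> \<le> B"
    using compact_imp_bounded by (fastforce simp: bounded_iff)
  have m: "c \<in> borel_measurable borel" using c by (rule borel_measurable_continuous_onI)
  have "integrable lborel (\<lambda>s. c s * (indicator {a..b} s * F s))"
  proof (rule Bochner_Integration.integrable_bound[where f="\<lambda>s. B * (indicator {a..b} s * F s)"])
    show "integrable lborel (\<lambda>s. B * (indicator {a..b} s * F s))"
      using F by (simp add: set_integrable_def)
    have "(\<lambda>s. indicator {a..b} s * F s) \<in> borel_measurable lborel"
      using F borel_measurable_integrable by (fastforce simp: set_integrable_def)
    then show "(\<lambda>s. c s * (indicator {a..b} s * F s)) \<in> borel_measurable lborel"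
      using m by (intro borel_measurable_times[of c]) auto
    show "AE s in lborel. norm (c s * (indicator {a..b} s * F s)) \<le> norm (B * (indicator {a..b} s * F s))"
      using B by (intro AE_I2) (auto simp: indicator_def abs_mult intro!: mult_right_mono intro: order_trans[OF _ abs_ge_self])
  qed
  then show ?thesis by (simp add: set_integrable_def mult_ac)
qed

lemma set_integral_mult_bound:
  fixes F c :: "real \<Rightarrow> real"
  assumes F: "set_integrable lborel {a..b} F" "set_integrable lborel {a..b} (\<lambda>s. c s * F s)"
    and c: "\<And>s. s \<in> {a..b} \<Longrightarrow> \<bar>c s\<bar> \<le> e"
  shows "\<bar>LBINT s:{a..b}. c s * F s\<bar> \<le> e * (LBINT s:{a..b}. \<bar>F s\<bar>)"
proof -
  have "\<bar>LBINT s:{a..b}. c s * F s\<bar> \<le> (LBINT s:{a..b}. \<bar>c s * F s\<bar>)"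
    using set_integral_norm_bound[OF F(2)] by simp
  also have "\<dots> \<le> (LBINT s:{a..b}. e * \<bar>F s\<bar>)"
    using c F by (intro set_integral_mono set_integrable_mult_right set_integrable_abs)
      (auto simp: abs_mult intro: mult_right_mono)
  finally show ?thesis by simp
qed

text \<open>On a short interval the mean value theorem gives the increment as
  \<open>\<phi>' \<xi>\<close> times the increment of \<open>G\<close>. Continuity of
  \<open>G\<close> makes \<open>\<xi>\<close> a value \<open>G \<sigma>\<close>, so the error is the
  integral of \<open>(\<phi>' (G \<sigma>) - \<phi>' (G s)) * F s\<close>, which is small against
  the integral of \<open>\<bar>F s\<bar>\<close> by uniform continuity.\<close>

lemma primitive_of_comp:
  assumes P: "primitive_of F G" and d: "\<And>g. (\<phi> has_real_derivative \<phi>' g) (at g)"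
    and c: "continuous_on UNIV \<phi>'"
  shows "primitive_of (\<lambda>s. \<phi>' (G s) * F s) (\<lambda>s. \<phi> (G s))"
proof (rule primitive_ofI_local[where M="\<lambda>s. \<bar>F s\<bar>"])
  note P' = primitive_ofD[OF P]
  have cG: "continuous_on UNIV G" by (rule primitive_of_continuous[OF P])
  have cc: "continuous_on UNIV (\<lambda>s. \<phi>' (G s))"
    by (rule continuous_on_compose2[OF c cG]) auto
  show 1: "set_integrable lborel {a..b} (\<lambda>s. \<phi>' (G s) * F s)" for a b
    by (rule set_integrable_mult_continuous[OF P'(1) cc])
  show "set_integrable lborel {a..b} (\<lambda>s. \<bar>F s\<bar>)" for a b
    by (intro set_integrable_abs P')
  fix a b \<epsilon> :: real assume \<epsilon>: "\<epsilon> > 0" and "a < b"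
  have "uniformly_continuous_on {a..b} (\<lambda>s. \<phi>' (G s))"
    by (intro compact_uniformly_continuous continuous_on_subset[OF cc]) auto
  then obtain \<delta> where \<delta>: "\<delta> > 0" "\<And>s \<sigma>. s \<in> {a..b} \<Longrightarrow> \<sigma> \<in> {a..b} \<Longrightarrow> \<bar>\<sigma> - s\<bar> < \<delta> \<Longrightarrow>
      \<bar>\<phi>' (G \<sigma>) - \<phi>' (G s)\<bar> < \<epsilon>"
    using \<epsilon> unfolding uniformly_continuous_on_def dist_real_def by metis
  have "\<bar>\<phi> (G y) - \<phi> (G x) - (LBINT s:{x..y}. \<phi>' (G s) * F s)\<bar> \<le> \<epsilon> * (LBINT s:{x..y}. \<bar>F s\<bar>)"
    if xy: "a \<le> x" "x \<le> y" "y \<le> b" "y - x < \<delta>" for x y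
  proof -
    obtain \<sigma> where \<sigma>: "\<sigma> \<in> {x..y}" "\<phi> (G y) - \<phi> (G x) = \<phi>' (G \<sigma>) * (G y - G x)"
    proof -
      have "\<exists>\<xi>\<in>closed_segment (G x) (G y). \<phi> (G y) - \<phi> (G x) = \<phi>' \<xi> * (G y - G x)"
      proof (cases "G x" "G y" rule: linorder_cases)
        case less
        then obtain z where "G x < z" "z < G y" "\<phi> (G y) - \<phi> (G x) = (G y - G x) * \<phi>' z"
          using MVT2[OF less, of \<phi> \<phi>'] d by blast
        then show ?thesis by (intro bexI[of _ z]) (auto simp: closed_segment_eq_real_ivl algebra_simps)
      next
        case greater
        then obtain z where "G y < z" "z < G x" "\<phi> (G x) - \<phi> (G y) = (G x - G y) * \<phi>' z"
          using MVT2[OF greater, of \<phi> \<phi>'] d by blast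
        then show ?thesis by (intro bexI[of _ z]) (auto simp: closed_segment_eq_real_ivl algebra_simps)
      qed auto
      then obtain \<xi> where \<xi>: "\<xi> \<in> closed_segment (G x) (G y)"
        "\<phi> (G y) - \<phi> (G x) = \<phi>' \<xi> * (G y - G x)" by blast
      have "connected (G ` {x..y})"
        by (intro connected_continuous_image continuous_on_subset[OF cG]) auto
      then have "closed_segment (G x) (G y) \<subseteq> G ` {x..y}"
        using connected_contains_Icc[of "G ` {x..y}" "G x" "G y"]
          connected_contains_Icc[of "G ` {x..y}" "G y" "G x"] xy
        by (simp add: closed_segment_eq_real_ivl)
      then show ?thesis using \<xi> that by blast
    qed
    have "\<phi> (G y) - \<phi> (G x) = (LBINT s:{x..y}. \<phi>' (G \<sigma>) * F s)"
      using \<sigma>(2) P'(2)[of x y] xy by simp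
    then have "\<phi> (G y) - \<phi> (G x) - (LBINT s:{x..y}. \<phi>' (G s) * F s)
        = (LBINT s:{x..y}. (\<phi>' (G \<sigma>) - \<phi>' (G s)) * F s)"
      using 1 P'(1) by (simp add: left_diff_distrib)
    also have "\<bar>\<dots>\<bar> \<le> \<epsilon> * (LBINT s:{x..y}. \<bar>F s\<bar>)"
      using 1 P'(1) \<sigma> xy \<delta>(2)[of _ \<sigma>]
      by (intro set_integral_mult_bound) (auto simp: left_diff_distrib intro!: less_imp_le \<delta>(2))
    finally show ?thesis .
  qed
  with \<delta>(1) show "\<exists>\<delta>>0. \<forall>x y. a \<le> x \<and> x \<le> y \<and> y \<le> b \<and> y - x < \<delta> \<longrightarrow>
      \<bar>\<phi> (G y) - \<phi> (G x) - (LBINT s:{x..y}. \<phi>' (G s) * F s)\<bar> \<le> \<epsilon> * (LBINT s:{x..y}. \<bar>F s\<bar>)" by blast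
qed

lemma primitive_of_mult:
  assumes P: "primitive_of F G" and Q: "primitive_of K H"
  shows "primitive_of (\<lambda>s. H s * F s + G s * K s) (\<lambda>s. G s * H s)"
proof (rule primitive_ofI_local[where M="\<lambda>s. \<bar>F s\<bar> + \<bar>K s\<bar>"])
  note P' = primitive_ofD[OF P] and Q' = primitive_ofD[OF Q]
  have c: "continuous_on UNIV G" "continuous_on UNIV H" using primitive_of_continuous P Q by auto
  have i: "set_integrable lborel {a..b} (\<lambda>s. H s * F s)" "set_integrable lborel {a..b} (\<lambda>s. G s * K s)" for a b
    using set_integrable_mult_continuous P'(1) Q'(1) c by blast+
  show "set_integrable lborel {a..b} (\<lambda>s. H s * F s + G s * K s)" for a b
    using i by (rule set_integral_add)
  show "set_integrable lborel {a..b} (\<lambda>s. \<bar>F s\<bar> + \<bar>K s\<bar>)" for a b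
    by (intro set_integral_add set_integrable_abs P' Q')
  fix a b \<epsilon> :: real assume \<epsilon>: "\<epsilon> > 0" and "a < b"
  have "uniformly_continuous_on {a..b} G" "uniformly_continuous_on {a..b} H"
    by (intro compact_uniformly_continuous continuous_on_subset[OF c(1)] continuous_on_subset[OF c(2)]; auto)+
  then obtain \<delta>1 \<delta>2 where \<delta>: "\<delta>1 > 0" "\<delta>2 > 0" "\<forall>s\<in>{a..b}. \<forall>\<sigma>\<in>{a..b}. dist \<sigma> s < \<delta>1 \<longrightarrow> dist (G \<sigma>) (G s) < \<epsilon>"
      "\<forall>s\<in>{a..b}. \<forall>\<sigma>\<in>{a..b}. dist \<sigma> s < \<delta>2 \<longrightarrow> dist (H \<sigma>) (H s) < \<epsilon>"
    using \<epsilon> unfolding uniformly_continuous_on_def by blast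
  have \<delta>': "\<bar>G \<sigma> - G s\<bar> \<le> \<epsilon>" "\<bar>H \<sigma> - H s\<bar> \<le> \<epsilon>"
    if "s \<in> {a..b}" "\<sigma> \<in> {a..b}" "\<bar>\<sigma> - s\<bar> < min \<delta>1 \<delta>2" for s \<sigma>
    using \<delta>(3)[rule_format, of s \<sigma>] \<delta>(4)[rule_format, of s \<sigma>] that by (auto simp: dist_real_def)
  have "\<bar>G y * H y - G x * H x - (LBINT s:{x..y}. H s * F s + G s * K s)\<bar>
      \<le> \<epsilon> * (LBINT s:{x..y}. \<bar>F s\<bar> + \<bar>K s\<bar>)"
    if xy: "a \<le> x" "x \<le> y" "y \<le> b" "y - x < min \<delta>1 \<delta>2" for x y
  proof -
    have "G y * H y - G x * H x = H y * (G y - G x) + G x * (H y - H x)" by (simp add: algebra_simps)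
    also have "\<dots> = (LBINT s:{x..y}. H y * F s) + (LBINT s:{x..y}. G x * K s)"
      using P'(2) Q'(2) xy by simp
    finally have "G y * H y - G x * H x - (LBINT s:{x..y}. H s * F s + G s * K s)
        = (LBINT s:{x..y}. (H y - H s) * F s) + (LBINT s:{x..y}. (G x - G s) * K s)"
      using i P'(1) Q'(1) by (simp add: left_diff_distrib)
    moreover have "\<bar>LBINT s:{x..y}. (H y - H s) * F s\<bar> \<le> \<epsilon> * (LBINT s:{x..y}. \<bar>F s\<bar>)"
      using i P'(1) xy by (intro set_integral_mult_bound) (auto simp: left_diff_distrib intro!: \<delta>')
    moreover have "\<bar>LBINT s:{x..y}. (G x - G s) * K s\<bar> \<le> \<epsilon> * (LBINT s:{x..y}. \<bar>K s\<bar>)"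
      using i Q'(1) xy by (intro set_integral_mult_bound) (auto simp: left_diff_distrib intro!: \<delta>')
    moreover have "(LBINT s:{x..y}. \<bar>F s\<bar> + \<bar>K s\<bar>) = (LBINT s:{x..y}. \<bar>F s\<bar>) + (LBINT s:{x..y}. \<bar>K s\<bar>)"
      using P'(1) Q'(1) by (intro set_integral_add set_integrable_abs)
    ultimately show ?thesis by (simp add: distrib_left)
  qed
  then show "\<exists>\<delta>>0. \<forall>x y. a \<le> x \<and> x \<le> y \<and> y \<le> b \<and> y - x < \<delta> \<longrightarrow>
      \<bar>G y * H y - G x * H x - (LBINT s:{x..y}. H s * F s + G s * K s)\<bar>
      \<le> \<epsilon> * (LBINT s:{x..y}. \<bar>F s\<bar> + \<bar>K s\<bar>)"
    using \<delta> by (intro exI[of _ "min \<delta>1 \<delta>2"]) auto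
qed

lemma primitive_of_C1:
  assumes "\<And>x. (G has_real_derivative F x) (at x)" "continuous_on UNIV F"
  shows "primitive_of F G"
  unfolding primitive_of_def
proof (intro conjI allI impI)
  show i: "set_integrable lborel {a..b} F" for a b
    using borel_integrable_atLeastAtMost'[OF continuous_on_subset[OF assms(2)]] by simp
  fix a b :: real assume ab: "a \<le> b"
  have "(F has_integral (G b - G a)) {a..b}"
    using ab assms(1) by (intro fundamental_theorem_of_calculus)
      (auto simp: has_real_derivative_iff_has_vector_derivative[symmetric] intro: DERIV_subset)
  then show "G b - G a = (LBINT s:{a..b}. F s)"
    using set_borel_integral_eq_integral(2)[OF i] by (simp add: integral_unique)
qed

lemma primitive_of_imp_DERIV:
  assumes P: "primitive_of F G" and c: "continuous_on UNIV F"
  shows "(G has_real_derivative F x) (at x)"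
proof -
  note P' = primitive_ofD[OF P]
  have "((\<lambda>y. integral {x-1..y} F) has_real_derivative F x) (at x within {x-1..x+1})"
    using continuous_on_subset[OF c] by (intro integral_has_real_derivative) auto
  then have "((\<lambda>y. G (x-1) + integral {x-1..y} F) has_real_derivative F x) (at x within {x-1..x+1})"
    by (auto intro!: derivative_eq_intros)
  moreover have "G (x-1) + integral {x-1..y} F = G y" if "y \<in> {x-1..x+1}" for y
    using P'(2)[of "x-1" y] that set_borel_integral_eq_integral(2)[OF P'(1)] by simp
  ultimately have "(G has_real_derivative F x) (at x within {x-1..x+1})"
    by (auto intro: has_field_derivative_transform_within[where d=1])
  then show ?thesis by (simp add: at_within_Icc_at)
qed

section \<open>Smooth functions and cut-offs\<close>

text \<open>The derivative is two-sided and enters as a witness valid on \<open>S\<close> only. For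
  open \<open>S\<close> the notion is thus local, and a function that is smooth on two overlapping
  half-lines can be glued, which the global \<open>C_k\<close> does not express. All radial test
  functions are built from such one-dimensional pieces.\<close>

primrec ck_on :: "nat \<Rightarrow> real set \<Rightarrow> (real \<Rightarrow> real) \<Rightarrow> bool" where
  "ck_on 0 S f \<longleftrightarrow> continuous_on S f"
| "ck_on (Suc k) S f \<longleftrightarrow> (\<exists>f'. (\<forall>x\<in>S. (f has_real_derivative f' x) (at x)) \<and> ck_on k S f')"

lemma ck_on_SucI:
  "(\<And>x. x \<in> S \<Longrightarrow> (f has_real_derivative f' x) (at x)) \<Longrightarrow> ck_on k S f' \<Longrightarrow> ck_on (Suc k) S f"
  by auto

lemma ck_on_SucE:
  assumes "ck_on (Suc k) S f"
  obtains f' where "\<And>x. x \<in> S \<Longrightarrow> (f has_real_derivative f' x) (at x)" "ck_on k S f'"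
  using assms by auto

lemma ck_on_cong:
  assumes "open S" "ck_on k S f" "\<And>x. x \<in> S \<Longrightarrow> f x = g x"
  shows "ck_on k S g"
proof (cases k)
  case 0 then show ?thesis using assms continuous_on_cong[of S S f g] by auto
next
  case (Suc m)
  then obtain f' where f': "\<And>x. x \<in> S \<Longrightarrow> (f has_real_derivative f' x) (at x)" "ck_on m S f'"
    using assms(2) by auto
  have "(g has_real_derivative f' x) (at x)" if "x \<in> S" for x
    using has_field_derivative_transform_within_open[OF f'(1)[OF that] assms(1) that] assms(3) by simp
  then show ?thesis using f'(2) Suc by auto
qed

lemma ck_on_Suc_imp: "ck_on (Suc k) S f \<Longrightarrow> ck_on k S f"
proof (induction k arbitrary: f)
  case 0
  then show ?case by (elim ck_on_SucE) (auto intro: DERIV_isCont continuous_at_imp_continuous_on)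
next
  case (Suc k)
  then obtain f' where f': "\<And>x. x \<in> S \<Longrightarrow> (f has_real_derivative f' x) (at x)" "ck_on (Suc k) S f'"
    by auto
  then show ?case using Suc.IH[OF f'(2)] by auto
qed

lemma ck_on_Suc_deriv:
  assumes "open S"
  shows "ck_on (Suc k) S f \<longleftrightarrow> (\<forall>x\<in>S. (f has_real_derivative deriv f x) (at x)) \<and> ck_on k S (deriv f)"
proof
  assume "ck_on (Suc k) S f"
  then obtain f' where f': "\<And>x. x \<in> S \<Longrightarrow> (f has_real_derivative f' x) (at x)" "ck_on k S f'" by auto
  then have "deriv f x = f' x" if "x \<in> S" for x using that by (simp add: DERIV_imp_deriv)
  then show "(\<forall>x\<in>S. (f has_real_derivative deriv f x) (at x)) \<and> ck_on k S (deriv f)"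
    using f' ck_on_cong[OF assms f'(2)] by simp
qed auto

lemma ck_on_Un:
  assumes "open S" "open T" "ck_on k S f" "ck_on k T f"
  shows "ck_on k (S \<union> T) f"
  using assms(3,4)
proof (induction k arbitrary: f)
  case 0 then show ?case using assms(1,2) by (auto intro: continuous_on_open_Un)
next
  case (Suc k)
  \<comment> \<open>The witnesses for the derivative on the two sets are unrelated;
    \<open>deriv f\<close> serves on both.\<close>
  then show ?case using assms(1,2) by (simp only: ck_on_Suc_deriv open_Un) blast
qed

lemma ck_on_const [simp]: "ck_on k S (\<lambda>x. c)"
proof (induction k arbitrary: c)
  case (Suc k) then show ?case by (auto intro!: exI[of _ "\<lambda>x. 0"])
qed auto

lemma ck_on_ident [simp]: "ck_on k S (\<lambda>x. x)"
  by (cases k) (auto intro!: exI[of _ "\<lambda>x. 1"])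

lemma ck_on_add: "ck_on k S f \<Longrightarrow> ck_on k S g \<Longrightarrow> ck_on k S (\<lambda>x. f x + g x)"
proof (induction k arbitrary: f g)
  case (Suc k)
  obtain f' where f': "\<And>x. x \<in> S \<Longrightarrow> (f has_real_derivative f' x) (at x)" "ck_on k S f'"
    using Suc.prems(1) by (rule ck_on_SucE) blast
  obtain g' where g': "\<And>x. x \<in> S \<Longrightarrow> (g has_real_derivative g' x) (at x)" "ck_on k S g'"
    using Suc.prems(2) by (rule ck_on_SucE) blast
  note d = f' g'
  then show ?case using Suc.IH[OF d(2,4)]
    by (auto intro!: exI[of _ "\<lambda>x. f' x + g' x"] derivative_eq_intros)
qed (auto intro: continuous_on_add)

lemma ck_on_mult: "ck_on k S f \<Longrightarrow> ck_on k S g \<Longrightarrow> ck_on k S (\<lambda>x. f x * g x)"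
proof (induction k arbitrary: f g)
  case (Suc k)
  obtain f' where f': "\<And>x. x \<in> S \<Longrightarrow> (f has_real_derivative f' x) (at x)" "ck_on k S f'"
    using Suc.prems(1) by (rule ck_on_SucE) blast
  obtain g' where g': "\<And>x. x \<in> S \<Longrightarrow> (g has_real_derivative g' x) (at x)" "ck_on k S g'"
    using Suc.prems(2) by (rule ck_on_SucE) blast
  note d = f' g'
  have "ck_on k S (\<lambda>x. f' x * g x + f x * g' x)"
    using Suc.IH[OF d(2)] Suc.IH[OF _ d(4)] ck_on_Suc_imp[OF Suc.prems(1)] ck_on_Suc_imp[OF Suc.prems(2)]
    by (intro ck_on_add) auto
  then show ?case using d(1,3)
    by (auto intro!: exI[of _ "\<lambda>x. f' x * g x + f x * g' x"] derivative_eq_intros)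
qed (auto intro: continuous_on_mult)

lemma ck_on_compose:
  "ck_on k T f \<Longrightarrow> ck_on k S g \<Longrightarrow> g ` S \<subseteq> T \<Longrightarrow> ck_on k S (\<lambda>x. f (g x))"
proof (induction k arbitrary: f)
  case 0 then show ?case by (auto intro: continuous_on_compose2)
next
  case (Suc k)
  obtain f' where f': "\<And>x. x \<in> T \<Longrightarrow> (f has_real_derivative f' x) (at x)" "ck_on k T f'"
    using Suc.prems(1) by (rule ck_on_SucE) blast
  obtain g' where g': "\<And>x. x \<in> S \<Longrightarrow> (g has_real_derivative g' x) (at x)" "ck_on k S g'"
    using Suc.prems(2) by (rule ck_on_SucE) blast
  note d = f' g'
  have "ck_on k S (\<lambda>x. f' (g x) * g' x)"
    using Suc.IH[OF d(2) ck_on_Suc_imp[OF Suc.prems(2)] Suc.prems(3)] d(4) by (rule ck_on_mult)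
  moreover have "((\<lambda>x. f (g x)) has_real_derivative f' (g x) * g' x) (at x)" if "x \<in> S" for x
    using DERIV_chain2[OF d(1) d(3)] that Suc.prems(3) by auto
  ultimately show ?case by (intro ck_on_SucI)
qed

lemma ck_on_exp [simp]: "ck_on k S exp"
  by (induction k) (auto intro!: continuous_intros DERIV_exp exI[of _ exp])

lemma ck_on_powr: "ck_on k {0<..} (\<lambda>x. x powr a)"
proof (induction k arbitrary: a)
  case (Suc k)
  have "ck_on k {0<..} (\<lambda>x. a * x powr (a - 1))" using Suc by (intro ck_on_mult) auto
  then show ?case by (auto intro!: exI[of _ "\<lambda>x. a * x powr (a - 1)"] has_real_derivative_powr)
qed (auto intro!: continuous_intros)

lemma ck_on_ln: "ck_on k {0<..} ln"
proof (cases k)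
  case (Suc m)
  have "ck_on m {0<..} (\<lambda>x. x powr (- 1))" by (rule ck_on_powr)
  then show ?thesis using Suc
    by (auto intro!: exI[of _ "\<lambda>x. x powr (- 1)"] derivative_eq_intros simp: powr_minus divide_inverse)
qed (auto intro!: continuous_intros)

text \<open>The powers \<open>x powr (- j)\<close> are carried along because the family is then
  closed under differentiation up to linear combinations, so that smoothness follows by one
  induction on \<open>k\<close> for all \<open>j\<close> at once.\<close>

definition bump_tail :: "real \<Rightarrow> real \<Rightarrow> real" where
  "bump_tail j x = (if x \<le> 0 then 0 else x powr (- j) * exp (- (1 / x)))"

lemma bump_tail_tendsto_0: "((\<lambda>x. bump_tail j x) \<longlongrightarrow> 0) (at 0)"
proof -
  have "((\<lambda>x. x powr (- j) * exp (- (1 / x))) \<longlongrightarrow> (0::real)) (at_right 0)" by real_asymp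
  then have "((\<lambda>x. bump_tail j x) \<longlongrightarrow> 0) (at_right 0)"
    by (rule Lim_transform_eventually) (auto simp: bump_tail_def eventually_at_right_less intro!: eventually_at_rightI[of 0 1])
  moreover have "((\<lambda>x. bump_tail j x) \<longlongrightarrow> 0) (at_left 0)"
    by (rule Lim_transform_eventually[OF tendsto_const])
      (auto simp: bump_tail_def intro!: eventually_at_leftI[of "-1" 0])
  ultimately show ?thesis by (simp add: filterlim_split_at)
qed

lemma bump_tail_DERIV:
  "(bump_tail j has_real_derivative (- j * bump_tail (j + 1) x + bump_tail (j + 2) x)) (at x)"
proof (cases x "0::real" rule: linorder_cases)
  case less
  have "((\<lambda>x. 0) has_real_derivative (- j * bump_tail (j + 1) x + bump_tail (j + 2) x)) (at x)"
    using less by (simp add: bump_tail_def)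
  then show ?thesis
    by (rule has_field_derivative_transform_within_open[where S="{..<0}"]) (use less in \<open>auto simp: bump_tail_def\<close>)
next
  case greater
  have "((\<lambda>x. x powr (- j) * exp (- (1 / x))) has_real_derivative (- j * bump_tail (j + 1) x + bump_tail (j + 2) x)) (at x)"
    using greater
    by (auto intro!: derivative_eq_intros simp: bump_tail_def field_simps powr_diff powr_add powr_minus power2_eq_square)
  then show ?thesis
    by (rule has_field_derivative_transform_within_open[where S="{0<..}"]) (use greater in \<open>auto simp: bump_tail_def\<close>)
next
  case equal
  have "(bump_tail j has_real_derivative 0) (at 0)"
    unfolding has_field_derivative_iff
  \<comment> \<open>The difference quotient of \<open>bump_tail j\<close> at the origin is
    \<open>bump_tail (j + 1)\<close> itself.\<close>
  proof (rule Lim_transform_eventually[OF bump_tail_tendsto_0[of "j + 1"]])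
    show "\<forall>\<^sub>F y in at 0. bump_tail (j + 1) y = (bump_tail j y - bump_tail j 0) / (y - 0)"
      by (auto simp: eventually_at_filter bump_tail_def powr_diff powr_add powr_minus field_simps)
  qed
  then show ?thesis using equal by (simp add: bump_tail_def)
qed

lemma ck_on_bump_tail: "ck_on k UNIV (bump_tail j)"
proof (induction k arbitrary: j)
  case 0 show ?case by (auto intro!: DERIV_isCont bump_tail_DERIV continuous_at_imp_continuous_on)
next
  case (Suc k)
  have "ck_on k UNIV (\<lambda>x. - j * bump_tail (j + 1) x + bump_tail (j + 2) x)"
    by (intro ck_on_add ck_on_mult Suc.IH ck_on_const)
  with bump_tail_DERIV show ?case by (rule ck_on_SucI)
qed

text \<open>The usual quotient that rises smoothly from 0 on \<open>{..0}\<close> to 1 on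
  \<open>{1..}\<close>. It is written with \<open>powr (- 1)\<close> so that smoothness comes from
  \<open>ck_on_powr\<close>; the base is positive because \<open>x\<close> and \<open>1 - x\<close>
  cannot both be nonpositive.\<close>

definition step :: "real \<Rightarrow> real" where
  "step x = bump_tail 0 x * (bump_tail 0 x + bump_tail 0 (1 - x)) powr (- 1)"

lemma bump_tail_nonneg: "bump_tail j x \<ge> 0" and bump_tail_pos: "x > 0 \<Longrightarrow> bump_tail j x > 0"
  by (auto simp: bump_tail_def)

lemma bump_tail_sum_pos: "bump_tail 0 x + bump_tail 0 (1 - x) > 0"
  using bump_tail_nonneg[of 0 x] bump_tail_nonneg[of 0 "1-x"] bump_tail_pos[of x 0] bump_tail_pos[of "1-x" 0]
  by (cases "x > 0") auto

lemma step_range: "0 \<le> step x" "step x \<le> 1"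
  using bump_tail_nonneg[of 0 x] bump_tail_nonneg[of 0 "1-x"] bump_tail_sum_pos[of x]
  by (auto simp: step_def powr_minus field_simps)

lemma step_0: "x \<le> 0 \<Longrightarrow> step x = 0"
  by (simp add: step_def bump_tail_def)

lemma step_1: "x \<ge> 1 \<Longrightarrow> step x = 1"
  using bump_tail_pos[of x 0] by (simp add: step_def bump_tail_def powr_minus)

lemma ck_on_step: "ck_on k UNIV step"
proof -
  have "ck_on k UNIV (\<lambda>x. 1 + (- 1) * x)" by (intro ck_on_add ck_on_mult) auto
  then have 1: "ck_on k UNIV (\<lambda>x. bump_tail 0 (1 - x))"
    using ck_on_compose[OF ck_on_bump_tail[of k 0], of UNIV "\<lambda>x. 1 + (- 1) * x"] by simp
  have "ck_on k UNIV (\<lambda>x. (bump_tail 0 x + bump_tail 0 (1 - x)) powr (- 1))"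
    using ck_on_compose[OF ck_on_powr[of k "-1"] ck_on_add[OF ck_on_bump_tail 1]] bump_tail_sum_pos by auto
  then show ?thesis unfolding step_def by (intro ck_on_mult ck_on_bump_tail)
qed

text \<open>For \<open>j > 0\<close> it vanishes off the open interval, and its transition layers at
  the two ends have width \<open>1 / j\<close>. As \<open>j\<close> grows it tends to the indicator
  of the open interval while staying between 0 and 1.\<close>

definition plateau :: "real \<Rightarrow> real \<Rightarrow> real \<Rightarrow> real \<Rightarrow> real" where
  "plateau j a b x = step (j * (x - a)) * step (j * (b - x))"

lemma ck_on_plateau: "ck_on k UNIV (plateau j a b)"
proof -
  have "ck_on k UNIV (\<lambda>x. j * (x + (- a)))" "ck_on k UNIV (\<lambda>x. j * (b + (- 1) * x))"
    by (intro ck_on_add ck_on_mult ck_on_const ck_on_ident)+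
  note l = this
  have "ck_on k UNIV (\<lambda>x. step (j * (x + (- a))) * step (j * (b + (- 1) * x)))"
    by (intro ck_on_mult ck_on_compose[OF ck_on_step l(1)] ck_on_compose[OF ck_on_step l(2)]) auto
  then show ?thesis by (simp add: plateau_def[abs_def])
qed

lemma plateau_range: "0 \<le> plateau j a b x" "plateau j a b x \<le> 1"
  unfolding plateau_def by (auto intro!: mult_nonneg_nonneg mult_le_one step_range)

lemma plateau_eq_0: "j > 0 \<Longrightarrow> x \<notin> {a<..<b} \<Longrightarrow> plateau j a b x = 0"
  using mult_nonneg_nonpos[of j "x - a"] mult_nonneg_nonpos[of j "b - x"]
  by (cases "x \<le> a") (auto simp: plateau_def step_0)

lemma plateau_tendsto: "(\<lambda>j. plateau (real j) a b x) \<longlonglongrightarrow> indicator {a<..<b} x"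
proof (cases "x \<in> {a<..<b}")
  case True
  have "\<forall>\<^sub>F j in sequentially. plateau (real j) a b x = 1"
  proof -
    have "\<forall>\<^sub>F j in sequentially. real j \<ge> 1 / (x - a)" "\<forall>\<^sub>F j in sequentially. real j \<ge> 1 / (b - x)"
      by real_asymp+
    then show ?thesis by eventually_elim (use True in \<open>simp add: plateau_def step_1 field_simps\<close>)
  qed
  then show ?thesis using True by (simp add: tendsto_eventually)
next
  case False
  have "\<forall>\<^sub>F j in sequentially. plateau (real j) a b x = 0"
    using eventually_gt_at_top[of 0] by eventually_elim (use False in \<open>auto intro!: plateau_eq_0\<close>)
  then show ?thesis using False by (simp add: tendsto_eventually)
qed

section \<open>Differential calculus of \<open>C_k\<close> functions and of test functions on
  Euclidean space\<close>

lemma C_kI: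
  fixes f :: "'a::euclidean_space \<Rightarrow> real"
  assumes "\<And>x. (f has_derivative f' x) (at x)" "\<And>b. b \<in> Basis \<Longrightarrow> C_k k (\<lambda>x. f' x b)"
  shows "C_k (Suc k) f"
proof -
  have "partial_deriv b f = (\<lambda>x. f' x b)" for b
    using frechet_derivative_at[OF assms(1)] by (simp add: partial_deriv_def[abs_def])
  then show ?thesis using assms by (auto simp: differentiable_def)
qed

lemma has_derivative_grad:
  fixes f :: "'a::euclidean_space \<Rightarrow> real"
  assumes "f differentiable (at x)"
  shows "(f has_derivative (\<lambda>h. grad f x \<bullet> h)) (at x)"
proof -
  have d: "(f has_derivative frechet_derivative f (at x)) (at x)"
    using assms by (simp add: frechet_derivative_works)
  then interpret l: linear "frechet_derivative f (at x)" by (rule has_derivative_linear)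
  have "frechet_derivative f (at x) h = grad f x \<bullet> h" for h
  proof -
    have "frechet_derivative f (at x) h = frechet_derivative f (at x) (\<Sum>b\<in>Basis. (h \<bullet> b) *\<^sub>R b)"
      by (simp add: euclidean_representation)
    also have "\<dots> = grad f x \<bullet> h"
      by (simp add: l.sum l.scale grad_def partial_deriv_def inner_sum_left inner_sum_right inner_commute mult.commute)
    finally show ?thesis .
  qed
  then have "frechet_derivative f (at x) = (\<lambda>h. grad f x \<bullet> h)" by blast
  then show ?thesis using d by simp
qed

lemma grad_eqI:
  fixes f :: "'a::euclidean_space \<Rightarrow> real"
  assumes "(f has_derivative (\<lambda>h. v \<bullet> h)) (at x)"
  shows "grad f x = v" "partial_deriv b f x = v \<bullet> b"
proof -
  have "frechet_derivative f (at x) = (\<lambda>h. v \<bullet> h)" using frechet_derivative_at[OF assms] by simp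
  then show "grad f x = v" "partial_deriv b f x = v \<bullet> b"
    by (simp_all add: grad_def partial_deriv_def euclidean_representation)
qed

lemma C_k_SucD:
  fixes f :: "'a::euclidean_space \<Rightarrow> real"
  assumes "C_k (Suc k) f"
  shows "(f has_derivative (\<lambda>h. grad f x \<bullet> h)) (at x)"
    "b \<in> Basis \<Longrightarrow> C_k k (\<lambda>x. grad f x \<bullet> b)"
proof -
  show "(f has_derivative (\<lambda>h. grad f x \<bullet> h)) (at x)" for x
    using assms by (intro has_derivative_grad) simp
  then have "partial_deriv b f = (\<lambda>x. grad f x \<bullet> b)" for b using grad_eqI(2) by blast
  then show "b \<in> Basis \<Longrightarrow> C_k k (\<lambda>x. grad f x \<bullet> b)" using assms by simp
qed

lemma C_k_Suc_imp: "C_k (Suc k) f \<Longrightarrow> C_k k f" for f :: "'a::euclidean_space \<Rightarrow> real"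
proof (induction k arbitrary: f)
  case 0
  then show ?case
    by (auto intro!: differentiable_imp_continuous_within continuous_at_imp_continuous_on)
next
  case (Suc k) then show ?case by simp
qed

lemma C_k_const [simp]: "C_k k (\<lambda>x::'a::euclidean_space. c)"
proof (induction k arbitrary: c)
  case (Suc k) show ?case by (rule C_kI[OF has_derivative_const]) (rule Suc)
qed simp

lemma C_k_add:
  fixes f g :: "'a::euclidean_space \<Rightarrow> real"
  shows "C_k k f \<Longrightarrow> C_k k g \<Longrightarrow> C_k k (\<lambda>x. f x + g x)"
proof (induction k arbitrary: f g)
  case (Suc k)
  show ?case
    by (rule C_kI[OF has_derivative_add[OF C_k_SucD(1)[OF Suc.prems(1)] C_k_SucD(1)[OF Suc.prems(2)]]])
      (intro Suc.IH C_k_SucD(2)[OF Suc.prems(1)] C_k_SucD(2)[OF Suc.prems(2)])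
qed (auto intro: continuous_on_add)

lemma C_k_mult:
  fixes f g :: "'a::euclidean_space \<Rightarrow> real"
  shows "C_k k f \<Longrightarrow> C_k k g \<Longrightarrow> C_k k (\<lambda>x. f x * g x)"
proof (induction k arbitrary: f g)
  case (Suc k)
  show ?case
    by (rule C_kI[OF has_derivative_mult[OF C_k_SucD(1)[OF Suc.prems(1)] C_k_SucD(1)[OF Suc.prems(2)]]])
      (intro C_k_add Suc.IH C_k_SucD(2)[OF Suc.prems(1)] C_k_SucD(2)[OF Suc.prems(2)]
         C_k_Suc_imp[OF Suc.prems(1)] C_k_Suc_imp[OF Suc.prems(2)])
qed (auto intro: continuous_on_mult)

lemma C_k_inner: "C_k k (\<lambda>x::'a::euclidean_space. x \<bullet> c)"
proof (cases k)
  case (Suc m)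
  have "((\<lambda>x::'a. x \<bullet> c) has_derivative (\<lambda>h. h \<bullet> c)) (at x)" for x
    by (auto intro!: derivative_eq_intros)
  then show ?thesis unfolding Suc by (rule C_kI) simp
qed (auto intro!: continuous_intros)

lemma C_k_sum:
  fixes f :: "'b \<Rightarrow> 'a::euclidean_space \<Rightarrow> real"
  assumes "\<And>i. i \<in> I \<Longrightarrow> C_k k (f i)"
  shows "C_k k (\<lambda>x. \<Sum>i\<in>I. f i x)"
  using assms by (induction I rule: infinite_finite_induct) (auto intro: C_k_add)

lemma C_k_prod:
  fixes f :: "'b \<Rightarrow> 'a::euclidean_space \<Rightarrow> real"
  assumes "\<And>i. i \<in> I \<Longrightarrow> C_k k (f i)"
  shows "C_k k (\<lambda>x. \<Prod>i\<in>I. f i x)"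
  using assms by (induction I rule: infinite_finite_induct) (auto intro: C_k_mult)

lemma C_k_compose:
  fixes g :: "'a::euclidean_space \<Rightarrow> real"
  shows "ck_on k UNIV \<Phi> \<Longrightarrow> C_k k g \<Longrightarrow> C_k k (\<lambda>x. \<Phi> (g x))"
proof (induction k arbitrary: \<Phi>)
  case 0 then show ?case by (auto intro: continuous_on_compose2)
next
  case (Suc k)
  obtain \<Phi>' where d: "\<And>x. (\<Phi> has_real_derivative \<Phi>' x) (at x)" "ck_on k UNIV \<Phi>'"
    using Suc.prems(1) by (auto elim: ck_on_SucE)
  have "((\<lambda>x. \<Phi> (g x)) has_derivative (\<lambda>h. \<Phi>' (g x) * (grad g x \<bullet> h))) (at x)" for x
    using has_derivative_compose[OF C_k_SucD(1)[OF Suc.prems(2)] d(1)[unfolded has_field_derivative_def]] .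
  then show ?case
    by (rule C_kI) (rule C_k_mult[OF Suc.IH[OF d(2) C_k_Suc_imp[OF Suc.prems(2)]] C_k_SucD(2)[OF Suc.prems(2)]])
qed

text \<open>Radial test functions are composed with \<open>x \<bullet> x\<close>, because the norm
  itself is not differentiable at the origin.\<close>

lemma C_k_norm_sq: "C_k k (\<lambda>x::'a::euclidean_space. x \<bullet> x)"
proof -
  have "C_k k (\<lambda>x::'a. \<Sum>b\<in>Basis. (x \<bullet> b) * (x \<bullet> b))" by (intro C_k_sum C_k_mult C_k_inner)
  then show ?thesis by (simp add: euclidean_inner[symmetric])
qed

lemma test_functionI:
  fixes \<phi> :: "'a::euclidean_space \<Rightarrow> real"
  assumes "\<And>k. C_k k \<phi>" "\<And>x. norm x > R \<Longrightarrow> \<phi> x = 0"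
  shows "test_function \<phi>"
proof -
  have "{x. \<phi> x \<noteq> 0} \<subseteq> cball 0 R" using assms(2) by (force simp: not_less)
  then have "bounded {x. \<phi> x \<noteq> 0}" using bounded_cball bounded_subset by blast
  then show ?thesis using assms(1) by (simp add: test_function_def)
qed

lemma test_functionD:
  fixes \<phi> :: "'a::euclidean_space \<Rightarrow> real"
  assumes "test_function \<phi>"
  shows "C_k k \<phi>" "continuous_on UNIV \<phi>" "(\<phi> has_derivative (\<lambda>h. grad \<phi> x \<bullet> h)) (at x)"
    "partial_deriv b \<phi> x = grad \<phi> x \<bullet> b" "\<exists>R>0. \<forall>x. norm x > R \<longrightarrow> \<phi> x = 0"
    "x \<notin> closure {x. \<phi> x \<noteq> 0} \<Longrightarrow> \<phi> x = 0"
    "x \<notin> closure {x. \<phi> x \<noteq> 0} \<Longrightarrow> grad \<phi> x = 0"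
proof -
  show C: "C_k k \<phi>" for k using assms by (simp add: test_function_def)
  show "continuous_on UNIV \<phi>" using C[of 0] by simp
  show d: "(\<phi> has_derivative (\<lambda>h. grad \<phi> x \<bullet> h)) (at x)" for x using C_k_SucD(1)[OF C[of 1, unfolded One_nat_def]] .
  show "partial_deriv b \<phi> x = grad \<phi> x \<bullet> b" by (rule grad_eqI(2)[OF d])
  obtain R where "\<forall>x\<in>closure {x. \<phi> x \<noteq> 0}. norm x \<le> R"
    using assms compact_imp_bounded by (metis test_function_def bounded_iff)
  then have R: "norm x \<le> R" if "x \<in> closure {x. \<phi> x \<noteq> 0}" for x using that by blast
  show 0: "\<phi> x = 0" if "x \<notin> closure {x. \<phi> x \<noteq> 0}" for x
    using that subsetD[OF closure_subset, of x "{x. \<phi> x \<noteq> 0}"] by auto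
  have "\<forall>x. norm x > max R 1 \<longrightarrow> \<phi> x = 0" using R 0 by (metis linorder_not_le max.cobounded1 order_trans)
  moreover have "max R 1 > 0" by linarith
  ultimately show "\<exists>R>0. \<forall>x. norm x > R \<longrightarrow> \<phi> x = 0" by blast
  assume x: "x \<notin> closure {x. \<phi> x \<noteq> 0}"
  have "(\<phi> has_derivative (\<lambda>h. 0 \<bullet> h)) (at x)"
  proof (rule has_derivative_transform_within_open[where f="\<lambda>x. 0" and s="- closure {x. \<phi> x \<noteq> 0}"])
    show "((\<lambda>x. 0) has_derivative (\<lambda>h. 0 \<bullet> h)) (at x)" by simp
    show "open (- closure {x. \<phi> x \<noteq> 0})" by (rule open_Compl[OF closed_closure])
    show "x \<in> - closure {x. \<phi> x \<noteq> 0}" using x by (simp only: Compl_iff not_False_eq_True)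
    show "0 = \<phi> y" if "y \<in> - closure {x. \<phi> x \<noteq> 0}" for y using 0[of y] that by (metis ComplD)
  qed
  then show "grad \<phi> x = 0" by (rule grad_eqI)
qed

lemma test_function_partial:
  fixes \<phi> :: "'a::euclidean_space \<Rightarrow> real"
  assumes "test_function \<phi>" "b \<in> Basis"
  shows "test_function (partial_deriv b \<phi>)"
    "closure {x. partial_deriv b \<phi> x \<noteq> 0} \<subseteq> closure {x. \<phi> x \<noteq> 0}"
proof -
  have "{x. partial_deriv b \<phi> x \<noteq> 0} \<subseteq> closure {x. \<phi> x \<noteq> 0}"
    using test_functionD(4,7)[OF assms(1)] by fastforce
  then show 1: "closure {x. partial_deriv b \<phi> x \<noteq> 0} \<subseteq> closure {x. \<phi> x \<noteq> 0}"
    by (rule closure_minimal) simp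
  have "compact (closure {x. partial_deriv b \<phi> x \<noteq> 0})"
    using compact_Int_closed[of "closure {x. \<phi> x \<noteq> 0}" "closure {x. partial_deriv b \<phi> x \<noteq> 0}"] assms(1) 1
    by (simp add: test_function_def Int_absorb1)
  moreover have "C_k k (partial_deriv b \<phi>)" for k using test_functionD(1)[OF assms(1), of "Suc k"] assms(2) by simp
  ultimately show "test_function (partial_deriv b \<phi>)" by (simp add: test_function_def)
qed

section \<open>Polar coordinates\<close>

definition sphere_area :: "'a::euclidean_space itself \<Rightarrow> real" where
  "sphere_area _ = real DIM('a) * unit_ball_vol (real DIM('a))"

lemma sphere_area_pos: "sphere_area TYPE('a::euclidean_space) > 0"
  by (simp add: sphere_area_def)

lemma lnorm_measurable [measurable]: "(\<lambda>x::'a::euclidean_space. ln (norm x)) \<in> borel_measurable borel"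
  by measurable

text \<open>Compact intervals determine both measures. The preimage of such an interval is an
  annulus, whose volume is a difference of two ball volumes, and differentiating in the end point
  gives the density. All later integrals in polar coordinates go through this image measure, without
  a measure on the sphere.\<close>

lemma polar_distr:
  "distr lborel borel (\<lambda>x::'a::euclidean_space. ln (norm x))
    = density lborel (\<lambda>s. ennreal (sphere_area TYPE('a) * exp (real DIM('a) * s)))" (is "?M = ?N")
proof (rule measure_eqI_generator_eq)
  let ?n = "real DIM('a)" and ?v = "unit_ball_vol (real DIM('a))"
  let ?E = "range (\<lambda>(a, b). {a..b::real})"
  show "Int_stable ?E" by (auto simp: Int_stable_def)
  show "?E \<subseteq> Pow UNIV" "sets ?M = sigma_sets UNIV ?E" "sets ?N = sigma_sets UNIV ?E"
    by (simp_all add: borel_eq_atLeastAtMost)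
  have M: "emeasure ?M {a..b} = ennreal (?v * exp (?n * b) - ?v * exp (?n * a))" if ab: "a \<le> b" for a b
  proof -
    have "emeasure ?M {a..b} = emeasure lborel {x::'a. a \<le> ln (norm x) \<and> ln (norm x) \<le> b}"
      by (subst emeasure_distr) (auto simp: vimage_def)
    also have "\<dots> = emeasure lborel (cball (0::'a) (exp b) - ball 0 (exp a))"
    \<comment> \<open>The two sets agree off the origin, whatever value \<open>ln\<close> takes at
      0.\<close>
    proof (rule emeasure_eq_AE)
      show "AE x in lborel. (x \<in> {x::'a. a \<le> ln (norm x) \<and> ln (norm x) \<le> b})
          = (x \<in> cball (0::'a) (exp b) - ball 0 (exp a))"
        using AE_lborel_singleton[of "0::'a"]
      proof eventually_elim
        case (elim x)
        then have "a \<le> ln (norm x) \<longleftrightarrow> exp a \<le> norm x" "ln (norm x) \<le> b \<longleftrightarrow> norm x \<le> exp b"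
          using ln_le_cancel_iff[of "norm x" "exp b"] by (auto simp: ln_ge_iff)
        then show ?case by auto
      qed
    qed auto
    also have "\<dots> = emeasure lborel (cball (0::'a) (exp b)) - emeasure lborel (ball (0::'a) (exp a))"
      using ab emeasure_ball[of "exp a" "0::'a"] by (intro emeasure_Diff)
        (auto intro: order_trans[OF less_imp_le])
    also have "\<dots> = ennreal (?v * exp (?n * b)) - ennreal (?v * exp (?n * a))"
      using emeasure_cball[of "exp b" "0::'a"] emeasure_ball[of "exp a" "0::'a"]
      by (simp add: exp_of_nat_mult)
    also have "\<dots> = ennreal (?v * exp (?n * b) - ?v * exp (?n * a))"
      by (rule ennreal_minus) simp
    finally show ?thesis .
  qed
  have N: "emeasure ?N {a..b} = ennreal (?v * exp (?n * b) - ?v * exp (?n * a))" if ab: "a \<le> b" for a b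
  proof -
    have "emeasure ?N {a..b} = (\<integral>\<^sup>+s. ennreal (sphere_area TYPE('a) * exp (?n * s)) * indicator {a..b} s \<partial>lborel)"
      by (subst emeasure_density) auto
    also have "\<dots> = ennreal (?v * exp (?n * b) - ?v * exp (?n * a))"
      by (rule nn_integral_FTC_Icc[OF _ _ _ ab])
        (auto intro!: derivative_eq_intros sphere_area_pos mult_nonneg_nonneg less_imp_le simp: sphere_area_def)
    finally show ?thesis .
  qed
  show "emeasure ?M X = emeasure ?N X" if X: "X \<in> ?E" for X
  proof -
    obtain a b where "X = {a..b}" using X by auto
    then show ?thesis using M[of a b] N[of a b] by (cases "a \<le> b") auto
  qed
  let ?A = "\<lambda>i::nat. {- real i..real i}"
  show "range ?A \<subseteq> ?E" by auto
  show "(\<Union>i. ?A i) = UNIV"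
  proof -
    have "\<exists>i. x \<in> ?A i" for x :: real
      using real_arch_simple[of "\<bar>x\<bar>"] by (auto simp: abs_le_iff) (metis minus_le_iff)
    then show ?thesis by auto
  qed
  show "emeasure ?M (?A i) \<noteq> \<infinity>" for i using M[of "- real i" "real i"] by simp
qed

lemma nn_integral_polar:
  assumes [measurable]: "h \<in> borel_measurable borel"
  shows "(\<integral>\<^sup>+(x::'a::euclidean_space). h (ln (norm x)) \<partial>lborel)
    = (\<integral>\<^sup>+s. ennreal (sphere_area TYPE('a) * exp (real DIM('a) * s)) * h s \<partial>lborel)"
proof -
  have "(\<integral>\<^sup>+(x::'a). h (ln (norm x)) \<partial>lborel) = (\<integral>\<^sup>+s. h s \<partial>distr lborel borel (\<lambda>x::'a. ln (norm x)))"
    by (subst nn_integral_distr) auto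
  also have "\<dots> = (\<integral>\<^sup>+s. ennreal (sphere_area TYPE('a) * exp (real DIM('a) * s)) * h s \<partial>lborel)"
    unfolding polar_distr by (subst nn_integral_density) auto
  finally show ?thesis .
qed

lemma
  fixes h :: "real \<Rightarrow> real"
  assumes [measurable]: "h \<in> borel_measurable borel"
  shows integrable_polar: "integrable lborel (\<lambda>x::'a::euclidean_space. h (ln (norm x)))
      \<longleftrightarrow> integrable lborel (\<lambda>s. exp (real DIM('a) * s) * h s)" (is ?i)
    and integral_polar: "(\<integral>(x::'a). h (ln (norm x)) \<partial>lborel)
    = sphere_area TYPE('a) * (\<integral>s. exp (real DIM('a) * s) * h s \<partial>lborel)" (is ?e)
proof -
  let ?w = "\<lambda>s. sphere_area TYPE('a) * exp (real DIM('a) * s)"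
  have p: "AE s in lborel. 0 \<le> ?w s" using sphere_area_pos[where 'a='a] by simp
  have "integrable lborel (\<lambda>x::'a. h (ln (norm x))) \<longleftrightarrow> integrable (distr lborel borel (\<lambda>x::'a. ln (norm x))) h"
    by (subst integrable_distr_eq) auto
  also have "\<dots> \<longleftrightarrow> integrable lborel (\<lambda>s. sphere_area TYPE('a) *\<^sub>R (exp (real DIM('a) * s) * h s))"
    unfolding polar_distr by (subst integrable_density[OF _ _ p]) (auto simp: mult_ac)
  also have "\<dots> \<longleftrightarrow> integrable lborel (\<lambda>s. exp (real DIM('a) * s) * h s)"
    using sphere_area_pos[where 'a='a] by simp
  finally show ?i .
  have "(\<integral>(x::'a). h (ln (norm x)) \<partial>lborel) = (\<integral>s. h s \<partial>distr lborel borel (\<lambda>x::'a. ln (norm x)))"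
    by (subst integral_distr) auto
  also have "\<dots> = (\<integral>s. sphere_area TYPE('a) * (exp (real DIM('a) * s) * h s) \<partial>lborel)"
    unfolding polar_distr by (subst integral_density[OF _ _ p]) (auto simp: mult_ac)
  finally show ?e by simp
qed

text \<open>The image measure of \<open>polar_distr\<close> has a density, so preimages of null sets
  of the line are null sets.\<close>

lemma AE_polar:
  assumes "AE s in lborel. P s"
  shows "AE (x::'a::euclidean_space) in lborel. P (ln (norm x))"
proof -
  obtain N where N: "{s. \<not> P s} \<subseteq> N" "N \<in> sets borel" "emeasure lborel N = 0"
    using assms by (auto elim!: AE_E)
  have "(\<integral>\<^sup>+s. ennreal (sphere_area TYPE('a) * exp (real DIM('a) * s)) * indicator N s \<partial>lborel) = 0"
    using N by (intro nn_integral_null_set) (auto simp: null_sets_def)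
  then have "(\<integral>\<^sup>+(x::'a). indicator N (ln (norm x)) \<partial>lborel) = 0"
    using N by (subst nn_integral_polar) auto
  then have "AE (x::'a) in lborel. indicator N (ln (norm x)) = (0::ennreal)"
    using N by (subst (asm) nn_integral_0_iff_AE) (auto intro!: measurable_compose[OF lnorm_measurable])
  then show ?thesis by eventually_elim (use N in \<open>auto simp: indicator_def split: if_splits\<close>)
qed

text \<open>The measure with density \<open>g\<close> is pushed forward by
  \<open>ln (norm x)\<close>, and Radon-Nikodym gives the density of the image, absolute continuity
  being \<open>AE_polar\<close>. This yields spherical averages without Fubini in polar coordinates.
  The bound \<open>loc\<close> makes the density finite almost everywhere, so that it can be taken
  real-valued.\<close>

lemma radial_density_nonneg:
  fixes g :: "'a::euclidean_space \<Rightarrow> real"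
  assumes [measurable]: "g \<in> borel_measurable borel" and g0: "\<And>x. g x \<ge> 0"
    and loc: "\<And>a b. (\<integral>\<^sup>+x. ennreal (g x) * indicator {a..b} (ln (norm x)) \<partial>lborel) < \<infinity>"
  obtains F :: "real \<Rightarrow> real" where "F \<in> borel_measurable borel" "\<And>s. F s \<ge> 0"
    "distr (density lborel (\<lambda>x. ennreal (g x))) borel (\<lambda>x. ln (norm x)) = density lborel (\<lambda>s. ennreal (F s))"
proof -
  let ?N = "distr (density lborel (\<lambda>x. ennreal (g x))) borel (\<lambda>x. ln (norm x))"
  have e: "emeasure ?N E = (\<integral>\<^sup>+x. ennreal (g x) * indicator E (ln (norm x)) \<partial>lborel)" if [measurable]: "E \<in> sets borel" for E
  proof -
    have [measurable]: "(\<lambda>x::'a. ln (norm x)) -` E \<in> sets borel"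
      using measurable_sets[OF lnorm_measurable, of E] by simp
    show ?thesis
      by (subst emeasure_distr, simp, simp, subst emeasure_density)
        (auto simp: indicator_def intro!: nn_integral_cong)
  qed
  have "absolutely_continuous lborel ?N"
    unfolding absolutely_continuous_def
  proof
    fix E assume E: "E \<in> null_sets (lborel :: real measure)"
    then have [measurable]: "E \<in> sets borel" by (auto simp: null_sets_def)
    have "AE s in lborel. s \<notin> E" using E by (rule AE_not_in)
    then have "AE (x::'a) in lborel. ln (norm x) \<notin> E" by (rule AE_polar)
    then have "(\<integral>\<^sup>+x. ennreal (g x) * indicator E (ln (norm x)) \<partial>lborel) = 0"
      by (subst nn_integral_0_iff_AE) (auto elim!: eventually_mono)
    then show "E \<in> null_sets ?N" using e[of E] by (auto simp: null_sets_def)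
  qed
  then obtain f where f[measurable]: "f \<in> borel_measurable borel" and fN: "density lborel f = ?N"
    using sigma_finite_measure.Radon_Nikodym[OF sigma_finite_lborel, of ?N] by auto
  have fin: "AE s in lborel. f s * indicator {- real i..real i} s \<noteq> \<infinity>" for i :: nat
  proof (rule nn_integral_PInf_AE)
    show "(\<integral>\<^sup>+s. f s * indicator {- real i..real i} s \<partial>lborel) \<noteq> \<infinity>"
      using loc[of "- real i" "real i"] e[of "{- real i..real i}"]
        emeasure_density[of f lborel "{- real i..real i}"] unfolding fN[symmetric] by simp
  qed auto
  then have "AE s in lborel. \<forall>i::nat. f s * indicator {- real i..real i} s \<noteq> \<infinity>"
    by (subst AE_all_countable) auto
  then have ae: "AE s in lborel. f s = ennreal (enn2real (f s))"
  proof eventually_elim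
    case (elim s)
    obtain i :: nat where "\<bar>s\<bar> \<le> real i" using real_arch_simple by blast
    then have "s \<in> {- real i..real i}" by (auto simp: abs_le_iff)
    then have "f s \<noteq> \<infinity>" using elim[rule_format, of i] by simp
    then show ?case by (simp add: less_top)
  qed
  have "?N = density lborel (\<lambda>s. ennreal (enn2real (f s)))"
    unfolding fN[symmetric] by (rule density_cong[OF _ _ ae]) auto
  then show ?thesis by (intro that[of "\<lambda>s. enn2real (f s)"]) auto
qed

text \<open>Up to the factor \<open>e\<^sup>n\<^sup>s\<close>, the function \<open>F\<close> is the average of \<open>g\<close> over the sphere of
  radius \<open>e\<^sup>s\<close>.\<close>

lemma radial_density:
  fixes g :: "'a::euclidean_space \<Rightarrow> real"
  assumes [measurable]: "g \<in> borel_measurable borel"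
    and loc: "\<And>a b. integrable lborel (\<lambda>x. g x * indicator {a..b} (ln (norm x)))"
  obtains F :: "real \<Rightarrow> real" where "F \<in> borel_measurable borel"
    "\<And>\<psi>. \<psi> \<in> borel_measurable borel \<Longrightarrow> integrable lborel (\<lambda>x. g x * \<psi> (ln (norm x))) \<Longrightarrow>
       integrable lborel (\<lambda>s. F s * \<psi> s) \<and>
       (\<integral>x. g x * \<psi> (ln (norm x)) \<partial>lborel) = sphere_area TYPE('a) * (\<integral>s. F s * \<psi> s \<partial>lborel)"
proof -
  have nn: "(\<integral>\<^sup>+x. ennreal (h x) * indicator {a..b} (ln (norm x)) \<partial>lborel) < \<infinity>"
    if h[measurable]: "h \<in> borel_measurable borel" "\<And>x. 0 \<le> h x" "\<And>x. h x \<le> \<bar>g x\<bar>" for h :: "'a \<Rightarrow> real" and a b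
  proof -
    have "(\<integral>\<^sup>+x. ennreal (h x) * indicator {a..b} (ln (norm x)) \<partial>lborel)
        \<le> (\<integral>\<^sup>+x. ennreal (norm (g x * indicator {a..b} (ln (norm x)))) \<partial>lborel)"
      using that by (intro nn_integral_mono) (auto simp: indicator_def intro!: ennreal_leI)
    also have "\<dots> < \<infinity>" using loc[of a b] by (simp add: integrable_iff_bounded)
    finally show ?thesis .
  qed
  obtain F1 where F1[measurable]: "F1 \<in> borel_measurable borel" and F1p: "\<And>s. F1 s \<ge> 0" and
    F1d: "distr (density lborel (\<lambda>x. ennreal (max 0 (g x)))) borel (\<lambda>x. ln (norm x)) = density lborel (\<lambda>s. ennreal (F1 s))"
    by (rule radial_density_nonneg[of "\<lambda>x. max 0 (g x)"], simp, simp, rule nn) auto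
  obtain F2 where F2[measurable]: "F2 \<in> borel_measurable borel" and F2p: "\<And>s. F2 s \<ge> 0" and
    F2d: "distr (density lborel (\<lambda>x. ennreal (max 0 (- g x)))) borel (\<lambda>x. ln (norm x)) = density lborel (\<lambda>s. ennreal (F2 s))"
    by (rule radial_density_nonneg[of "\<lambda>x. max 0 (- g x)"], simp, simp, rule nn) auto
  have main: "integrable lborel (\<lambda>s. F s * \<psi> s) \<and> (\<integral>x. h x * \<psi> (ln (norm x)) \<partial>lborel) = (\<integral>s. F s * \<psi> s \<partial>lborel)"
    if [measurable]: "h \<in> borel_measurable borel" "F \<in> borel_measurable borel" "\<psi> \<in> borel_measurable borel"
      and p: "\<And>x. h x \<ge> 0" "\<And>s. F s \<ge> 0"
      and d: "distr (density lborel (\<lambda>x. ennreal (h x))) borel (\<lambda>x. ln (norm x)) = density lborel (\<lambda>s. ennreal (F s))"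
      and i: "integrable lborel (\<lambda>x. h x * \<psi> (ln (norm x)))"
    for h :: "'a \<Rightarrow> real" and F \<psi> :: "real \<Rightarrow> real"
  proof -
    have "integrable (density lborel (\<lambda>x. ennreal (h x))) (\<lambda>x. \<psi> (ln (norm x)))"
      using i p by (subst integrable_density) auto
    then have "integrable (distr (density lborel (\<lambda>x. ennreal (h x))) borel (\<lambda>x. ln (norm x))) \<psi>"
      by (subst integrable_distr_eq) auto
    then have "integrable lborel (\<lambda>s. F s * \<psi> s)"
      unfolding d using p by (subst (asm) integrable_density) auto
    moreover have "(\<integral>x. h x * \<psi> (ln (norm x)) \<partial>lborel) = (\<integral>x. \<psi> (ln (norm x)) \<partial>density lborel (\<lambda>x. ennreal (h x)))"
      using p by (subst integral_density) auto
    moreover have "\<dots> = (\<integral>s. \<psi> s \<partial>distr (density lborel (\<lambda>x. ennreal (h x))) borel (\<lambda>x. ln (norm x)))"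
      by (subst integral_distr) auto
    moreover have "\<dots> = (\<integral>s. F s * \<psi> s \<partial>lborel)"
      unfolding d using p by (subst integral_density) auto
    ultimately show ?thesis by simp
  qed
  define A where "A = sphere_area TYPE('a)"
  have A: "A > 0" using sphere_area_pos by (auto simp: A_def)
  show ?thesis
  \<comment> \<open>The positive and negative parts of \<open>g\<close> have their own densities
    \<open>F1\<close> and \<open>F2\<close>; dividing by the area turns a total over a sphere into a
    mean, in accordance with the factor in \<open>integral_polar\<close>.\<close>
  proof (rule that[of "\<lambda>s. (F1 s - F2 s) / A"])
    show "(\<lambda>s. (F1 s - F2 s) / A) \<in> borel_measurable borel" by measurable
    fix \<psi> :: "real \<Rightarrow> real" assume [measurable]: "\<psi> \<in> borel_measurable borel"
      and i: "integrable lborel (\<lambda>x. g x * \<psi> (ln (norm x)))"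
    have i1: "integrable lborel (\<lambda>x. max 0 (g x) * \<psi> (ln (norm x)))"
      by (rule Bochner_Integration.integrable_bound[OF i]) (auto simp: abs_mult intro!: AE_I2 mult_right_mono)
    have i2: "integrable lborel (\<lambda>x. max 0 (- g x) * \<psi> (ln (norm x)))"
      by (rule Bochner_Integration.integrable_bound[OF i]) (auto simp: abs_mult intro!: AE_I2 mult_right_mono)
    note m1 = main[OF _ F1 _ _ F1p F1d i1] and m2 = main[OF _ F2 _ _ F2p F2d i2]
    have "(\<integral>x. g x * \<psi> (ln (norm x)) \<partial>lborel)
        = (\<integral>x. max 0 (g x) * \<psi> (ln (norm x)) - max 0 (- g x) * \<psi> (ln (norm x)) \<partial>lborel)"
      by (intro Bochner_Integration.integral_cong) (auto simp: max_def)
    also have "\<dots> = (\<integral>s. F1 s * \<psi> s - F2 s * \<psi> s \<partial>lborel)"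
      using m1 m2 i1 i2 by simp
    also have "\<dots> = A * (\<integral>s. (F1 s - F2 s) / A * \<psi> s \<partial>lborel)"
    proof -
      have "(\<lambda>s. (F1 s - F2 s) / A * \<psi> s) = (\<lambda>s. (F1 s * \<psi> s - F2 s * \<psi> s) / A)"
        by (auto simp: field_simps)
      then show ?thesis using A by simp
    qed
    finally have 1: "(\<integral>x. g x * \<psi> (ln (norm x)) \<partial>lborel) = A * (\<integral>s. (F1 s - F2 s) / A * \<psi> s \<partial>lborel)" .
    have "integrable lborel (\<lambda>s. (F1 s * \<psi> s - F2 s * \<psi> s) / A)" using m1 m2 by simp
    then have "integrable lborel (\<lambda>s. (F1 s - F2 s) / A * \<psi> s)" by (simp add: left_diff_distrib)
    with 1 show "integrable lborel (\<lambda>s. (F1 s - F2 s) / A * \<psi> s) \<and>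
       (\<integral>x. g x * \<psi> (ln (norm x)) \<partial>lborel) = sphere_area TYPE('a) * (\<integral>s. (F1 s - F2 s) / A * \<psi> s \<partial>lborel)"
      by (simp add: A_def)
  qed
qed

text \<open>Boxes are stable under intersection and generate the Borel sets, so by Dynkin's argument
  \<open>k\<close> integrates to 0 over every Borel set. The step for complements needs the integral
  over the whole space, which is a limit over growing boxes. Uniqueness of densities then gives the
  claim.\<close>

lemma AE_zero_of_box_integrals:
  fixes k :: "'a::euclidean_space \<Rightarrow> real"
  assumes k: "integrable lborel k" and box: "\<And>a b. (LINT x:box a b|lborel. k x) = 0"
  shows "AE x in lborel. k x = 0"
proof -
  have total: "(\<integral>x. k x \<partial>lborel) = 0"
  proof -
    have "(\<lambda>i. LINT x:box (- (real i *\<^sub>R One)) (real i *\<^sub>R One)|lborel. k x) \<longlonglongrightarrow> (\<integral>x. k x \<partial>lborel)"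
      unfolding set_lebesgue_integral_def
    proof (rule integral_dominated_convergence[where w="\<lambda>x. norm (k x)"])
      show "AE x in lborel. (\<lambda>i. indicat_real (box (- (real i *\<^sub>R One)) (real i *\<^sub>R One)) x *\<^sub>R k x) \<longlonglongrightarrow> k x"
      proof (rule AE_I2)
        fix x :: 'a
        obtain i0 :: nat where i0: "x \<in> box (- (real i0 *\<^sub>R One)) (real i0 *\<^sub>R One)"
          using UN_box_eq_UNIV by blast
        have bx: "x \<in> box (- (real i *\<^sub>R One)) (real i *\<^sub>R One)" if "i \<ge> i0" for i
          using i0 that by (force simp: mem_box inner_simps)
        then have "\<forall>\<^sub>F i in sequentially. indicat_real (box (- (real i *\<^sub>R One)) (real i *\<^sub>R One)) x *\<^sub>R k x = k x"
          by (intro eventually_sequentiallyI[of i0]) (simp add: bx)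
        then show "(\<lambda>i. indicat_real (box (- (real i *\<^sub>R One)) (real i *\<^sub>R One)) x *\<^sub>R k x) \<longlonglongrightarrow> k x"
          by (rule tendsto_eventually)
      qed
    qed (use k in \<open>auto simp: indicator_def intro!: borel_measurable_times borel_measurable_integrable\<close>)
    then show ?thesis using box by (simp add: LIMSEQ_const_iff)
  qed
  have si: "set_integrable lborel A k" if "A \<in> sets borel" for A
    using k that unfolding set_integrable_def by (intro integrable_mult_indicator) auto
  let ?E = "range (\<lambda>(a, b). box a b::'a set)"
  have "(LINT x:A|lborel. k x) = 0" if "A \<in> sets borel" for A
  proof -
    have s: "Int_stable ?E" "?E \<subseteq> Pow UNIV" "A \<in> sigma_sets UNIV ?E"
      using that by (auto simp: Int_stable_def box_Int_box borel_eq_box)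
    have b: "sigma_sets UNIV ?E = sets borel" by (simp add: borel_eq_box)
    from s show ?thesis
    proof (induction rule: sigma_sets_induct_disjoint)
      case (basic A) then show ?case using box by auto
    next
      case empty show ?case by (simp add: set_lebesgue_integral_def)
    next
      case (compl A)
      then have A: "A \<in> sets borel" by (simp add: b)
      have "(LINT x:(A \<union> (UNIV - A))|lborel. k x) = (LINT x:A|lborel. k x) + (LINT x:UNIV - A|lborel. k x)"
        using A by (intro set_integral_Un si) auto
      moreover have "(LINT x:(A \<union> (UNIV - A))|lborel. k x) = 0"
        using total by (simp add: set_lebesgue_integral_def)
      ultimately show ?case using compl by simp
    next
      case (union A)
      then have A: "\<And>i. A i \<in> sets borel" by (auto simp: b)
      then have "(LINT x:(\<Union>i. A i)|lborel. k x) = (\<Sum>i. (LINT x:(A i)|lborel. k x))"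
        using union.hyps(1) by (intro lebesgue_integral_countable_add si) (auto simp: disjoint_family_on_def)
      then show ?case using union.IH by simp
    qed
  qed
  then show ?thesis using density_unique_real[OF k, of "\<lambda>_. 0"] by simp
qed

section \<open>The fundamental lemma of the calculus of variations\<close>

lemma prod_plateau_tendsto:
  fixes x :: "'a::euclidean_space"
  shows "(\<lambda>j. \<Prod>i\<in>Basis. plateau (real j) (a \<bullet> i) (b \<bullet> i) (x \<bullet> i)) \<longlonglongrightarrow> indicator (box a b) x"
proof -
  have "indicator (box a b) x = (\<Prod>i\<in>Basis. indicat_real {a \<bullet> i<..<b \<bullet> i} (x \<bullet> i))"
    by (auto simp: indicator_def mem_box prod_zero_iff)
  then show ?thesis by (auto intro!: tendsto_prod plateau_tendsto)
qed

lemma prod_plateau_test_function: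
  fixes a b :: "'a::euclidean_space"
  assumes "j > 0"
  defines "\<phi> \<equiv> \<lambda>x. \<Prod>i\<in>Basis. plateau j (a \<bullet> i) (b \<bullet> i) (x \<bullet> i)"
  shows "test_function \<phi>" "{x. \<phi> x \<noteq> 0} \<subseteq> box a b" "0 \<le> \<phi> x" "\<phi> x \<le> 1"
proof -
  show s: "{x. \<phi> x \<noteq> 0} \<subseteq> box a b"
  proof
    fix x assume "x \<in> {x. \<phi> x \<noteq> 0}"
    then have "plateau j (a \<bullet> i) (b \<bullet> i) (x \<bullet> i) \<noteq> 0" if "i \<in> Basis" for i
      using that by (auto simp: \<phi>_def prod_zero_iff)
    then have "x \<bullet> i \<in> {a \<bullet> i<..<b \<bullet> i}" if "i \<in> Basis" for i
      using plateau_eq_0[OF assms(1)] that by metis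
    then show "x \<in> box a b" by (auto simp: mem_box)
  qed
  have "C_k k \<phi>" for k unfolding \<phi>_def
    by (intro C_k_prod C_k_compose[OF ck_on_plateau] C_k_inner)
  moreover have "compact (closure {x. \<phi> x \<noteq> 0})"
    using bounded_subset[OF bounded_box s] by simp
  ultimately show "test_function \<phi>" by (simp add: test_function_def)
  show "0 \<le> \<phi> x" "\<phi> x \<le> 1" unfolding \<phi>_def
    using plateau_range by (auto intro!: prod_nonneg prod_le_1)
qed

text \<open>Products of plateaus are test functions that converge boundedly to the indicator of a
  box, so dominated convergence passes from test functions to boxes, and
  \<open>AE_zero_of_box_integrals\<close> applies to \<open>k\<close> cut off to
  \<open>box a b\<close>.\<close>

lemma fundamental_lemma_box:
  fixes k :: "'a::euclidean_space \<Rightarrow> real"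
  assumes k: "set_integrable lborel (box a b) k"
    and t: "\<And>\<phi>. test_function \<phi> \<Longrightarrow> {x. \<phi> x \<noteq> 0} \<subseteq> box a b \<Longrightarrow> (\<integral>x. k x * \<phi> x \<partial>lborel) = 0"
  shows "AE x in lborel. x \<in> box a b \<longrightarrow> k x = 0"
proof -
  let ?k = "\<lambda>x. indicator (box a b) x * k x"
  have k': "integrable lborel ?k" using k by (simp add: set_integrable_def)
  have "AE x in lborel. ?k x = 0"
  proof (rule AE_zero_of_box_integrals[OF k'])
    fix c d :: 'a
    \<comment> \<open>An arbitrary box is first cut down to one inside \<open>box a b\<close>, where
      the plateaus are admissible in \<open>t\<close>.\<close>
    obtain e f where ef: "box c d \<inter> box a b = box e f" unfolding box_Int_box by blast
    define \<phi> where "\<phi> j x = (\<Prod>i\<in>Basis. plateau (real (Suc j)) (e \<bullet> i) (f \<bullet> i) (x \<bullet> i))" for j and x :: 'a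
    have \<phi>: "test_function (\<phi> j)" "{x. \<phi> j x \<noteq> 0} \<subseteq> box e f" "0 \<le> \<phi> j x" "\<phi> j x \<le> 1" for j x
      unfolding \<phi>_def[abs_def] by (rule prod_plateau_test_function; simp)+
    have [measurable]: "\<phi> j \<in> borel_measurable borel" for j
      by (rule borel_measurable_continuous_onI[OF test_functionD(2)[OF \<phi>(1)]])
    have [measurable]: "?k \<in> borel_measurable borel" using borel_measurable_integrable[OF k'] by simp
    have "(\<lambda>j. \<integral>x. ?k x * \<phi> j x \<partial>lborel) \<longlonglongrightarrow> (\<integral>x. ?k x * indicator (box e f) x \<partial>lborel)"
    proof (rule integral_dominated_convergence[where w="\<lambda>x. norm (?k x)"])
      show "AE x in lborel. (\<lambda>j. ?k x * \<phi> j x) \<longlonglongrightarrow> ?k x * indicator (box e f) x"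
        using LIMSEQ_Suc[OF prod_plateau_tendsto[of e f]] unfolding \<phi>_def by (intro AE_I2 tendsto_mult_left)
      show "AE x in lborel. norm (?k x * \<phi> j x) \<le> norm (?k x)" for j
        using \<phi>(3,4) by (intro AE_I2) (auto simp: abs_mult intro!: mult_right_le_one_le)
    qed (use k' in auto)
    moreover have "(\<integral>x. ?k x * \<phi> j x \<partial>lborel) = 0" for j
    proof -
      have "(\<integral>x. ?k x * \<phi> j x \<partial>lborel) = (\<integral>x. k x * \<phi> j x \<partial>lborel)"
        using \<phi>(2)[of j] ef by (intro Bochner_Integration.integral_cong) (auto simp: indicator_def)
      moreover have "{x. \<phi> j x \<noteq> 0} \<subseteq> box a b" using \<phi>(2)[of j] ef by blast
      ultimately show ?thesis using t[OF \<phi>(1)] by simp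
    qed
    ultimately have "(\<integral>x. ?k x * indicator (box e f) x \<partial>lborel) = 0" by (simp add: LIMSEQ_const_iff)
    moreover have "(\<integral>x. ?k x * indicator (box e f) x \<partial>lborel) = (LINT x:box c d|lborel. ?k x)"
      unfolding set_lebesgue_integral_def ef[symmetric]
      by (intro Bochner_Integration.integral_cong) (auto simp: indicator_def)
    ultimately show "(LINT x:box c d|lborel. ?k x) = 0" by simp
  qed
  then show ?thesis by eventually_elim auto
qed

text \<open>The complement of the origin is covered by countably many boxes whose closures avoid it.
  A test function that vanishes outside such a box has its support away from 0, so the version for
  boxes applies to each of them.\<close>

lemma fundamental_lemma_punctured:
  fixes k :: "'a::euclidean_space \<Rightarrow> real"
  assumes k: "\<And>K. compact K \<Longrightarrow> 0 \<notin> K \<Longrightarrow> set_integrable lborel K k"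
    and t: "\<And>\<phi>. test_function \<phi> \<Longrightarrow> 0 \<notin> closure {x. \<phi> x \<noteq> 0} \<Longrightarrow> (\<integral>x. k x * \<phi> x \<partial>lborel) = 0"
  shows "AE x in lborel. k x = 0"
proof -
  have b: "AE x in lborel. x \<in> box l u \<longrightarrow> k x = 0" if 0: "0 \<notin> cbox l u" for l u :: 'a
  proof (rule fundamental_lemma_box)
    have "set_integrable lborel (cbox l u) k" using 0 by (intro k) auto
    then show "set_integrable lborel (box l u) k"
      by (rule set_integrable_subset) (auto simp: box_subset_cbox)
    fix \<phi> :: "'a \<Rightarrow> real" assume p: "test_function \<phi>" "{x. \<phi> x \<noteq> 0} \<subseteq> box l u"
    have "closure {x. \<phi> x \<noteq> 0} \<subseteq> cbox l u"
      using p(2) box_subset_cbox by (intro closure_minimal) (auto intro: closed_cbox)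
    then show "(\<integral>x. k x * \<phi> x \<partial>lborel) = 0" using 0 by (intro t p) auto
  qed
  \<comment> \<open>The \<open>i\<close>-th coordinate of the lower corner is
    \<open>1 / (m + 1)\<close> and the others are \<open>- m\<close>, so \<open>Bp i m\<close> lies
    in the half-space of positive \<open>i\<close>-th coordinate; \<open>Bm i m\<close> is its
    mirror image.\<close>
  define Bp where "Bp i m = box ((1 / real (Suc m) + real m) *\<^sub>R i - real m *\<^sub>R One) (real m *\<^sub>R One)" for i :: 'a and m
  define Bm where "Bm i m = box (- (real m *\<^sub>R One)) (real m *\<^sub>R One - (1 / real (Suc m) + real m) *\<^sub>R i)" for i :: 'a and m
  have ip: "AE x in lborel. x \<in> Bp i m \<longrightarrow> k x = 0" and im: "AE x in lborel. x \<in> Bm i m \<longrightarrow> k x = 0"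
    if "i \<in> Basis" for i m
  proof -
    have p: "0 < ((1 / real (Suc m) + real m) *\<^sub>R i - real m *\<^sub>R One) \<bullet> i"
      and m: "(real m *\<^sub>R One - (1 / real (Suc m) + real m) *\<^sub>R i) \<bullet> i < 0"
      using that by (simp_all add: inner_diff_left)
    have "0 \<notin> cbox ((1 / real (Suc m) + real m) *\<^sub>R i - real m *\<^sub>R One) (real m *\<^sub>R One)"
    proof
      assume "0 \<in> cbox ((1 / real (Suc m) + real m) *\<^sub>R i - real m *\<^sub>R One) (real m *\<^sub>R One)"
      from this[unfolded mem_box(2), rule_format, OF that] p show False unfolding inner_zero_left by linarith
    qed
    then show "AE x in lborel. x \<in> Bp i m \<longrightarrow> k x = 0" unfolding Bp_def by (rule b)
    have "0 \<notin> cbox (- (real m *\<^sub>R One)) (real m *\<^sub>R One - (1 / real (Suc m) + real m) *\<^sub>R i)"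
    proof
      assume "0 \<in> cbox (- (real m *\<^sub>R One)) (real m *\<^sub>R One - (1 / real (Suc m) + real m) *\<^sub>R i)"
      from this[unfolded mem_box(2), rule_format, OF that] m show False unfolding inner_zero_left by linarith
    qed
    then show "AE x in lborel. x \<in> Bm i m \<longrightarrow> k x = 0" unfolding Bm_def by (rule b)
  qed
  have "AE x in lborel. \<forall>i\<in>Basis. \<forall>m. (x \<in> Bp i m \<longrightarrow> k x = 0) \<and> (x \<in> Bm i m \<longrightarrow> k x = 0)"
    using ip im by (intro AE_finite_allI) (auto simp: AE_all_countable)
  then show ?thesis
    using AE_lborel_singleton[of "0::'a"]
  proof eventually_elim
    case (elim x)
    then obtain i where i: "i \<in> Basis" "x \<bullet> i \<noteq> 0" using euclidean_all_zero_iff by blast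
    obtain m :: nat where m: "real m > norm x + 1 / \<bar>x \<bullet> i\<bar>" using reals_Archimedean2 by blast
    have "1 / \<bar>x \<bullet> i\<bar> \<ge> 0" by simp
    then have m1: "norm x < real m" using m by linarith
    have "1 / \<bar>x \<bullet> i\<bar> < real m" using m norm_ge_zero[of x] by linarith
    then have m2: "1 / real (Suc m) < \<bar>x \<bullet> i\<bar>" using i(2) by (simp add: field_simps)
    have c: "- real m < x \<bullet> j" "x \<bullet> j < real m" if "j \<in> Basis" for j
      using Basis_le_norm[OF that, of x] m1 by (auto simp: abs_le_iff)
    have "x \<in> Bp i m \<or> x \<in> Bm i m"
    proof (cases "x \<bullet> i > 0")
      case True
      have "((1 / real (Suc m) + real m) *\<^sub>R i - real m *\<^sub>R One) \<bullet> j < x \<bullet> j" if "j \<in> Basis" for j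
        using m2 c[OF that] i(1) that True by (cases "i = j") (simp_all add: inner_diff_left inner_not_same_Basis)
      then have "x \<in> Bp i m" using c by (simp add: Bp_def mem_box)
      then show ?thesis ..
    next
      case False
      have "x \<bullet> j < (real m *\<^sub>R One - (1 / real (Suc m) + real m) *\<^sub>R i) \<bullet> j" if "j \<in> Basis" for j
        using m2 c[OF that] i that False by (cases "i = j") (simp_all add: inner_diff_left inner_not_same_Basis)
      then have "x \<in> Bm i m" using c by (simp add: Bm_def mem_box)
      then show ?thesis ..
    qed
    then show ?case using elim i by blast
  qed
qed

text \<open>Translation invariance makes the integral of each difference quotient 0, and the
  Lipschitz bound along \<open>b\<close> dominates the quotients. Differentiability is asked only
  almost everywhere, because the truncated logarithm of \<open>flux_identity\<close> has kinks on
  two spheres.\<close>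

lemma integral_directional_derivative_zero:
  fixes F :: "'a::euclidean_space \<Rightarrow> real"
  assumes [measurable]: "F \<in> borel_measurable borel" "D \<in> borel_measurable borel"
    and B: "\<And>x. \<bar>F x\<bar> \<le> B" and supp: "\<And>x. norm x > R \<Longrightarrow> F x = 0"
    and lip: "\<And>x h. 0 \<le> h \<Longrightarrow> \<bar>F (x + h *\<^sub>R b) - F x\<bar> \<le> M * h"
    and D: "AE x in lborel. ((\<lambda>h. (F (x + h *\<^sub>R b) - F x) / h) \<longlongrightarrow> D x) (at_right 0)"
    and b: "norm b = 1"
  shows "integrable lborel D" "(\<integral>x. D x \<partial>lborel) = 0"
proof -
  let ?q = "\<lambda>k x. (F (x + (1 / real (Suc k)) *\<^sub>R b) - F x) / (1 / real (Suc k))"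
  have fl: "filterlim (\<lambda>k. 1 / real (Suc k)) (at_right 0) sequentially" by real_asymp
  have lim: "AE x in lborel. (\<lambda>k. ?q k x) \<longlonglongrightarrow> D x"
    using D by eventually_elim (rule filterlim_compose[OF _ fl])
  have "M * 1 \<ge> 0" using lip[of 1 0] by simp
  then have M: "M \<ge> 0" by simp
  \<comment> \<open>The steps \<open>1 / (k + 1)\<close> are at most 1, so all quotients vanish
    outside the ball of radius \<open>R + 1\<close>.\<close>
  have bnd: "norm (?q k x) \<le> M * indicator (cball 0 (R + 1)) x" for k x
  proof (cases "norm x \<le> R + 1")
    case True
    have "\<bar>F (x + (1 / real (Suc k)) *\<^sub>R b) - F x\<bar> \<le> M * (1 / real (Suc k))"
      by (rule lip) simp
    then have "\<bar>F (x + (1 / real (Suc k)) *\<^sub>R b) - F x\<bar> / (1 / real (Suc k)) \<le> M"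
      by (subst divide_le_eq) (auto simp: mult.commute)
    then show ?thesis using True by (simp only: real_norm_def abs_divide) simp
  next
    case False
    have "norm x \<le> norm (x + (1 / real (Suc k)) *\<^sub>R b) + norm ((1 / real (Suc k)) *\<^sub>R b)"
      using norm_triangle_ineq4[of "x + (1 / real (Suc k)) *\<^sub>R b" "(1 / real (Suc k)) *\<^sub>R b"] by simp
    moreover have "norm ((1 / real (Suc k)) *\<^sub>R b) \<le> 1" using b by (simp add: field_simps)
    ultimately have "norm x > R" "norm (x + (1 / real (Suc k)) *\<^sub>R b) > R" using False by linarith+
    then show ?thesis using False supp by simp
  qed
  have w: "integrable lborel (\<lambda>x::'a. M * indicator (cball 0 (R + 1)) x)"
    by (intro integrable_mult_right integrable_real_indicator[OF _ emeasure_lborel_cball_finite]) simp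
  have bnd': "AE x in lborel. norm (?q k x) \<le> M * indicator (cball 0 (R + 1)) x" for k
    using bnd by simp
  show "integrable lborel D"
    by (rule integrable_dominated_convergence[OF _ _ w lim bnd']) measurable
  have "(\<lambda>k. \<integral>x. ?q k x \<partial>lborel) \<longlonglongrightarrow> (\<integral>x. D x \<partial>lborel)"
    by (rule integral_dominated_convergence[OF _ _ w lim bnd']) measurable
  moreover have "(\<integral>x. ?q k x \<partial>lborel) = 0" for k
  proof -
    let ?c = "(1 / real (Suc k)) *\<^sub>R b"
    have "integrable lborel (\<lambda>x::'a. B * indicator (cball 0 R) x)"
      by (intro integrable_mult_right integrable_real_indicator[OF _ emeasure_lborel_cball_finite]) simp
    then have i: "integrable lborel F"
      by (rule Bochner_Integration.integrable_bound) (use B supp in \<open>auto simp: indicator_def intro!: AE_I2 order_trans[OF B]\<close>)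
    have i2: "integrable lborel (\<lambda>x. F (?c + x))"
      using i integrable_distr_eq[of "(+) ?c" lborel borel F] lborel_distr_plus[of ?c] by simp
    have e: "(\<integral>x. F (?c + x) \<partial>lborel) = (\<integral>x. F x \<partial>lborel)"
      using integral_distr[of "(+) ?c" lborel borel F] lborel_distr_plus[of ?c] by simp
    have "(\<integral>x. F (?c + x) - F x \<partial>lborel) = 0" using i i2 e by simp
    then show ?thesis by (simp add: add.commute)
  qed
  ultimately show "(\<integral>x. D x \<partial>lborel) = 0" by (simp add: LIMSEQ_const_iff)
qed

lemma compact_support_bounded:
  fixes f :: "'a::euclidean_space \<Rightarrow> 'b::real_normed_vector"
  assumes "continuous_on UNIV f" "\<And>x. norm x > R \<Longrightarrow> f x = 0"
  obtains B where "B \<ge> 0" "\<And>x. norm (f x) \<le> B"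
proof -
  have "compact (f ` cball 0 R)"
    by (rule compact_continuous_image[OF continuous_on_subset[OF assms(1)]]) auto
  then obtain B where "\<And>x. norm x \<le> R \<Longrightarrow> norm (f x) \<le> B"
    using compact_imp_bounded by (fastforce simp: bounded_iff)
  then have "norm (f x) \<le> max 0 B" for x using assms(2)[of x] by (cases "norm x \<le> R") (auto simp: le_max_iff_disj)
  then show ?thesis using that[of "max 0 B"] by auto
qed

lemma lipschitz_of_grad_bound:
  fixes F :: "'a::euclidean_space \<Rightarrow> real"
  assumes "\<And>x. (F has_derivative (\<lambda>h. G x \<bullet> h)) (at x)" "\<And>x. norm (G x) \<le> B"
  shows "\<bar>F x - F y\<bar> \<le> B * norm (x - y)"
proof -
  have "norm (F x - F y) \<le> B * norm (x - y)"
  proof (rule differentiable_bound[of UNIV])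
    show "(F has_derivative (\<lambda>h. G x \<bullet> h)) (at x within UNIV)" for x using assms(1)[of x] by simp
    show "onorm (\<lambda>h. G x \<bullet> h) \<le> B" for x
    proof (rule onorm_le)
      fix h show "norm (G x \<bullet> h) \<le> B * norm h"
        using Cauchy_Schwarz_ineq2[of "G x" h] mult_right_mono[OF assms(2)[of x], of "norm h"] by simp
    qed
  qed auto
  then show ?thesis by simp
qed

lemma integral_grad_zero:
  fixes F :: "'a::euclidean_space \<Rightarrow> real"
  assumes d: "\<And>x. (F has_derivative (\<lambda>h. G x \<bullet> h)) (at x)" and G: "continuous_on UNIV G"
    and supp: "\<And>x. norm x > R \<Longrightarrow> F x = 0" and b: "b \<in> Basis"
  shows "integrable lborel (\<lambda>x. G x \<bullet> b)" "(\<integral>x. G x \<bullet> b \<partial>lborel) = 0"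
proof -
  have cF: "continuous_on UNIV F"
    using d by (auto intro!: continuous_at_imp_continuous_on has_derivative_continuous)
  have G0: "G x = 0" if "norm x > R" for x
  proof -
    have "open {x::'a. R < norm x}" by (intro open_Collect_less continuous_intros)
    moreover have "((\<lambda>x. 0) has_derivative (\<lambda>h. 0 \<bullet> h)) (at x)" by simp
    moreover have "x \<in> {x. R < norm x}" using that by (rule CollectI)
    moreover have "0 = F y" if "y \<in> {x. R < norm x}" for y using supp[of y] that by (simp only: mem_Collect_eq)
    ultimately have "(F has_derivative (\<lambda>h. 0 \<bullet> h)) (at x)"
      using has_derivative_transform_within_open by metis
    then have "(\<lambda>h. 0 \<bullet> h) = (\<lambda>h. G x \<bullet> h)" using d has_derivative_unique by blast
    then show ?thesis by (metis inner_eq_zero_iff inner_zero_left)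
  qed
  obtain B where B: "\<And>x. norm (F x) \<le> B" by (rule compact_support_bounded[OF cF supp]) auto
  obtain M where M: "\<And>x. norm (G x) \<le> M" by (rule compact_support_bounded[OF G G0]) auto
  have n: "norm b = 1" using b by simp
  note * = integral_directional_derivative_zero[where F=F and D="\<lambda>x. G x \<bullet> b" and B=B and R=R and M=M and b=b]
  have 1: "F \<in> borel_measurable borel" using cF by (rule borel_measurable_continuous_onI)
  have 2: "(\<lambda>x. G x \<bullet> b) \<in> borel_measurable borel"
    by (intro borel_measurable_continuous_onI continuous_intros G)
  have 3: "\<bar>F (x + h *\<^sub>R b) - F x\<bar> \<le> M * h" if "0 \<le> h" for x h
    using lipschitz_of_grad_bound[OF d M, of "x + h *\<^sub>R b" x] that n by simp
  have 4: "((\<lambda>h. (F (x + h *\<^sub>R b) - F x) / h) \<longlongrightarrow> G x \<bullet> b) (at_right 0)" for x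
  proof -
    have "((\<lambda>h. x + h *\<^sub>R b) has_derivative (\<lambda>k. k *\<^sub>R b)) (at 0)" by (auto intro!: derivative_eq_intros)
    then have "((\<lambda>h. F (x + h *\<^sub>R b)) has_derivative (\<lambda>k. G x \<bullet> (k *\<^sub>R b))) (at 0)"
      by (rule has_derivative_compose) (use d[of x] in simp)
    then have "((\<lambda>h. F (x + h *\<^sub>R b)) has_real_derivative (G x \<bullet> b)) (at 0)"
      by (rule has_derivative_imp_has_field_derivative) simp
    then have "((\<lambda>h. (F (x + h *\<^sub>R b) - F x) / h) \<longlongrightarrow> G x \<bullet> b) (at 0)"
      by (simp add: has_field_derivative_iff)
    then show ?thesis by (rule tendsto_within_subset) auto
  qed
  show "integrable lborel (\<lambda>x. G x \<bullet> b)" "(\<integral>x. G x \<bullet> b \<partial>lborel) = 0"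
    by (rule *; use 1 2 3 4 B supp n in auto)+
qed

section \<open>The one-dimensional inequality\<close>

lemma has_real_derivative_abs_powr:
  fixes t :: real
  assumes "t > 1"
  shows "((\<lambda>g. \<bar>g\<bar> powr t) has_real_derivative t * (sgn g * \<bar>g\<bar> powr (t - 1))) (at g)"
proof (cases g "0::real" rule: linorder_cases)
  case less
  have "((\<lambda>g. (- g) powr t) has_real_derivative t * (sgn g * \<bar>g\<bar> powr (t - 1))) (at g)"
    using less by (auto intro!: derivative_eq_intros simp: sgn_if)
  then show ?thesis
    by (rule has_field_derivative_transform_within_open[where S="{..<0}"]) (use less in auto)
next
  case greater
  have "((\<lambda>g. g powr t) has_real_derivative t * (sgn g * \<bar>g\<bar> powr (t - 1))) (at g)"
    using greater by (auto intro!: derivative_eq_intros simp: sgn_if)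
  then show ?thesis
    by (rule has_field_derivative_transform_within_open[where S="{0<..}"]) (use greater in auto)
next
  case equal
  have "((\<lambda>h. \<bar>h\<bar> powr (t - 1)) \<longlongrightarrow> \<bar>0\<bar> powr (t - 1)) (at (0::real))"
    using assms by (intro tendsto_powr' tendsto_intros) auto
  then have "((\<lambda>h. \<bar>h\<bar> powr (t - 1)) \<longlongrightarrow> 0) (at (0::real))" by simp
  then have "((\<lambda>h. sgn h * \<bar>h\<bar> powr (t - 1)) \<longlongrightarrow> 0) (at (0::real))"
    by (rule Lim_null_comparison[rotated]) (auto simp: abs_mult sgn_if)
  then have "((\<lambda>h. (\<bar>h\<bar> powr t - \<bar>0\<bar> powr t) / (h - 0)) \<longlongrightarrow> 0) (at (0::real))"
    by (rule Lim_transform_eventually)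
      (use assms in \<open>auto simp: eventually_at_filter powr_diff sgn_if divide_simps\<close>)
  then show ?thesis using equal by (simp add: has_field_derivative_iff)
qed

lemma continuous_sgn_abs_powr:
  assumes "p > (0::real)"
  shows "continuous_on UNIV (\<lambda>g::real. sgn g * \<bar>g\<bar> powr p)"
proof -
  have "isCont (\<lambda>g. sgn g * \<bar>g\<bar> powr p) g" for g :: real
  proof (cases "g = 0")
    case True
    have "((\<lambda>h. \<bar>h\<bar> powr p) \<longlongrightarrow> \<bar>0\<bar> powr p) (at (0::real))"
      using assms by (intro tendsto_powr' tendsto_intros) auto
    then have "((\<lambda>h. \<bar>h\<bar> powr p) \<longlongrightarrow> 0) (at (0::real))" by simp
    then have "((\<lambda>h. sgn h * \<bar>h\<bar> powr p) \<longlongrightarrow> 0) (at (0::real))"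
      by (rule Lim_null_comparison[rotated]) (auto simp: abs_mult sgn_if)
    then show ?thesis using True by (simp add: isCont_def)
  next
    case False
    then show ?thesis by (auto intro!: continuous_intros isCont_sgn)
  qed
  then show ?thesis by (simp add: continuous_at_imp_continuous_on)
qed

text \<open>If the bound failed beyond \<open>N\<close>, then \<open>Z\<close> would dominate a
  multiple of \<open>1 / (1 + s)\<close>, whose integral diverges logarithmically. The factor
  \<open>1 + \<bar>s\<bar>\<close> is the one in the growth bound of \<open>flux_primitive\<close>,
  so the points found here make the boundary terms small.\<close>

lemma integrable_small_point:
  fixes Z :: "real \<Rightarrow> real"
  assumes Z: "integrable lborel Z" and \<epsilon>: "\<epsilon> > 0"
  shows "\<exists>s\<ge>N. (1 + \<bar>s\<bar>) * Z s < \<epsilon>"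
proof (rule ccontr)
  assume "\<not> ?thesis"
  then have ge: "(1 + \<bar>s\<bar>) * Z s \<ge> \<epsilon>" if "s \<ge> N" for s using that by force
  define N0 where "N0 = max N 0"
  have Zge: "Z s \<ge> \<epsilon> * (1 / (1 + s))" if "s \<ge> N0" for s
    using ge[of s] that by (simp add: N0_def field_simps)
  have bound: "\<epsilon> * (ln (1 + b) - ln (1 + N0)) \<le> (\<integral>s. \<bar>Z s\<bar> \<partial>lborel)" if b: "b \<ge> N0" for b
  proof -
    have N0: "N0 \<ge> 0" by (simp add: N0_def)
    have i: "((\<lambda>s. 1 / (1 + s)) has_integral (ln (1 + b) - ln (1 + N0))) {N0..b}"
      using N0 b by (intro fundamental_theorem_of_calculus)
        (auto intro!: derivative_eq_intros simp: has_real_derivative_iff_has_vector_derivative[symmetric])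
    have si: "set_integrable lborel {N0..b} (\<lambda>s. 1 / (1 + s))"
      using N0 by (intro borel_integrable_atLeastAtMost') (auto intro!: continuous_intros)
    have sZ: "set_integrable lborel {N0..b} Z"
      using Z unfolding set_integrable_def by (intro integrable_mult_indicator) auto
    have "\<epsilon> * (ln (1 + b) - ln (1 + N0)) = \<epsilon> * (LBINT s:{N0..b}. 1 / (1 + s))"
      using i set_borel_integral_eq_integral(2)[OF si] by (simp add: integral_unique)
    also have "\<dots> = (LBINT s:{N0..b}. \<epsilon> * (1 / (1 + s)))" by (rule set_integral_mult_right[symmetric])
    also have "\<dots> \<le> (LBINT s:{N0..b}. Z s)"
      using Zge by (intro set_integral_mono set_integrable_mult_right si sZ) auto
    also have "\<dots> \<le> (\<integral>s. \<bar>Z s\<bar> \<partial>lborel)"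
      unfolding set_lebesgue_integral_def
      using Z sZ by (intro integral_mono) (auto simp: set_integrable_def indicator_def)
    finally show ?thesis .
  qed
  have "filterlim (\<lambda>b. \<epsilon> * (ln (1 + b) - c)) at_top at_top" for c
    using \<epsilon> by real_asymp
  then have "\<forall>\<^sub>F b in at_top. \<epsilon> * (ln (1 + b) - ln (1 + N0)) \<ge> (\<integral>s. \<bar>Z s\<bar> \<partial>lborel) + 1"
    by (simp add: filterlim_at_top)
  then obtain b where "b \<ge> N0" "\<epsilon> * (ln (1 + b) - ln (1 + N0)) \<ge> (\<integral>s. \<bar>Z s\<bar> \<partial>lborel) + 1"
    by (metis (mono_tags, lifting) eventually_at_top_linorder max.cobounded1 max.cobounded2)
  then show False using bound[of b] by simp
qed

lemma integrable_small_point_neg: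
  fixes Z :: "real \<Rightarrow> real"
  assumes Z: "integrable lborel Z" and \<epsilon>: "\<epsilon> > 0"
  shows "\<exists>s\<le>N. (1 + \<bar>s\<bar>) * Z s < \<epsilon>"
proof -
  have "integrable lborel (\<lambda>s. Z (0 + (-1) * s))" using Z by (rule lborel_integrable_real_affine) simp
  then obtain s where "s \<ge> - N" "(1 + \<bar>s\<bar>) * Z (- s) < \<epsilon>"
    using integrable_small_point[OF _ \<epsilon>, of "\<lambda>s. Z (- s)" "- N"] by auto
  then show ?thesis by (intro exI[of _ "- s"]) auto
qed

text \<open>Fatou's lemma along intervals whose ends are not prescribed: they will be points at
  which boundary terms are small.\<close>

lemma nn_integral_le_exhaustion:
  fixes f :: "real \<Rightarrow> ennreal" and a b c :: "nat \<Rightarrow> real"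
  assumes [measurable]: "f \<in> borel_measurable borel"
    and ab: "\<And>k. a k \<le> - real k" "\<And>k. real k \<le> b k"
    and le: "\<And>k. (\<integral>\<^sup>+s. f s * indicator {a k..b k} s \<partial>lborel) \<le> ennreal (c k)" and c: "c \<longlonglongrightarrow> C"
  shows "(\<integral>\<^sup>+s. f s \<partial>lborel) \<le> ennreal C"
proof -
  have "(\<integral>\<^sup>+s. f s \<partial>lborel) \<le> (\<integral>\<^sup>+s. liminf (\<lambda>k. f s * indicator {a k..b k} s) \<partial>lborel)"
  proof (intro nn_integral_mono)
    fix s :: real
    obtain k0 :: nat where k0: "\<bar>s\<bar> \<le> real k0" using real_arch_simple by blast
    have "f s * indicator {a k..b k} s = f s" if "k \<ge> k0" for k
    proof -
      have "\<bar>s\<bar> \<le> real k" using k0 that by linarith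
      then have "a k \<le> s" "s \<le> b k" using ab[of k] by linarith+
      then show ?thesis by simp
    qed
    then have "\<forall>\<^sub>F k in sequentially. f s \<le> f s * indicator {a k..b k} s"
      by (intro eventually_sequentiallyI[of k0]) simp
    then show "f s \<le> liminf (\<lambda>k. f s * indicator {a k..b k} s)" by (rule Liminf_bounded)
  qed
  also have "\<dots> \<le> liminf (\<lambda>k. \<integral>\<^sup>+s. f s * indicator {a k..b k} s \<partial>lborel)"
    by (rule nn_integral_liminf) auto
  also have "\<dots> \<le> liminf (\<lambda>k. ennreal (c k))"
    by (intro Liminf_mono always_eventually allI le)
  also have "\<dots> = ennreal C"
    using tendsto_ennrealI[OF c] by (intro lim_imp_Liminf) auto
  finally show ?thesis .
qed

text \<open>The quantity \<open>I0 - 2 \<tau> (L / t) D + \<tau>\<^sup>2 B\<close> below bounds a nonnegative integral for every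
  \<open>\<tau>\<close>; its discriminant is the inequality, and the integral vanishes at the optimal \<open>\<tau>\<close> exactly
  in the case of equality.  No sign is lost in the passage from \<open>F\<close> to \<open>F - 2 m G\<close>, because the
  squares differ by the derivative of \<open>2 m G\<^sup>2 e\<^sup>-\<^sup>2\<^sup>m\<^sup>s\<close>.\<close>

lemma one_dim_estimate:
  fixes F G :: "real \<Rightarrow> real" and t m L C :: real
  assumes t: "t \<ge> 2" and L: "L \<noteq> 0"
    and P: "primitive_of F G" and Fm[measurable]: "F \<in> borel_measurable borel"
    and IF: "integrable lborel (\<lambda>s. (F s)\<^sup>2 * exp (- (2 * m * s)))"
    and b_pos: "m > 0 \<Longrightarrow> ((\<lambda>s. (G s)\<^sup>2 * exp (- (2 * m * s))) \<longlongrightarrow> 0) at_bot"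
    and b_neg: "m < 0 \<Longrightarrow> ((\<lambda>s. (G s)\<^sup>2 * exp (- (2 * m * s))) \<longlongrightarrow> 0) at_top"
    and growth: "\<And>s. (G s)\<^sup>2 * exp (- (2 * m * s)) \<le> C * (1 + \<bar>s\<bar>)"
  defines "q \<equiv> \<lambda>s. G s * exp (- (2 * m * s))"
  defines "X \<equiv> \<lambda>s. (F s - 2 * m * G s) * exp (- (m * s))"
  defines "Y \<equiv> \<lambda>s. sgn (q s) * \<bar>q s\<bar> powr (t - 1) * exp ((L - m) * s)"
  defines "h \<equiv> \<lambda>s. \<bar>q s\<bar> powr t * exp (L * s)"
  assumes IY: "integrable lborel (\<lambda>s. (Y s)\<^sup>2)"
  shows "integrable lborel h"
    and "(\<integral>\<^sup>+s. ennreal ((X s + \<tau> * Y s)\<^sup>2) \<partial>lborel)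
      \<le> ennreal ((\<integral>s. (F s)\<^sup>2 * exp (- (2 * m * s)) \<partial>lborel) - 2 * \<tau> * (L / t) * (\<integral>s. h s \<partial>lborel)
            + \<tau>\<^sup>2 * (\<integral>s. (Y s)\<^sup>2 \<partial>lborel))"
    and "0 \<le> (\<integral>s. (F s)\<^sup>2 * exp (- (2 * m * s)) \<partial>lborel) - 2 * \<tau> * (L / t) * (\<integral>s. h s \<partial>lborel)
            + \<tau>\<^sup>2 * (\<integral>s. (Y s)\<^sup>2 \<partial>lborel)"
proof -
  define I0 where "I0 = (\<integral>s. (F s)\<^sup>2 * exp (- (2 * m * s)) \<partial>lborel)"
  define B where "B = (\<integral>s. (Y s)\<^sup>2 \<partial>lborel)"
  let ?p2 = "\<lambda>s. (G s)\<^sup>2 * exp (- (2 * m * s))"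
  have cG: "continuous_on UNIV G" by (rule primitive_of_continuous[OF P])
  have [measurable]: "G \<in> borel_measurable borel" using cG by (rule borel_measurable_continuous_onI)
  have [measurable]: "q \<in> borel_measurable borel" "X \<in> borel_measurable borel"
    "Y \<in> borel_measurable borel" "h \<in> borel_measurable borel"
    unfolding q_def X_def Y_def h_def by measurable
  have Pexp: "primitive_of (\<lambda>s. c * exp (c * s)) (\<lambda>s. exp (c * s))" for c
    by (rule primitive_of_C1) (auto intro!: derivative_eq_intros continuous_intros)
  have PG2: "primitive_of (\<lambda>s. 2 * G s * F s) (\<lambda>s. (G s)\<^sup>2)"
    by (rule primitive_of_comp[OF P, of "\<lambda>g. g\<^sup>2" "\<lambda>g. 2 * g"])
      (auto intro!: derivative_eq_intros continuous_intros)
  have Pp: "primitive_of (\<lambda>s. exp (- (2 * m * s)) * (2 * G s * F s) + (G s)\<^sup>2 * (- 2 * m * exp (- (2 * m * s)))) ?p2"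
    using primitive_of_mult[OF PG2 Pexp[of "- 2 * m"]] by (simp add: mult.assoc)
  have Pq: "primitive_of (\<lambda>s. exp (- (2 * m * s)) * F s + G s * (- 2 * m * exp (- (2 * m * s)))) q"
    using primitive_of_mult[OF P Pexp[of "- 2 * m"]] by (simp add: mult.assoc q_def)
  have "primitive_of (\<lambda>s. (t * (sgn (q s) * \<bar>q s\<bar> powr (t - 1))) *
      (exp (- (2 * m * s)) * F s + G s * (- 2 * m * exp (- (2 * m * s))))) (\<lambda>s. \<bar>q s\<bar> powr t)"
    using t by (intro primitive_of_comp[OF Pq has_real_derivative_abs_powr] continuous_on_mult_left
      continuous_sgn_abs_powr) auto
  from primitive_of_mult[OF this Pexp[of L]]
  have "primitive_of (\<lambda>s. exp (L * s) * ((t * (sgn (q s) * \<bar>q s\<bar> powr (t - 1))) *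
      (exp (- (2 * m * s)) * F s + G s * (- 2 * m * exp (- (2 * m * s))))) + \<bar>q s\<bar> powr t * (L * exp (L * s))) h"
    by (simp add: h_def)
  also have "(\<lambda>s. exp (L * s) * ((t * (sgn (q s) * \<bar>q s\<bar> powr (t - 1))) *
      (exp (- (2 * m * s)) * F s + G s * (- 2 * m * exp (- (2 * m * s))))) + \<bar>q s\<bar> powr t * (L * exp (L * s)))
      = (\<lambda>s. t * (X s * Y s) + L * h s)"
  proof
    fix s
    \<comment> \<open>\<open>X\<close> carries the weight \<open>e^(-m s)\<close> and
      \<open>Y\<close> the weight \<open>e^((L - m) s)\<close>; their product has to be the weight
      that appears in the derivative of \<open>h\<close>.\<close>
    have e: "exp (L * s) * exp (- (2 * m * s)) = exp (- (m * s)) * exp ((L - m) * s)"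
      by (simp add: exp_add[symmetric] algebra_simps)
    show "exp (L * s) * ((t * (sgn (q s) * \<bar>q s\<bar> powr (t - 1))) *
      (exp (- (2 * m * s)) * F s + G s * (- 2 * m * exp (- (2 * m * s))))) + \<bar>q s\<bar> powr t * (L * exp (L * s))
      = t * (X s * Y s) + L * h s"
    proof -
      have "exp (L * s) * ((t * (sgn (q s) * \<bar>q s\<bar> powr (t - 1))) *
        (exp (- (2 * m * s)) * F s + G s * (- 2 * m * exp (- (2 * m * s)))))
        = t * (sgn (q s) * \<bar>q s\<bar> powr (t - 1)) * (F s - 2 * m * G s) * (exp (L * s) * exp (- (2 * m * s)))"
        by (simp add: algebra_simps)
      then show ?thesis unfolding e X_def Y_def h_def by (simp add: mult_ac)
    qed
  qed
  finally have Ph: "primitive_of (\<lambda>s. t * (X s * Y s) + L * h s) h" .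
  have ch: "continuous_on UNIV h" by (rule primitive_of_continuous[OF Ph])
  have h0: "h s \<ge> 0" for s by (simp add: h_def)
  have hi: "set_integrable lborel {a..b} h" for a b
    by (rule borel_integrable_atLeastAtMost'[OF continuous_on_subset[OF ch]]) auto
  have sub: "set_integrable lborel {a..b} f" if "integrable lborel f" for f :: "real \<Rightarrow> real" and a b
    using that unfolding set_integrable_def by (intro integrable_mult_indicator) auto
  have XYi: "set_integrable lborel {a..b} (\<lambda>s. X s * Y s)" for a b
  proof -
    have "set_integrable lborel {a..b} (\<lambda>s. (1 / t) * ((t * (X s * Y s) + L * h s) - L * h s))"
      by (intro set_integrable_mult_right set_integral_diff primitive_ofD(1)[OF Ph] hi)
    then show ?thesis using t by simp
  qed
  have X2: "(X s)\<^sup>2 = (F s)\<^sup>2 * exp (- (2 * m * s)) - 2 * m *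
     (exp (- (2 * m * s)) * (2 * G s * F s) + (G s)\<^sup>2 * (- 2 * m * exp (- (2 * m * s))))" for s
  proof -
    have "(exp (- (m * s)))\<^sup>2 = exp (- (2 * m * s))" by (simp add: power2_eq_square exp_add[symmetric] algebra_simps)
    then have "(X s)\<^sup>2 = (F s - 2 * m * G s)\<^sup>2 * exp (- (2 * m * s))" by (simp add: X_def power_mult_distrib)
    then show ?thesis by (simp add: power2_eq_square algebra_simps)
  qed
  have Pp1: "set_integrable lborel {a..b} (\<lambda>s. 2 * m *
     (exp (- (2 * m * s)) * (2 * G s * F s) + (G s)\<^sup>2 * (- 2 * m * exp (- (2 * m * s)))))" for a b
    by (intro set_integrable_mult_right primitive_ofD(1)[OF Pp])
  have X2i: "set_integrable lborel {a..b} (\<lambda>s. (X s)\<^sup>2)" for a b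
    unfolding X2 by (intro set_integral_diff sub[OF IF] Pp1)
  have Qi: "set_integrable lborel {a..b} (\<lambda>s. (X s)\<^sup>2 + 2 * \<sigma> * (X s * Y s) + \<sigma>\<^sup>2 * (Y s)\<^sup>2)" for a b \<sigma>
    by (intro set_integral_add set_integrable_mult_right X2i XYi sub[OF IY])
  have Qe: "(X s + \<sigma> * Y s)\<^sup>2 = (X s)\<^sup>2 + 2 * \<sigma> * (X s * Y s) + \<sigma>\<^sup>2 * (Y s)\<^sup>2" for \<sigma> s
    by (simp add: power2_eq_square algebra_simps)
  have le_full: "(LBINT s:{a..b}. f s) \<le> (\<integral>s. f s \<partial>lborel)"
    if "integrable lborel f" "\<And>s. f s \<ge> 0" for f :: "real \<Rightarrow> real" and a b
    using that sub[OF that(1)] unfolding set_lebesgue_integral_def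
    by (intro integral_mono) (auto simp: set_integrable_def indicator_def)
  have key: "(LBINT s:{a..b}. (X s + \<sigma> * Y s)\<^sup>2)
      \<le> I0 - 2 * m * (?p2 b - ?p2 a) + 2 * \<sigma> * ((h b - h a) / t - (L / t) * (LBINT s:{a..b}. h s)) + \<sigma>\<^sup>2 * B"
    if ab: "a \<le> b" for a b \<sigma>
  proof -
    have xy: "(LBINT s:{a..b}. X s * Y s) = (h b - h a) / t - (L / t) * (LBINT s:{a..b}. h s)"
    proof -
      have "h b - h a = (LBINT s:{a..b}. t * (X s * Y s) + L * h s)" using primitive_ofD(2)[OF Ph ab] .
      also have "\<dots> = t * (LBINT s:{a..b}. X s * Y s) + L * (LBINT s:{a..b}. h s)"
        using XYi hi by simp
      finally show ?thesis using t by (simp add: field_simps)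
    qed
    have x2: "(LBINT s:{a..b}. (X s)\<^sup>2) = (LBINT s:{a..b}. (F s)\<^sup>2 * exp (- (2 * m * s))) - 2 * m * (?p2 b - ?p2 a)"
      unfolding X2 primitive_ofD(2)[OF Pp ab] using set_integral_diff(2)[OF sub[OF IF] Pp1] by simp
    have "(LBINT s:{a..b}. (X s + \<sigma> * Y s)\<^sup>2) = (LBINT s:{a..b}. (X s)\<^sup>2) + 2 * \<sigma> * (LBINT s:{a..b}. X s * Y s)
        + \<sigma>\<^sup>2 * (LBINT s:{a..b}. (Y s)\<^sup>2)"
      unfolding Qe using X2i XYi sub[OF IY] by (simp add: set_integral_add set_integrable_mult_right)
    moreover have "(LBINT s:{a..b}. (F s)\<^sup>2 * exp (- (2 * m * s))) \<le> I0" unfolding I0_def by (intro le_full IF) auto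
    moreover have "\<sigma>\<^sup>2 * (LBINT s:{a..b}. (Y s)\<^sup>2) \<le> \<sigma>\<^sup>2 * B" unfolding B_def by (intro mult_left_mono le_full IY) auto
    ultimately show ?thesis unfolding x2 xy by linarith
  qed
  \<comment> \<open>With the growth bound on \<open>G\<close> this gives
    \<open>h^2 \<le> C (1 + |s|) Y^2\<close>. Since \<open>Y^2\<close> is integrable,
    \<open>h\<close> is small at suitable points arbitrarily far out on both sides.\<close>
  have h2: "(h s)\<^sup>2 = (Y s)\<^sup>2 * ?p2 s" for s
  proof -
    have 1: "exp (L * s) * exp (L * s) = exp ((L - m) * s) * exp ((L - m) * s) * (exp (- (2 * m * s)) * exp (4 * m * s))"
      by (simp add: exp_add[symmetric] algebra_simps)
    have 2: "?p2 s = (q s)\<^sup>2 * (exp (- (2 * m * s)) * exp (4 * m * s))"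
    proof -
      have "(exp (- (2 * m * s)))\<^sup>2 * exp (4 * m * s) = 1" by (simp add: power2_eq_square exp_add[symmetric])
      then show ?thesis by (simp add: q_def power_mult_distrib mult_ac)
    qed
    have 3: "\<bar>q s\<bar> powr t * \<bar>q s\<bar> powr t = (sgn (q s) * \<bar>q s\<bar> powr (t - 1))\<^sup>2 * (q s)\<^sup>2"
      by (cases "q s = 0") (auto simp: powr_diff power_mult_distrib sgn_if power2_eq_square)
    have "(h s)\<^sup>2 = (\<bar>q s\<bar> powr t * \<bar>q s\<bar> powr t) * (exp (L * s) * exp (L * s))"
      by (simp add: h_def power2_eq_square)
    then show ?thesis unfolding 1 2 3 Y_def by (simp add: power2_eq_square)
  qed
  have C: "C \<ge> 0" using order_trans[OF _ growth[of 0]] by simp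
  have hsmall: "h s \<le> \<epsilon>" if "(1 + \<bar>s\<bar>) * (C * (Y s)\<^sup>2) < \<epsilon>\<^sup>2" "\<epsilon> > 0" for s \<epsilon>
  proof -
    have "(h s)\<^sup>2 \<le> (Y s)\<^sup>2 * (C * (1 + \<bar>s\<bar>))" unfolding h2 by (intro mult_left_mono growth) auto
    then have "(h s)\<^sup>2 \<le> \<epsilon>\<^sup>2" using that by (simp add: mult_ac)
    then show ?thesis using that by (simp add: power2_le_iff_abs_le h0)
  qed
  have IC: "integrable lborel (\<lambda>s. C * (Y s)\<^sup>2)" using IY by simp
  have "\<exists>s\<ge>real k. h s \<le> 1 / real (Suc k)" for k
    using integrable_small_point[OF IC, of "(1 / real (Suc k))\<^sup>2" "real k"] hsmall[of _ "1 / real (Suc k)"] by auto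
  then obtain b where b: "\<And>k. b k \<ge> real k" "\<And>k. h (b k) \<le> 1 / real (Suc k)" by metis
  have "\<exists>s\<le>- real k. h s \<le> 1 / real (Suc k)" for k
    using integrable_small_point_neg[OF IC, of "(1 / real (Suc k))\<^sup>2" "- real k"] hsmall[of _ "1 / real (Suc k)"] by auto
  then obtain a where a: "\<And>k. a k \<le> - real k" "\<And>k. h (a k) \<le> 1 / real (Suc k)" by metis
  have ab: "a k \<le> b k" for k using a(1)[of k] b(1)[of k] by linarith
  have lim1: "(\<lambda>k. 1 / real (Suc k)) \<longlonglongrightarrow> 0" using LIMSEQ_inverse_real_of_nat by (simp add: inverse_eq_divide)
  have "(\<lambda>k. h (b k)) \<longlonglongrightarrow> 0" "(\<lambda>k. h (a k)) \<longlonglongrightarrow> 0"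
    by (rule real_tendsto_sandwich[OF always_eventually always_eventually tendsto_const lim1]; use h0 a b in blast)+
  note hb = this
  have flb: "filterlim b at_top sequentially"
    by (rule filterlim_at_top_mono[OF filterlim_real_sequentially]) (simp add: b)
  have "filterlim (\<lambda>k. - real k) at_bot sequentially" by real_asymp
  then have fla: "filterlim a at_bot sequentially"
    by (rule filterlim_at_bot_mono) (simp add: a)
  obtain d where d: "d \<longlonglongrightarrow> 0" "\<And>k. - 2 * m * (?p2 (b k) - ?p2 (a k)) \<le> d k"
  proof (cases m "0::real" rule: linorder_cases)
    case less
    have "(\<lambda>k. - 2 * m * ?p2 (b k)) \<longlonglongrightarrow> - 2 * m * 0"
      by (intro tendsto_mult_left filterlim_compose[OF b_neg[OF less] flb])
    then show ?thesis using less by (intro that[of "\<lambda>k. - 2 * m * ?p2 (b k)"]) (auto simp: algebra_simps mult_nonpos_nonneg)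
  next
    case greater
    have "(\<lambda>k. 2 * m * ?p2 (a k)) \<longlonglongrightarrow> 2 * m * 0"
      by (intro tendsto_mult_left filterlim_compose[OF b_pos[OF greater] fla])
    then show ?thesis using greater by (intro that[of "\<lambda>k. 2 * m * ?p2 (a k)"]) (auto simp: algebra_simps)
  next
    case equal then show ?thesis by (intro that[of "\<lambda>k. 0"]) auto
  qed
  define e where "e \<sigma> k = d k + 2 * \<sigma> * ((h (b k) - h (a k)) / t)" for \<sigma> k
  have e: "e \<sigma> \<longlonglongrightarrow> 0" for \<sigma>
  proof -
    have "(\<lambda>k. d k + 2 * \<sigma> * ((h (b k) - h (a k)) / t)) \<longlonglongrightarrow> 0 + 2 * \<sigma> * ((0 - 0) / t)"
      using t by (intro tendsto_intros d hb) auto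
    then show ?thesis by (simp add: e_def[abs_def])
  qed
  have key': "(LBINT s:{a k..b k}. (X s + \<sigma> * Y s)\<^sup>2)
      \<le> I0 + e \<sigma> k - 2 * \<sigma> * (L / t) * (LBINT s:{a k..b k}. h s) + \<sigma>\<^sup>2 * B" for k \<sigma>
    using key[OF ab[of k], of \<sigma>] d(2)[of k] by (simp add: e_def algebra_simps)
  have Q0: "0 \<le> (LBINT s:{a k..b k}. (X s + \<sigma> * Y s)\<^sup>2)" for k \<sigma>
    unfolding set_lebesgue_integral_def by (intro integral_nonneg_AE AE_I2) simp
  have nnset: "(\<integral>\<^sup>+s. ennreal (f s) * indicator {a k..b k} s \<partial>lborel) = ennreal (LBINT s:{a k..b k}. f s)"
    if "set_integrable lborel {a k..b k} f" "\<And>s. f s \<ge> 0" for f :: "real \<Rightarrow> real" and k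
    using that nn_integral_eq_integral[of lborel "\<lambda>s. indicator {a k..b k} s * f s"]
    by (auto simp: set_integrable_def set_lebesgue_integral_def indicator_def mult.commute
       intro!: nn_integral_cong trans[rotated, OF nn_integral_eq_integral] split: if_splits)
  show hint: "integrable lborel h"
  proof -
    \<comment> \<open>Nonnegativity of the left-hand side of \<open>key'\<close> at
      \<open>\<sigma> = sgn L\<close> bounds \<open>2 * (\<bar>L\<bar> / t)\<close> times the
      integral of \<open>h\<close>; dividing by this factor is where \<open>L \<noteq> 0\<close>
      enters.\<close>
    define c where "c k = (I0 + e (sgn L) k + B) / (2 * (\<bar>L\<bar> / t))" for k
    have "(LBINT s:{a k..b k}. h s) \<le> c k" for k
    proof -
      have "2 * (\<bar>L\<bar> / t) * (LBINT s:{a k..b k}. h s) \<le> I0 + e (sgn L) k + B"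
        using order_trans[OF Q0 key'[of k "sgn L"]] L by (simp add: sgn_if split: if_splits)
      then show ?thesis using t L by (simp add: c_def field_simps)
    qed
    then have le: "(\<integral>\<^sup>+s. ennreal (h s) * indicator {a k..b k} s \<partial>lborel) \<le> ennreal (c k)" for k
      by (subst nnset) (auto simp: hi h0 intro: ennreal_leI)
    have "c \<longlonglongrightarrow> (I0 + 0 + B) / (2 * (\<bar>L\<bar> / t))"
      unfolding c_def using t L by (intro tendsto_intros e) auto
    from nn_integral_le_exhaustion[OF _ a(1) b(1) le this]
    have "(\<integral>\<^sup>+s. ennreal (h s) \<partial>lborel) < \<infinity>" by (auto simp: le_less_trans)
    then show ?thesis by (simp add: integrable_iff_bounded h0)
  qed
  have hlim: "(\<lambda>k. LBINT s:{a k..b k}. h s) \<longlonglongrightarrow> (\<integral>s. h s \<partial>lborel)"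
    unfolding set_lebesgue_integral_def
  proof (rule integral_dominated_convergence[OF _ _ hint])
    show "AE s in lborel. (\<lambda>k. indicat_real {a k..b k} s *\<^sub>R h s) \<longlonglongrightarrow> h s"
    proof (rule AE_I2)
      fix s :: real
      have "\<forall>\<^sub>F k in sequentially. a k \<le> s" "\<forall>\<^sub>F k in sequentially. s \<le> b k"
        using fla flb by (auto simp: filterlim_at_top filterlim_at_bot)
      then have "\<forall>\<^sub>F k in sequentially. indicat_real {a k..b k} s *\<^sub>R h s = h s"
        by eventually_elim simp
      then show "(\<lambda>k. indicat_real {a k..b k} s *\<^sub>R h s) \<longlonglongrightarrow> h s" by (rule tendsto_eventually)
    qed
    show "AE s in lborel. norm (indicat_real {a k..b k} s *\<^sub>R h s) \<le> h s" for k
      by (rule AE_I2) (auto simp: indicator_def h0)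
  qed auto
  define D where "D = (\<integral>s. h s \<partial>lborel)"
  have lim: "(\<lambda>k. I0 + e \<tau> k - 2 * \<tau> * (L / t) * (LBINT s:{a k..b k}. h s) + \<tau>\<^sup>2 * B)
      \<longlonglongrightarrow> I0 + 0 - 2 * \<tau> * (L / t) * D + \<tau>\<^sup>2 * B"
    using hlim unfolding D_def by (intro tendsto_intros e)
  have "0 \<le> I0 + 0 - 2 * \<tau> * (L / t) * D + \<tau>\<^sup>2 * B"
    by (rule LIMSEQ_le_const[OF lim]) (use order_trans[OF Q0 key'] in blast)
  then show "0 \<le> (\<integral>s. (F s)\<^sup>2 * exp (- (2 * m * s)) \<partial>lborel) - 2 * \<tau> * (L / t) * (\<integral>s. h s \<partial>lborel)
            + \<tau>\<^sup>2 * (\<integral>s. (Y s)\<^sup>2 \<partial>lborel)"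
    by (simp add: I0_def B_def D_def)
  have "(\<integral>\<^sup>+s. ennreal ((X s + \<tau> * Y s)\<^sup>2) \<partial>lborel) \<le> ennreal (I0 + 0 - 2 * \<tau> * (L / t) * D + \<tau>\<^sup>2 * B)"
  proof (rule nn_integral_le_exhaustion[OF _ a(1) b(1)])
    show "(\<integral>\<^sup>+s. ennreal ((X s + \<tau> * Y s)\<^sup>2) * indicator {a k..b k} s \<partial>lborel)
      \<le> ennreal (I0 + e \<tau> k - 2 * \<tau> * (L / t) * (LBINT s:{a k..b k}. h s) + \<tau>\<^sup>2 * B)" for k
      using Qi[of "a k" "b k" \<tau>] key'[of k \<tau>] unfolding Qe[symmetric]
      by (subst nnset) (auto intro!: ennreal_leI)
    show "(\<lambda>k. I0 + e \<tau> k - 2 * \<tau> * (L / t) * (LBINT s:{a k..b k}. h s) + \<tau>\<^sup>2 * B)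
      \<longlonglongrightarrow> I0 + 0 - 2 * \<tau> * (L / t) * D + \<tau>\<^sup>2 * B" by (rule lim)
  qed measurable
  then show "(\<integral>\<^sup>+s. ennreal ((X s + \<tau> * Y s)\<^sup>2) \<partial>lborel)
      \<le> ennreal ((\<integral>s. (F s)\<^sup>2 * exp (- (2 * m * s)) \<partial>lborel) - 2 * \<tau> * (L / t) * (\<integral>s. h s \<partial>lborel)
            + \<tau>\<^sup>2 * (\<integral>s. (Y s)\<^sup>2 \<partial>lborel))"
    by (simp add: I0_def B_def D_def)
qed

section \<open>The discriminant and the Cauchy-Schwarz inequality\<close>

lemma quadratic_nonneg_imp:
  fixes A B C :: real
  assumes "\<And>\<tau>. 0 \<le> A + 2 * \<tau> * B + \<tau>\<^sup>2 * C" and C: "C \<ge> 0"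
  shows "B\<^sup>2 \<le> A * C"
proof (cases "C = 0")
  case True
  have "B = 0"
  proof (rule ccontr)
    assume "B \<noteq> 0"
    then show False using assms(1)[of "- (A + 1) / (2 * B)"] True by (simp add: field_simps)
  qed
  then show ?thesis using True by simp
next
  case False
  have "0 \<le> A + 2 * (- B / C) * B + (- B / C)\<^sup>2 * C" by (rule assms)
  also have "\<dots> = A - B\<^sup>2 / C" using False by (simp add: power2_eq_square field_simps)
  finally show ?thesis using False C by (simp add: field_simps)
qed

lemma
  fixes f g :: "'b \<Rightarrow> real"
  assumes [measurable]: "f \<in> borel_measurable M" "g \<in> borel_measurable M"
    and f2: "integrable M (\<lambda>x. (f x)\<^sup>2)" and g2: "integrable M (\<lambda>x. (g x)\<^sup>2)"
  shows integrable_mult_L2: "integrable M (\<lambda>x. f x * g x)"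
    and Cauchy_Schwarz_integral: "(\<integral>x. f x * g x \<partial>M)\<^sup>2 \<le> (\<integral>x. (f x)\<^sup>2 \<partial>M) * (\<integral>x. (g x)\<^sup>2 \<partial>M)"
proof -
  show fg: "integrable M (\<lambda>x. f x * g x)"
  proof (rule Bochner_Integration.integrable_bound[OF Bochner_Integration.integrable_add[OF f2 g2]])
    have "\<bar>f x * g x\<bar> \<le> (f x)\<^sup>2 + (g x)\<^sup>2" for x
    proof -
      have "0 \<le> \<bar>f x\<bar> * \<bar>g x\<bar>" by simp
      then show ?thesis using sum_squares_bound[of "\<bar>f x\<bar>" "\<bar>g x\<bar>"]
        by (simp only: abs_mult power2_abs mult.assoc)
    qed
    then show "AE x in M. norm (f x * g x) \<le> norm ((f x)\<^sup>2 + (g x)\<^sup>2)" by (intro AE_I2) simp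
  qed measurable
  show "(\<integral>x. f x * g x \<partial>M)\<^sup>2 \<le> (\<integral>x. (f x)\<^sup>2 \<partial>M) * (\<integral>x. (g x)\<^sup>2 \<partial>M)"
  proof (rule quadratic_nonneg_imp)
    fix \<tau> :: real
    have "0 \<le> (\<integral>x. (f x + \<tau> * g x)\<^sup>2 \<partial>M)" by (intro integral_nonneg_AE) auto
    also have "\<dots> = (\<integral>x. (f x)\<^sup>2 + 2 * \<tau> * (f x * g x) + \<tau>\<^sup>2 * (g x)\<^sup>2 \<partial>M)"
      by (intro Bochner_Integration.integral_cong) (auto simp: power2_eq_square algebra_simps)
    also have "\<dots> = (\<integral>x. (f x)\<^sup>2 \<partial>M) + 2 * \<tau> * (\<integral>x. f x * g x \<partial>M) + \<tau>\<^sup>2 * (\<integral>x. (g x)\<^sup>2 \<partial>M)"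
      using f2 g2 fg by simp
    finally show "0 \<le> (\<integral>x. (f x)\<^sup>2 \<partial>M) + 2 * \<tau> * (\<integral>x. f x * g x \<partial>M) + \<tau>\<^sup>2 * (\<integral>x. (g x)\<^sup>2 \<partial>M)" .
  qed auto
qed

text \<open>\<open>k\<close> is integrable on compact intervals only, so the statement for boxes is
  applied to its cut-offs to \<open>{- N..N}\<close>; up to end points, intersecting with a box
  leaves an interval.\<close>

lemma AE_zero_of_interval_integrals:
  fixes k :: "real \<Rightarrow> real"
  assumes k: "\<And>a b. set_integrable lborel {a..b} k"
    and z: "\<And>a b. a < b \<Longrightarrow> (LBINT s:{a..b}. k s) = 0"
  shows "AE s in lborel. k s = 0"
proof -
  have "AE s in lborel. indicator {- real N..real N} s * k s = 0" for N :: nat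
  proof (rule AE_zero_of_box_integrals)
    show "integrable lborel (\<lambda>s. indicator {- real N..real N} s * k s)"
      using k[of "- real N" "real N"] by (simp add: set_integrable_def)
    fix a b :: real
    have "(LINT s:box a b|lborel. indicator {- real N..real N} s * k s)
        = (LBINT s:{max a (- real N)..min b (real N)}. k s)"
      unfolding set_lebesgue_integral_def
    proof (rule integral_cong_AE)
      show "AE s in lborel. indicat_real (box a b) s *\<^sub>R (indicator {- real N..real N} s * k s)
          = indicat_real {max a (- real N)..min b (real N)} s *\<^sub>R k s"
        using AE_lborel_singleton[of a] AE_lborel_singleton[of b]
        by eventually_elim (auto simp: indicator_def box_real)
      have "(\<lambda>s. indicator {- real N..real N} s * k s) \<in> borel_measurable borel"
        using k[of "- real N" "real N"] borel_measurable_integrable by (fastforce simp: set_integrable_def)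
      then show "(\<lambda>s. indicat_real (box a b) s *\<^sub>R (indicator {- real N..real N} s * k s)) \<in> borel_measurable lborel"
        by (intro borel_measurable_scaleR) auto
      show "(\<lambda>s. indicat_real {max a (- real N)..min b (real N)} s *\<^sub>R k s) \<in> borel_measurable lborel"
        using k borel_measurable_integrable unfolding set_integrable_def by blast
    qed
    also have "\<dots> = 0"
    proof (cases "max a (- real N)" "min b (real N)" rule: linorder_cases)
      case less then show ?thesis by (rule z)
    next
      case equal then show ?thesis by simp
    next
      case greater then show ?thesis by (simp add: set_lebesgue_integral_def)
    qed
    finally show "(LINT s:box a b|lborel. indicator {- real N..real N} s * k s) = 0" .
  qed
  then have "AE s in lborel. \<forall>N::nat. indicator {- real N..real N} s * k s = 0"
    by (subst AE_all_countable) auto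
  then show ?thesis
  proof eventually_elim
    case (elim s)
    obtain N :: nat where "\<bar>s\<bar> \<le> real N" using real_arch_simple by blast
    then have "s \<in> {- real N..real N}" by (auto simp: abs_le_iff)
    then show ?case using elim[rule_format, of N] by simp
  qed
qed

lemma primitive_of_exists:
  assumes F: "\<And>a b. set_integrable lborel {a..b} F"
  obtains G where "primitive_of F G"
proof -
  define G where "G s = (if s \<ge> 0 then LBINT x:{0..s}. F x else - (LBINT x:{s..0}. F x))" for s
  have "primitive_of F G"
    unfolding primitive_of_def
  proof (intro conjI allI impI F)
    fix a b :: real assume ab: "a \<le> b"
    consider "0 \<le> a" | "a < 0" "0 \<le> b" | "b < 0" using ab by linarith
    then show "G b - G a = (LBINT s:{a..b}. F s)"
    proof cases
      case 1 then show ?thesis using set_integral_Icc_combine[OF F, of 0 a b] ab by (simp add: G_def)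
    next
      case 2 then show ?thesis using set_integral_Icc_combine[OF F, of a 0 b] by (simp add: G_def)
    next
      case 3 then show ?thesis using set_integral_Icc_combine[OF F, of a b 0] ab by (simp add: G_def)
    qed
  qed
  then show ?thesis by (rule that)
qed

lemma primitive_of_add_const: "primitive_of F G \<Longrightarrow> primitive_of F (\<lambda>s. G s + c)"
  by (simp add: primitive_of_def)

text \<open>Integration by parts against the function of \<open>s\<close> that is
  \<open>b - a\<close> up to \<open>a\<close>, falls with slope \<open>-1\<close> on
  \<open>{a..b}\<close> and is 0 beyond \<open>b\<close>. It is the profile of a truncated
  logarithm, so the fluxes obtained from test functions become integrals of a primitive over
  intervals.\<close>

lemma primitive_clamp_integral:
  assumes P: "primitive_of F G" and o: "N \<le> a" "a < b" "b \<le> M"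
  shows "(LBINT s:{N..M}. (b - max a (min b s)) * F s) = (LBINT s:{a..b}. G s) - (b - a) * G N"
proof -
  note P' = primitive_ofD[OF P]
  have i: "set_integrable lborel {x..y} (\<lambda>s. (b - max a (min b s)) * F s)" for x y
    by (rule set_integrable_mult_continuous[OF P'(1)]) (intro continuous_intros)
  have cG: "continuous_on UNIV G" by (rule primitive_of_continuous[OF P])
  have Gi: "set_integrable lborel {x..y} G" for x y
    by (rule borel_integrable_atLeastAtMost'[OF continuous_on_subset[OF cG]]) auto
  have "(LBINT s:{N..a}. (b - max a (min b s)) * F s) = (LBINT s:{N..a}. (b - a) * F s)"
    using o by (intro set_lebesgue_integral_cong) auto
  then have 1: "(LBINT s:{N..a}. (b - max a (min b s)) * F s) = (b - a) * (G a - G N)"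
    using P'(2)[of N a] o by simp
  have "(LBINT s:{b..M}. (b - max a (min b s)) * F s) = (LBINT s:{b..M}. 0)"
    using o by (intro set_lebesgue_integral_cong) auto
  then have 3: "(LBINT s:{b..M}. (b - max a (min b s)) * F s) = 0" by (simp add: set_lebesgue_integral_def)
  have "(LBINT s:{a..b}. (b - max a (min b s)) * F s) = (LBINT s:{a..b}. (b - s) * F s)"
    using o by (intro set_lebesgue_integral_cong) auto
  moreover have "(LBINT s:{a..b}. (b - s) * F s) - (LBINT s:{a..b}. G s) = - ((b - a) * G a)"
  proof -
    have Q: "primitive_of (\<lambda>s. - 1) (\<lambda>s. b - s)"
      by (rule primitive_of_C1) (auto intro!: derivative_eq_intros)
    have i': "set_integrable lborel {a..b} (\<lambda>s. (b - s) * F s)"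
      by (rule set_integrable_mult_continuous[OF P'(1)]) (intro continuous_intros)
    have "G b * (b - b) - G a * (b - a) = (LBINT s:{a..b}. (b - s) * F s + G s * (- 1))"
      using primitive_ofD(2)[OF primitive_of_mult[OF P Q], of a b] o by simp
    then show ?thesis using i' Gi by (simp add: mult.commute)
  qed
  ultimately have 2: "(LBINT s:{a..b}. (b - max a (min b s)) * F s) = (LBINT s:{a..b}. G s) - (b - a) * G a" by simp
  have "(LBINT s:{N..M}. (b - max a (min b s)) * F s) = (LBINT s:{N..a}. (b - max a (min b s)) * F s)
     + ((LBINT s:{a..b}. (b - max a (min b s)) * F s) + (LBINT s:{b..M}. (b - max a (min b s)) * F s))"
    using set_integral_Icc_combine[OF i, of N a M] set_integral_Icc_combine[OF i, of a b M] o by simp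
  then show ?thesis unfolding 1 2 3 by (simp add: algebra_simps)
qed

lemma set_integral_at_bot:
  fixes f :: "real \<Rightarrow> real"
  assumes "integrable lborel f"
  shows "((\<lambda>x. LBINT s:{..x}. f s) \<longlongrightarrow> 0) at_bot" "((\<lambda>x. LBINT s:{x..}. f s) \<longlongrightarrow> 0) at_top"
proof -
  have m: "f \<in> borel_measurable borel" using borel_measurable_integrable[OF assms] by simp
  have "((\<lambda>x. LBINT s:{..- x}. f s) \<longlongrightarrow> (\<integral>s. 0 \<partial>(lborel::real measure))) at_top"
    unfolding set_lebesgue_integral_def
  proof (rule integral_dominated_convergence_at_top[where w="\<lambda>s. norm (f s)"])
    show "AE s in lborel. ((\<lambda>x. indicat_real {..- x} s *\<^sub>R f s) \<longlongrightarrow> 0) at_top"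
    proof (intro AE_I2 tendsto_eventually)
      fix s :: real
      show "\<forall>\<^sub>F x in at_top. indicat_real {..- x} s *\<^sub>R f s = 0"
        using eventually_gt_at_top[of "- s"] by eventually_elim simp
    qed
    show "\<forall>\<^sub>F x in at_top. AE s in lborel. norm (indicat_real {..- x} s *\<^sub>R f s) \<le> norm (f s)"
      by (intro always_eventually allI AE_I2) (auto simp: indicator_def)
  qed (use m assms in auto)
  then have "((\<lambda>x. LBINT s:{..- x}. f s) \<longlongrightarrow> 0) at_top" by simp
  then show "((\<lambda>x. LBINT s:{..x}. f s) \<longlongrightarrow> 0) at_bot"
    by (simp add: filterlim_at_bot_mirror)
  have "((\<lambda>x. LBINT s:{x..}. f s) \<longlongrightarrow> (\<integral>s. 0 \<partial>(lborel::real measure))) at_top"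
    unfolding set_lebesgue_integral_def
  proof (rule integral_dominated_convergence_at_top[where w="\<lambda>s. norm (f s)"])
    show "AE s in lborel. ((\<lambda>x. indicat_real {x..} s *\<^sub>R f s) \<longlongrightarrow> 0) at_top"
    proof (intro AE_I2 tendsto_eventually)
      fix s :: real
      show "\<forall>\<^sub>F x in at_top. indicat_real {x..} s *\<^sub>R f s = 0"
        using eventually_gt_at_top[of s] by eventually_elim simp
    qed
    show "\<forall>\<^sub>F x in at_top. AE s in lborel. norm (indicat_real {x..} s *\<^sub>R f s) \<le> norm (f s)"
      by (intro always_eventually allI AE_I2) (auto simp: indicator_def)
  qed (use m assms in auto)
  then show "((\<lambda>x. LBINT s:{x..}. f s) \<longlongrightarrow> 0) at_top" by simp
qed

lemma set_integral_le_set_integral: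
  fixes f :: "real \<Rightarrow> real"
  assumes "integrable lborel f" "\<And>s. f s \<ge> 0" "A \<subseteq> B" "A \<in> sets borel" "B \<in> sets borel"
  shows "(LBINT s:A. f s) \<le> (LBINT s:B. f s)"
  unfolding set_lebesgue_integral_def
  using assms by (intro integral_mono integrable_mult_indicator) (auto simp: indicator_def)

text \<open>The identities \<open>c1\<close>, \<open>c2\<close>, \<open>c3\<close> say that \<open>Gt\<close> is the flux of a field with divergence
  \<open>F\<close>; which of them is available at the ends of the line depends on the sign of \<open>m\<close>, and this is
  what fixes the constant of integration.\<close>

lemma flux_primitive:
  fixes F Gt :: "real \<Rightarrow> real" and m :: real
  assumes F: "\<And>a b. set_integrable lborel {a..b} F" and Fm[measurable]: "F \<in> borel_measurable borel"
    and Gt: "\<And>a b. set_integrable lborel {a..b} Gt"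
    and IF: "integrable lborel (\<lambda>s. (F s)\<^sup>2 * exp (- (2 * m * s)))"
    and c1: "\<And>a b c d. a < b \<Longrightarrow> c < d \<Longrightarrow>
      (\<integral>s. F s * ((b - max a (min b s)) / (b - a) - (d - max c (min d s)) / (d - c)) \<partial>lborel)
        = (LBINT s:{a..b}. Gt s) / (b - a) - (LBINT s:{c..d}. Gt s) / (d - c)"
    and c2: "\<And>a b. m > 0 \<Longrightarrow> a < b \<Longrightarrow> integrable lborel (\<lambda>s. F s * (b - max a (min b s))) \<and>
       (\<integral>s. F s * (b - max a (min b s)) \<partial>lborel) = (LBINT s:{a..b}. Gt s)"
    and c3: "\<And>a b. m < 0 \<Longrightarrow> a < b \<Longrightarrow> integrable lborel (\<lambda>s. F s * (a - max a (min b s))) \<and>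
       (\<integral>s. F s * (a - max a (min b s)) \<partial>lborel) = (LBINT s:{a..b}. Gt s)"
  obtains G C where "primitive_of F G" "AE s in lborel. Gt s = G s"
    "m > 0 \<Longrightarrow> ((\<lambda>s. (G s)\<^sup>2 * exp (- (2 * m * s))) \<longlongrightarrow> 0) at_bot"
    "m < 0 \<Longrightarrow> ((\<lambda>s. (G s)\<^sup>2 * exp (- (2 * m * s))) \<longlongrightarrow> 0) at_top"
    "\<And>s. (G s)\<^sup>2 * exp (- (2 * m * s)) \<le> C * (1 + \<bar>s\<bar>)"
proof -
  obtain G0 where G0: "primitive_of F G0" by (rule primitive_of_exists[OF F])
  \<comment> \<open>The constant gives \<open>G\<close> and \<open>Gt\<close> the same mean over
    \<open>{0..1}\<close>; \<open>c1\<close> then compares every other interval with this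
    one.\<close>
  define c where "c = (LBINT s:{0..1}. Gt s) - (LBINT s:{0..1}. G0 s)"
  define G where "G s = G0 s + c" for s
  have P: "primitive_of F G" unfolding G_def[abs_def] by (rule primitive_of_add_const[OF G0])
  note P' = primitive_ofD[OF P]
  have cG: "continuous_on UNIV G" by (rule primitive_of_continuous[OF P])
  have [measurable]: "G \<in> borel_measurable borel" using cG by (rule borel_measurable_continuous_onI)
  have Gi: "set_integrable lborel {x..y} G" for x y
    by (rule borel_integrable_atLeastAtMost'[OF continuous_on_subset[OF cG]]) auto
  have G0i: "set_integrable lborel {x..y} G0" for x y
    by (rule borel_integrable_atLeastAtMost'[OF continuous_on_subset[OF primitive_of_continuous[OF G0]]]) auto
  have avg1: "(LBINT s:{0..1}. G s) = (LBINT s:{0..1}. Gt s)"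
  proof -
    have "set_integrable lborel {0..1} (\<lambda>s::real. c)"
      by (intro borel_integrable_atLeastAtMost' continuous_intros)
    moreover have "(LBINT s:{0..1::real}. c) = c" by (simp add: set_lebesgue_integral_def)
    ultimately have "(LBINT s:{0..1}. G s) = (LBINT s:{0..1}. G0 s) + c"
      unfolding G_def using set_integral_add(2)[OF G0i] by simp
    then show ?thesis by (simp add: c_def)
  qed
  have eqI: "(LBINT s:{a..b}. Gt s) = (LBINT s:{a..b}. G s)" if ab: "a < b" for a b
  proof -
    define N where "N = min a 0" define M where "M = max b 1"
    have NM: "N \<le> a" "N \<le> 0" "b \<le> M" "1 \<le> M" by (auto simp: N_def M_def)
    let ?\<Psi> = "\<lambda>s::real. (b - max a (min b s)) / (b - a) - (1 - max 0 (min 1 s)) / (1 - 0)"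
    have i: "set_integrable lborel {N..M} (\<lambda>s. (v - max u (min v s)) * F s)" for u v :: real
      by (rule set_integrable_mult_continuous[OF F]) (intro continuous_intros)
    have z: "?\<Psi> s = 0" if "s \<notin> {N..M}" for s
    proof (cases "s < N")
      case True
      then have "max a (min b s) = a" "max 0 (min 1 s) = 0" using NM ab by auto
      then show ?thesis using ab by simp
    next
      case False
      then have "max a (min b s) = b" "max 0 (min 1 s) = 1" using NM ab that by auto
      then show ?thesis by simp
    qed
    have "(\<integral>s. F s * ?\<Psi> s \<partial>lborel) = (LBINT s:{N..M}. (1 / (b - a)) * ((b - max a (min b s)) * F s) - (1 - max 0 (min 1 s)) * F s)"
      unfolding set_lebesgue_integral_def
    proof (rule Bochner_Integration.integral_cong)
      fix s
      show "F s * ?\<Psi> s = indicat_real {N..M} s *\<^sub>R ((1 / (b - a)) * ((b - max a (min b s)) * F s) - (1 - max 0 (min 1 s)) * F s)"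
      proof (cases "s \<in> {N..M}")
        case True
        have "F s * ?\<Psi> s = (1 / (b - a)) * ((b - max a (min b s)) * F s) - (1 - max 0 (min 1 s)) * F s"
          unfolding right_diff_distrib[of "F s"] by (simp add: mult.commute)
        then show ?thesis using True by simp
      qed (use z[of s] in simp)
    qed simp
    also have "\<dots> = (1 / (b - a)) * (LBINT s:{N..M}. (b - max a (min b s)) * F s) - (LBINT s:{N..M}. (1 - max 0 (min 1 s)) * F s)"
      by (simp only: set_integral_diff(2)[OF set_integrable_mult_right[OF i] i] set_integral_mult_right)
    also have "\<dots> = (1 / (b - a)) * (LBINT s:{a..b}. G s) - (LBINT s:{0..1}. G s)"
      unfolding primitive_clamp_integral[OF P NM(1) ab NM(3)]
        primitive_clamp_integral[OF P NM(2) zero_less_one NM(4)]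
      using ab by (simp add: field_simps)
    finally show ?thesis using c1[OF ab, of 0 1] avg1 ab by (simp add: field_simps)
  qed
  have "AE s in lborel. Gt s - G s = 0"
    using eqI Gi Gt by (intro AE_zero_of_interval_integrals) auto
  then have ae: "AE s in lborel. Gt s = G s" by simp
  define J where "J A = (LBINT s:A. (F s)\<^sup>2 * exp (- (2 * m * s)))" for A
  define I0 where "I0 = J UNIV"
  have JI: "J A \<le> I0" if "A \<in> sets borel" for A
    unfolding J_def I0_def using that by (intro set_integral_le_set_integral IF) auto
  have J0: "J A \<ge> 0" for A
    unfolding J_def set_lebesgue_integral_def by (intro integral_nonneg_AE AE_I2) auto
  \<comment> \<open>Cauchy-Schwarz for the splitting
    \<open>F = (F e^(-m s)) e^(m s)\<close>.\<close>
  have CS: "(G y - G x)\<^sup>2 \<le> J {x..y} * (LBINT s:{x..y}. exp (2 * m * s))" if "x \<le> y" for x y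
  proof -
    let ?f = "\<lambda>s. indicator {x..y} s * (F s * exp (- (m * s)))" and ?g = "\<lambda>s. indicator {x..y} s * exp (m * s)"
    have f2: "(?f s)\<^sup>2 = indicator {x..y} s *\<^sub>R ((F s)\<^sup>2 * exp (- (2 * m * s)))" for s
      by (auto simp: indicator_def power_mult_distrib power2_eq_square exp_add[symmetric] algebra_simps)
    have g2: "(?g s)\<^sup>2 = indicator {x..y} s *\<^sub>R exp (2 * m * s)" for s
      by (auto simp: indicator_def power2_eq_square exp_add[symmetric] algebra_simps)
    have fg: "?f s * ?g s = indicator {x..y} s *\<^sub>R F s" for s
      by (auto simp: indicator_def exp_add[symmetric] algebra_simps)
    have "(\<integral>s. ?f s * ?g s \<partial>lborel)\<^sup>2 \<le> (\<integral>s. (?f s)\<^sup>2 \<partial>lborel) * (\<integral>s. (?g s)\<^sup>2 \<partial>lborel)"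
    proof (rule Cauchy_Schwarz_integral)
      show "integrable lborel (\<lambda>s. (?f s)\<^sup>2)" unfolding f2 using IF by (intro integrable_mult_indicator) auto
      have "set_integrable lborel {x..y} (\<lambda>s. exp (2 * m * s))"
        by (intro borel_integrable_atLeastAtMost' continuous_intros)
      then show "integrable lborel (\<lambda>s. (?g s)\<^sup>2)" unfolding g2 set_integrable_def .
    qed measurable
    then show ?thesis unfolding f2 g2 fg P'(2)[OF that] J_def set_lebesgue_integral_def .
  qed
  have expI: "(LBINT s:{x..y}. exp (2 * m * s)) = (exp (2 * m * y) - exp (2 * m * x)) / (2 * m)" if "x \<le> y" "m \<noteq> 0" for x y
  proof -
    have "primitive_of (\<lambda>s. exp (2 * m * s)) (\<lambda>s. exp (2 * m * s) / (2 * m))"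
      using that by (intro primitive_of_C1) (auto intro!: derivative_eq_intros continuous_intros)
    from primitive_ofD(2)[OF this that(1)] show ?thesis by (simp add: diff_divide_distrib)
  qed
  consider "m > 0" | "m < 0" | "m = 0" by linarith
  then show ?thesis
  proof cases
    case 1
    have lim: "(G \<longlongrightarrow> 0) at_bot"
    proof -
      \<comment> \<open>The multiplier is 1 on all of \<open>{..0}\<close>. It is admissible by
        \<open>c2\<close>, and for \<open>N \<le> 0\<close> this identifies \<open>G N\<close> as
        the integral of \<open>F\<close> over \<open>{..N}\<close>, with no constant left
        over.\<close>
      let ?k = "\<lambda>s. F s * (1 - max 0 (min 1 s))"
      have ki: "integrable lborel ?k" and ke: "(\<integral>s. ?k s \<partial>lborel) = (LBINT s:{0..1}. Gt s)" using c2[OF 1, of 0 1] by auto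
      have "(LBINT s:{..N}. ?k s) = G N" if "N \<le> 0" for N
      proof -
        have a: "set_integrable lborel A ?k" if "A \<in> sets borel" for A
          using ki that unfolding set_integrable_def by (intro integrable_mult_indicator) auto
        have u: "{..N} \<union> {N<..} = UNIV" by auto
        have "(\<integral>s. ?k s \<partial>lborel) = (LBINT s:{..N} \<union> {N<..}. ?k s)"
          unfolding u by (simp add: set_lebesgue_integral_def)
        also have "\<dots> = (LBINT s:{..N}. ?k s) + (LBINT s:{N<..}. ?k s)"
          by (intro set_integral_Un a) auto
        also have "(LBINT s:{N<..}. ?k s) = (LBINT s:{N..1}. (1 - max 0 (min 1 s)) * F s)"
          unfolding set_lebesgue_integral_def
        proof (rule integral_cong_AE)
          show "AE s in lborel. indicat_real {N<..} s *\<^sub>R ?k s = indicat_real {N..1} s *\<^sub>R ((1 - max 0 (min 1 s)) * F s)"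
            using AE_lborel_singleton[of N] by eventually_elim (auto simp: indicator_def)
        qed measurable
        also have "\<dots> = (LBINT s:{0..1}. G s) - G N"
          using primitive_clamp_integral[OF P that, of 1 1] by simp
        finally show ?thesis using ke avg1 by simp
      qed
      then have "\<forall>\<^sub>F N in at_bot. (LBINT s:{..N}. ?k s) = G N"
        by (rule eventually_mono[OF eventually_le_at_bot[of 0]])
      with set_integral_at_bot(1)[OF ki] show ?thesis by (rule Lim_transform_eventually)
    qed
    \<comment> \<open>Letting \<open>x\<close> tend to minus infinity in \<open>CS\<close> removes
      \<open>G x\<close>. What remains is a tail of the convergent integral \<open>J UNIV\<close>,
      which yields both the uniform bound and the limit 0.\<close>
    have b: "(G y)\<^sup>2 * exp (- (2 * m * y)) \<le> J {..y} / (2 * m)" for y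
    proof -
      have "((\<lambda>x. (G y - G x)\<^sup>2) \<longlongrightarrow> (G y - 0)\<^sup>2) at_bot" by (intro tendsto_intros lim)
      moreover have "\<forall>\<^sub>F x in at_bot. (G y - G x)\<^sup>2 \<le> J {..y} * (exp (2 * m * y) / (2 * m))"
        using eventually_le_at_bot[of y]
      proof eventually_elim
        case (elim x)
        have "(G y - G x)\<^sup>2 \<le> J {x..y} * (LBINT s:{x..y}. exp (2 * m * s))" by (rule CS[OF elim])
        also have "\<dots> \<le> J {..y} * (exp (2 * m * y) / (2 * m))"
          unfolding expI[OF elim order.strict_implies_not_eq[OF 1, symmetric]]
          using 1 elim J0 by (intro mult_mono divide_right_mono)
            (auto simp: J_def intro!: set_integral_le_set_integral IF)
        finally show ?case .
      qed
      ultimately have "(G y - 0)\<^sup>2 \<le> J {..y} * (exp (2 * m * y) / (2 * m))"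
        by (intro tendsto_upperbound) auto
      then have "(G y)\<^sup>2 * exp (- (2 * m * y)) \<le> J {..y} * (exp (2 * m * y) / (2 * m)) * exp (- (2 * m * y))"
        by (intro mult_right_mono) auto
      also have "\<dots> = J {..y} / (2 * m) * (exp (2 * m * y) * exp (- (2 * m * y)))" by simp
      finally show ?thesis by (simp add: exp_add[symmetric])
    qed
    have J1: "((\<lambda>y. J {..y} / (2 * m)) \<longlongrightarrow> 0) at_bot"
      using tendsto_divide[OF set_integral_at_bot(1)[OF IF] tendsto_const[of "2 * m"]] 1 by (simp add: J_def)
    show ?thesis
    proof (rule that[OF P ae])
      show "((\<lambda>s. (G s)\<^sup>2 * exp (- (2 * m * s))) \<longlongrightarrow> 0) at_bot"
        by (rule tendsto_sandwich[OF always_eventually always_eventually[OF allI, OF b] tendsto_const J1]) simp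
      show "(G s)\<^sup>2 * exp (- (2 * m * s)) \<le> I0 / (2 * m) * (1 + \<bar>s\<bar>)" for s
      proof -
        have p: "I0 / (2 * m) \<ge> 0" using 1 J0[of UNIV] unfolding I0_def by (intro divide_nonneg_pos) auto
        have "J {..s} / (2 * m) \<le> I0 / (2 * m)" using JI 1 by (intro divide_right_mono) auto
        also have "\<dots> = I0 / (2 * m) * 1" by simp
        also have "\<dots> \<le> I0 / (2 * m) * (1 + \<bar>s\<bar>)" by (rule mult_left_mono[OF _ p]) simp
        finally show ?thesis using b[of s] by linarith
      qed
    qed (use 1 in auto)
  next
    case 2
    have lim: "(G \<longlongrightarrow> 0) at_top"
    proof -
      \<comment> \<open>Mirror image of the previous case: the multiplier from \<open>c3\<close>
        vanishes on the left and is \<open>- 1\<close> on \<open>{1..}\<close>, so for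
        \<open>N \<ge> 1\<close> the value \<open>G N\<close> is minus the integral of
        \<open>F\<close> over \<open>{N..}\<close>.\<close>
      let ?k = "\<lambda>s. F s * (0 - max 0 (min 1 s))"
      have ki: "integrable lborel ?k" and ke: "(\<integral>s. ?k s \<partial>lborel) = (LBINT s:{0..1}. Gt s)" using c3[OF 2, of 0 1] by auto
      have "(LBINT s:{N..}. ?k s) = G N" if "N \<ge> 1" for N
      proof -
        have a: "set_integrable lborel A ?k" if "A \<in> sets borel" for A
          using ki that unfolding set_integrable_def by (intro integrable_mult_indicator) auto
        have u: "{..<N} \<union> {N..} = UNIV" by auto
        have "(\<integral>s. ?k s \<partial>lborel) = (LBINT s:{..<N} \<union> {N..}. ?k s)"
          unfolding u by (simp add: set_lebesgue_integral_def)
        also have "\<dots> = (LBINT s:{..<N}. ?k s) + (LBINT s:{N..}. ?k s)"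
          by (intro set_integral_Un a) auto
        also have "(LBINT s:{..<N}. ?k s) = (LBINT s:{0..N}. (1 - max 0 (min 1 s)) * F s - F s)"
          unfolding set_lebesgue_integral_def
        proof (rule integral_cong_AE)
          show "AE s in lborel. indicat_real {..<N} s *\<^sub>R ?k s = indicat_real {0..N} s *\<^sub>R ((1 - max 0 (min 1 s)) * F s - F s)"
            using AE_lborel_singleton[of N] by eventually_elim (auto simp: indicator_def algebra_simps)
        qed measurable
        also have "\<dots> = (LBINT s:{0..N}. (1 - max 0 (min 1 s)) * F s) - (LBINT s:{0..N}. F s)"
          by (intro set_integral_diff F set_integrable_mult_continuous continuous_intros)
        also have "\<dots> = ((LBINT s:{0..1}. G s) - G 0) - (G N - G 0)"
          using primitive_clamp_integral[OF P, of 0 0 1 N] P'(2)[of 0 N] that by simp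
        finally show ?thesis using ke avg1 by simp
      qed
      then have "\<forall>\<^sub>F N in at_top. (LBINT s:{N..}. ?k s) = G N"
        by (rule eventually_mono[OF eventually_ge_at_top[of 1]])
      with set_integral_at_bot(2)[OF ki] show ?thesis by (rule Lim_transform_eventually)
    qed
    have b: "(G x)\<^sup>2 * exp (- (2 * m * x)) \<le> J {x..} / (- 2 * m)" for x
    proof -
      have "((\<lambda>y. (G y - G x)\<^sup>2) \<longlongrightarrow> (0 - G x)\<^sup>2) at_top" by (intro tendsto_intros lim)
      moreover have "\<forall>\<^sub>F y in at_top. (G y - G x)\<^sup>2 \<le> J {x..} * (exp (2 * m * x) / (- 2 * m))"
        using eventually_ge_at_top[of x]
      proof eventually_elim
        case (elim y)
        have "(G y - G x)\<^sup>2 \<le> J {x..y} * (LBINT s:{x..y}. exp (2 * m * s))" by (rule CS[OF elim])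
        also have "\<dots> \<le> J {x..} * (exp (2 * m * x) / (- 2 * m))"
          unfolding expI[OF elim order.strict_implies_not_eq[OF 2]]
        proof (intro mult_mono J0)
          show "J {x..y} \<le> J {x..}" by (auto simp: J_def intro!: set_integral_le_set_integral IF)
          show "(exp (2 * m * y) - exp (2 * m * x)) / (2 * m) \<le> exp (2 * m * x) / (- 2 * m)"
            using mult_nonpos_nonneg[of m "exp (m * (y * 2))"] 2 by (simp add: field_simps)
          show "0 \<le> (exp (2 * m * y) - exp (2 * m * x)) / (2 * m)"
            using 2 elim by (intro divide_nonpos_neg) (auto simp: mult_left_mono_neg)
        qed
        finally show ?case .
      qed
      ultimately have "(0 - G x)\<^sup>2 \<le> J {x..} * (exp (2 * m * x) / (- 2 * m))"
        by (intro tendsto_upperbound) auto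
      then have "(G x)\<^sup>2 * exp (- (2 * m * x)) \<le> J {x..} * (exp (2 * m * x) / (- 2 * m)) * exp (- (2 * m * x))"
        by (intro mult_right_mono) auto
      also have "\<dots> = J {x..} / (- 2 * m) * (exp (2 * m * x) * exp (- (2 * m * x)))" by simp
      finally show ?thesis by (simp add: exp_add[symmetric])
    qed
    have J1: "((\<lambda>y. J {y..} / (- 2 * m)) \<longlongrightarrow> 0) at_top"
      using tendsto_divide[OF set_integral_at_bot(2)[OF IF] tendsto_const[of "- 2 * m"]] 2 by (simp add: J_def)
    show ?thesis
    proof (rule that[OF P ae])
      show "((\<lambda>s. (G s)\<^sup>2 * exp (- (2 * m * s))) \<longlongrightarrow> 0) at_top"
        by (rule tendsto_sandwich[OF always_eventually always_eventually[OF allI, OF b] tendsto_const J1]) simp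
      show "(G s)\<^sup>2 * exp (- (2 * m * s)) \<le> I0 / (- 2 * m) * (1 + \<bar>s\<bar>)" for s
      proof -
        have p: "I0 / (- 2 * m) \<ge> 0" using 2 J0[of UNIV] unfolding I0_def by (intro divide_nonneg_pos) auto
        have "J {s..} / (- 2 * m) \<le> I0 / (- 2 * m)" using JI 2 by (intro divide_right_mono) auto
        also have "\<dots> = I0 / (- 2 * m) * 1" by simp
        also have "\<dots> \<le> I0 / (- 2 * m) * (1 + \<bar>s\<bar>)" by (rule mult_left_mono[OF _ p]) simp
        finally show ?thesis using b[of s] by linarith
      qed
    qed (use 2 in auto)
  next
    case 3
    have E: "(LBINT s:{x..y}. exp (2 * m * s)) = y - x" if "x \<le> y" for x y :: real
      unfolding set_lebesgue_integral_def using 3 that by simp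
    \<comment> \<open>No decay of \<open>G\<close> is available here. Cauchy-Schwarz with a constant
      weight leaves linear growth of the square of \<open>G\<close>, which is the origin of the
      factor \<open>1 + \<bar>s\<bar>\<close> in the conclusion.\<close>
    have inc: "(G s - G 0)\<^sup>2 \<le> I0 * \<bar>s\<bar>" for s
    proof (cases "s \<ge> 0")
      case True
      then have "(G s - G 0)\<^sup>2 \<le> J {0..s} * s" using CS[OF True] E[OF True] by simp
      also have "\<dots> \<le> I0 * \<bar>s\<bar>" using True by (intro mult_mono JI J0) (auto simp: I0_def J0)
      finally show ?thesis .
    next
      case False
      then have "(G s - G 0)\<^sup>2 \<le> J {s..0} * (- s)" using CS[of s 0] E[of s 0] by (simp add: power2_commute)
      also have "\<dots> \<le> I0 * \<bar>s\<bar>" using False by (intro mult_mono JI J0) (auto simp: I0_def J0)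
      finally show ?thesis .
    qed
    show ?thesis
    proof (rule that[OF P ae])
      show "(G s)\<^sup>2 * exp (- (2 * m * s)) \<le> (2 * (G 0)\<^sup>2 + 2 * I0) * (1 + \<bar>s\<bar>)" for s
      proof -
        have "(G s)\<^sup>2 \<le> 2 * (G s - G 0)\<^sup>2 + 2 * (G 0)\<^sup>2"
          using sum_squares_bound[of "G s - G 0" "G 0"] by (simp add: power2_eq_square algebra_simps)
        also have "\<dots> \<le> 2 * (I0 * \<bar>s\<bar>) + 2 * (G 0)\<^sup>2" using inc[of s] by simp
        also have "\<dots> \<le> (2 * (G 0)\<^sup>2 + 2 * I0) * (1 + \<bar>s\<bar>)"
          using J0[of UNIV] mult_nonneg_nonneg[of "(G 0)\<^sup>2" "\<bar>s\<bar>"] by (simp add: I0_def[symmetric] algebra_simps)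
        finally show ?thesis using 3 by simp
      qed
    qed (use 3 in auto)
  qed
qed

section \<open>The divergence identity for test functions\<close>

lemma directional_limit:
  fixes F :: "'a::euclidean_space \<Rightarrow> real"
  assumes "(F has_derivative (\<lambda>h. v \<bullet> h)) (at x)"
  shows "((\<lambda>h. (F (x + h *\<^sub>R b) - F x) / h) \<longlongrightarrow> v \<bullet> b) (at_right 0)"
proof -
  have "((\<lambda>h. x + h *\<^sub>R b) has_derivative (\<lambda>k. k *\<^sub>R b)) (at 0)" by (auto intro!: derivative_eq_intros)
  then have "((\<lambda>h. F (x + h *\<^sub>R b)) has_derivative (\<lambda>k. v \<bullet> (k *\<^sub>R b))) (at 0)"
    by (rule has_derivative_compose) (use assms in simp)
  then have "((\<lambda>h. F (x + h *\<^sub>R b)) has_real_derivative (v \<bullet> b)) (at 0)"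
    by (rule has_derivative_imp_has_field_derivative) simp
  then have "((\<lambda>h. (F (x + h *\<^sub>R b) - F x) / h) \<longlongrightarrow> v \<bullet> b) (at 0)"
    by (simp add: has_field_derivative_iff)
  then show ?thesis by (rule tendsto_within_subset) auto
qed

lemma test_function_bounds:
  fixes \<phi> :: "'a::euclidean_space \<Rightarrow> real"
  assumes "test_function \<phi>"
  obtains M where "M \<ge> 0" "\<And>x. \<bar>\<phi> x\<bar> \<le> M" "\<And>x. norm (grad \<phi> x) \<le> M" "\<And>x y. \<bar>\<phi> x - \<phi> y\<bar> \<le> M * norm (x - y)"
proof -
  note T = test_functionD[OF assms]
  obtain R where R: "\<And>x. norm x > R \<Longrightarrow> \<phi> x = 0" using T(5) by blast
  have cg: "continuous_on UNIV (grad \<phi>)"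
    unfolding grad_def[abs_def] using test_functionD(2)[OF test_function_partial(1)[OF assms]]
    by (intro continuous_on_sum continuous_on_scaleR) auto
  have g0: "grad \<phi> x = 0" if "norm x > R" for x
  proof -
    have "closure {x. \<phi> x \<noteq> 0} \<subseteq> cball 0 R" using R by (intro closure_minimal) (force simp: not_less)+
    then have "x \<notin> closure {x. \<phi> x \<noteq> 0}" using that by (metis mem_cball_0 not_le subsetD)
    then show ?thesis by (rule T(7))
  qed
  obtain B1 where B1: "\<And>x. norm (\<phi> x) \<le> B1" by (rule compact_support_bounded[OF T(2) R]) auto
  obtain B2 where B2: "B2 \<ge> 0" "\<And>x. norm (grad \<phi> x) \<le> B2" by (rule compact_support_bounded[OF cg g0]) auto
  show ?thesis
  proof (rule that[of "max B1 B2"])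
    show "\<bar>\<phi> x\<bar> \<le> max B1 B2" for x using B1[of x] by simp
    show g: "norm (grad \<phi> x) \<le> max B1 B2" for x using B2(2)[of x] by simp
    show "\<bar>\<phi> x - \<phi> y\<bar> \<le> max B1 B2 * norm (x - y)" for x y
      by (rule lipschitz_of_grad_bound[OF T(3) g])
  qed (use B2 in simp)
qed

lemma test_function_continuous:
  fixes \<phi> :: "'a::euclidean_space \<Rightarrow> real"
  assumes "test_function \<phi>"
  shows "continuous_on UNIV (grad \<phi>)" "continuous_on UNIV (laplacian \<phi>)"
proof -
  show "continuous_on UNIV (grad \<phi>)"
    unfolding grad_def[abs_def] using test_functionD(2)[OF test_function_partial(1)[OF assms]]
    by (intro continuous_on_sum continuous_on_scaleR) auto
  show "continuous_on UNIV (laplacian \<phi>)"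
    unfolding laplacian_def[abs_def]
    using test_functionD(2)[OF test_function_partial(1)[OF test_function_partial(1)[OF assms]]]
    by (intro continuous_on_sum) auto
qed

lemma test_function_measurable:
  fixes \<phi> :: "'a::euclidean_space \<Rightarrow> real"
  assumes "test_function \<phi>"
  shows "\<phi> \<in> borel_measurable borel" "grad \<phi> \<in> borel_measurable borel" "laplacian \<phi> \<in> borel_measurable borel"
  using test_functionD(2)[OF assms] test_function_continuous[OF assms]
  by (auto intro: borel_measurable_continuous_onI)

lemma grad_inner_Basis: "b \<in> Basis \<Longrightarrow> grad f x \<bullet> b = partial_deriv b f x"
  by (simp add: grad_def inner_sum_left inner_Basis if_distrib cong: if_cong)

lemma laplacian_grad_zero_outside:
  fixes \<phi> :: "'a::euclidean_space \<Rightarrow> real"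
  assumes t: "test_function \<phi>"
  obtains R where "R > 0" "\<And>x. norm x > R \<Longrightarrow> \<phi> x = 0" "\<And>x. norm x > R \<Longrightarrow> grad \<phi> x = 0"
    "\<And>x. norm x > R \<Longrightarrow> laplacian \<phi> x = 0"
proof -
  obtain R where R: "R > 0" "\<And>x. norm x > R \<Longrightarrow> \<phi> x = 0" using test_functionD(5)[OF t] by blast
  have c: "closure {x. \<phi> x \<noteq> 0} \<subseteq> cball 0 R" using R by (intro closure_minimal) (force simp: not_less)+
  show ?thesis
  proof (rule that[OF R])
    fix x :: 'a assume x: "norm x > R"
    then have nx: "x \<notin> closure {x. \<phi> x \<noteq> 0}" using c by (metis mem_cball_0 not_le subsetD)
    show "grad \<phi> x = 0" by (rule test_functionD(7)[OF t nx])
    have "partial_deriv b (partial_deriv b \<phi>) x = 0" if b: "b \<in> Basis" for b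
    proof -
      note tb = test_function_partial[OF t b]
      have "x \<notin> closure {x. partial_deriv b \<phi> x \<noteq> 0}" using nx tb(2) by blast
      then show ?thesis using test_functionD(4,7)[OF tb(1)] by simp
    qed
    then show "laplacian \<phi> x = 0" by (simp add: laplacian_def)
  qed
qed

text \<open>\<open>ln\<close> has slope at most \<open>1 / A\<close> on \<open>{A..}\<close>, and
  clamping does not increase distances.\<close>

lemma ln_clamp_lipschitz:
  fixes u v A B :: real
  assumes A: "0 < A" "A \<le> B"
  shows "\<bar>ln (max A (min B u)) - ln (max A (min B v))\<bar> \<le> \<bar>u - v\<bar> / A"
proof -
  have l: "ln y - ln x \<le> (y - x) / A" if "A \<le> x" "x \<le> y" for x y
  proof -
    have "ln y - ln x = ln (y / x)" using that A by (simp add: ln_div)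
    also have "\<dots> \<le> y / x - 1" using that A by (intro ln_le_minus_one) auto
    also have "\<dots> = (y - x) / x" using that A by (simp add: field_simps)
    also have "\<dots> \<le> (y - x) / A" using that A by (intro divide_left_mono) auto
    finally show ?thesis .
  qed
  have m: "\<bar>ln x - ln y\<bar> \<le> \<bar>x - y\<bar> / A" if "A \<le> x" "A \<le> y" for x y
  proof (cases "x \<le> y")
    case True
    then have "ln x \<le> ln y" using that A by simp
    then show ?thesis using l[OF that(1) True] True by simp
  next
    case False
    then have "ln y \<le> ln x" using that A by simp
    then show ?thesis using l[OF that(2), of x] False by simp
  qed
  have "\<bar>ln (max A (min B u)) - ln (max A (min B v))\<bar> \<le> \<bar>max A (min B u) - max A (min B v)\<bar> / A"
    by (rule m) auto
  also have "\<dots> \<le> \<bar>u - v\<bar> / A" using A by (intro divide_right_mono) (auto simp: max_def min_def)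
  finally show ?thesis .
qed

text \<open>Green's formula for \<open>\<phi>\<close> and the truncated logarithm \<open>P\<close>,
  whose gradient is \<open>x / |x|^2\<close> inside an annulus and 0 outside. It is proved one
  coordinate at a time for the products of \<open>partial_deriv i \<phi>\<close> with
  \<open>P\<close>: this \<open>P\<close> is only Lipschitz, but
  \<open>integral_directional_derivative_zero\<close> asks no more.\<close>

lemma flux_identity:
  fixes \<phi> :: "'a::euclidean_space \<Rightarrow> real"
  assumes t: "test_function \<phi>" and ab: "a < b"
  shows "integrable lborel (\<lambda>x. laplacian \<phi> x * max a (min b (ln (norm x))))"
    "integrable lborel (\<lambda>x. (grad \<phi> x \<bullet> x) / (norm x)\<^sup>2 * indicator {a..b} (ln (norm x)))"
    "(\<integral>x. laplacian \<phi> x * max a (min b (ln (norm x))) \<partial>lborel)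
      = - (\<integral>x. (grad \<phi> x \<bullet> x) / (norm x)\<^sup>2 * indicator {a..b} (ln (norm x)) \<partial>lborel)"
    "integrable lborel (laplacian \<phi>)" "(\<integral>x. laplacian \<phi> x \<partial>lborel) = 0"
proof -
  define A where "A = exp a" define B where "B = exp b"
  have AB: "0 < A" "A < B" using ab by (auto simp: A_def B_def)
  \<comment> \<open>Clamping the norm before taking the logarithm makes \<open>P\<close> continuous
    at the origin, with value \<open>a\<close> there.\<close>
  define P where "P x = ln (max A (min B (norm x)))" for x :: 'a
  have Pcl: "P x = max a (min b (ln (norm x)))" if "x \<noteq> 0" for x
  proof -
    have "norm x > 0" using that by simp
    then have m: "ln (min B (norm x)) = min b (ln (norm x))" using AB
      by (cases "B \<le> norm x") (auto simp: min_def B_def ln_ge_iff)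
    have "min B (norm x) > 0" using AB that by simp
    then have "a \<le> ln (min B (norm x)) \<longleftrightarrow> A \<le> min B (norm x)" by (simp only: ln_ge_iff A_def)
    then have "ln (max A (min B (norm x))) = max a (ln (min B (norm x)))"
      unfolding max_def by (simp add: A_def)
    then show ?thesis by (simp add: P_def m)
  qed
  have Pc: "continuous_on UNIV P" unfolding P_def[abs_def] using AB
    by (intro continuous_intros) (auto simp: max_def)
  have Pb: "\<bar>P x\<bar> \<le> max \<bar>a\<bar> \<bar>b\<bar>" for x
  proof -
    have "a \<le> P x" unfolding P_def using AB
      by (subst ln_ge_iff) (auto simp: A_def less_max_iff_disj)
    moreover have "P x \<le> b"
    proof -
      have "P x \<le> ln B" unfolding P_def using AB by (subst ln_le_cancel_iff) auto
      then show ?thesis by (simp add: B_def)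
    qed
    ultimately show ?thesis by linarith
  qed
  have Pl: "\<bar>P x - P y\<bar> \<le> norm (x - y) / A" for x y
  proof -
    have "\<bar>P x - P y\<bar> \<le> \<bar>norm x - norm y\<bar> / A" unfolding P_def using AB by (intro ln_clamp_lipschitz) auto
    also have "\<dots> \<le> norm (x - y) / A" using AB norm_triangle_ineq3[of x y] by (intro divide_right_mono) auto
    finally show ?thesis .
  qed
  define v where "v x = (indicator {a..b} (ln (norm x)) / (norm x)\<^sup>2) *\<^sub>R x" for x :: 'a
  have vm: "v \<in> borel_measurable borel" unfolding v_def[abs_def] by measurable
  have ae: "AE x::'a in lborel. x \<noteq> 0 \<and> ln (norm x) \<noteq> a \<and> ln (norm x) \<noteq> b"
    using AE_lborel_singleton[of "0::'a"] AE_polar[OF AE_lborel_singleton[of a]] AE_polar[OF AE_lborel_singleton[of b]]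
    by eventually_elim simp
  have Pd: "(P has_derivative (\<lambda>h. v x \<bullet> h)) (at x)" if x: "x \<noteq> 0" "ln (norm x) \<noteq> a" "ln (norm x) \<noteq> b" for x
  proof -
    have x0: "norm x > 0" using x by simp
    consider "norm x < A" | "A < norm x" "norm x < B" | "B < norm x"
      using x x0 by (cases "norm x" A rule: linorder_cases; cases "norm x" B rule: linorder_cases) (auto simp: A_def B_def)
    then show ?thesis
    proof cases
      case 1
      have "ln (norm x) < a" using 1 x0 ln_less_cancel_iff[of "norm x" A] AB by (simp add: A_def)
      then have v0: "v x = 0" by (simp add: v_def)
      have "((\<lambda>x. ln A) has_derivative (\<lambda>h. v x \<bullet> h)) (at x)" by (simp add: v0)
      then show ?thesis
        by (rule has_derivative_transform_within_open[where s="{x. norm x < A}"])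
          (use 1 AB in \<open>auto simp: P_def intro!: open_Collect_less continuous_intros\<close>)
    next
      case 2
      have "a < ln (norm x)" "ln (norm x) < b"
        using 2 x0 ln_less_cancel_iff[of A "norm x"] ln_less_cancel_iff[of "norm x" B] AB by (simp_all add: A_def B_def)
      then have v1: "v x = (1 / (norm x)\<^sup>2) *\<^sub>R x" by (simp add: v_def)
      have "((\<lambda>x. ln (norm x)) has_derivative (\<lambda>h. v x \<bullet> h)) (at x)"
      proof -
        have "((\<lambda>x. ln (norm x)) has_derivative (\<lambda>h. inverse (norm x) * (sgn x \<bullet> h))) (at x)"
          using has_derivative_compose[OF has_derivative_norm[OF x(1)], of ln "\<lambda>y. inverse (norm x) * y"]
            DERIV_ln[OF x0] by (simp add: has_field_derivative_def inner_commute)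
        moreover have "(\<lambda>h. inverse (norm x) * (sgn x \<bullet> h)) = (\<lambda>h. v x \<bullet> h)"
          by (auto simp: v1 sgn_div_norm power2_eq_square divide_inverse)
        ultimately show ?thesis by simp
      qed
      then show ?thesis
        by (rule has_derivative_transform_within_open[where s="{x. A < norm x} \<inter> {x. norm x < B}"])
          (use 2 AB in \<open>auto simp: P_def intro!: open_Collect_less continuous_intros open_Int\<close>)
    next
      case 3
      have "b < ln (norm x)" using 3 x0 ln_less_cancel_iff[of B "norm x"] AB by (simp add: B_def)
      then have v0: "v x = 0" by (simp add: v_def)
      have "((\<lambda>x. ln B) has_derivative (\<lambda>h. v x \<bullet> h)) (at x)" by (simp add: v0)
      then show ?thesis
        by (rule has_derivative_transform_within_open[where s="{x. B < norm x}"])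
          (use 3 AB in \<open>auto simp: P_def intro!: open_Collect_less continuous_intros\<close>)
    qed
  qed
  have part: "integrable lborel (\<lambda>x. partial_deriv i (partial_deriv i \<phi>) x * P x + (grad \<phi> x \<bullet> i) * (v x \<bullet> i)) \<and>
     (\<integral>x. partial_deriv i (partial_deriv i \<phi>) x * P x + (grad \<phi> x \<bullet> i) * (v x \<bullet> i) \<partial>lborel) = 0 \<and>
     integrable lborel (\<lambda>x. partial_deriv i (partial_deriv i \<phi>) x * P x) \<and>
     integrable lborel (partial_deriv i (partial_deriv i \<phi>)) \<and>
     (\<integral>x. partial_deriv i (partial_deriv i \<phi>) x \<partial>lborel) = 0"
    if i: "i \<in> Basis" for i
  proof -
    define \<phi>i where "\<phi>i = partial_deriv i \<phi>"
    have ti: "test_function \<phi>i" unfolding \<phi>i_def by (rule test_function_partial(1)[OF t i])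
    note T = test_functionD[OF ti]
    have gi: "grad \<phi> x \<bullet> i = \<phi>i x" for x unfolding \<phi>i_def by (rule grad_inner_Basis[OF i])
    obtain M where M: "M \<ge> 0" "\<And>x. \<bar>\<phi>i x\<bar> \<le> M" "\<And>x. norm (grad \<phi>i x) \<le> M" "\<And>x y. \<bar>\<phi>i x - \<phi>i y\<bar> \<le> M * norm (x - y)"
      by (rule test_function_bounds[OF ti]) blast
    obtain R where R: "\<And>x. norm x > R \<Longrightarrow> \<phi>i x = 0" using T(5) by blast
    let ?K = "max \<bar>a\<bar> \<bar>b\<bar>"
    have pg: "partial_deriv i \<phi>i x = grad \<phi>i x \<bullet> i" for x by (rule T(4))
    have cpg: "continuous_on UNIV (partial_deriv i \<phi>i)"
      by (rule test_functionD(2)[OF test_function_partial(1)[OF ti i]])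
    have [measurable]: "P \<in> borel_measurable borel" "\<phi>i \<in> borel_measurable borel" "partial_deriv i \<phi>i \<in> borel_measurable borel"
      using Pc T(2) cpg by (auto intro: borel_measurable_continuous_onI)
    have n: "norm i = 1" using i by simp
    have tii: "test_function (partial_deriv i \<phi>i)" by (rule test_function_partial(1)[OF ti i])
    obtain R2 where R2: "\<And>x. norm x > R2 \<Longrightarrow> partial_deriv i \<phi>i x = 0" using test_functionD(5)[OF tii] by blast
    have ic: "integrable lborel (\<lambda>x. partial_deriv i \<phi>i x * Q x)" if Q: "continuous_on UNIV Q" for Q
    proof -
      have c: "continuous_on UNIV (\<lambda>x. partial_deriv i \<phi>i x * Q x)" by (intro continuous_intros Q cpg)
      have "integrable lborel (\<lambda>x. indicator (cball 0 R2) x *\<^sub>R (partial_deriv i \<phi>i x * Q x))"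
        by (rule borel_integrable_compact) (auto intro: continuous_on_subset[OF c])
      also have "(\<lambda>x. indicator (cball 0 R2) x *\<^sub>R (partial_deriv i \<phi>i x * Q x)) = (\<lambda>x. partial_deriv i \<phi>i x * Q x)"
      proof
        fix x show "indicator (cball 0 R2) x *\<^sub>R (partial_deriv i \<phi>i x * Q x) = partial_deriv i \<phi>i x * Q x"
          using R2[of x] by (cases "norm x \<le> R2") auto
      qed
      finally show ?thesis .
    qed
    note * = integral_directional_derivative_zero[where F="\<lambda>x. \<phi>i x * P x"
      and D="\<lambda>x. partial_deriv i \<phi>i x * P x + \<phi>i x * (v x \<bullet> i)" and B="M * ?K" and R=R and b=i and M="M * ?K + M / A"]
    have 1: "(\<lambda>x. \<phi>i x * P x) \<in> borel_measurable borel" by measurable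
    have 2: "(\<lambda>x. partial_deriv i \<phi>i x * P x + \<phi>i x * (v x \<bullet> i)) \<in> borel_measurable borel" using vm by measurable
    have 3: "\<bar>\<phi>i x * P x\<bar> \<le> M * ?K" for x unfolding abs_mult using M Pb by (intro mult_mono) auto
    have 4: "\<bar>\<phi>i (x + h *\<^sub>R i) * P (x + h *\<^sub>R i) - \<phi>i x * P x\<bar> \<le> (M * ?K + M / A) * h" if h: "0 \<le> h" for x h
    proof -
      let ?y = "x + h *\<^sub>R i"
      have nh: "norm (?y - x) = h" using h n by simp
      have "\<phi>i ?y * P ?y - \<phi>i x * P x = (\<phi>i ?y - \<phi>i x) * P ?y + \<phi>i x * (P ?y - P x)" by (simp add: algebra_simps)
      also have "\<bar>\<dots>\<bar> \<le> \<bar>\<phi>i ?y - \<phi>i x\<bar> * \<bar>P ?y\<bar> + \<bar>\<phi>i x\<bar> * \<bar>P ?y - P x\<bar>"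
        unfolding abs_mult[symmetric] by (rule abs_triangle_ineq)
      also have "\<dots> \<le> (M * h) * ?K + M * (h / A)"
        using M(1,2) M(4)[of ?y x] Pb Pl[of ?y x] nh AB h by (intro add_mono mult_mono) auto
      finally show ?thesis by (simp add: algebra_simps)
    qed
    have 5: "AE x in lborel. ((\<lambda>h. (\<phi>i (x + h *\<^sub>R i) * P (x + h *\<^sub>R i) - \<phi>i x * P x) / h)
        \<longlongrightarrow> partial_deriv i \<phi>i x * P x + \<phi>i x * (v x \<bullet> i)) (at_right 0)"
      using ae
    proof eventually_elim
      case (elim x)
      have "((\<lambda>x. \<phi>i x * P x) has_derivative (\<lambda>h. (P x *\<^sub>R grad \<phi>i x + \<phi>i x *\<^sub>R v x) \<bullet> h)) (at x)"
        using has_derivative_mult[OF T(3)[of x] Pd[of x]] elim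
        by (auto elim!: has_derivative_eq_rhs simp: inner_add_left algebra_simps)
      from directional_limit[OF this, of i] show ?case by (simp add: inner_add_left pg mult.commute)
    qed
    have "integrable lborel (\<lambda>x. partial_deriv i \<phi>i x * P x + \<phi>i x * (v x \<bullet> i))"
      by (rule *(1)[OF 1 2 3 _ 4 5 n]) (use R in auto)
    moreover have "(\<integral>x. partial_deriv i \<phi>i x * P x + \<phi>i x * (v x \<bullet> i) \<partial>lborel) = 0"
      by (rule *(2)[OF 1 2 3 _ 4 5 n]) (use R in auto)
    moreover have "(\<integral>x. partial_deriv i \<phi>i x \<partial>lborel) = 0"
      using integral_grad_zero(2)[OF T(3) test_function_continuous(1)[OF ti] R i] by (simp add: pg)
    ultimately show ?thesis using ic[OF Pc] ic[of "\<lambda>_. 1"] unfolding gi \<phi>i_def[symmetric] by simp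
  qed
  have sumi: "integrable lborel (\<lambda>x. \<Sum>i\<in>Basis. partial_deriv i (partial_deriv i \<phi>) x * P x)"
    using part by (intro Bochner_Integration.integrable_sum) blast
  have lapP: "(\<lambda>x. \<Sum>i\<in>Basis. partial_deriv i (partial_deriv i \<phi>) x * P x) = (\<lambda>x. laplacian \<phi> x * P x)"
    by (simp add: laplacian_def sum_distrib_right)
  have gv: "(\<Sum>i\<in>Basis. (grad \<phi> x \<bullet> i) * (v x \<bullet> i)) = (grad \<phi> x \<bullet> x) / (norm x)\<^sup>2 * indicator {a..b} (ln (norm x))" for x
    unfolding euclidean_inner[symmetric] by (simp add: v_def)
  have tot: "integrable lborel (\<lambda>x. \<Sum>i\<in>Basis. partial_deriv i (partial_deriv i \<phi>) x * P x + (grad \<phi> x \<bullet> i) * (v x \<bullet> i))"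
    using part by (intro Bochner_Integration.integrable_sum) blast
  have tote: "(\<lambda>x. \<Sum>i\<in>Basis. partial_deriv i (partial_deriv i \<phi>) x * P x + (grad \<phi> x \<bullet> i) * (v x \<bullet> i))
     = (\<lambda>x. laplacian \<phi> x * P x + (grad \<phi> x \<bullet> x) / (norm x)\<^sup>2 * indicator {a..b} (ln (norm x)))"
    unfolding sum.distrib gv using lapP by (simp add: fun_eq_iff)
  have tot0: "(\<integral>x. (\<Sum>i\<in>Basis. partial_deriv i (partial_deriv i \<phi>) x * P x + (grad \<phi> x \<bullet> i) * (v x \<bullet> i)) \<partial>lborel) = 0"
    using part by (subst Bochner_Integration.integral_sum) auto
  have I1: "integrable lborel (\<lambda>x. laplacian \<phi> x * P x)" using sumi unfolding lapP .
  have I2: "integrable lborel (\<lambda>x. (grad \<phi> x \<bullet> x) / (norm x)\<^sup>2 * indicator {a..b} (ln (norm x)))"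
    using Bochner_Integration.integrable_diff[OF tot[unfolded tote] I1] by simp
  have aeP: "AE x in lborel. laplacian \<phi> x * P x = laplacian \<phi> x * max a (min b (ln (norm x)))"
    using AE_lborel_singleton[of "0::'a"] by eventually_elim (simp add: Pcl)
  have [measurable]: "laplacian \<phi> \<in> borel_measurable borel" by (rule test_function_measurable[OF t])
  have [measurable]: "P \<in> borel_measurable borel" using Pc by (rule borel_measurable_continuous_onI)
  show "integrable lborel (\<lambda>x. laplacian \<phi> x * max a (min b (ln (norm x))))"
    using I1 integrable_cong_AE[OF _ _ aeP] by simp
  show "integrable lborel (\<lambda>x. (grad \<phi> x \<bullet> x) / (norm x)\<^sup>2 * indicator {a..b} (ln (norm x)))" by (rule I2)
  show "(\<integral>x. laplacian \<phi> x * max a (min b (ln (norm x))) \<partial>lborel)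
      = - (\<integral>x. (grad \<phi> x \<bullet> x) / (norm x)\<^sup>2 * indicator {a..b} (ln (norm x)) \<partial>lborel)"
    using integral_cong_AE[OF _ _ aeP] tot0 I1 I2 unfolding tote by simp
  show "integrable lborel (laplacian \<phi>)"
    unfolding laplacian_def[abs_def] using part by (intro Bochner_Integration.integrable_sum) blast
  show "(\<integral>x. laplacian \<phi> x \<partial>lborel) = 0"
    unfolding laplacian_def[abs_def] using part by (subst Bochner_Integration.integral_sum) auto
qed

section \<open>Weighted spaces\<close>

lemma nn_integral_exp_atLeast:
  assumes "k > 0"
  shows "(\<integral>\<^sup>+s. ennreal (exp (- (k * s))) * indicator {a..} s \<partial>lborel) = ennreal (exp (- (k * a)) / k)"
proof -
  have "((\<lambda>s. - exp (- (k * s)) / k) \<longlongrightarrow> 0) at_top" using assms by real_asymp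
  then have "(\<integral>\<^sup>+s. ennreal (exp (- (k * s))) * indicator {a..} s \<partial>lborel) = 0 - (- exp (- (k * a)) / k)"
    using assms by (intro nn_integral_FTC_atLeast) (auto intro!: derivative_eq_intros)
  then show ?thesis by simp
qed

lemma nn_integral_exp_atMost:
  assumes "k > 0"
  shows "(\<integral>\<^sup>+s. ennreal (exp (k * s)) * indicator {..a} s \<partial>lborel) = ennreal (exp (k * a) / k)"
proof -
  have "(\<integral>\<^sup>+s. ennreal (exp (k * s)) * indicator {..a} s \<partial>lborel)
      = (\<integral>\<^sup>+s. ennreal (exp (- (k * s))) * indicator {..a} (- s) \<partial>lborel)"
    by (subst nn_integral_real_affine[where c="-1" and t=0]) auto
  also have "\<dots> = (\<integral>\<^sup>+s. ennreal (exp (- (k * s))) * indicator {- a..} s \<partial>lborel)"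
    by (intro nn_integral_cong) (auto simp: indicator_def)
  also have "\<dots> = ennreal (exp (k * a) / k)" using nn_integral_exp_atLeast[OF assms, of "- a"] by simp
  finally show ?thesis .
qed

lemma nn_integral_bounded_support_finite:
  fixes \<psi> :: "real \<Rightarrow> real"
  assumes "\<And>s. \<bar>\<psi> s\<bar> \<le> B" "\<And>s. s \<notin> {a..b} \<Longrightarrow> \<psi> s = 0"
  shows "(\<integral>\<^sup>+s. ennreal ((\<psi> s)\<^sup>2 * exp (k * s)) \<partial>lborel) < \<infinity>"
proof -
  let ?E = "exp (\<bar>k\<bar> * (\<bar>a\<bar> + \<bar>b\<bar>))"
  have "(\<integral>\<^sup>+s. ennreal ((\<psi> s)\<^sup>2 * exp (k * s)) \<partial>lborel) \<le> (\<integral>\<^sup>+s. ennreal (B\<^sup>2 * ?E) * indicator {a..b} s \<partial>lborel)"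
  proof (rule nn_integral_mono)
    fix s :: real
    show "ennreal ((\<psi> s)\<^sup>2 * exp (k * s)) \<le> ennreal (B\<^sup>2 * ?E) * indicator {a..b} s"
    proof (cases "s \<in> {a..b}")
      case True
      have "\<bar>s\<bar> \<le> \<bar>a\<bar> + \<bar>b\<bar>" using True by auto
      then have "k * s \<le> \<bar>k\<bar> * (\<bar>a\<bar> + \<bar>b\<bar>)"
        by (metis abs_ge_self abs_ge_zero abs_mult mult_left_mono order_trans)
      moreover have "(\<psi> s)\<^sup>2 \<le> B\<^sup>2" using assms(1)[of s] by (simp add: abs_le_square_iff[symmetric])
      ultimately have "(\<psi> s)\<^sup>2 * exp (k * s) \<le> B\<^sup>2 * ?E" by (intro mult_mono) auto
      then show ?thesis using True by (simp add: ennreal_leI)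
    qed (simp add: assms(2))
  qed
  also have "\<dots> < \<infinity>" by (simp add: nn_integral_cmult_indicator ennreal_mult_less_top emeasure_lborel_Icc_eq)
  finally show ?thesis .
qed

lemma nn_integral_radial_weight:
  fixes \<psi> :: "real \<Rightarrow> real"
  assumes [measurable]: "\<psi> \<in> borel_measurable borel"
  shows "(\<integral>\<^sup>+(x::'a::euclidean_space). ennreal ((\<psi> (ln (norm x)))\<^sup>2 * norm x powr p) \<partial>lborel)
    = ennreal (sphere_area TYPE('a)) * (\<integral>\<^sup>+s. ennreal ((\<psi> s)\<^sup>2 * exp ((real DIM('a) + p) * s)) \<partial>lborel)"
proof -
  have "(\<integral>\<^sup>+(x::'a). ennreal ((\<psi> (ln (norm x)))\<^sup>2 * norm x powr p) \<partial>lborel)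
      = (\<integral>\<^sup>+(x::'a). ennreal ((\<psi> (ln (norm x)))\<^sup>2 * exp (p * ln (norm x))) \<partial>lborel)"
    by (rule nn_integral_cong_AE, use AE_lborel_singleton[of "0::'a"] in eventually_elim) (simp add: powr_def)
  also have "\<dots> = (\<integral>\<^sup>+s. ennreal (sphere_area TYPE('a) * exp (real DIM('a) * s)) * ennreal ((\<psi> s)\<^sup>2 * exp (p * s)) \<partial>lborel)"
    by (subst nn_integral_polar[of "\<lambda>s. ennreal ((\<psi> s)\<^sup>2 * exp (p * s))"]) auto
  also have "\<dots> = (\<integral>\<^sup>+s. ennreal (sphere_area TYPE('a)) * ennreal ((\<psi> s)\<^sup>2 * exp ((real DIM('a) + p) * s)) \<partial>lborel)"
  proof (rule nn_integral_cong)
    fix s :: real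
    have e: "exp ((real DIM('a) + p) * s) = exp (real DIM('a) * s) * exp (p * s)"
      by (simp add: distrib_right exp_add)
    show "ennreal (sphere_area TYPE('a) * exp (real DIM('a) * s)) * ennreal ((\<psi> s)\<^sup>2 * exp (p * s))
      = ennreal (sphere_area TYPE('a)) * ennreal ((\<psi> s)\<^sup>2 * exp ((real DIM('a) + p) * s))"
      unfolding e using sphere_area_pos[where 'a='a] by (simp add: ennreal_mult'[symmetric] mult_ac)
  qed
  also have "\<dots> = ennreal (sphere_area TYPE('a)) * (\<integral>\<^sup>+s. ennreal ((\<psi> s)\<^sup>2 * exp ((real DIM('a) + p) * s)) \<partial>lborel)"
    by (rule nn_integral_cmult) auto
  finally show ?thesis .
qed

lemma powr_half_squared: "((x::real) powr (p / 2))\<^sup>2 = x powr p"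
  by (simp add: power2_eq_square powr_add[symmetric])

text \<open>The factor \<open>norm x powr (p / 2)\<close> is moved from one function to the other:
  the space with weight \<open>|x|^(-p)\<close> is paired with the one with weight
  \<open>|x|^p\<close>.\<close>

lemma weighted_Cauchy_Schwarz:
  fixes g w :: "'a::euclidean_space \<Rightarrow> real"
  assumes [measurable]: "g \<in> borel_measurable borel" "w \<in> borel_measurable borel"
  shows "(\<integral>\<^sup>+x. ennreal \<bar>g x * w x\<bar> \<partial>lborel)\<^sup>2
    \<le> (\<integral>\<^sup>+x. ennreal (\<bar>g x\<bar>\<^sup>2 / norm x powr p) \<partial>lborel) * (\<integral>\<^sup>+x. ennreal ((w x)\<^sup>2 * norm x powr p) \<partial>lborel)"
proof -
  have "(\<integral>\<^sup>+x. ennreal \<bar>g x * w x\<bar> \<partial>lborel)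
      = (\<integral>\<^sup>+x. ennreal (\<bar>g x\<bar> / norm x powr (p / 2)) * ennreal (\<bar>w x\<bar> * norm x powr (p / 2)) \<partial>lborel)"
    by (rule nn_integral_cong_AE, use AE_lborel_singleton[of "0::'a"] in eventually_elim)
      (simp add: ennreal_mult'[symmetric] abs_mult)
  also have "\<dots>\<^sup>2 \<le> (\<integral>\<^sup>+x. (ennreal (\<bar>g x\<bar> / norm x powr (p / 2)))\<^sup>2 \<partial>lborel)
      * (\<integral>\<^sup>+x. (ennreal (\<bar>w x\<bar> * norm x powr (p / 2)))\<^sup>2 \<partial>lborel)"
    by (rule Cauchy_Schwarz_nn_integral) auto
  also have "\<dots> = (\<integral>\<^sup>+x. ennreal (\<bar>g x\<bar>\<^sup>2 / norm x powr p) \<partial>lborel) * (\<integral>\<^sup>+x. ennreal ((w x)\<^sup>2 * norm x powr p) \<partial>lborel)"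
    by (intro arg_cong2[where f="(*)"] nn_integral_cong)
      (simp_all add: ennreal_power power_divide power_mult_distrib powr_half_squared)
  finally show ?thesis .
qed

lemma weighted_integrable:
  fixes g w :: "'a::euclidean_space \<Rightarrow> real"
  assumes [measurable]: "g \<in> borel_measurable borel" "w \<in> borel_measurable borel"
    and g: "(\<integral>\<^sup>+x. ennreal (\<bar>g x\<bar>\<^sup>2 / norm x powr p) \<partial>lborel) < \<infinity>"
    and w: "(\<integral>\<^sup>+x. ennreal ((w x)\<^sup>2 * norm x powr p) \<partial>lborel) < \<infinity>"
  shows "integrable lborel (\<lambda>x. g x * w x)"
proof -
  have "(\<integral>\<^sup>+x. ennreal \<bar>g x * w x\<bar> \<partial>lborel)\<^sup>2 < \<infinity>"
    using weighted_Cauchy_Schwarz[of g w p] g w by (auto simp: ennreal_mult_less_top elim!: le_less_trans)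
  then have "(\<integral>\<^sup>+x. ennreal \<bar>g x * w x\<bar> \<partial>lborel) < \<infinity>" by (simp add: power_less_top_ennreal)
  then show ?thesis by (simp add: integrable_iff_bounded)
qed

lemma weighted_tendsto:
  fixes g w :: "'a::euclidean_space \<Rightarrow> real"
  assumes m[measurable]: "g \<in> borel_measurable borel" "w \<in> borel_measurable borel" "\<And>k. gk k \<in> borel_measurable borel"
    and g: "(\<lambda>k::nat. \<integral>\<^sup>+x. ennreal (\<bar>gk k x - g x\<bar>\<^sup>2 / norm x powr p) \<partial>lborel) \<longlonglongrightarrow> 0"
    and w: "(\<integral>\<^sup>+x. ennreal ((w x)\<^sup>2 * norm x powr p) \<partial>lborel) < \<infinity>"
    and i: "integrable lborel (\<lambda>x. g x * w x)" "\<And>k. integrable lborel (\<lambda>x. gk k x * w x)"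
  shows "(\<lambda>k. \<integral>x. gk k x * w x \<partial>lborel) \<longlonglongrightarrow> (\<integral>x. g x * w x \<partial>lborel)"
proof -
  define d where "d k = \<bar>(\<integral>x. gk k x * w x \<partial>lborel) - (\<integral>x. g x * w x \<partial>lborel)\<bar>" for k
  let ?W = "\<integral>\<^sup>+x. ennreal ((w x)\<^sup>2 * norm x powr p) \<partial>lborel"
  let ?a = "\<lambda>k. \<integral>\<^sup>+x. ennreal (\<bar>gk k x - g x\<bar>\<^sup>2 / norm x powr p) \<partial>lborel"
  have le: "ennreal ((d k)\<^sup>2) \<le> ?a k * ?W" for k
  proof -
    have "ennreal (d k) = ennreal (norm (\<integral>x. (gk k x - g x) * w x \<partial>lborel))"
      using i by (simp add: d_def left_diff_distrib)
    also have "\<dots> \<le> (\<integral>\<^sup>+x. norm ((gk k x - g x) * w x) \<partial>lborel)"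
      using i by (intro integral_norm_bound_ennreal) (simp add: left_diff_distrib)
    finally have "(ennreal (d k))\<^sup>2 \<le> (\<integral>\<^sup>+x. ennreal \<bar>(gk k x - g x) * w x\<bar> \<partial>lborel)\<^sup>2"
      by (intro power_mono) auto
    also have "\<dots> \<le> ?a k * ?W" by (rule weighted_Cauchy_Schwarz) auto
    finally show ?thesis by (simp add: ennreal_power d_def)
  qed
  have "(\<lambda>k. ?a k * ?W) \<longlonglongrightarrow> 0 * ?W"
    using w by (intro tendsto_mult_ennreal g tendsto_const) auto
  then have lim0: "(\<lambda>k. ?a k * ?W) \<longlonglongrightarrow> 0" by simp
  have "(\<lambda>k. ennreal ((d k)\<^sup>2)) \<longlonglongrightarrow> 0"
    by (rule tendsto_sandwich[OF always_eventually always_eventually[OF allI, OF le] tendsto_const lim0]) simp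
  then have "(\<lambda>k. (d k)\<^sup>2) \<longlonglongrightarrow> 0" by (simp add: ennreal_tendsto_0_iff)
  then have "(\<lambda>k. sqrt ((d k)\<^sup>2)) \<longlonglongrightarrow> sqrt 0" by (rule tendsto_real_sqrt)
  then have "(\<lambda>k. \<bar>(\<integral>x. gk k x * w x \<partial>lborel) - (\<integral>x. g x * w x \<partial>lborel)\<bar>) \<longlonglongrightarrow> 0" by (simp add: d_def)
  then show ?thesis by (simp only: tendsto_rabs_zero_iff LIM_zero_iff)
qed

text \<open>The condition on \<open>p\<close> makes \<open>|x|^(-p)\<close> integrable near the
  origin; in the variable \<open>s\<close> this is the convergence of an exponential integral at
  minus infinity. The hypotheses on \<open>n - 2 \<alpha>\<close> and \<open>n - \<beta>\<close>
  enter here and give test functions a finite norm.\<close>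

lemma weighted_test_finite:
  fixes g :: "'a::euclidean_space \<Rightarrow> real"
  assumes p: "real DIM('a) - p > 0" and g: "\<And>x. \<bar>g x\<bar> \<le> M" "\<And>x. norm x > R \<Longrightarrow> g x = 0" and R: "R > 0"
  shows "(\<integral>\<^sup>+x. ennreal (\<bar>g x\<bar>\<^sup>2 / norm x powr p) \<partial>lborel) < \<infinity>"
proof -
  let ?\<psi> = "\<lambda>s. M * indicator {..ln R} s :: real"
  have "(\<integral>\<^sup>+x. ennreal (\<bar>g x\<bar>\<^sup>2 / norm x powr p) \<partial>lborel)
      \<le> (\<integral>\<^sup>+(x::'a). ennreal ((?\<psi> (ln (norm x)))\<^sup>2 * norm x powr (- p)) \<partial>lborel)"
  proof (rule nn_integral_mono_AE, use AE_lborel_singleton[of "0::'a"] in eventually_elim)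
    case (elim x)
    show ?case
    proof (cases "norm x \<le> R")
      case True
      then have "ln (norm x) \<le> ln R" using elim R by (subst ln_le_cancel_iff) auto
      moreover have "\<bar>g x\<bar>\<^sup>2 \<le> M\<^sup>2" using g(1)[of x] by (intro power_mono) auto
      ultimately show ?thesis by (auto simp: powr_minus divide_inverse intro!: ennreal_leI mult_right_mono)
    qed (simp add: g(2))
  qed
  also have "\<dots> = ennreal (sphere_area TYPE('a)) * (\<integral>\<^sup>+s. ennreal ((?\<psi> s)\<^sup>2 * exp ((real DIM('a) + - p) * s)) \<partial>lborel)"
    by (rule nn_integral_radial_weight) auto
  also have "(\<integral>\<^sup>+s. ennreal ((?\<psi> s)\<^sup>2 * exp ((real DIM('a) + - p) * s)) \<partial>lborel)
      = (\<integral>\<^sup>+s. ennreal (M\<^sup>2) * (ennreal (exp ((real DIM('a) - p) * s)) * indicator {..ln R} s) \<partial>lborel)"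
    by (intro nn_integral_cong) (auto simp: indicator_def ennreal_mult)
  also have "\<dots> = ennreal (M\<^sup>2) * ennreal (exp ((real DIM('a) - p) * ln R) / (real DIM('a) - p))"
    using nn_integral_exp_atMost[OF p, of "ln R"] by (subst nn_integral_cmult) auto
  finally show ?thesis by (auto simp: ennreal_mult_less_top elim!: le_less_trans)
qed

lemma grad_int_2: "grad_int 2 p V = (\<integral>\<^sup>+x. ennreal (\<bar>norm (V x)\<bar>\<^sup>2 / norm x powr p) \<partial>lborel)"
  unfolding grad_int_def by (intro nn_integral_cong) (simp add: powr_numeral)

lemma test_function_int_finite:
  fixes \<phi> :: "'a::euclidean_space \<Rightarrow> real"
  assumes t: "test_function \<phi>"
  shows "real DIM('a) - 2 * \<alpha> > 0 \<Longrightarrow> lap_int \<alpha> (laplacian \<phi>) < \<infinity>"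
    and "real DIM('a) - \<beta> > 0 \<Longrightarrow> grad_int 2 \<beta> (grad \<phi>) < \<infinity>"
proof -
  obtain R where R: "R > 0" "\<And>x. norm x > R \<Longrightarrow> \<phi> x = 0" "\<And>x. norm x > R \<Longrightarrow> grad \<phi> x = 0"
    "\<And>x. norm x > R \<Longrightarrow> laplacian \<phi> x = 0" by (rule laplacian_grad_zero_outside[OF t]) blast
  obtain M1 where M1: "\<And>x. norm (laplacian \<phi> x) \<le> M1"
    by (rule compact_support_bounded[OF test_function_continuous(2)[OF t] R(4)]) auto
  obtain M2 where M2: "\<And>x. norm (grad \<phi> x) \<le> M2"
    by (rule compact_support_bounded[OF test_function_continuous(1)[OF t] R(3)]) auto
  show "real DIM('a) - 2 * \<alpha> > 0 \<Longrightarrow> lap_int \<alpha> (laplacian \<phi>) < \<infinity>"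
    unfolding lap_int_def using M1 R by (intro weighted_test_finite[where M=M1 and R=R]) auto
  show "real DIM('a) - \<beta> > 0 \<Longrightarrow> grad_int 2 \<beta> (grad \<phi>) < \<infinity>"
    unfolding grad_int_2 using M2 R by (intro weighted_test_finite[where M=M2 and R=R]) auto
qed

lemma nn_integral_square_add:
  fixes g h :: "'a::euclidean_space \<Rightarrow> real"
  assumes [measurable]: "g \<in> borel_measurable borel" "h \<in> borel_measurable borel" "k \<in> borel_measurable borel"
    and le: "\<And>x. \<bar>k x\<bar> \<le> \<bar>g x\<bar> + \<bar>h x\<bar>"
    and g: "(\<integral>\<^sup>+x. ennreal (\<bar>g x\<bar>\<^sup>2 / norm x powr p) \<partial>lborel) < \<infinity>"
    and h: "(\<integral>\<^sup>+x. ennreal (\<bar>h x\<bar>\<^sup>2 / norm x powr p) \<partial>lborel) < \<infinity>"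
  shows "(\<integral>\<^sup>+x. ennreal (\<bar>k x\<bar>\<^sup>2 / norm x powr p) \<partial>lborel) < \<infinity>"
proof -
  have "(\<integral>\<^sup>+x. ennreal (\<bar>k x\<bar>\<^sup>2 / norm x powr p) \<partial>lborel)
     \<le> (\<integral>\<^sup>+x. ennreal 2 * ennreal (\<bar>g x\<bar>\<^sup>2 / norm x powr p) + ennreal 2 * ennreal (\<bar>h x\<bar>\<^sup>2 / norm x powr p) \<partial>lborel)"
  proof (rule nn_integral_mono)
    fix x
    have "\<bar>k x\<bar>\<^sup>2 \<le> (\<bar>g x\<bar> + \<bar>h x\<bar>)\<^sup>2" using le[of x] by (intro power_mono) auto
    also have "\<dots> \<le> 2 * \<bar>g x\<bar>\<^sup>2 + 2 * \<bar>h x\<bar>\<^sup>2"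
      using sum_squares_bound[of "\<bar>g x\<bar>" "\<bar>h x\<bar>"] by (simp add: power2_sum)
    finally have "\<bar>k x\<bar>\<^sup>2 / norm x powr p \<le> 2 * (\<bar>g x\<bar>\<^sup>2 / norm x powr p) + 2 * (\<bar>h x\<bar>\<^sup>2 / norm x powr p)"
      by (simp add: add_divide_distrib[symmetric] divide_right_mono)
    then have "ennreal (\<bar>k x\<bar>\<^sup>2 / norm x powr p)
      \<le> ennreal (2 * (\<bar>g x\<bar>\<^sup>2 / norm x powr p) + 2 * (\<bar>h x\<bar>\<^sup>2 / norm x powr p))"
      by (rule ennreal_leI)
    also have "\<dots> = ennreal 2 * ennreal (\<bar>g x\<bar>\<^sup>2 / norm x powr p) + ennreal 2 * ennreal (\<bar>h x\<bar>\<^sup>2 / norm x powr p)"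
      by (subst ennreal_plus, simp, simp, subst (1 2) ennreal_mult) auto
    finally show "ennreal (\<bar>k x\<bar>\<^sup>2 / norm x powr p)
      \<le> ennreal 2 * ennreal (\<bar>g x\<bar>\<^sup>2 / norm x powr p) + ennreal 2 * ennreal (\<bar>h x\<bar>\<^sup>2 / norm x powr p)" .
  qed
  also have "\<dots> = ennreal 2 * (\<integral>\<^sup>+x. ennreal (\<bar>g x\<bar>\<^sup>2 / norm x powr p) \<partial>lborel)
      + ennreal 2 * (\<integral>\<^sup>+x. ennreal (\<bar>h x\<bar>\<^sup>2 / norm x powr p) \<partial>lborel)"
    by (subst nn_integral_add) (auto simp: nn_integral_cmult)
  also have "\<dots> < \<infinity>" using g h by (simp add: ennreal_mult_less_top)
  finally show ?thesis .
qed

text \<open>Finiteness of the two integrals is not part of \<open>H2\<close>. It follows because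
  some \<open>\<phi> k\<close> is at finite distance from the element and test functions have finite
  norm.\<close>

lemma H2E:
  fixes u f :: "'a::euclidean_space \<Rightarrow> real"
  assumes H: "H2 \<alpha> \<beta> u V f" and \<alpha>: "real DIM('a) - 2 * \<alpha> > 0" and \<beta>: "real DIM('a) - \<beta> > 0"
  obtains \<phi> where "\<And>k::nat. test_function (\<phi> k)"
    "(\<lambda>k. lap_int \<alpha> (\<lambda>x. laplacian (\<phi> k) x - f x)) \<longlonglongrightarrow> 0"
    "(\<lambda>k. grad_int 2 \<beta> (\<lambda>x. grad (\<phi> k) x - V x)) \<longlonglongrightarrow> 0"
    "lap_int \<alpha> f < \<infinity>" "grad_int 2 \<beta> V < \<infinity>"
    "u \<in> borel_measurable borel" "V \<in> borel_measurable borel" "f \<in> borel_measurable borel"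
proof -
  obtain \<phi> where t: "\<And>k::nat. test_function (\<phi> k)" and
    l: "(\<lambda>k. H2_norm_sq \<alpha> \<beta> (\<lambda>x. grad (\<phi> k) x - V x) (\<lambda>x. laplacian (\<phi> k) x - f x)) \<longlonglongrightarrow> 0"
    using H by (auto simp: H2_def)
  have m[measurable]: "u \<in> borel_measurable borel" "V \<in> borel_measurable borel" "f \<in> borel_measurable borel"
    using H by (auto simp: H2_def)
  have l1: "(\<lambda>k. lap_int \<alpha> (\<lambda>x. laplacian (\<phi> k) x - f x)) \<longlonglongrightarrow> 0"
    by (rule tendsto_sandwich[OF _ _ tendsto_const l]) (auto simp: H2_norm_sq_def)
  have l2: "(\<lambda>k. grad_int 2 \<beta> (\<lambda>x. grad (\<phi> k) x - V x)) \<longlonglongrightarrow> 0"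
    by (rule tendsto_sandwich[OF _ _ tendsto_const l]) (auto simp: H2_norm_sq_def)
  have "\<forall>\<^sub>F k in sequentially. lap_int \<alpha> (\<lambda>x. laplacian (\<phi> k) x - f x) < 1"
    "\<forall>\<^sub>F k in sequentially. grad_int 2 \<beta> (\<lambda>x. grad (\<phi> k) x - V x) < 1"
    using order_tendstoD(2)[OF l1, of 1] order_tendstoD(2)[OF l2, of 1] by auto
  then have "\<forall>\<^sub>F k in sequentially. lap_int \<alpha> (\<lambda>x. laplacian (\<phi> k) x - f x) < 1 \<and> grad_int 2 \<beta> (\<lambda>x. grad (\<phi> k) x - V x) < 1"
    by eventually_elim simp
  then obtain k where "lap_int \<alpha> (\<lambda>x. laplacian (\<phi> k) x - f x) < 1" "grad_int 2 \<beta> (\<lambda>x. grad (\<phi> k) x - V x) < 1"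
    by (auto simp: eventually_sequentially)
  then have k: "lap_int \<alpha> (\<lambda>x. laplacian (\<phi> k) x - f x) < \<infinity>" "grad_int 2 \<beta> (\<lambda>x. grad (\<phi> k) x - V x) < \<infinity>"
    using less_trans[OF _ ennreal_one_less_top] by auto
  note [measurable] = test_function_measurable[OF t[of k]]
  have f1: "lap_int \<alpha> f < \<infinity>"
    unfolding lap_int_def
  proof (rule nn_integral_square_add[where g="\<lambda>x. laplacian (\<phi> k) x - f x" and h="laplacian (\<phi> k)"])
    show "(\<integral>\<^sup>+x. ennreal (\<bar>laplacian (\<phi> k) x\<bar>\<^sup>2 / norm x powr (2 * \<alpha>)) \<partial>lborel) < \<infinity>"
      using test_function_int_finite(1)[OF t[of k] \<alpha>] by (simp only: lap_int_def)
    show "(\<integral>\<^sup>+x. ennreal (\<bar>laplacian (\<phi> k) x - f x\<bar>\<^sup>2 / norm x powr (2 * \<alpha>)) \<partial>lborel) < \<infinity>"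
      using k(1) by (simp only: lap_int_def)
  qed auto
  have f2: "grad_int 2 \<beta> V < \<infinity>"
    unfolding grad_int_2
  proof (rule nn_integral_square_add[where g="\<lambda>x. norm (grad (\<phi> k) x - V x)" and h="\<lambda>x. norm (grad (\<phi> k) x)"])
    show "(\<integral>\<^sup>+x. ennreal (\<bar>norm (grad (\<phi> k) x)\<bar>\<^sup>2 / norm x powr \<beta>) \<partial>lborel) < \<infinity>"
      using test_function_int_finite(2)[OF t[of k] \<beta>] by (simp only: grad_int_2)
    show "(\<integral>\<^sup>+x. ennreal (\<bar>norm (grad (\<phi> k) x - V x)\<bar>\<^sup>2 / norm x powr \<beta>) \<partial>lborel) < \<infinity>"
      using k(2) by (simp only: grad_int_2)
    show "\<bar>norm (V x)\<bar> \<le> \<bar>norm (grad (\<phi> k) x - V x)\<bar> + \<bar>norm (grad (\<phi> k) x)\<bar>" for x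
      using norm_triangle_ineq4[of "grad (\<phi> k) x" "grad (\<phi> k) x - V x"] by simp
  qed auto
  show ?thesis by (rule that[OF t l1 l2 f1 f2 m])
qed

text \<open>Radial multipliers of the divergence identity survive in the limit as soon as they are square
  integrable for the dual weight; in particular they need not vanish at the origin.\<close>

lemma flux_limit:
  fixes u f :: "'a::euclidean_space \<Rightarrow> real" and \<Psi> \<psi> :: "real \<Rightarrow> real"
  assumes H: "H2 \<alpha> \<beta> u V f" and \<alpha>: "real DIM('a) - 2 * \<alpha> > 0" and \<beta>: "real DIM('a) - \<beta> > 0"
    and [measurable]: "\<Psi> \<in> borel_measurable borel" "\<psi> \<in> borel_measurable borel"
    and \<Psi>: "(\<integral>\<^sup>+s. ennreal ((\<Psi> s)\<^sup>2 * exp ((real DIM('a) + 2 * \<alpha>) * s)) \<partial>lborel) < \<infinity>"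
    and \<psi>: "\<And>s. \<bar>\<psi> s\<bar> \<le> B" "\<And>s. s \<notin> {a..b} \<Longrightarrow> \<psi> s = 0"
    and pair: "\<And>\<phi> :: 'a \<Rightarrow> real. test_function \<phi> \<Longrightarrow>
       (\<integral>x. laplacian \<phi> x * \<Psi> (ln (norm x)) \<partial>lborel) = (\<integral>x. (grad \<phi> x \<bullet> x) / (norm x)\<^sup>2 * \<psi> (ln (norm x)) \<partial>lborel)"
  shows "integrable lborel (\<lambda>x. f x * \<Psi> (ln (norm x)))"
    "integrable lborel (\<lambda>x. (V x \<bullet> x) / (norm x)\<^sup>2 * \<psi> (ln (norm x)))"
    "(\<integral>x. f x * \<Psi> (ln (norm x)) \<partial>lborel) = (\<integral>x. (V x \<bullet> x) / (norm x)\<^sup>2 * \<psi> (ln (norm x)) \<partial>lborel)"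
proof -
  obtain \<phi> where t: "\<And>k::nat. test_function (\<phi> k)" and
    l: "(\<lambda>k. lap_int \<alpha> (\<lambda>x. laplacian (\<phi> k) x - f x)) \<longlonglongrightarrow> 0"
    "(\<lambda>k. grad_int 2 \<beta> (\<lambda>x. grad (\<phi> k) x - V x)) \<longlonglongrightarrow> 0"
    and fin: "lap_int \<alpha> f < \<infinity>" "grad_int 2 \<beta> V < \<infinity>"
    and [measurable]: "V \<in> borel_measurable borel" "f \<in> borel_measurable borel"
    by (rule H2E[OF H \<alpha> \<beta>]) blast
  have [measurable]: "grad (\<phi> k) \<in> borel_measurable borel" "laplacian (\<phi> k) \<in> borel_measurable borel" for k
    using test_function_measurable[OF t] by auto
  let ?w1 = "\<lambda>x::'a. \<Psi> (ln (norm x))" and ?w2 = "\<lambda>x::'a. \<psi> (ln (norm x)) / norm x"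
  have w1: "(\<integral>\<^sup>+x. ennreal ((?w1 x)\<^sup>2 * norm x powr (2 * \<alpha>)) \<partial>lborel) < \<infinity>"
    unfolding nn_integral_radial_weight[OF assms(4)] using \<Psi> by (simp add: ennreal_mult_less_top)
  have w2: "(\<integral>\<^sup>+x. ennreal ((?w2 x)\<^sup>2 * norm x powr \<beta>) \<partial>lborel) < \<infinity>"
  proof -
    have "(\<integral>\<^sup>+x. ennreal ((?w2 x)\<^sup>2 * norm x powr \<beta>) \<partial>lborel)
        = (\<integral>\<^sup>+(x::'a). ennreal ((\<psi> (ln (norm x)))\<^sup>2 * norm x powr (\<beta> - 2)) \<partial>lborel)"
      by (rule nn_integral_cong_AE, use AE_lborel_singleton[of "0::'a"] in eventually_elim)
        (simp add: power_divide powr_diff powr_numeral)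
    then show ?thesis unfolding nn_integral_radial_weight[OF assms(5)]
      using nn_integral_bounded_support_finite[of \<psi> B a b "real DIM('a) + (\<beta> - 2)", OF \<psi>] by (simp add: ennreal_mult_less_top)
  qed
  \<comment> \<open>Only the radial component of the gradient occurs, and the norm bounds it; hence
    it converges in the same weighted space as the gradient itself.\<close>
  let ?h = "\<lambda>W x. (W x \<bullet> x) / norm x :: real"
  have hle: "\<bar>?h W x\<bar> \<le> norm (W x)" for W :: "'a \<Rightarrow> 'a" and x
    using Cauchy_Schwarz_ineq2[of "W x" x] by (cases "x = 0") (auto simp: abs_divide divide_le_eq)
  have hint: "(\<integral>\<^sup>+x. ennreal (\<bar>?h W x\<bar>\<^sup>2 / norm x powr \<beta>) \<partial>lborel) \<le> grad_int 2 \<beta> W" for W :: "'a \<Rightarrow> 'a"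
    unfolding grad_int_2 using hle by (intro nn_integral_mono ennreal_leI divide_right_mono power_mono) auto
  have e2: "?h W x * ?w2 x = (W x \<bullet> x) / (norm x)\<^sup>2 * \<psi> (ln (norm x))" for W :: "'a \<Rightarrow> 'a" and x
    by (simp add: power2_eq_square)
  have i1: "integrable lborel (\<lambda>x. g x * ?w1 x)" if "g \<in> borel_measurable borel" "lap_int \<alpha> g < \<infinity>" for g
    using that(2) w1 unfolding lap_int_def by (intro weighted_integrable[where p="2 * \<alpha>"] that(1)) auto
  have i2: "integrable lborel (\<lambda>x. ?h W x * ?w2 x)" if [measurable]: "W \<in> borel_measurable borel" and "grad_int 2 \<beta> W < \<infinity>" for W
    using le_less_trans[OF hint that(2)] w2 by (intro weighted_integrable[where p=\<beta>]) auto
  show if1: "integrable lborel (\<lambda>x. f x * \<Psi> (ln (norm x)))" by (rule i1) (use fin in auto)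
  show "integrable lborel (\<lambda>x. (V x \<bullet> x) / (norm x)\<^sup>2 * \<psi> (ln (norm x)))" using i2[of V] fin unfolding e2 by simp
  have L1: "(\<lambda>k. \<integral>x. laplacian (\<phi> k) x * ?w1 x \<partial>lborel) \<longlonglongrightarrow> (\<integral>x. f x * ?w1 x \<partial>lborel)"
    by (rule weighted_tendsto[OF _ _ _ l(1)[unfolded lap_int_def] w1])
      (use i1 test_function_int_finite(1)[OF t \<alpha>] fin in auto)
  have L2: "(\<lambda>k. \<integral>x. ?h (grad (\<phi> k)) x * ?w2 x \<partial>lborel) \<longlonglongrightarrow> (\<integral>x. ?h V x * ?w2 x \<partial>lborel)"
  proof (rule weighted_tendsto[OF _ _ _ _ w2])
    have e: "?h (grad (\<phi> k)) x - ?h V x = ?h (\<lambda>x. grad (\<phi> k) x - V x) x" for k x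
      by (simp add: inner_diff_left diff_divide_distrib)
    show "(\<lambda>k. \<integral>\<^sup>+x. ennreal (\<bar>?h (grad (\<phi> k)) x - ?h V x\<bar>\<^sup>2 / norm x powr \<beta>) \<partial>lborel) \<longlonglongrightarrow> 0"
      unfolding e
      by (rule tendsto_sandwich[OF always_eventually always_eventually[OF allI, OF hint] tendsto_const l(2)]) simp
  qed (use i2 test_function_int_finite(2)[OF t \<beta>] fin in auto)
  have "(\<integral>x. laplacian (\<phi> k) x * ?w1 x \<partial>lborel) = (\<integral>x. ?h (grad (\<phi> k)) x * ?w2 x \<partial>lborel)" for k
    unfolding e2 by (rule pair[OF t])
  with L1 have "(\<lambda>k. \<integral>x. ?h (grad (\<phi> k)) x * ?w2 x \<partial>lborel) \<longlonglongrightarrow> (\<integral>x. f x * ?w1 x \<partial>lborel)" by simp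
  from LIMSEQ_unique[OF this L2]
  show "(\<integral>x. f x * \<Psi> (ln (norm x)) \<partial>lborel) = (\<integral>x. (V x \<bullet> x) / (norm x)\<^sup>2 * \<psi> (ln (norm x)) \<partial>lborel)"
    unfolding e2 .
qed

section \<open>The radial profile of an element of $H^2_{\alpha,\beta}$\<close>

text \<open>Averaging over spheres is an orthogonal projection in the weighted space. The bound
  comes from duality, by pairing \<open>f\<close> with its own weighted average \<open>F w\<close>.
  If the projection has the full norm of \<open>f\<close>, then \<open>f\<close> coincides with its
  average, which is the last claim.\<close>

lemma radial_density_L2:
  fixes f :: "'a::euclidean_space \<Rightarrow> real" and F :: "real \<Rightarrow> real"
  assumes [measurable]: "f \<in> borel_measurable borel" "F \<in> borel_measurable borel"
    and fin: "lap_int \<alpha> f < \<infinity>"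
    and F: "\<And>\<psi>. \<psi> \<in> borel_measurable borel \<Longrightarrow> integrable lborel (\<lambda>x. f x * \<psi> (ln (norm x))) \<Longrightarrow>
       integrable lborel (\<lambda>s. F s * \<psi> s) \<and>
       (\<integral>x. f x * \<psi> (ln (norm x)) \<partial>lborel) = sphere_area TYPE('a) * (\<integral>s. F s * \<psi> s \<partial>lborel)"
  defines "w \<equiv> \<lambda>s. exp (- ((real DIM('a) + 2 * \<alpha>) * s))"
  shows "integrable lborel (\<lambda>s. (F s)\<^sup>2 * w s)"
    "ennreal (sphere_area TYPE('a) * (\<integral>s. (F s)\<^sup>2 * w s \<partial>lborel)) \<le> lap_int \<alpha> f"
    "lap_int \<alpha> f \<le> ennreal (sphere_area TYPE('a) * (\<integral>s. (F s)\<^sup>2 * w s \<partial>lborel)) \<Longrightarrow>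
      AE x in lborel. f x = F (ln (norm x)) * exp (- (real DIM('a) * ln (norm x)))"
proof -
  define A where "A = enn2real (lap_int \<alpha> f)"
  have A: "lap_int \<alpha> f = ennreal A" "A \<ge> 0" using fin by (auto simp: A_def)
  define \<omega> where "\<omega> = sphere_area TYPE('a)"
  have \<omega>: "\<omega> > 0" by (simp add: \<omega>_def sphere_area_pos)
  have wm[measurable]: "w \<in> borel_measurable borel" by (simp add: w_def)
  have w0: "w s > 0" for s by (simp add: w_def)
  have w2: "(y * w s)\<^sup>2 * exp ((real DIM('a) + 2 * \<alpha>) * s) = y\<^sup>2 * w s" for y s
  proof -
    have "w s * exp ((real DIM('a) + 2 * \<alpha>) * s) = 1" by (simp add: w_def exp_add[symmetric])
    then have "w s * w s * exp ((real DIM('a) + 2 * \<alpha>) * s) = w s" by (simp add: mult.assoc)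
    then show ?thesis by (simp add: power2_eq_square mult_ac)
  qed
  \<comment> \<open>\<open>F w\<close> is not yet known to be an admissible multiplier, so
    \<open>F\<close> is truncated both in value and in argument; Fatou's lemma removes the
    truncation.\<close>
  define c where "c N s = (if \<bar>F s\<bar> \<le> real N \<and> \<bar>s\<bar> \<le> real N then F s else 0)" for N s
  have cm[measurable]: "c N \<in> borel_measurable borel" for N unfolding c_def[abs_def] by measurable
  have cF: "F s * c N s = (c N s)\<^sup>2" for N s by (auto simp: c_def power2_eq_square)
  have fin1: "(\<integral>\<^sup>+s. ennreal ((c N s)\<^sup>2 * w s) \<partial>lborel) < \<infinity>" for N
  proof -
    have "(\<integral>\<^sup>+s. ennreal ((c N s)\<^sup>2 * exp (- (real DIM('a) + 2 * \<alpha>) * s)) \<partial>lborel) < \<infinity>"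
      by (rule nn_integral_bounded_support_finite[where B="real N" and a="- real N" and b="real N"])
        (auto simp: c_def)
    then show ?thesis by (simp only: w_def mult_minus_left)
  qed
  have ci: "integrable lborel (\<lambda>s. (c N s)\<^sup>2 * w s)" for N
    using fin1[of N] w0 by (subst integrable_iff_bounded) (auto simp: abs_mult less_imp_le)
  define K where "K N = (\<integral>s. (c N s)\<^sup>2 * w s \<partial>lborel)" for N
  have K0: "K N \<ge> 0" for N unfolding K_def using w0 by (intro integral_nonneg_AE AE_I2) (simp add: less_imp_le)
  have Kn: "(\<integral>\<^sup>+s. ennreal ((c N s)\<^sup>2 * w s) \<partial>lborel) = ennreal (K N)" for N
    unfolding K_def using w0 by (intro nn_integral_eq_integral ci AE_I2) (simp add: less_imp_le)
  have KA: "\<omega> * K N \<le> A" for N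
  proof -
    let ?\<psi> = "\<lambda>s. c N s * w s"
    have pm[measurable]: "?\<psi> \<in> borel_measurable borel" by measurable
    have W: "(\<integral>\<^sup>+(x::'a). ennreal ((?\<psi> (ln (norm x)))\<^sup>2 * norm x powr (2 * \<alpha>)) \<partial>lborel) = ennreal (\<omega> * K N)"
      unfolding nn_integral_radial_weight[OF pm] w2 Kn using \<omega> K0 by (simp add: \<omega>_def ennreal_mult)
    have i: "integrable lborel (\<lambda>x. f x * ?\<psi> (ln (norm x)))"
      using fin unfolding lap_int_def by (rule weighted_integrable[rotated 2]) (auto simp: W)
    have e: "(\<integral>x. f x * ?\<psi> (ln (norm x)) \<partial>lborel) = \<omega> * K N"
    proof -
      have "(\<lambda>s. F s * ?\<psi> s) = (\<lambda>s. (c N s)\<^sup>2 * w s)" using cF by (auto simp: mult.assoc[symmetric])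
      then show ?thesis using F[OF pm i] by (simp add: K_def \<omega>_def)
    qed
    have "ennreal (\<omega> * K N) \<le> (\<integral>\<^sup>+x. ennreal \<bar>f x * ?\<psi> (ln (norm x))\<bar> \<partial>lborel)"
      using integral_norm_bound_ennreal[OF i] K0[of N] \<omega> unfolding e by (simp add: abs_mult)
    then have "(ennreal (\<omega> * K N))\<^sup>2 \<le> (\<integral>\<^sup>+x. ennreal \<bar>f x * ?\<psi> (ln (norm x))\<bar> \<partial>lborel)\<^sup>2" by (intro power_mono) auto
    also have "\<dots> \<le> lap_int \<alpha> f * ennreal (\<omega> * K N)"
      using weighted_Cauchy_Schwarz[of f "\<lambda>x. ?\<psi> (ln (norm x))" "2 * \<alpha>"] unfolding W lap_int_def by simp
    finally have "(\<omega> * K N)\<^sup>2 \<le> A * (\<omega> * K N)"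
      unfolding A(1) using \<omega> K0[of N] A(2) by (simp add: ennreal_power ennreal_mult[symmetric])
    then show ?thesis using \<omega> K0[of N] A(2)
      by (cases "K N = 0") (auto simp: power2_eq_square mult_le_cancel_right)
  qed
  have lim: "(\<integral>\<^sup>+s. ennreal ((F s)\<^sup>2 * w s) \<partial>lborel) \<le> ennreal (A / \<omega>)"
  proof -
    have "(\<integral>\<^sup>+s. ennreal ((F s)\<^sup>2 * w s) \<partial>lborel) \<le> (\<integral>\<^sup>+s. liminf (\<lambda>N. ennreal ((c N s)\<^sup>2 * w s)) \<partial>lborel)"
    proof (rule nn_integral_mono)
      fix s :: real
      obtain N0 :: nat where N0: "max \<bar>F s\<bar> \<bar>s\<bar> \<le> real N0" using real_arch_simple by blast
      have "c N s = F s" if "N \<ge> N0" for N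
      proof -
        have "real N0 \<le> real N" using that by simp
        then show ?thesis using N0 by (simp add: c_def)
      qed
      then have "\<forall>\<^sub>F N in sequentially. ennreal ((F s)\<^sup>2 * w s) \<le> ennreal ((c N s)\<^sup>2 * w s)"
        by (intro eventually_sequentiallyI[of N0]) simp
      then show "ennreal ((F s)\<^sup>2 * w s) \<le> liminf (\<lambda>N. ennreal ((c N s)\<^sup>2 * w s))" by (rule Liminf_bounded)
    qed
    also have "\<dots> \<le> liminf (\<lambda>N. \<integral>\<^sup>+s. ennreal ((c N s)\<^sup>2 * w s) \<partial>lborel)" by (rule nn_integral_liminf) auto
    also have "\<dots> \<le> liminf (\<lambda>N. ennreal (A / \<omega>))"
    proof (intro Liminf_mono always_eventually allI)
      fix N show "(\<integral>\<^sup>+s. ennreal ((c N s)\<^sup>2 * w s) \<partial>lborel) \<le> ennreal (A / \<omega>)"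
        unfolding Kn using KA[of N] \<omega> by (intro ennreal_leI) (simp add: field_simps)
    qed
    also have "\<dots> = ennreal (A / \<omega>)" by (simp add: Liminf_const)
    finally show ?thesis .
  qed
  have "(\<integral>\<^sup>+s. ennreal ((F s)\<^sup>2 * w s) \<partial>lborel) < \<infinity>" using lim by (rule le_less_trans) simp
  then show I: "integrable lborel (\<lambda>s. (F s)\<^sup>2 * w s)"
    using w0 by (subst integrable_iff_bounded) (auto simp: abs_mult less_imp_le)
  define I where "I = (\<integral>s. (F s)\<^sup>2 * w s \<partial>lborel)"
  have I0: "I \<ge> 0" unfolding I_def using w0 by (intro integral_nonneg_AE AE_I2) (simp add: less_imp_le)
  have In: "(\<integral>\<^sup>+s. ennreal ((F s)\<^sup>2 * w s) \<partial>lborel) = ennreal I"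
    unfolding I_def using w0 by (intro nn_integral_eq_integral I AE_I2) (simp add: less_imp_le)
  have "I \<le> A / \<omega>" using lim \<omega> A(2) unfolding In by simp
  then have IA: "\<omega> * I \<le> A" using \<omega> by (simp add: field_simps)
  then show "ennreal (sphere_area TYPE('a) * (\<integral>s. (F s)\<^sup>2 * w s \<partial>lborel)) \<le> lap_int \<alpha> f"
    unfolding A(1) by (simp add: \<omega>_def I_def ennreal_leI)
  assume le: "lap_int \<alpha> f \<le> ennreal (sphere_area TYPE('a) * (\<integral>s. (F s)\<^sup>2 * w s \<partial>lborel))"
  then have AI: "A = \<omega> * I" using IA \<omega> I0 A(2) by (simp add: A(1) \<omega>_def I_def)
  let ?\<psi> = "\<lambda>s. F s * w s"
  have pm[measurable]: "?\<psi> \<in> borel_measurable borel" by measurable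
  \<comment> \<open>The weight is split evenly, so that \<open>g\<close> and \<open>h\<close> lie in
    the unweighted space. The average pairs with \<open>f\<close> as it does with itself, and
    therefore the square of \<open>g - h\<close> integrates to
    \<open>A - \<omega> * I = 0\<close>.\<close>
  define g where "g x = f x / norm x powr \<alpha>" for x :: 'a
  define h where "h x = ?\<psi> (ln (norm x)) * norm x powr \<alpha>" for x :: 'a
  have gm[measurable]: "g \<in> borel_measurable borel" unfolding g_def[abs_def] by measurable
  have hm[measurable]: "h \<in> borel_measurable borel" unfolding h_def[abs_def] by measurable
  have p2: "(y powr \<alpha>)\<^sup>2 = y powr (2 * \<alpha>)" for y :: real using powr_half_squared[of y "2 * \<alpha>"] by simp
  have g2n: "(\<integral>\<^sup>+x. ennreal ((g x)\<^sup>2) \<partial>lborel) = ennreal A"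
    using A(1) by (simp add: lap_int_def g_def power_divide p2)
  have h2n: "(\<integral>\<^sup>+x. ennreal ((h x)\<^sup>2) \<partial>lborel) = ennreal (\<omega> * I)"
  proof -
    have he: "(h x)\<^sup>2 = (?\<psi> (ln (norm x)))\<^sup>2 * norm x powr (2 * \<alpha>)" for x
      by (simp only: h_def power_mult_distrib[of "?\<psi> (ln (norm x))"] p2)
    show ?thesis unfolding he nn_integral_radial_weight[OF pm] w2 In
      using \<omega> I0 by (simp add: \<omega>_def ennreal_mult)
  qed
  have g2i: "integrable lborel (\<lambda>x. (g x)\<^sup>2)" by (subst integrable_iff_bounded) (simp add: g2n)
  have h2i: "integrable lborel (\<lambda>x. (h x)\<^sup>2)" by (subst integrable_iff_bounded) (simp add: h2n)
  have g2: "(\<integral>x. (g x)\<^sup>2 \<partial>lborel) = A" using g2n A(2) by (subst integral_eq_nn_integral) auto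
  have h2: "(\<integral>x. (h x)\<^sup>2 \<partial>lborel) = \<omega> * I" using h2n \<omega> I0 by (subst integral_eq_nn_integral) auto
  have gh: "integrable lborel (\<lambda>x. g x * h x)" by (rule integrable_mult_L2) (use g2i h2i in auto)
  have ghe: "AE x in lborel. g x * h x = f x * ?\<psi> (ln (norm x))"
    using AE_lborel_singleton[of "0::'a"] by eventually_elim (simp add: g_def h_def)
  have fi: "integrable lborel (\<lambda>x. f x * ?\<psi> (ln (norm x)))" using gh integrable_cong_AE[OF _ _ ghe] by simp
  have ghI: "(\<integral>x. g x * h x \<partial>lborel) = \<omega> * I"
  proof -
    have "(\<integral>x. g x * h x \<partial>lborel) = (\<integral>x. f x * ?\<psi> (ln (norm x)) \<partial>lborel)" by (rule integral_cong_AE) (use ghe in auto)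
    also have "\<dots> = \<omega> * (\<integral>s. F s * ?\<psi> s \<partial>lborel)" using F[OF pm fi] by (simp add: \<omega>_def)
    also have "(\<lambda>s. F s * ?\<psi> s) = (\<lambda>s. (F s)\<^sup>2 * w s)" by (auto simp: power2_eq_square)
    finally show ?thesis by (simp add: I_def)
  qed
  have "(\<integral>x. (g x - h x)\<^sup>2 \<partial>lborel) = (\<integral>x. (g x)\<^sup>2 - 2 * (g x * h x) + (h x)\<^sup>2 \<partial>lborel)"
    by (intro Bochner_Integration.integral_cong) (auto simp: power2_diff)
  also have "\<dots> = A - 2 * (\<omega> * I) + \<omega> * I" using g2i h2i gh by (simp add: g2 h2 ghI)
  finally have z: "(\<integral>x. (g x - h x)\<^sup>2 \<partial>lborel) = 0" by (simp add: AI)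
  have "integrable lborel (\<lambda>x. (g x - h x)\<^sup>2)"
  proof -
    have "integrable lborel (\<lambda>x. (g x)\<^sup>2 - 2 * (g x * h x) + (h x)\<^sup>2)" using g2i h2i gh by simp
    moreover have "(\<lambda>x. (g x)\<^sup>2 - 2 * (g x * h x) + (h x)\<^sup>2) = (\<lambda>x. (g x - h x)\<^sup>2)"
      by (simp add: fun_eq_iff power2_diff)
    ultimately show ?thesis by simp
  qed
  then have "AE x in lborel. (g x - h x)\<^sup>2 = 0" using z integral_nonneg_eq_0_iff_AE[of lborel "\<lambda>x. (g x - h x)\<^sup>2"] by simp
  then show "AE x in lborel. f x = F (ln (norm x)) * exp (- (real DIM('a) * ln (norm x)))"
    using AE_lborel_singleton[of "0::'a"]
  proof eventually_elim
    case (elim x)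
    then have "f x / norm x powr \<alpha> = ?\<psi> (ln (norm x)) * norm x powr \<alpha>" by (simp add: g_def h_def)
    then have "f x = F (ln (norm x)) * (w (ln (norm x)) * (norm x powr \<alpha> * norm x powr \<alpha>))"
      using elim by (simp add: field_simps)
    also have "w (ln (norm x)) * (norm x powr \<alpha> * norm x powr \<alpha>) = exp (- (real DIM('a) * ln (norm x)))"
      using elim by (simp add: w_def powr_def exp_add[symmetric] algebra_simps)
    finally show ?case .
  qed
qed

text \<open>\<open>F\<close> averages \<open>f\<close>, and \<open>Gt\<close> averages the radial
  part of \<open>V\<close>. For test functions \<open>flux_identity\<close> links the two averages,
  \<open>flux_limit\<close> carries the link over to \<open>H2\<close>, and
  \<open>flux_primitive\<close> turns it into a primitive \<open>G\<close> with known behaviour at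
  the ends.\<close>

lemma H2_radial_profile:
  fixes u f :: "'a::euclidean_space \<Rightarrow> real"
  assumes H: "H2 \<alpha> \<beta> u V f" and \<alpha>: "real DIM('a) - 2 * \<alpha> > 0" and \<beta>: "real DIM('a) - \<beta> > 0"
  defines "m \<equiv> (real DIM('a) + 2 * \<alpha>) / 2"
  obtains F G :: "real \<Rightarrow> real" and C where "primitive_of F G" "F \<in> borel_measurable borel"
    "integrable lborel (\<lambda>s. (F s)\<^sup>2 * exp (- (2 * m * s)))"
    "ennreal (sphere_area TYPE('a) * (\<integral>s. (F s)\<^sup>2 * exp (- (2 * m * s)) \<partial>lborel)) \<le> lap_int \<alpha> f"
    "lap_int \<alpha> f \<le> ennreal (sphere_area TYPE('a) * (\<integral>s. (F s)\<^sup>2 * exp (- (2 * m * s)) \<partial>lborel)) \<Longrightarrow>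
      AE x in lborel. f x = F (ln (norm x)) * exp (- (real DIM('a) * ln (norm x)))"
    "m > 0 \<Longrightarrow> ((\<lambda>s. (G s)\<^sup>2 * exp (- (2 * m * s))) \<longlongrightarrow> 0) at_bot"
    "m < 0 \<Longrightarrow> ((\<lambda>s. (G s)\<^sup>2 * exp (- (2 * m * s))) \<longlongrightarrow> 0) at_top"
    "\<And>s. (G s)\<^sup>2 * exp (- (2 * m * s)) \<le> C * (1 + \<bar>s\<bar>)"
    "\<And>\<psi>. \<psi> \<in> borel_measurable borel \<Longrightarrow> integrable lborel (\<lambda>x. (V x \<bullet> x) / (norm x)\<^sup>2 * \<psi> (ln (norm x))) \<Longrightarrow>
       (\<integral>x. (V x \<bullet> x) / (norm x)\<^sup>2 * \<psi> (ln (norm x)) \<partial>lborel) = sphere_area TYPE('a) * (\<integral>s. G s * \<psi> s \<partial>lborel)"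
proof -
  have m2: "2 * m = real DIM('a) + 2 * \<alpha>" by (simp add: m_def)
  have Vm[measurable]: "V \<in> borel_measurable borel" and fm[measurable]: "f \<in> borel_measurable borel"
    and fin: "lap_int \<alpha> f < \<infinity>" "grad_int 2 \<beta> V < \<infinity>"
    by (rule H2E[OF H \<alpha> \<beta>]; blast)+
  let ?g = "\<lambda>x. (V x \<bullet> x) / (norm x)\<^sup>2"
  let ?c = "\<lambda>a b s. b - max a (min b s) :: real"
  have f0: "integrable lborel (\<lambda>x. f x * indicator {a..b} (ln (norm x)))" for a b
  proof -
    have "(\<integral>\<^sup>+(x::'a). ennreal ((indicator {a..b} (ln (norm x)))\<^sup>2 * norm x powr (2 * \<alpha>)) \<partial>lborel) < \<infinity>"
      using nn_integral_bounded_support_finite[of "indicator {a..b}" 1 a b "real DIM('a) + 2 * \<alpha>"]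
      by (subst nn_integral_radial_weight) (auto simp: ennreal_mult_less_top)
    then show ?thesis using fin(1) unfolding lap_int_def
      by (intro weighted_integrable[where p="2 * \<alpha>"]) auto
  qed
  have pairc: "(\<integral>x. laplacian \<phi> x * ?c a b (ln (norm x)) \<partial>lborel) = (\<integral>x. (grad \<phi> x \<bullet> x) / (norm x)\<^sup>2 * indicator {a..b} (ln (norm x)) \<partial>lborel)
     \<and> integrable lborel (\<lambda>x. laplacian \<phi> x * ?c a b (ln (norm x)))"
    if t: "test_function \<phi>" and ab: "a < b" for \<phi> :: "'a \<Rightarrow> real" and a b
  proof -
    note fl = flux_identity[OF t ab]
    \<comment> \<open>The constant \<open>b\<close> can be inserted because the Laplacian of a test
      function has integral 0; it decides on which side the multiplier vanishes.\<close>
    have e: "(\<lambda>x. laplacian \<phi> x * ?c a b (ln (norm x))) = (\<lambda>x. laplacian \<phi> x * b - laplacian \<phi> x * max a (min b (ln (norm x))))"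
      by (simp add: right_diff_distrib)
    show ?thesis unfolding e using fl by simp
  qed
  have gi: "integrable lborel (\<lambda>x. ?g x * indicator {a..b} (ln (norm x)))" if ab: "a < b" for a b
  proof -
    \<comment> \<open>A single multiplier \<open>?c a b\<close> is constant near the origin, hence
      square integrable for the dual weight only if \<open>n + 2 \<alpha> > 0\<close>; the
      difference of two normalised ones has compact support. The second interval is disjoint from
      \<open>{a..b}\<close>, so that no cancellation hides the wanted term.\<close>
    let ?\<Psi> = "\<lambda>s. ?c a b s / (b - a) - ?c (b + 1) (b + 2) s / 1"
    let ?\<psi> = "\<lambda>s. indicator {a..b} s / (b - a) - indicator {b + 1..b + 2} s / 1 :: real"
    note fl = flux_limit(2)[OF H \<alpha> \<beta>]
    have i: "integrable lborel (\<lambda>x. \<bar>?g x * ?\<psi> (ln (norm x))\<bar>)"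
    proof (rule integrable_abs, rule fl[where \<Psi>="?\<Psi>" and B="1 / (b - a) + 1" and a=a and b="b + 2"])
      show "?\<Psi> \<in> borel_measurable borel" "?\<psi> \<in> borel_measurable borel" by measurable
      have "\<bar>?\<Psi> s\<bar> \<le> 2" for s
      proof -
        have "0 \<le> ?c a b s / (b - a)" "?c a b s / (b - a) \<le> 1" "0 \<le> ?c (b + 1) (b + 2) s" "?c (b + 1) (b + 2) s \<le> 1"
          using ab by (auto simp: divide_le_eq)
        then show ?thesis unfolding div_by_1 abs_le_iff by linarith
      qed
      moreover have "?\<Psi> s = 0" if "s \<notin> {a..b + 2}" for s
        using that ab by (cases "s < a") auto
      ultimately show "(\<integral>\<^sup>+s. ennreal ((?\<Psi> s)\<^sup>2 * exp ((real DIM('a) + 2 * \<alpha>) * s)) \<partial>lborel) < \<infinity>"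
        by (rule nn_integral_bounded_support_finite)
      show "\<bar>?\<psi> s\<bar> \<le> 1 / (b - a) + 1" for s using ab by (auto simp: indicator_def)
      show "?\<psi> s = 0" if "s \<notin> {a..b + 2}" for s using that ab by (auto simp: indicator_def)
      fix \<phi> :: "'a \<Rightarrow> real" assume t: "test_function \<phi>"
      have b12: "b + 1 < b + 2" by simp
      note p1 = pairc[OF t ab] and p2 = pairc[OF t b12]
      have "(\<integral>x. laplacian \<phi> x * ?\<Psi> (ln (norm x)) \<partial>lborel)
          = (\<integral>x. (laplacian \<phi> x * ?c a b (ln (norm x))) / (b - a) - laplacian \<phi> x * ?c (b + 1) (b + 2) (ln (norm x)) \<partial>lborel)"
        by (intro Bochner_Integration.integral_cong) (auto simp: right_diff_distrib)
      also have "\<dots> = (\<integral>x. (grad \<phi> x \<bullet> x) / (norm x)\<^sup>2 * indicator {a..b} (ln (norm x)) \<partial>lborel) / (b - a)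
          - (\<integral>x. (grad \<phi> x \<bullet> x) / (norm x)\<^sup>2 * indicator {b + 1..b + 2} (ln (norm x)) \<partial>lborel)"
        using p1 p2 by simp
      also have "\<dots> = (\<integral>x. ((grad \<phi> x \<bullet> x) / (norm x)\<^sup>2 * indicator {a..b} (ln (norm x))) / (b - a)
          - (grad \<phi> x \<bullet> x) / (norm x)\<^sup>2 * indicator {b + 1..b + 2} (ln (norm x)) \<partial>lborel)"
        by (simp only: Bochner_Integration.integral_diff[OF integrable_divide[OF flux_identity(2)[OF t ab]]
          flux_identity(2)[OF t b12]] integral_divide_zero)
      finally show "(\<integral>x. laplacian \<phi> x * ?\<Psi> (ln (norm x)) \<partial>lborel) = (\<integral>x. (grad \<phi> x \<bullet> x) / (norm x)\<^sup>2 * ?\<psi> (ln (norm x)) \<partial>lborel)"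
        by (simp add: right_diff_distrib)
    qed
    have "integrable lborel (\<lambda>x. (b - a) * \<bar>?g x * ?\<psi> (ln (norm x))\<bar>)"
      by (rule integrable_mult_right[OF i])
    then show ?thesis
    proof (rule Bochner_Integration.integrable_bound)
      show "AE x in lborel. norm (?g x * indicator {a..b} (ln (norm x))) \<le> norm ((b - a) * \<bar>?g x * ?\<psi> (ln (norm x))\<bar>)"
        using ab by (intro AE_I2) (auto simp: indicator_def abs_mult)
    qed measurable
  qed
  have gi': "integrable lborel (\<lambda>x. ?g x * indicator {a..b} (ln (norm x)))" for a b
  proof (rule Bochner_Integration.integrable_bound[OF gi[of a "max (a + 1) b"]])
    show "AE x in lborel. norm (?g x * indicator {a..b} (ln (norm x))) \<le> norm (?g x * indicator {a..max (a + 1) b} (ln (norm x)))"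
      by (intro AE_I2) (auto simp: indicator_def max_def)
  qed measurable
  obtain F where Fm[measurable]: "F \<in> borel_measurable borel" and F:
    "\<And>\<psi>. \<psi> \<in> borel_measurable borel \<Longrightarrow> integrable lborel (\<lambda>x. f x * \<psi> (ln (norm x))) \<Longrightarrow>
       integrable lborel (\<lambda>s. F s * \<psi> s) \<and>
       (\<integral>x. f x * \<psi> (ln (norm x)) \<partial>lborel) = sphere_area TYPE('a) * (\<integral>s. F s * \<psi> s \<partial>lborel)"
    by (rule radial_density[OF fm f0]) blast
  have gm: "?g \<in> borel_measurable borel" by measurable
  obtain Gt where Gtm[measurable]: "Gt \<in> borel_measurable borel" and Gt:
    "\<And>\<psi>. \<psi> \<in> borel_measurable borel \<Longrightarrow> integrable lborel (\<lambda>x. ?g x * \<psi> (ln (norm x))) \<Longrightarrow>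
       integrable lborel (\<lambda>s. Gt s * \<psi> s) \<and>
       (\<integral>x. ?g x * \<psi> (ln (norm x)) \<partial>lborel) = sphere_area TYPE('a) * (\<integral>s. Gt s * \<psi> s \<partial>lborel)"
    by (rule radial_density[OF gm gi']) blast
  have im: "indicat_real {a..b} \<in> borel_measurable borel" for a b :: real by measurable
  have Fi: "set_integrable lborel {a..b} F" for a b
    using F[OF im f0[of a b]] by (simp add: set_integrable_def mult.commute)
  have Gti: "set_integrable lborel {a..b} Gt" for a b
    using Gt[OF im gi'[of a b]] by (simp add: set_integrable_def mult.commute)
  note L2 = radial_density_L2[OF fm Fm fin(1) F]
  have IF: "integrable lborel (\<lambda>s. (F s)\<^sup>2 * exp (- (2 * m * s)))" using L2(1) by (simp only: m2)
  have \<omega>: "sphere_area TYPE('a) > 0" by (rule sphere_area_pos)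
  have trans: "integrable lborel (\<lambda>s. F s * \<Psi> s) \<and> (\<integral>s. F s * \<Psi> s \<partial>lborel) = (\<integral>s. Gt s * \<psi> s \<partial>lborel)"
    if m: "\<Psi> \<in> borel_measurable borel" "\<psi> \<in> borel_measurable borel"
    and \<Psi>: "(\<integral>\<^sup>+s. ennreal ((\<Psi> s)\<^sup>2 * exp ((real DIM('a) + 2 * \<alpha>) * s)) \<partial>lborel) < \<infinity>"
    and \<psi>: "\<And>s. \<bar>\<psi> s\<bar> \<le> B" "\<And>s. s \<notin> {a..b} \<Longrightarrow> \<psi> s = 0"
    and pair: "\<And>\<phi> :: 'a \<Rightarrow> real. test_function \<phi> \<Longrightarrow>
       (\<integral>x. laplacian \<phi> x * \<Psi> (ln (norm x)) \<partial>lborel) = (\<integral>x. (grad \<phi> x \<bullet> x) / (norm x)\<^sup>2 * \<psi> (ln (norm x)) \<partial>lborel)"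
    for \<Psi> \<psi> B a b
  proof -
    note fl = flux_limit[where \<Psi>=\<Psi> and \<psi>=\<psi> and B=B and a=a and b=b, OF H \<alpha> \<beta> m \<Psi> \<psi> pair]
    have "sphere_area TYPE('a) * (\<integral>s. F s * \<Psi> s \<partial>lborel) = sphere_area TYPE('a) * (\<integral>s. Gt s * \<psi> s \<partial>lborel)"
      using F[OF m(1) fl(1)] Gt[OF m(2) fl(2)] fl(3) by simp
    then show ?thesis using F[OF m(1) fl(1)] \<omega> by simp
  qed
  have Gtset: "(\<integral>s. Gt s * indicator {a..b} s \<partial>lborel) = (LBINT s:{a..b}. Gt s)" for a b
    by (simp add: set_lebesgue_integral_def mult.commute)
  obtain G C where "primitive_of F G" and ae: "AE s in lborel. Gt s = G s" and
    G: "m > 0 \<Longrightarrow> ((\<lambda>s. (G s)\<^sup>2 * exp (- (2 * m * s))) \<longlongrightarrow> 0) at_bot"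
    "m < 0 \<Longrightarrow> ((\<lambda>s. (G s)\<^sup>2 * exp (- (2 * m * s))) \<longlongrightarrow> 0) at_top"
    "\<And>s. (G s)\<^sup>2 * exp (- (2 * m * s)) \<le> C * (1 + \<bar>s\<bar>)"
  proof (rule flux_primitive[OF Fi Fm Gti IF])
    fix a b c d :: real assume ab: "a < b" and cd: "c < d"
    let ?\<Psi> = "\<lambda>s. ?c a b s / (b - a) - ?c c d s / (d - c)"
    let ?\<psi> = "\<lambda>s. indicator {a..b} s / (b - a) - indicator {c..d} s / (d - c) :: real"
    have "integrable lborel (\<lambda>s. F s * ?\<Psi> s) \<and> (\<integral>s. F s * ?\<Psi> s \<partial>lborel) = (\<integral>s. Gt s * ?\<psi> s \<partial>lborel)"
    proof (rule trans[where B="1 / (b - a) + 1 / (d - c)" and a="min a c" and b="max b d"])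
      show "?\<Psi> \<in> borel_measurable borel" "?\<psi> \<in> borel_measurable borel" by measurable
      have "\<bar>?\<Psi> s\<bar> \<le> 2" for s
      proof -
        have "0 \<le> ?c a b s / (b - a)" "?c a b s / (b - a) \<le> 1" "0 \<le> ?c c d s / (d - c)" "?c c d s / (d - c) \<le> 1"
          using ab cd by (auto simp: divide_le_eq)
        then show ?thesis unfolding div_by_1 abs_le_iff by linarith
      qed
      moreover have "?\<Psi> s = 0" if "s \<notin> {min a c..max b d}" for s
        using that ab cd by (cases "s < min a c") auto
      ultimately show "(\<integral>\<^sup>+s. ennreal ((?\<Psi> s)\<^sup>2 * exp ((real DIM('a) + 2 * \<alpha>) * s)) \<partial>lborel) < \<infinity>"
        by (rule nn_integral_bounded_support_finite)
      show "\<bar>?\<psi> s\<bar> \<le> 1 / (b - a) + 1 / (d - c)" for s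
      proof -
        have "\<bar>?\<psi> s\<bar> \<le> \<bar>indicator {a..b} s / (b - a)\<bar> + \<bar>indicator {c..d} s / (d - c)\<bar>" by (rule abs_triangle_ineq4)
        also have "\<dots> \<le> 1 / (b - a) + 1 / (d - c)" using ab cd by (intro add_mono) (auto simp: indicator_def)
        finally show ?thesis .
      qed
      show "?\<psi> s = 0" if "s \<notin> {min a c..max b d}" for s using that by (auto simp: indicator_def)
      fix \<phi> :: "'a \<Rightarrow> real" assume t: "test_function \<phi>"
      note p1 = pairc[OF t ab] and p2 = pairc[OF t cd]
      have "(\<integral>x. laplacian \<phi> x * ?\<Psi> (ln (norm x)) \<partial>lborel)
          = (\<integral>x. (laplacian \<phi> x * ?c a b (ln (norm x))) / (b - a) - (laplacian \<phi> x * ?c c d (ln (norm x))) / (d - c) \<partial>lborel)"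
        by (intro Bochner_Integration.integral_cong) (auto simp: right_diff_distrib)
      also have "\<dots> = (\<integral>x. (grad \<phi> x \<bullet> x) / (norm x)\<^sup>2 * indicator {a..b} (ln (norm x)) \<partial>lborel) / (b - a)
          - (\<integral>x. (grad \<phi> x \<bullet> x) / (norm x)\<^sup>2 * indicator {c..d} (ln (norm x)) \<partial>lborel) / (d - c)"
        using p1 p2 by simp
      also have "\<dots> = (\<integral>x. ((grad \<phi> x \<bullet> x) / (norm x)\<^sup>2 * indicator {a..b} (ln (norm x))) / (b - a)
          - ((grad \<phi> x \<bullet> x) / (norm x)\<^sup>2 * indicator {c..d} (ln (norm x))) / (d - c) \<partial>lborel)"
        by (simp only: Bochner_Integration.integral_diff[OF integrable_divide[OF flux_identity(2)[OF t ab]]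
          integrable_divide[OF flux_identity(2)[OF t cd]]] integral_divide_zero)
      finally show "(\<integral>x. laplacian \<phi> x * ?\<Psi> (ln (norm x)) \<partial>lborel) = (\<integral>x. (grad \<phi> x \<bullet> x) / (norm x)\<^sup>2 * ?\<psi> (ln (norm x)) \<partial>lborel)"
        by (simp add: right_diff_distrib)
    qed
    moreover have "(\<integral>s. Gt s * ?\<psi> s \<partial>lborel) = (LBINT s:{a..b}. Gt s) / (b - a) - (LBINT s:{c..d}. Gt s) / (d - c)"
    proof -
      have gg: "integrable lborel (\<lambda>s. Gt s * indicator {u..v} s)" for u v using Gt[OF im gi'[of u v]] by simp
      have "(\<integral>s. Gt s * ?\<psi> s \<partial>lborel) = (\<integral>s. (Gt s * indicator {a..b} s) / (b - a) - (Gt s * indicator {c..d} s) / (d - c) \<partial>lborel)"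
        by (intro Bochner_Integration.integral_cong) (auto simp: right_diff_distrib)
      then show ?thesis using gg by (simp add: Gtset)
    qed
    ultimately show "(\<integral>s. F s * ?\<Psi> s \<partial>lborel) = (LBINT s:{a..b}. Gt s) / (b - a) - (LBINT s:{c..d}. Gt s) / (d - c)" by simp
  next
    \<comment> \<open>For \<open>m > 0\<close> the dual weight decays at minus infinity, so a single
      multiplier that stays constant there is admissible.\<close>
    fix a b :: real assume m0: "m > 0" and ab: "a < b"
    have "integrable lborel (\<lambda>s. F s * ?c a b s) \<and> (\<integral>s. F s * ?c a b s \<partial>lborel) = (\<integral>s. Gt s * indicator {a..b} s \<partial>lborel)"
    proof (rule trans[where B=1 and a=a and b=b])
      have k: "real DIM('a) + 2 * \<alpha> > 0" using m0 m2 by linarith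
      have "(\<integral>\<^sup>+s. ennreal ((?c a b s)\<^sup>2 * exp ((real DIM('a) + 2 * \<alpha>) * s)) \<partial>lborel)
        \<le> (\<integral>\<^sup>+s. ennreal ((b - a)\<^sup>2) * (ennreal (exp ((real DIM('a) + 2 * \<alpha>) * s)) * indicator {..b} s) \<partial>lborel)"
      proof (rule nn_integral_mono)
        fix s
        show "ennreal ((?c a b s)\<^sup>2 * exp ((real DIM('a) + 2 * \<alpha>) * s))
           \<le> ennreal ((b - a)\<^sup>2) * (ennreal (exp ((real DIM('a) + 2 * \<alpha>) * s)) * indicator {..b} s)"
        proof (cases "s \<le> b")
          case True
          have "(?c a b s)\<^sup>2 \<le> (b - a)\<^sup>2" using ab by (intro power_mono) auto
          then show ?thesis using True by (simp add: ennreal_mult[symmetric] ennreal_leI mult_right_mono)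
        qed (use ab in simp)
      qed
      also have "\<dots> = ennreal ((b - a)\<^sup>2) * ennreal (exp ((real DIM('a) + 2 * \<alpha>) * b) / (real DIM('a) + 2 * \<alpha>))"
        using nn_integral_exp_atMost[OF k, of b] by (subst nn_integral_cmult) auto
      finally show "(\<integral>\<^sup>+s. ennreal ((?c a b s)\<^sup>2 * exp ((real DIM('a) + 2 * \<alpha>) * s)) \<partial>lborel) < \<infinity>"
        by (rule le_less_trans) (simp add: ennreal_mult_less_top)
      show "(\<integral>x. laplacian \<phi> x * ?c a b (ln (norm x)) \<partial>lborel) = (\<integral>x. (grad \<phi> x \<bullet> x) / (norm x)\<^sup>2 * indicator {a..b} (ln (norm x)) \<partial>lborel)"
        if "test_function \<phi>" for \<phi> :: "'a \<Rightarrow> real" using pairc[OF that ab] by simp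
    qed (auto simp: indicator_def)
    then show "integrable lborel (\<lambda>s. F s * ?c a b s) \<and> (\<integral>s. F s * ?c a b s \<partial>lborel) = (LBINT s:{a..b}. Gt s)"
      unfolding Gtset .
  next
    fix a b :: real assume m0: "m < 0" and ab: "a < b"
    \<comment> \<open>For \<open>m < 0\<close> the dual weight decays at plus infinity. Subtracting
      from \<open>a\<close> instead of \<open>b\<close> gives the multiplier that vanishes on the
      left.\<close>
    let ?d = "\<lambda>s. a - max a (min b s)"
    have "integrable lborel (\<lambda>s. F s * ?d s) \<and> (\<integral>s. F s * ?d s \<partial>lborel) = (\<integral>s. Gt s * indicator {a..b} s \<partial>lborel)"
    proof (rule trans[where B=1 and a=a and b=b])
      have k: "- (real DIM('a) + 2 * \<alpha>) > 0" using m0 m2 by linarith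
      have "(\<integral>\<^sup>+s. ennreal ((?d s)\<^sup>2 * exp ((real DIM('a) + 2 * \<alpha>) * s)) \<partial>lborel)
        \<le> (\<integral>\<^sup>+s. ennreal ((b - a)\<^sup>2) * (ennreal (exp (- (- (real DIM('a) + 2 * \<alpha>) * s))) * indicator {a..} s) \<partial>lborel)"
      proof (rule nn_integral_mono)
        fix s
        have ee: "- (- (real DIM('a) + 2 * \<alpha>) * s) = (real DIM('a) + 2 * \<alpha>) * s" by (simp add: algebra_simps)
        show "ennreal ((?d s)\<^sup>2 * exp ((real DIM('a) + 2 * \<alpha>) * s))
           \<le> ennreal ((b - a)\<^sup>2) * (ennreal (exp (- (- (real DIM('a) + 2 * \<alpha>) * s))) * indicator {a..} s)"
        proof (cases "s \<ge> a")
          case True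
          have "(?d s)\<^sup>2 \<le> (b - a)\<^sup>2" unfolding abs_le_square_iff[symmetric] using ab by auto
          then show ?thesis unfolding ee using True by (simp add: ennreal_mult[symmetric] ennreal_leI mult_right_mono)
        qed (use ab in simp)
      qed
      also have "\<dots> = ennreal ((b - a)\<^sup>2) * ennreal (exp (- (- (real DIM('a) + 2 * \<alpha>) * a)) / - (real DIM('a) + 2 * \<alpha>))"
        using nn_integral_exp_atLeast[OF k, of a] by (subst nn_integral_cmult) auto
      finally show "(\<integral>\<^sup>+s. ennreal ((?d s)\<^sup>2 * exp ((real DIM('a) + 2 * \<alpha>) * s)) \<partial>lborel) < \<infinity>"
        by (rule le_less_trans) (simp add: ennreal_mult_less_top)
      show "(\<integral>x. laplacian \<phi> x * ?d (ln (norm x)) \<partial>lborel) = (\<integral>x. (grad \<phi> x \<bullet> x) / (norm x)\<^sup>2 * indicator {a..b} (ln (norm x)) \<partial>lborel)"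
        if t: "test_function \<phi>" for \<phi> :: "'a \<Rightarrow> real"
      proof -
        have "(\<lambda>x. laplacian \<phi> x * ?d (ln (norm x))) = (\<lambda>x. laplacian \<phi> x * a - laplacian \<phi> x * max a (min b (ln (norm x))))"
          by (simp add: right_diff_distrib)
        then show ?thesis using flux_identity[OF t ab] by simp
      qed
    qed (auto simp: indicator_def)
    then show "integrable lborel (\<lambda>s. F s * ?d s) \<and> (\<integral>s. F s * ?d s \<partial>lborel) = (LBINT s:{a..b}. Gt s)"
      unfolding Gtset .
  qed blast
  show ?thesis
  proof (rule that[OF \<open>primitive_of F G\<close> Fm IF _ _ G])
    show "ennreal (sphere_area TYPE('a) * (\<integral>s. (F s)\<^sup>2 * exp (- (2 * m * s)) \<partial>lborel)) \<le> lap_int \<alpha> f"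
      using L2(2) by (simp only: m2)
    show "lap_int \<alpha> f \<le> ennreal (sphere_area TYPE('a) * (\<integral>s. (F s)\<^sup>2 * exp (- (2 * m * s)) \<partial>lborel)) \<Longrightarrow>
      AE x in lborel. f x = F (ln (norm x)) * exp (- (real DIM('a) * ln (norm x)))"
      using L2(3) by (simp only: m2)
    fix \<psi> :: "real \<Rightarrow> real" assume m[measurable]: "\<psi> \<in> borel_measurable borel"
      and i: "integrable lborel (\<lambda>x. ?g x * \<psi> (ln (norm x)))"
    have [measurable]: "G \<in> borel_measurable borel"
      by (rule borel_measurable_continuous_onI[OF primitive_of_continuous[OF \<open>primitive_of F G\<close>]])
    have "(\<integral>s. Gt s * \<psi> s \<partial>lborel) = (\<integral>s. G s * \<psi> s \<partial>lborel)"
      by (rule integral_cong_AE, measurable, use ae in eventually_elim) simp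
    then show "(\<integral>x. ?g x * \<psi> (ln (norm x)) \<partial>lborel) = sphere_area TYPE('a) * (\<integral>s. G s * \<psi> s \<partial>lborel)"
      using Gt[OF m i] by simp
  qed
qed

section \<open>Weak derivatives of radial functions away from the origin\<close>

lemma ck_on_of_C_k:
  fixes f :: "real \<Rightarrow> real"
  shows "C_k k f \<Longrightarrow> ck_on k UNIV f"
proof (induction k arbitrary: f)
  case (Suc k)
  have "(f has_real_derivative grad f x) (at x)" for x
    using C_k_SucD(1)[OF Suc.prems, of x] by (simp add: has_field_derivative_def)
  moreover have "ck_on k UNIV (grad f)"
    using Suc.IH[OF C_k_SucD(2)[OF Suc.prems, of 1]] by simp
  ultimately show ?case by (intro ck_on_SucI)
qed simp

lemma integrable_compact_support:
  fixes g \<theta> :: "'a::euclidean_space \<Rightarrow> real"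
  assumes g: "set_integrable lborel K g" and \<theta>: "continuous_on UNIV \<theta>" and K: "compact K" "\<And>x. x \<notin> K \<Longrightarrow> \<theta> x = 0"
  shows "integrable lborel (\<lambda>x. g x * \<theta> x)"
proof -
  have "compact (\<theta> ` K)" by (rule compact_continuous_image[OF continuous_on_subset[OF \<theta>] K(1)]) auto
  then obtain B where "\<And>x. x \<in> K \<Longrightarrow> \<bar>\<theta> x\<bar> \<le> B" using compact_imp_bounded by (fastforce simp: bounded_iff)
  have gi: "integrable lborel (\<lambda>x. indicator K x * g x)" using g by (simp add: set_integrable_def)
  have "integrable lborel (\<lambda>x. (indicator K x * g x) * \<theta> x)"
  proof (rule Bochner_Integration.integrable_bound[of _ "\<lambda>x. B * (indicator K x * g x)"])
    show "integrable lborel (\<lambda>x. B * (indicator K x * g x))" using gi by (rule integrable_mult_right)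
    have "\<theta> \<in> borel_measurable borel" using \<theta> by (rule borel_measurable_continuous_onI)
    then show "(\<lambda>x. (indicator K x * g x) * \<theta> x) \<in> borel_measurable lborel"
      by (intro borel_measurable_times[OF borel_measurable_integrable[OF gi]]) simp
    show "AE x in lborel. norm ((indicator K x * g x) * \<theta> x) \<le> norm (B * (indicator K x * g x))"
    proof (intro AE_I2)
      fix x
      show "norm ((indicator K x * g x) * \<theta> x) \<le> norm (B * (indicator K x * g x))"
      proof (cases "x \<in> K")
        case True
        then have "\<bar>\<theta> x\<bar> \<le> \<bar>B\<bar>" using \<open>\<And>x. x \<in> K \<Longrightarrow> \<bar>\<theta> x\<bar> \<le> B\<close>[of x] by linarith
        then show ?thesis using True by (simp add: abs_mult mult.commute mult_right_mono)
      qed simp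
    qed
  qed
  moreover have "(\<lambda>x. (indicator K x * g x) * \<theta> x) = (\<lambda>x. g x * \<theta> x)"
  proof
    fix x show "(indicator K x * g x) * \<theta> x = g x * \<theta> x" using K(2)[of x] by (cases "x \<in> K") auto
  qed
  ultimately show ?thesis by simp
qed

text \<open>A test function on the line is the derivative of another one exactly if its integral is
  0. Every \<open>\<theta>\<close> gets this property after subtracting a multiple of a fixed
  \<open>\<rho>\<close> with integral 1, and the constant is the pairing of \<open>k\<close> with
  \<open>\<rho>\<close>.\<close>

lemma du_Bois_Reymond:
  fixes k :: "real \<Rightarrow> real"
  assumes k: "\<And>a b. set_integrable lborel {a..b} k"
    and z: "\<And>\<eta> \<eta>' a b. (\<And>j. ck_on j UNIV \<eta>) \<Longrightarrow> (\<And>s. (\<eta> has_real_derivative \<eta>' s) (at s)) \<Longrightarrow> continuous_on UNIV \<eta>' \<Longrightarrow>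
       (\<And>s. s \<notin> {a..b} \<Longrightarrow> \<eta> s = 0) \<Longrightarrow> (\<And>s. s \<notin> {a..b} \<Longrightarrow> \<eta>' s = 0) \<Longrightarrow> (\<integral>s. k s * \<eta>' s \<partial>lborel) = 0"
  obtains c where "AE s in lborel. k s = c"
proof -
  \<comment> \<open>With \<open>j = 4\<close> the layers have width \<open>1 / 4\<close>, so
    \<open>\<rho>0\<close> is 1 on \<open>{1/4..3/4}\<close> and has a positive integral.\<close>
  define \<rho>0 where "\<rho>0 = plateau 4 0 1"
  have \<rho>0: "\<And>j. ck_on j UNIV \<rho>0" "\<And>s. s \<notin> {0..1} \<Longrightarrow> \<rho>0 s = 0" "\<And>s. \<rho>0 s \<ge> 0"
    unfolding \<rho>0_def by (auto intro: ck_on_plateau plateau_range plateau_eq_0)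
  have cc: "continuous_on UNIV f" if "\<And>j. ck_on j UNIV f" for f using that[of 0] by simp
  have ii: "integrable lborel (\<lambda>s. g s * \<theta> s)" if "\<And>a b. set_integrable lborel {a..b} g" "continuous_on UNIV \<theta>"
    "\<And>s. s \<notin> {a..b} \<Longrightarrow> \<theta> s = 0" for g \<theta> :: "real \<Rightarrow> real" and a b :: real
    by (rule integrable_compact_support[OF that(1)[of a b] that(2)]) (use that(3) in auto)
  have one: "set_integrable lborel {a..b} (\<lambda>s. 1::real)" for a b :: real
    by (intro borel_integrable_atLeastAtMost' continuous_intros)
  have \<rho>i: "integrable lborel \<rho>0" using ii[OF one cc[OF \<rho>0(1)] \<rho>0(2)] by simp
  define I where "I = (\<integral>s. \<rho>0 s \<partial>lborel)"
  have "I > 0"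
  proof -
    have "set_integrable lborel {1/4::real..3/4} (\<lambda>s. 1::real)" by (rule one)
    then have "(\<integral>s. indicator {1/4::real..3/4} s *\<^sub>R 1 \<partial>lborel) \<le> I" unfolding I_def set_integrable_def
    proof (rule integral_mono[OF _ \<rho>i])
      fix s :: real
      show "indicator {1/4..3/4} s *\<^sub>R 1 \<le> \<rho>0 s"
        using \<rho>0(3)[of s] by (auto simp: indicator_def \<rho>0_def plateau_def step_1)
    qed
    then show ?thesis by simp
  qed
  define \<rho> where "\<rho> s = \<rho>0 s / I" for s
  have \<rho>ck: "ck_on j UNIV \<rho>" for j
    using ck_on_mult[OF ck_on_const[of j UNIV "1 / I"] \<rho>0(1)] by (simp add: \<rho>_def[abs_def])
  have \<rho>s: "s \<notin> {0..1} \<Longrightarrow> \<rho> s = 0" for s using \<rho>0(2) by (simp add: \<rho>_def)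
  have \<rho>I: "(\<integral>s. \<rho> s \<partial>lborel) = 1" using \<open>I > 0\<close> by (simp add: \<rho>_def I_def)
  define c where "c = (\<integral>s. k s * \<rho> s \<partial>lborel)"
  have main: "(\<integral>s. (k s - c) * \<theta> s \<partial>lborel) = 0"
    if \<theta>: "\<And>j. ck_on j UNIV \<theta>" "\<And>s. s \<notin> {a..b} \<Longrightarrow> \<theta> s = 0" for \<theta> a b
  proof -
    define T where "T = (\<integral>s. \<theta> s \<partial>lborel)"
    define \<zeta> where "\<zeta> s = \<theta> s + (- T) * \<rho> s" for s
    define A where "A = min a 0" define B where "B = max b 1"
    have \<zeta>ck: "ck_on j UNIV \<zeta>" for j unfolding \<zeta>_def[abs_def] by (intro ck_on_add ck_on_mult ck_on_const \<theta>(1) \<rho>ck)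
    have \<zeta>s: "\<zeta> s = 0" if "s \<notin> {A..B}" for s
    proof -
      have "s \<notin> {a..b}" "s \<notin> {0..1}" using that by (auto simp: A_def B_def)
      then show ?thesis using \<theta>(2)[of s] \<rho>s[of s] by (simp add: \<zeta>_def)
    qed
    have \<theta>i: "integrable lborel \<theta>" using ii[OF one cc[OF \<theta>(1)] \<theta>(2)] by simp
    have \<rho>i': "integrable lborel \<rho>" using \<rho>i by (simp add: \<rho>_def[abs_def])
    have \<zeta>0: "(\<integral>s. \<zeta> s \<partial>lborel) = 0" unfolding \<zeta>_def using \<theta>i \<rho>i' \<rho>I by (simp add: T_def)
    have si: "set_integrable lborel {x..y} \<zeta>" for x y
      by (rule borel_integrable_atLeastAtMost'[OF continuous_on_subset[OF cc[OF \<zeta>ck]]]) auto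
    obtain E where E: "primitive_of \<zeta> E" by (rule primitive_of_exists[OF si])
    define \<eta> where "\<eta> s = E s + - E A" for s
    have P: "primitive_of \<zeta> \<eta>" unfolding \<eta>_def[abs_def] by (rule primitive_of_add_const[OF E])
    have d: "(\<eta> has_real_derivative \<zeta> s) (at s)" for s by (rule primitive_of_imp_DERIV[OF P cc[OF \<zeta>ck]])
    have \<eta>ck: "ck_on j UNIV \<eta>" for j
      by (rule ck_on_Suc_imp) (rule ck_on_SucI[OF d \<zeta>ck])
    have \<eta>A: "\<eta> A = 0" by (simp add: \<eta>_def)
    have AB: "A \<le> B" by (simp add: A_def B_def)
    have zero: "(LBINT s:{x..y}. \<zeta> s) = 0" if "{x..y} \<inter> {A<..<B} = {}" for x y
    proof -
      have "(LBINT s:{x..y}. \<zeta> s) = (LBINT s:{x..y}. 0)"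
        unfolding set_lebesgue_integral_def
      proof (rule integral_cong_AE)
        show "AE s in lborel. indicat_real {x..y} s *\<^sub>R \<zeta> s = indicat_real {x..y} s *\<^sub>R 0"
          using AE_lborel_singleton[of A] AE_lborel_singleton[of B]
        proof eventually_elim
          case (elim s)
          then show ?case using \<zeta>s[of s] that by (cases "s \<in> {x..y}") force+
        qed
      qed (use borel_measurable_continuous_onI[OF cc[OF \<zeta>ck]] in auto)
      then show ?thesis by (simp add: set_lebesgue_integral_def)
    qed
    have \<eta>s: "\<eta> s = 0" if "s \<notin> {A..B}" for s
    proof (cases "s < A")
      case True
      then show ?thesis using primitive_ofD(2)[OF P, of s A] zero[of s A] \<eta>A by (auto simp: disjoint_iff)
    next
      case False
      then have sB: "B < s" using that AB by auto
      have "(LBINT s:{A..B}. \<zeta> s) = (\<integral>s. \<zeta> s \<partial>lborel)"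
        unfolding set_lebesgue_integral_def
      proof (intro Bochner_Integration.integral_cong refl)
        fix s show "indicat_real {A..B} s *\<^sub>R \<zeta> s = \<zeta> s" using \<zeta>s[of s] by (cases "s \<in> {A..B}") auto
      qed
      then have "\<eta> B = 0" using primitive_ofD(2)[OF P AB] \<eta>A \<zeta>0 by simp
      then show ?thesis using primitive_ofD(2)[OF P, of B s] zero[of B s] sB by (auto simp: disjoint_iff)
    qed
    have "(\<integral>s. k s * \<zeta> s \<partial>lborel) = 0" by (rule z[OF \<eta>ck d cc[OF \<zeta>ck] \<eta>s \<zeta>s])
    moreover have "(\<integral>s. k s * \<zeta> s \<partial>lborel) = (\<integral>s. k s * \<theta> s - T * (k s * \<rho> s) \<partial>lborel)"
      by (intro Bochner_Integration.integral_cong) (auto simp: \<zeta>_def algebra_simps)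
    moreover have k\<theta>: "integrable lborel (\<lambda>s. k s * \<theta> s)" by (rule ii[OF k cc[OF \<theta>(1)] \<theta>(2)])
    moreover have "integrable lborel (\<lambda>s. k s * \<rho> s)" by (rule ii[OF k cc[OF \<rho>ck] \<rho>s])
    ultimately have "(\<integral>s. k s * \<theta> s \<partial>lborel) = T * c" by (simp add: c_def)
    moreover have "(\<integral>s. (k s - c) * \<theta> s \<partial>lborel) = (\<integral>s. k s * \<theta> s \<partial>lborel) - c * T"
      using k\<theta> \<theta>i by (simp add: left_diff_distrib T_def)
    ultimately show ?thesis by simp
  qed
  have "AE s in lborel. s \<in> box (- real N) (real N) \<longrightarrow> k s - c = 0" for N :: nat
  proof (rule fundamental_lemma_box)
    have "set_integrable lborel {- real N..real N} (\<lambda>s. k s - c)"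
      by (intro set_integral_diff k borel_integrable_atLeastAtMost' continuous_intros)
    then show "set_integrable lborel (box (- real N) (real N)) (\<lambda>s. k s - c)"
      by (rule set_integrable_subset) (auto simp: box_real)
    fix \<phi> :: "real \<Rightarrow> real" assume t: "test_function \<phi>" and s: "{x. \<phi> x \<noteq> 0} \<subseteq> box (- real N) (real N)"
    have "\<phi> x = 0" if "x \<notin> {- real N..real N}" for x using s that by (auto simp: box_real)
    then show "(\<integral>s. (k s - c) * \<phi> s \<partial>lborel) = 0"
      by (intro main[where a="- real N" and b="real N"] ck_on_of_C_k test_functionD(1)[OF t])
  qed
  then have "AE s in lborel. \<forall>N::nat. s \<in> box (- real N) (real N) \<longrightarrow> k s - c = 0"
    by (subst AE_all_countable) auto
  then have "AE s in lborel. k s = c"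
  proof eventually_elim
    case (elim s)
    obtain N :: nat where "\<bar>s\<bar> < real N" using reals_Archimedean2 by blast
    then have "s \<in> box (- real N) (real N)" by (auto simp: box_real abs_less_iff)
    then show ?case using elim by auto
  qed
  then show ?thesis by (rule that)
qed

lemma annulus_compact:
  fixes a b :: real
  defines "K \<equiv> {x::'a::euclidean_space. exp a \<le> norm x \<and> norm x \<le> exp b}"
  shows "compact K" "0 \<notin> K" "x \<noteq> 0 \<Longrightarrow> x \<in> K \<longleftrightarrow> ln (norm x) \<in> {a..b}"
proof -
  have "K = cball 0 (exp b) - ball 0 (exp a)" by (auto simp: K_def)
  then show "compact K" by (simp add: compact_diff)
  show "0 \<notin> K" by (simp add: K_def)
  show "x \<noteq> 0 \<Longrightarrow> x \<in> K \<longleftrightarrow> ln (norm x) \<in> {a..b}"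
    using ln_le_cancel_iff[of "norm x" "exp b"] by (auto simp: K_def ln_ge_iff)
qed

text \<open>The divergence of \<open>\<eta>(ln |x|) x / |x|\<^sup>n\<close> is \<open>\<eta>'(ln |x|) / |x|\<^sup>n\<close>, so in the variable
  \<open>s = ln |x|\<close> these fields test the one-dimensional weak derivative.\<close>

lemma log_radial_test_field:
  fixes \<eta> \<eta>' :: "real \<Rightarrow> real"
  assumes ck: "\<And>j. ck_on j UNIV \<eta>" and d: "\<And>s. (\<eta> has_real_derivative \<eta>' s) (at s)"
    and supp: "\<And>s. s \<notin> {a..b} \<Longrightarrow> \<eta> s = 0"
  obtains \<phi> :: "'a::euclidean_space \<Rightarrow> 'a \<Rightarrow> real" where
    "\<And>i. test_function (\<phi> i)" "\<And>i. 0 \<notin> closure {x. \<phi> i x \<noteq> 0}"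
    "\<And>i x. x \<notin> {x. exp a \<le> norm x \<and> norm x \<le> exp b} \<Longrightarrow> \<phi> i x = 0"
    "\<And>i x. x \<noteq> 0 \<Longrightarrow> \<phi> i x = (x \<bullet> i) * exp (- (real DIM('a) * ln (norm x))) * \<eta> (ln (norm x))"
    "\<And>x. x \<noteq> 0 \<Longrightarrow> (\<Sum>i\<in>Basis. partial_deriv i (\<phi> i) x) = exp (- (real DIM('a) * ln (norm x))) * \<eta>' (ln (norm x))"
proof -
  let ?n = "real DIM('a)"
  \<comment> \<open>As a function of \<open>y = |x|^2\<close>, where \<open>y powr (- n / 2)\<close>
    is \<open>|x|^(-n)\<close> and \<open>ln y / 2\<close> is \<open>ln |x|\<close>. It vanishes for
    \<open>y < e^(2 a)\<close>, so it is smooth on the whole line and the field is smooth at the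
    origin.\<close>
  define \<Phi> where "\<Phi> y = (if y \<le> 0 then 0 else y powr (- ?n / 2) * \<eta> (ln y / 2))" for y :: real
  have \<Phi>0: "\<Phi> y = 0" if "y < exp (2 * a)" for y
  proof (cases "y \<le> 0")
    case False
    then have "ln y < 2 * a" using that by (metis exp_less_cancel_iff exp_ln not_le)
    then show ?thesis using supp[of "ln y / 2"] by (simp add: \<Phi>_def)
  qed (simp add: \<Phi>_def)
  have \<Phi>1: "\<Phi> y = 0" if "y > exp (2 * b)" for y
  proof -
    have y: "y > 0" using that by (metis exp_gt_zero less_trans)
    then have "ln y > 2 * b" using that by (metis exp_less_cancel_iff exp_ln)
    then show ?thesis using supp[of "ln y / 2"] by (simp add: \<Phi>_def)
  qed
  have \<Phi>ck: "ck_on k UNIV \<Phi>" for k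
  proof -
    have "ck_on k {0<..} (\<lambda>y. y powr (- ?n / 2) * \<eta> ((1 / 2) * ln y))"
      by (intro ck_on_mult ck_on_powr ck_on_compose[OF ck] ck_on_const ck_on_ln) auto
    then have 1: "ck_on k {0<..} \<Phi>" by (rule ck_on_cong[rotated]) (auto simp: \<Phi>_def)
    have 2: "ck_on k {..<exp (2 * a)} \<Phi>"
      by (rule ck_on_cong[OF _ ck_on_const[of k _ 0]]) (auto simp: \<Phi>0)
    have "UNIV = {0<..} \<union> {..<exp (2 * a)}"
    proof -
      have "x < exp (2 * a)" if "\<not> 0 < x" for x :: real using that exp_gt_zero[of "2 * a"] by linarith
      then show ?thesis by auto
    qed
    then show ?thesis using ck_on_Un[OF _ _ 1 2] by simp
  qed
  define \<phi> where "\<phi> i x = (x \<bullet> i) * \<Phi> (x \<bullet> x)" for i x :: 'a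
  have nx: "x \<bullet> x = (norm x)\<^sup>2" for x :: 'a by (rule dot_square_norm)
  have sq: "exp (2 * c) = (exp c)\<^sup>2" for c :: real by (simp add: power2_eq_square exp_add[symmetric])
  have \<phi>0: "\<phi> i x = 0" if "x \<notin> {x. exp a \<le> norm x \<and> norm x \<le> exp b}" for i x
  proof -
    have "norm x < exp a \<or> norm x > exp b" using that by auto
    then have "(norm x)\<^sup>2 < (exp a)\<^sup>2 \<or> (norm x)\<^sup>2 > (exp b)\<^sup>2"
      by (auto intro: power_strict_mono)
    then show ?thesis using \<Phi>0[of "(norm x)\<^sup>2"] \<Phi>1[of "(norm x)\<^sup>2"] unfolding \<phi>_def nx sq by auto
  qed
  have C: "C_k k (\<phi> i)" for i k unfolding \<phi>_def[abs_def]
    by (intro C_k_mult C_k_inner C_k_compose[OF \<Phi>ck C_k_norm_sq])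
  show ?thesis
  proof (rule that[of \<phi>])
    show "test_function (\<phi> i)" for i
      by (rule test_functionI[OF C, where R="exp b"]) (rule \<phi>0, simp)
    show "0 \<notin> closure {x. \<phi> i x \<noteq> 0}" for i
    proof -
      have "{x. \<phi> i x \<noteq> 0} \<subseteq> {x. exp a \<le> norm x}" using \<phi>0[of _ i] by blast
      moreover have "closed {x::'a. exp a \<le> norm x}" by (intro closed_Collect_le continuous_intros)
      ultimately have "closure {x. \<phi> i x \<noteq> 0} \<subseteq> {x. exp a \<le> norm x}" by (rule closure_minimal)
      moreover have "0 \<notin> {x::'a. exp a \<le> norm x}" by simp
      ultimately show ?thesis by blast
    qed
    show "\<And>i x. x \<notin> {x. exp a \<le> norm x \<and> norm x \<le> exp b} \<Longrightarrow> \<phi> i x = 0" by (rule \<phi>0)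
    fix x :: 'a assume x: "x \<noteq> 0"
    have x0: "norm x > 0" "x \<bullet> x > 0" using x by auto
    have l: "ln (x \<bullet> x) / 2 = ln (norm x)" using x0(1) by (simp add: nx ln_realpow)
    have pw: "(x \<bullet> x) powr (- ?n / 2) = exp (- (?n * ln (norm x)))"
      using x0 l[symmetric] by (simp add: powr_def)
    show "\<phi> i x = (x \<bullet> i) * exp (- (?n * ln (norm x))) * \<eta> (ln (norm x))" for i
    proof -
      have "\<not> x \<bullet> x \<le> 0" using x0(2) by linarith
      then show ?thesis by (simp only: \<phi>_def \<Phi>_def if_False l pw mult.assoc)
    qed
    define y where "y = x \<bullet> x"
    have y0: "y > 0" using x0 by (simp add: y_def)
    define D where "D = (- ?n / 2) * y powr (- ?n / 2 - 1) * \<eta> (ln y / 2) + y powr (- ?n / 2) * (\<eta>' (ln y / 2) * (1 / y / 2))"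
    have dl: "((\<lambda>y. ln y / 2) has_real_derivative (1 / y / 2)) (at y)"
      using y0 by (auto intro!: derivative_eq_intros)
    have "((\<lambda>y. y powr (- ?n / 2) * \<eta> (ln y / 2)) has_real_derivative D) (at y)"
      using DERIV_mult[OF has_real_derivative_powr[OF y0, of "- ?n / 2"] DERIV_chain2[OF d dl]]
      by (simp add: D_def algebra_simps)
    then have "(\<Phi> has_real_derivative D) (at y)"
      by (rule has_field_derivative_transform_within_open[where S="{0<..}"]) (use y0 in \<open>auto simp: \<Phi>_def\<close>)
    then have dP: "((\<lambda>x. \<Phi> (x \<bullet> x)) has_derivative (\<lambda>h. D * (2 * (x \<bullet> h)))) (at x)"
      unfolding y_def has_field_derivative_def
      by (rule has_derivative_compose[rotated]) (auto intro!: derivative_eq_intros simp: inner_commute)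
    have p: "partial_deriv i (\<phi> i) x = \<Phi> y + 2 * D * (x \<bullet> i)\<^sup>2" if i: "i \<in> Basis" for i
    proof -
      have "((\<lambda>x. x \<bullet> i) has_derivative (\<lambda>h. h \<bullet> i)) (at x)" by (auto intro!: derivative_eq_intros)
      from has_derivative_mult[OF this dP]
      have "(\<phi> i has_derivative (\<lambda>h. (\<Phi> y *\<^sub>R i + (2 * D * (x \<bullet> i)) *\<^sub>R x) \<bullet> h)) (at x)"
        unfolding \<phi>_def[abs_def]
        by (rule has_derivative_eq_rhs) (auto simp: y_def inner_add_left inner_commute algebra_simps)
      from grad_eqI(2)[OF this] show ?thesis using i by (simp add: inner_add_left power2_eq_square)
    qed
    have "(\<Sum>i\<in>Basis. partial_deriv i (\<phi> i) x) = ?n * \<Phi> y + 2 * D * (\<Sum>i\<in>Basis. (x \<bullet> i)\<^sup>2)"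
      using p by (simp add: sum.distrib sum_distrib_left)
    also have "(\<Sum>i\<in>Basis. (x \<bullet> i)\<^sup>2) = y" by (simp add: y_def euclidean_inner[of x x] power2_eq_square)
    \<comment> \<open>The terms with \<open>\<eta>\<close> cancel, since the field
      \<open>|x|^(-n) x\<close> is divergence free away from the origin; only \<open>\<eta>'\<close>
      remains.\<close>
    also have "?n * \<Phi> y + 2 * D * y = y powr (- ?n / 2) * \<eta>' (ln y / 2)"
    proof -
      have "y powr (- ?n / 2 - 1) = y powr (- ?n / 2) / y" using y0 by (subst powr_diff) simp
      then show ?thesis using y0 unfolding D_def \<Phi>_def by (simp add: field_simps)
    qed
    finally show "(\<Sum>i\<in>Basis. partial_deriv i (\<phi> i) x) = exp (- (?n * ln (norm x))) * \<eta>' (ln (norm x))"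
      by (simp only: y_def l pw)
  qed
qed

lemma log_radial_has_derivative:
  fixes x :: "'a::euclidean_space"
  assumes x: "x \<noteq> 0" and w: "(w has_real_derivative y) (at (ln (norm x)))"
  shows "((\<lambda>x. w (ln (norm x))) has_derivative (\<lambda>h. ((y / (norm x)\<^sup>2) *\<^sub>R x) \<bullet> h)) (at x)"
proof -
  have x0: "norm x > 0" using x by simp
  have 1: "((\<lambda>x. ln (norm x)) has_derivative (\<lambda>h. inverse (norm x) * (sgn x \<bullet> h))) (at x)"
    using has_derivative_compose[OF has_derivative_norm[OF x], of ln "\<lambda>y. inverse (norm x) * y"]
      DERIV_ln[OF x0] by (simp add: has_field_derivative_def inner_commute)
  have "((\<lambda>x. w (ln (norm x))) has_derivative (\<lambda>h. y * (inverse (norm x) * (sgn x \<bullet> h)))) (at x)"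
    using has_derivative_compose[OF 1 w[unfolded has_field_derivative_def]] .
  moreover have "y * (inverse (norm x) * (sgn x \<bullet> h)) = ((y / (norm x)\<^sup>2) *\<^sub>R x) \<bullet> h" for h
    using x by (simp add: sgn_div_norm power2_eq_square field_simps)
  ultimately show ?thesis by simp
qed

lemma norm_sq_eq_exp: "x \<noteq> 0 \<Longrightarrow> (norm x)\<^sup>2 = exp (2 * ln (norm x))" for x :: "'a::real_normed_vector"
  by (simp add: exp_double)

text \<open>The product of \<open>v\<close> and \<open>\<phi>\<close> is continuously differentiable
  on the whole space, because \<open>\<phi>\<close> vanishes in a neighbourhood of the origin, the
  only point where \<open>v\<close> is not controlled.\<close>

lemma punctured_integration_by_parts:
  fixes v \<phi> :: "'a::euclidean_space \<Rightarrow> real"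
  assumes vd: "\<And>x. x \<noteq> 0 \<Longrightarrow> (v has_derivative (\<lambda>h. W x \<bullet> h)) (at x)" and Wc: "continuous_on (-{0}) W"
    and t: "test_function \<phi>" and 0: "0 \<notin> closure {x. \<phi> x \<noteq> 0}" and b: "b \<in> Basis"
  shows "integrable lborel (\<lambda>x. (W x \<bullet> b) * \<phi> x)" "integrable lborel (\<lambda>x. v x * partial_deriv b \<phi> x)"
    "(\<integral>x. v x * partial_deriv b \<phi> x \<partial>lborel) = - (\<integral>x. (W x \<bullet> b) * \<phi> x \<partial>lborel)"
proof -
  have vc: "continuous_on (-{0}) v"
    by (intro continuous_at_imp_continuous_on ballI has_derivative_continuous[OF vd]) simp
  let ?S = "closure {x. \<phi> x \<noteq> 0}"
  note T = test_functionD[OF t]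
  have S: "compact ?S" using t by (simp add: test_function_def)
  have uS: "- {0} \<union> - ?S = UNIV" using 0 by blast
  have oS: "open (- {0::'a})" "open (- ?S)" by (auto intro: open_Compl)
  have cont: "continuous_on UNIV g" if "continuous_on (- {0}) g" "\<And>x. x \<notin> ?S \<Longrightarrow> g x = 0"
    for g :: "'a \<Rightarrow> 'c::real_normed_vector"
  proof -
    have "continuous_on (- ?S) (\<lambda>x. 0 :: 'c)" by (rule continuous_on_const)
    moreover have "0 = g x" if "x \<in> - ?S" for x using \<open>\<And>x. x \<notin> ?S \<Longrightarrow> g x = 0\<close>[of x] that by simp
    ultimately have "continuous_on (- ?S) g" by (rule continuous_on_eq)
    with oS that(1) have "continuous_on (- {0} \<union> - ?S) g" by (rule continuous_on_open_Un)
    then show ?thesis unfolding uS .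
  qed
  define H where "H x = \<phi> x *\<^sub>R W x + v x *\<^sub>R grad \<phi> x" for x
  have c1: "continuous_on UNIV (\<lambda>x. \<phi> x *\<^sub>R W x)"
    by (rule cont[OF continuous_on_scaleR[OF continuous_on_subset[OF T(2) subset_UNIV] Wc]])
      (metis T(6) scaleR_zero_left)
  have c2: "continuous_on UNIV (\<lambda>x. v x *\<^sub>R grad \<phi> x)"
    by (rule cont[OF continuous_on_scaleR[OF vc continuous_on_subset[OF test_function_continuous(1)[OF t] subset_UNIV]]])
      (metis T(7) scaleR_zero_right)
  have Hc: "continuous_on UNIV H" unfolding H_def[abs_def] by (intro continuous_on_add c1 c2)
  have Hd: "((\<lambda>x. v x * \<phi> x) has_derivative (\<lambda>h. H x \<bullet> h)) (at x)" for x
  proof (cases "x = 0")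
    case False
    from has_derivative_mult[OF vd[OF False] T(3)[of x]] show ?thesis
      by (rule has_derivative_eq_rhs) (auto simp: H_def inner_add_left)
  next
    case True
    then have xS: "x \<in> - ?S" using 0 by blast
    have H0: "H x = 0" using T(6)[of x] T(7)[of x] xS by (simp add: H_def)
    have h1: "((\<lambda>x. 0) has_derivative (\<lambda>h. H x \<bullet> h)) (at x)" by (simp add: H0)
    have h2: "0 = v y * \<phi> y" if "y \<in> - ?S" for y using T(6)[of y] that by (metis ComplD mult_zero_right)
    show ?thesis by (rule has_derivative_transform_within_open[OF h1 oS(2) xS h2])
  qed
  obtain R where R: "\<And>x. norm x > R \<Longrightarrow> \<phi> x = 0" using T(5) by blast
  have sp: "v x * \<phi> x = 0" if "norm x > R" for x using R[OF that] by simp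
  have Z: "(\<integral>x. H x \<bullet> b \<partial>lborel) = 0" by (rule integral_grad_zero(2)[OF Hd Hc sp b])
  have cs: "integrable lborel g" if "continuous_on UNIV g" "\<And>x. x \<notin> ?S \<Longrightarrow> g x = 0" for g :: "'a \<Rightarrow> real"
  proof -
    have "set_integrable lborel ?S (\<lambda>x. 1::real)"
      unfolding set_integrable_def by (rule borel_integrable_compact[OF S]) auto
    from integrable_compact_support[OF this that(1) S that(2)] show ?thesis by simp
  qed
  show I1: "integrable lborel (\<lambda>x. (W x \<bullet> b) * \<phi> x)"
  proof -
    have "continuous_on UNIV (\<lambda>x. (\<phi> x *\<^sub>R W x) \<bullet> b)" by (intro continuous_on_inner c1 continuous_on_const)
    then have "integrable lborel (\<lambda>x. (\<phi> x *\<^sub>R W x) \<bullet> b)" by (rule cs) (metis T(6) scaleR_zero_left inner_zero_left)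
    then show ?thesis by (simp add: mult.commute)
  qed
  show I2: "integrable lborel (\<lambda>x. v x * partial_deriv b \<phi> x)"
  proof -
    have "continuous_on UNIV (\<lambda>x. (v x *\<^sub>R grad \<phi> x) \<bullet> b)" by (intro continuous_on_inner c2 continuous_on_const)
    then have "integrable lborel (\<lambda>x. (v x *\<^sub>R grad \<phi> x) \<bullet> b)" by (rule cs) (metis T(7) scaleR_zero_right inner_zero_left)
    then show ?thesis by (simp add: T(4))
  qed
  have "(\<lambda>x. H x \<bullet> b) = (\<lambda>x. (W x \<bullet> b) * \<phi> x + v x * partial_deriv b \<phi> x)"
    by (simp add: H_def inner_add_left T(4) mult.commute fun_eq_iff)
  then show "(\<integral>x. v x * partial_deriv b \<phi> x \<partial>lborel) = - (\<integral>x. (W x \<bullet> b) * \<phi> x \<partial>lborel)"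
    using Z I1 I2 by simp
qed

text \<open>The fields of \<open>log_radial_test_field\<close> see only the radial component of
  \<open>V\<close>, that is \<open>G\<close>, and show that the profile of \<open>u\<close> has the
  weak derivative \<open>G e^((2 - n) s)\<close>. Since \<open>u\<close> is radial, it agrees almost
  everywhere with a function that is continuously differentiable off the origin, and uniqueness of
  the weak gradient makes all of \<open>V\<close> radial.\<close>

lemma H2_radial_gradient:
  fixes u :: "'a::euclidean_space \<Rightarrow> real" and V :: "'a \<Rightarrow> 'a" and G :: "real \<Rightarrow> real"
  assumes rad: "radial u" and um[measurable]: "u \<in> borel_measurable borel" and Vm[measurable]: "V \<in> borel_measurable borel"
    and wg: "weak_gradient u V" and G: "continuous_on UNIV G"
    and GV: "\<And>\<psi>. \<psi> \<in> borel_measurable borel \<Longrightarrow> integrable lborel (\<lambda>x. (V x \<bullet> x) / (norm x)\<^sup>2 * \<psi> (ln (norm x))) \<Longrightarrow>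
       (\<integral>x. (V x \<bullet> x) / (norm x)\<^sup>2 * \<psi> (ln (norm x)) \<partial>lborel) = sphere_area TYPE('a) * (\<integral>s. G s * \<psi> s \<partial>lborel)"
  shows "AE x in lborel. V x = (G (ln (norm x)) * exp (- (real DIM('a) * ln (norm x)))) *\<^sub>R x"
proof -
  let ?n = "real DIM('a)"
  have uK: "set_integrable lborel K u" and VK: "set_integrable lborel K V" if "compact K" "0 \<notin> K" for K
    using wg that by (auto simp: weak_gradient_def)
  have wt: "(\<integral>x. u x * partial_deriv b \<phi> x \<partial>lborel) = - (\<integral>x. (V x \<bullet> b) * \<phi> x \<partial>lborel)"
    if "test_function \<phi>" "0 \<notin> closure {x. \<phi> x \<noteq> 0}" "b \<in> Basis" for \<phi> b
    using wg that by (auto simp: weak_gradient_def)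
  have VKb: "set_integrable lborel K (\<lambda>x. V x \<bullet> b)" if "compact K" "0 \<notin> K" for K b
    using integrable_inner_left[of b lborel "\<lambda>x. indicator K x *\<^sub>R V x"] VK[OF that] by (simp add: set_integrable_def)
  obtain e :: 'a where e: "e \<in> Basis" using nonempty_Basis by blast
  \<comment> \<open>\<open>radial\<close> is a pointwise condition, so restricting \<open>u\<close>
    to a ray loses nothing.\<close>
  define u0 where "u0 s = u (exp s *\<^sub>R e)" for s
  have u0: "u x = u0 (ln (norm x))" if "x \<noteq> 0" for x
  proof -
    have "norm x = norm (norm x *\<^sub>R e)" using e by simp
    then have "u x = u (norm x *\<^sub>R e)" using rad unfolding radial_def by blast
    then show ?thesis using that by (simp add: u0_def)
  qed
  have u0m[measurable]: "u0 \<in> borel_measurable borel" unfolding u0_def[abs_def]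
    by (rule measurable_compose[OF _ um]) measurable
  have u0i: "set_integrable lborel {a..b} u0" for a b
  proof -
    let ?K = "{x::'a. exp a \<le> norm x \<and> norm x \<le> exp b}"
    let ?h = "\<lambda>s. indicator {a..b} s * u0 s"
    have "integrable lborel (\<lambda>x. indicator ?K x *\<^sub>R u x)"
      using uK[OF annulus_compact(1,2)] by (simp add: set_integrable_def)
    moreover have "AE x in lborel. indicator ?K x *\<^sub>R u x = ?h (ln (norm x))"
      using AE_lborel_singleton[of "0::'a"]
      by eventually_elim (use annulus_compact(3)[where 'a='a] u0 in \<open>simp add: indicator_def\<close>)
    moreover have "(\<lambda>x. indicator ?K x *\<^sub>R u x) \<in> borel_measurable lborel" by measurable
    moreover have "(\<lambda>x::'a. ?h (ln (norm x))) \<in> borel_measurable lborel" by measurable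
    ultimately have "integrable lborel (\<lambda>x::'a. ?h (ln (norm x)))" using integrable_cong_AE by blast
    then have "integrable lborel (\<lambda>s. exp (?n * s) * ?h s)"
      by (subst (asm) integrable_polar) auto
    then have "set_integrable lborel {a..b} (\<lambda>s. exp (?n * s) * u0 s)"
      by (simp add: set_integrable_def mult_ac)
    then have "set_integrable lborel {a..b} (\<lambda>s. exp (- (?n * s)) * (exp (?n * s) * u0 s))"
      by (rule set_integrable_mult_continuous) (intro continuous_intros)
    then show ?thesis by (simp add: mult.assoc[symmetric] exp_add[symmetric])
  qed
  \<comment> \<open>The derivative of a function in \<open>s = ln |x|\<close> is the inner product
    of its gradient with \<open>x\<close>; for the gradient \<open>G |x|^(-n) x\<close> this is
    \<open>G |x|^(2 - n)\<close>.\<close>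
  define Y where "Y s = G s * exp ((2 - ?n) * s)" for s
  have Yc: "continuous_on UNIV Y" unfolding Y_def[abs_def] by (intro continuous_intros G)
  have Yi: "set_integrable lborel {a..b} Y" for a b
    by (rule borel_integrable_atLeastAtMost'[OF continuous_on_subset[OF Yc]]) auto
  obtain w0 where w0: "primitive_of Y w0" by (rule primitive_of_exists[OF Yi])
  have w0c: "continuous_on UNIV w0" by (rule primitive_of_continuous[OF w0])
  have w0d: "(w0 has_real_derivative Y s) (at s)" for s by (rule primitive_of_imp_DERIV[OF w0 Yc])
  have w0i: "set_integrable lborel {a..b} w0" for a b
    by (rule borel_integrable_atLeastAtMost'[OF continuous_on_subset[OF w0c]]) auto
  \<comment> \<open>Both \<open>u0\<close> and the primitive \<open>w0\<close> have the weak
    derivative \<open>Y\<close>, so they differ by a constant.\<close>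
  obtain c where c: "AE s in lborel. u0 s - w0 s = c"
  proof (rule du_Bois_Reymond[of "\<lambda>s. u0 s - w0 s"])
    show "set_integrable lborel {a..b} (\<lambda>s. u0 s - w0 s)" for a b by (intro set_integral_diff u0i w0i)
    fix \<eta> \<eta>' :: "real \<Rightarrow> real" and a b :: real
    assume ck: "\<And>j. ck_on j UNIV \<eta>" and d: "\<And>s. (\<eta> has_real_derivative \<eta>' s) (at s)" and c': "continuous_on UNIV \<eta>'"
      and s: "\<And>s. s \<notin> {a..b} \<Longrightarrow> \<eta> s = 0" and s': "\<And>s. s \<notin> {a..b} \<Longrightarrow> \<eta>' s = 0"
    have c\<eta>: "continuous_on UNIV \<eta>" using ck[of 0] by simp
    have [measurable]: "\<eta> \<in> borel_measurable borel" "\<eta>' \<in> borel_measurable borel"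
      using c\<eta> c' by (auto intro: borel_measurable_continuous_onI)
    let ?K = "{x::'a. exp a \<le> norm x \<and> norm x \<le> exp b}"
    note K = annulus_compact(1,2)[where 'a='a, of a b]
    obtain \<phi> :: "'a \<Rightarrow> 'a \<Rightarrow> real" where t: "\<And>i. test_function (\<phi> i)" "\<And>i. 0 \<notin> closure {x. \<phi> i x \<noteq> 0}"
      and z: "\<And>i x. x \<notin> ?K \<Longrightarrow> \<phi> i x = 0"
      and f: "\<And>i x. x \<noteq> 0 \<Longrightarrow> \<phi> i x = (x \<bullet> i) * exp (- (?n * ln (norm x))) * \<eta> (ln (norm x))"
      and div: "\<And>x. x \<noteq> 0 \<Longrightarrow> (\<Sum>i\<in>Basis. partial_deriv i (\<phi> i) x) = exp (- (?n * ln (norm x))) * \<eta>' (ln (norm x))"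
      by (rule log_radial_test_field[where 'a='a and a=a and b=b, OF ck d s]; (assumption | rule that; assumption))
    have zp: "partial_deriv i (\<phi> i) x = 0" if "x \<notin> ?K" for i x
    proof -
      have "closure {x. \<phi> i x \<noteq> 0} \<subseteq> ?K"
        using z[of _ i] by (intro closure_minimal compact_imp_closed K(1)) blast
      then have "x \<notin> closure {x. \<phi> i x \<noteq> 0}" using that by blast
      then show ?thesis using test_functionD(4,7)[OF t(1)] by simp
    qed
    have i1: "integrable lborel (\<lambda>x. u x * partial_deriv i (\<phi> i) x)" if "i \<in> Basis" for i
      by (rule integrable_compact_support[OF uK[OF K] test_functionD(2)[OF test_function_partial(1)[OF t(1) that]] K(1) zp])
    have i2: "integrable lborel (\<lambda>x. (V x \<bullet> i) * \<phi> i x)" for i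
      by (rule integrable_compact_support[OF VKb[OF K] test_functionD(2)[OF t(1)] K(1) z])
    have "(\<integral>x. u x * (\<Sum>i\<in>Basis. partial_deriv i (\<phi> i) x) \<partial>lborel) = (\<Sum>i\<in>Basis. \<integral>x. u x * partial_deriv i (\<phi> i) x \<partial>lborel)"
      unfolding sum_distrib_left using i1 by (intro Bochner_Integration.integral_sum) auto
    also have "\<dots> = - (\<Sum>i\<in>Basis. \<integral>x. (V x \<bullet> i) * \<phi> i x \<partial>lborel)"
      using wt[OF t] by (simp add: sum_negf)
    also have "\<dots> = - (\<integral>x. (\<Sum>i\<in>Basis. (V x \<bullet> i) * \<phi> i x) \<partial>lborel)"
      using i2 by (subst Bochner_Integration.integral_sum) auto
    finally have main: "(\<integral>x. u x * (\<Sum>i\<in>Basis. partial_deriv i (\<phi> i) x) \<partial>lborel) = - (\<integral>x. (\<Sum>i\<in>Basis. (V x \<bullet> i) * \<phi> i x) \<partial>lborel)" .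
    let ?\<psi> = "\<lambda>s. exp ((2 - ?n) * s) * \<eta> s"
    have ae1: "AE x in lborel. u x * (\<Sum>i\<in>Basis. partial_deriv i (\<phi> i) x) = u0 (ln (norm x)) * (exp (- (?n * ln (norm x))) * \<eta>' (ln (norm x)))"
      using AE_lborel_singleton[of "0::'a"] by eventually_elim (simp add: u0 div)
    have ae2: "AE x in lborel. (\<Sum>i\<in>Basis. (V x \<bullet> i) * \<phi> i x) = (V x \<bullet> x) / (norm x)\<^sup>2 * ?\<psi> (ln (norm x))"
      using AE_lborel_singleton[of "0::'a"]
    proof eventually_elim
      case (elim x)
      have "(norm x)\<^sup>2 = exp (2 * ln (norm x))" using elim by (simp add: exp_double)
      then have ee: "exp ((2 - ?n) * ln (norm x)) = (norm x)\<^sup>2 * exp (- (?n * ln (norm x)))"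
        by (simp add: exp_add[symmetric] algebra_simps)
      have "(\<Sum>i\<in>Basis. (V x \<bullet> i) * \<phi> i x) = (\<Sum>i\<in>Basis. (V x \<bullet> i) * (x \<bullet> i)) * (exp (- (?n * ln (norm x))) * \<eta> (ln (norm x)))"
        unfolding sum_distrib_right by (intro sum.cong) (simp_all add: f elim)
      also have "(\<Sum>i\<in>Basis. (V x \<bullet> i) * (x \<bullet> i)) = V x \<bullet> x" by (rule euclidean_inner[symmetric])
      finally show ?case unfolding ee using elim by simp
    qed
    have pm: "partial_deriv i (\<phi> i) \<in> borel_measurable borel" if "i \<in> Basis" for i
      by (rule test_function_measurable(1)[OF test_function_partial(1)[OF t(1) that]])
    have \<phi>m[measurable]: "\<phi> i \<in> borel_measurable borel" for i by (rule test_function_measurable(1)[OF t(1)])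
    have m1: "(\<lambda>x. u x * (\<Sum>i\<in>Basis. partial_deriv i (\<phi> i) x)) \<in> borel_measurable lborel"
      by (intro borel_measurable_times borel_measurable_sum) (auto simp: pm)
    have m2: "(\<lambda>x. \<Sum>i\<in>Basis. (V x \<bullet> i) * \<phi> i x) \<in> borel_measurable lborel" by measurable
    have L: "(\<integral>x. u x * (\<Sum>i\<in>Basis. partial_deriv i (\<phi> i) x) \<partial>lborel) = sphere_area TYPE('a) * (\<integral>s. u0 s * \<eta>' s \<partial>lborel)"
    proof -
      have "(\<integral>x. u x * (\<Sum>i\<in>Basis. partial_deriv i (\<phi> i) x) \<partial>lborel)
          = (\<integral>(x::'a). u0 (ln (norm x)) * (exp (- (?n * ln (norm x))) * \<eta>' (ln (norm x))) \<partial>lborel)"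
        by (rule integral_cong_AE[OF m1 _ ae1]) measurable
      also have "\<dots> = sphere_area TYPE('a) * (\<integral>s. exp (?n * s) * (u0 s * (exp (- (?n * s)) * \<eta>' s)) \<partial>lborel)"
        by (rule integral_polar) measurable
      also have "(\<lambda>s. exp (?n * s) * (u0 s * (exp (- (?n * s)) * \<eta>' s))) = (\<lambda>s. u0 s * \<eta>' s)"
        by (auto simp: exp_minus field_simps)
      finally show ?thesis .
    qed
    have int2: "integrable lborel (\<lambda>x. (V x \<bullet> x) / (norm x)\<^sup>2 * ?\<psi> (ln (norm x)))"
    proof -
      have "integrable lborel (\<lambda>x. \<Sum>i\<in>Basis. (V x \<bullet> i) * \<phi> i x)" using i2 by (intro Bochner_Integration.integrable_sum) auto
      then show ?thesis by (subst (asm) integrable_cong_AE[OF m2 _ ae2]) measurable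
    qed
    have R: "(\<integral>x. (\<Sum>i\<in>Basis. (V x \<bullet> i) * \<phi> i x) \<partial>lborel) = sphere_area TYPE('a) * (\<integral>s. Y s * \<eta> s \<partial>lborel)"
    proof -
      have "(\<integral>x. (\<Sum>i\<in>Basis. (V x \<bullet> i) * \<phi> i x) \<partial>lborel) = (\<integral>x. (V x \<bullet> x) / (norm x)\<^sup>2 * ?\<psi> (ln (norm x)) \<partial>lborel)"
        by (rule integral_cong_AE[OF m2 _ ae2]) measurable
      also have "\<dots> = sphere_area TYPE('a) * (\<integral>s. G s * ?\<psi> s \<partial>lborel)" by (rule GV[OF _ int2]) measurable
      finally show ?thesis by (simp add: Y_def mult.assoc)
    qed
    have A: "(\<integral>s. u0 s * \<eta>' s \<partial>lborel) = - (\<integral>s. Y s * \<eta> s \<partial>lborel)"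
    proof -
      have "sphere_area TYPE('a) * (\<integral>s. u0 s * \<eta>' s \<partial>lborel) = sphere_area TYPE('a) * - (\<integral>s. Y s * \<eta> s \<partial>lborel)"
        using main unfolding L R by simp
      moreover have "sphere_area TYPE('a) \<noteq> 0" using sphere_area_pos[where 'a='a] by simp
      ultimately show "(\<integral>s. u0 s * \<eta>' s \<partial>lborel) = - (\<integral>s. Y s * \<eta> s \<partial>lborel)"
        using mult_left_cancel[of "sphere_area TYPE('a)" "\<integral>s. u0 s * \<eta>' s \<partial>lborel" "- (\<integral>s. Y s * \<eta> s \<partial>lborel)"]
        by blast
    qed
    have ki: "integrable lborel (\<lambda>s. g s * \<theta> s)" if "\<And>a b. set_integrable lborel {a..b} g" "continuous_on UNIV \<theta>"
      "\<And>s. s \<notin> {a..b} \<Longrightarrow> \<theta> s = 0" for g \<theta> :: "real \<Rightarrow> real"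
      by (rule integrable_compact_support[OF that(1)[of a b] that(2)]) (use that(3) in auto)
    have B: "(\<integral>s. w0 s * \<eta>' s \<partial>lborel) = - (\<integral>s. Y s * \<eta> s \<partial>lborel)"
    proof -
      define b' where "b' = max a b + 1"
      have Q: "primitive_of \<eta>' \<eta>" by (rule primitive_of_C1[OF d c'])
      have "w0 b' * \<eta> b' - w0 (a - 1) * \<eta> (a - 1) = (LBINT s:{a - 1..b'}. \<eta> s * Y s + w0 s * \<eta>' s)"
        by (rule primitive_ofD(2)[OF primitive_of_mult[OF w0 Q]]) (simp add: b'_def)
      also have "\<dots> = (\<integral>s. \<eta> s * Y s + w0 s * \<eta>' s \<partial>lborel)"
        unfolding set_lebesgue_integral_def
      proof (intro Bochner_Integration.integral_cong refl)
        fix x show "indicat_real {a - 1..b'} x *\<^sub>R (\<eta> x * Y x + w0 x * \<eta>' x) = \<eta> x * Y x + w0 x * \<eta>' x"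
          using s[of x] s'[of x] by (cases "x \<in> {a..b}") (auto simp: b'_def)
      qed
      also have "\<dots> = (\<integral>s. Y s * \<eta> s \<partial>lborel) + (\<integral>s. w0 s * \<eta>' s \<partial>lborel)"
        using ki[OF Yi c\<eta> s] ki[OF w0i c' s'] by (simp add: mult.commute[of "\<eta> _"])
      finally have "w0 b' * \<eta> b' - w0 (a - 1) * \<eta> (a - 1) = (\<integral>s. Y s * \<eta> s \<partial>lborel) + (\<integral>s. w0 s * \<eta>' s \<partial>lborel)" .
      moreover have "\<eta> b' = 0" "\<eta> (a - 1) = 0" by (rule s, force simp: b'_def)+
      ultimately show ?thesis by simp
    qed
    have "(\<integral>x. (u0 x - w0 x) * \<eta>' x \<partial>lborel) = (\<integral>s. u0 s * \<eta>' s \<partial>lborel) - (\<integral>s. w0 s * \<eta>' s \<partial>lborel)"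
      using ki[OF u0i c' s'] ki[OF w0i c' s'] by (simp add: left_diff_distrib)
    then show "(\<integral>x. (u0 x - w0 x) * \<eta>' x \<partial>lborel) = 0" unfolding A B by simp
  qed blast
  define W where "W x = (G (ln (norm x)) * exp (- (?n * ln (norm x)))) *\<^sub>R x" for x :: 'a
  define v where "v x = w0 (ln (norm x)) + c" for x :: 'a
  have vu: "AE x in lborel. u x = v x"
    using AE_polar[OF c, where 'a='a] AE_lborel_singleton[of "0::'a"]
    by eventually_elim (auto simp: u0 v_def)
  have vd: "(v has_derivative (\<lambda>h. W x \<bullet> h)) (at x)" if x: "x \<noteq> 0" for x
  proof -
    have ee: "exp ((2 - ?n) * ln (norm x)) = (norm x)\<^sup>2 * exp (- (?n * ln (norm x)))"
      unfolding norm_sq_eq_exp[OF x] by (simp add: exp_add[symmetric] algebra_simps)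
    have "((\<lambda>x. w0 (ln (norm x)) + c) has_derivative (\<lambda>h. ((Y (ln (norm x)) / (norm x)\<^sup>2) *\<^sub>R x) \<bullet> h)) (at x)"
      using log_radial_has_derivative[OF x w0d] by (auto intro!: derivative_eq_intros)
    moreover have "(Y (ln (norm x)) / (norm x)\<^sup>2) *\<^sub>R x = W x"
      unfolding Y_def W_def ee using x by simp
    ultimately show ?thesis unfolding v_def[abs_def] by simp
  qed
  have cln: "continuous_on (-{0}) (\<lambda>x::'a. ln (norm x))" by (intro continuous_intros) auto
  have Wc: "continuous_on (-{0}) W" unfolding W_def[abs_def]
    by (intro continuous_intros continuous_on_compose2[OF G cln] continuous_on_compose2[OF continuous_on_exp[OF continuous_on_id] ] cln) auto
  have weakW: "(\<integral>x. u x * partial_deriv b \<phi> x \<partial>lborel) = - (\<integral>x. (W x \<bullet> b) * \<phi> x \<partial>lborel)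
     \<and> integrable lborel (\<lambda>x. (W x \<bullet> b) * \<phi> x)"
    if t: "test_function \<phi>" and 0: "0 \<notin> closure {x. \<phi> x \<noteq> 0}" and b: "b \<in> Basis" for \<phi> b
  proof -
    note p = punctured_integration_by_parts[OF vd Wc t 0 b]
    have "(\<integral>x. u x * partial_deriv b \<phi> x \<partial>lborel) = (\<integral>x. v x * partial_deriv b \<phi> x \<partial>lborel)"
    proof (rule integral_cong_AE)
      show "AE x in lborel. u x * partial_deriv b \<phi> x = v x * partial_deriv b \<phi> x" using vu by eventually_elim simp
      show "(\<lambda>x. u x * partial_deriv b \<phi> x) \<in> borel_measurable lborel"
        using test_function_measurable(1)[OF test_function_partial(1)[OF t b]] by (intro borel_measurable_times) auto
      show "(\<lambda>x. v x * partial_deriv b \<phi> x) \<in> borel_measurable lborel" using borel_measurable_integrable[OF p(2)] .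
    qed
    then show ?thesis using p by simp
  qed
  have "AE x in lborel. (V x - W x) \<bullet> b = 0" if b: "b \<in> Basis" for b
  proof (rule fundamental_lemma_punctured)
    fix K :: "'a set" assume K: "compact K" "0 \<notin> K"
    have cWb: "continuous_on K (\<lambda>x. W x \<bullet> b)"
      by (intro continuous_on_inner continuous_on_subset[OF Wc] continuous_on_const) (use K in auto)
    have "set_integrable lborel K (\<lambda>x. W x \<bullet> b)"
      unfolding set_integrable_def by (rule borel_integrable_compact[OF K(1) cWb])
    then show "set_integrable lborel K (\<lambda>x. (V x - W x) \<bullet> b)"
      unfolding inner_diff_left by (intro set_integral_diff VKb K)
  next
    fix \<phi> :: "'a \<Rightarrow> real" assume t: "test_function \<phi>" and 0: "0 \<notin> closure {x. \<phi> x \<noteq> 0}"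
    let ?S = "closure {x. \<phi> x \<noteq> 0}"
    have S: "compact ?S" using t by (simp add: test_function_def)
    have i: "integrable lborel (\<lambda>x. (V x \<bullet> b) * \<phi> x)"
      by (rule integrable_compact_support[OF VKb[OF S 0] test_functionD(2)[OF t] S test_functionD(6)[OF t]])
    show "(\<integral>x. (V x - W x) \<bullet> b * \<phi> x \<partial>lborel) = 0"
      using wt[OF t 0 b] weakW[OF t 0 b] i by (simp add: inner_diff_left left_diff_distrib)
  qed
  then have "AE x in lborel. \<forall>b\<in>Basis. (V x - W x) \<bullet> b = 0" by (intro AE_finite_allI) auto
  then have "AE x in lborel. V x = W x"
  proof eventually_elim
    case (elim x) then show ?case using euclidean_all_zero_iff[of "V x - W x"] by auto
  qed
  then show ?thesis by (simp only: W_def)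
qed

section \<open>Radial fields in the variable \<open>s\<close>, and the inequality for radial
  elements of \<open>H2\<close>\<close>

lemma sgn_abs_powr_sq: "(sgn y * \<bar>y\<bar> powr p)\<^sup>2 = \<bar>y\<bar> powr (2 * p)" for y p :: real
proof -
  have "(\<bar>y\<bar> powr p)\<^sup>2 = \<bar>y\<bar> powr (2 * p)" using powr_half_squared[of "\<bar>y\<bar>" "2 * p"] by simp
  then show ?thesis by (cases "y = 0") (auto simp: power_mult_distrib sgn_if)
qed

text \<open>Radial fields are written as \<open>G(ln |x|) |x|\<^sup>-\<^sup>n x\<close>: then \<open>G\<close> is the flux through the sphere up to
  the constant \<open>sphere_area\<close>, and the divergence is \<open>G'(ln |x|) |x|\<^sup>-\<^sup>n\<close>.\<close>

definition flux_field :: "(real \<Rightarrow> real) \<Rightarrow> 'a::euclidean_space \<Rightarrow> 'a" where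
  "flux_field G x = (G (ln (norm x)) * exp (- (real DIM('a) * ln (norm x)))) *\<^sub>R x"

definition flux_div :: "(real \<Rightarrow> real) \<Rightarrow> 'a::euclidean_space \<Rightarrow> real" where
  "flux_div F x = F (ln (norm x)) * exp (- (real DIM('a) * ln (norm x)))"

lemma flux_measurable [measurable]:
  assumes [measurable]: "G \<in> borel_measurable borel"
  shows "(flux_field G :: 'a::euclidean_space \<Rightarrow> 'a) \<in> borel_measurable borel"
    "(flux_div G :: 'a \<Rightarrow> real) \<in> borel_measurable borel"
  unfolding flux_field_def[abs_def] flux_div_def[abs_def] by measurable

text \<open>The parameter \<open>m\<close> is free: \<open>e^(-2 m s)\<close> is inserted and
  compensated in the exponent. With the \<open>m\<close> of the problem the integrand is expressed
  by \<open>q\<close>, with \<open>m = 0\<close> by \<open>G\<close> itself.\<close>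

lemma grad_int_flux_field:
  fixes V :: "'a::euclidean_space \<Rightarrow> 'a"
  assumes V: "AE x in lborel. V x = flux_field G x" and Gm[measurable]: "G \<in> borel_measurable borel"
  shows "grad_int p a V = ennreal (sphere_area TYPE('a)) *
    (\<integral>\<^sup>+s. ennreal (\<bar>G s * exp (- (2 * m * s))\<bar> powr p * exp ((p * (1 - real DIM('a) + 2 * m) - a + real DIM('a)) * s)) \<partial>lborel)"
proof -
  let ?n = "real DIM('a)"
  let ?h = "\<lambda>s. \<bar>G s\<bar> powr p * exp ((p * (1 - ?n) - a) * s)"
  have "grad_int p a V = (\<integral>\<^sup>+(x::'a). ennreal (?h (ln (norm x))) \<partial>lborel)"
    unfolding grad_int_def
  proof (rule nn_integral_cong_AE, use V AE_lborel_singleton[of "0::'a"] in eventually_elim)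
    case (elim x)
    obtain s where s: "s = ln (norm x)" by blast
    then have nx: "norm x = exp s" using elim by simp
    have "norm (V x) = \<bar>G s\<bar> * (exp (- (?n * s)) * exp s)" using elim s by (simp add: flux_field_def abs_mult)
    also have "exp (- (?n * s)) * exp s = exp ((1 - ?n) * s)" by (simp add: exp_add[symmetric] algebra_simps)
    finally have "norm (V x) powr p = \<bar>G s\<bar> powr p * exp (p * ((1 - ?n) * s))"
      by (simp add: powr_mult powr_def[of "exp _"])
    moreover have "norm x powr a = exp (a * s)" by (simp add: nx powr_def)
    moreover have "exp (p * ((1 - ?n) * s)) / exp (a * s) = exp ((p * (1 - ?n) - a) * s)"
      by (simp add: exp_diff[symmetric] algebra_simps)
    ultimately show ?case unfolding s[symmetric] by (metis times_divide_eq_right)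
  qed
  also have "\<dots> = (\<integral>\<^sup>+s. ennreal (sphere_area TYPE('a) * exp (?n * s)) * ennreal (?h s) \<partial>lborel)"
    by (rule nn_integral_polar) measurable
  also have "\<dots> = (\<integral>\<^sup>+s. ennreal (sphere_area TYPE('a)) * ennreal (\<bar>G s * exp (- (2 * m * s))\<bar> powr p * exp ((p * (1 - ?n + 2 * m) - a + ?n) * s)) \<partial>lborel)"
  proof (rule nn_integral_cong)
    fix s :: real
    have "\<bar>G s * exp (- (2 * m * s))\<bar> powr p * exp ((p * (1 - ?n + 2 * m) - a + ?n) * s)
        = \<bar>G s\<bar> powr p * (exp (p * (- (2 * m * s))) * exp ((p * (1 - ?n + 2 * m) - a + ?n) * s))"
      by (simp add: abs_mult powr_mult powr_def[of "exp _"])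
    also have "exp (p * (- (2 * m * s))) * exp ((p * (1 - ?n + 2 * m) - a + ?n) * s) = exp (?n * s) * exp ((p * (1 - ?n) - a) * s)"
      by (simp add: exp_add[symmetric] algebra_simps)
    finally have e: "\<bar>G s * exp (- (2 * m * s))\<bar> powr p * exp ((p * (1 - ?n + 2 * m) - a + ?n) * s) = exp (?n * s) * ?h s" by simp
    show "ennreal (sphere_area TYPE('a) * exp (?n * s)) * ennreal (?h s) = ennreal (sphere_area TYPE('a)) * ennreal (\<bar>G s * exp (- (2 * m * s))\<bar> powr p * exp ((p * (1 - ?n + 2 * m) - a + ?n) * s))"
      unfolding e using sphere_area_pos[where 'a='a] by (simp add: ennreal_mult'[symmetric] mult_ac)
  qed
  also have "\<dots> = ennreal (sphere_area TYPE('a)) * (\<integral>\<^sup>+s. ennreal (\<bar>G s * exp (- (2 * m * s))\<bar> powr p * exp ((p * (1 - ?n + 2 * m) - a + ?n) * s)) \<partial>lborel)"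
    by (rule nn_integral_cmult) measurable
  finally show ?thesis .
qed

lemma lap_int_flux_div:
  fixes f :: "'a::euclidean_space \<Rightarrow> real"
  assumes f: "AE x in lborel. f x = flux_div F x" and [measurable]: "F \<in> borel_measurable borel"
  shows "lap_int \<alpha> f = ennreal (sphere_area TYPE('a)) * (\<integral>\<^sup>+s. ennreal ((F s)\<^sup>2 * exp (- ((real DIM('a) + 2 * \<alpha>) * s))) \<partial>lborel)"
proof -
  let ?n = "real DIM('a)"
  let ?\<psi> = "\<lambda>s. F s * exp (- (?n * s))"
  have "lap_int \<alpha> f = (\<integral>\<^sup>+(x::'a). ennreal ((?\<psi> (ln (norm x)))\<^sup>2 * norm x powr (- (2 * \<alpha>))) \<partial>lborel)"
    unfolding lap_int_def
    by (rule nn_integral_cong_AE, use f in eventually_elim) (simp add: flux_div_def powr_minus divide_inverse)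
  also have "\<dots> = ennreal (sphere_area TYPE('a)) * (\<integral>\<^sup>+s. ennreal ((?\<psi> s)\<^sup>2 * exp ((?n + - (2 * \<alpha>)) * s)) \<partial>lborel)"
    by (rule nn_integral_radial_weight) measurable
  also have "(\<lambda>s. (?\<psi> s)\<^sup>2 * exp ((?n + - (2 * \<alpha>)) * s)) = (\<lambda>s. (F s)\<^sup>2 * exp (- ((?n + 2 * \<alpha>) * s)))"
  proof
    fix s
    have "(exp (- (?n * s)))\<^sup>2 * exp ((?n + - (2 * \<alpha>)) * s) = exp (- ((?n + 2 * \<alpha>) * s))"
      by (simp add: power2_eq_square exp_add[symmetric] algebra_simps)
    then show "(?\<psi> s)\<^sup>2 * exp ((?n + - (2 * \<alpha>)) * s) = (F s)\<^sup>2 * exp (- ((?n + 2 * \<alpha>) * s))"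
      by (simp add: power_mult_distrib mult.assoc)
  qed
  finally show ?thesis .
qed

text \<open>The exponential is at least 1 on a half-line, whatever the sign of \<open>k\<close>.
  This is what excludes constant fluxes and pure powers of \<open>|x|\<close> from finite
  energy.\<close>

lemma nn_integral_exp_infinite: "(\<integral>\<^sup>+s. ennreal (exp (k * s)) \<partial>lborel) = \<infinity>" for k :: real
proof -
  have half: "(\<integral>\<^sup>+s. ennreal (1 :: real) * indicator {c..} s \<partial>lborel) = \<infinity>" for c :: real
  proof -
    have "ennreal (real N) \<le> emeasure lborel {c..}" for N :: nat
    proof -
      have "ennreal (real N) = emeasure lborel {c..c + real N}" by simp
      also have "\<dots> \<le> emeasure lborel {c..}" by (rule emeasure_mono) auto
      finally show ?thesis .
    qed
    then have "emeasure lborel {c..} = \<infinity>"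
      using ennreal_Ex_less_of_nat[of "emeasure lborel {c..}"]
      by (metis ennreal_of_nat_eq_real_of_nat infinity_ennreal_def less_top not_less)
    then show ?thesis by simp
  qed
  show ?thesis
  proof (cases "k \<ge> 0")
    case True
    have "\<infinity> = (\<integral>\<^sup>+s. ennreal (1::real) * indicator {0..} s \<partial>(lborel :: real measure))" by (rule half[symmetric])
    also have "\<dots> \<le> (\<integral>\<^sup>+s. ennreal (exp (k * s)) \<partial>lborel)"
      using True by (intro nn_integral_mono) (auto simp: indicator_def intro: ennreal_leI)
    finally show ?thesis by (simp add: top.extremum_unique)
  next
    case False
    have "\<infinity> = (\<integral>\<^sup>+s. ennreal (1::real) * indicator {0..} s \<partial>(lborel :: real measure))" by (rule half[symmetric])
    also have "\<dots> \<le> (\<integral>\<^sup>+s. ennreal (exp (- (k * s))) \<partial>lborel)"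
      using False by (intro nn_integral_mono) (auto simp: indicator_def mult_nonpos_nonneg intro!: ennreal_leI)
    also have "\<dots> = (\<integral>\<^sup>+s. ennreal (exp (k * s)) \<partial>lborel)"
      by (subst nn_integral_real_affine[where c="-1" and t=0]) auto
    finally show ?thesis by (simp add: top.extremum_unique)
  qed
qed

lemma H2_flux_profile:
  fixes u f :: "'a::euclidean_space \<Rightarrow> real"
  assumes rad: "radial u" and H: "H2 \<alpha> \<beta> u V f" and \<alpha>: "real DIM('a) - 2 * \<alpha> > 0" and \<beta>: "real DIM('a) - \<beta> > 0"
  defines "m \<equiv> (real DIM('a) + 2 * \<alpha>) / 2"
  obtains F G :: "real \<Rightarrow> real" and C where "primitive_of F G" "F \<in> borel_measurable borel"
    "integrable lborel (\<lambda>s. (F s)\<^sup>2 * exp (- (2 * m * s)))"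
    "ennreal (sphere_area TYPE('a) * (\<integral>s. (F s)\<^sup>2 * exp (- (2 * m * s)) \<partial>lborel)) \<le> lap_int \<alpha> f"
    "lap_int \<alpha> f \<le> ennreal (sphere_area TYPE('a) * (\<integral>s. (F s)\<^sup>2 * exp (- (2 * m * s)) \<partial>lborel)) \<Longrightarrow>
      AE x in lborel. f x = flux_div F x"
    "m > 0 \<Longrightarrow> ((\<lambda>s. (G s)\<^sup>2 * exp (- (2 * m * s))) \<longlongrightarrow> 0) at_bot"
    "m < 0 \<Longrightarrow> ((\<lambda>s. (G s)\<^sup>2 * exp (- (2 * m * s))) \<longlongrightarrow> 0) at_top"
    "\<And>s. (G s)\<^sup>2 * exp (- (2 * m * s)) \<le> C * (1 + \<bar>s\<bar>)"
    "AE x in lborel. V x = flux_field G x"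
proof -
  have m: "u \<in> borel_measurable borel" "V \<in> borel_measurable borel" and wg: "weak_gradient u V"
    using H by (auto simp: H2_def)
  show ?thesis
  proof (rule H2_radial_profile[OF H \<alpha> \<beta>, folded m_def], goal_cases)
    case (1 F G C)
    have "AE x in lborel. V x = flux_field G x" unfolding flux_field_def
      by (rule H2_radial_gradient[OF rad m wg primitive_of_continuous[OF 1(1)] 1(9)])
    then show ?case using 1(5) by (intro that[OF 1(1-4) _ 1(6-8)]) (simp_all only: flux_div_def)
  qed
qed

lemma grad_int_zero_field: "AE x in lborel. V x = 0 \<Longrightarrow> grad_int p a V = 0"
proof -
  assume "AE x in lborel. V x = 0"
  then have "grad_int p a V = (\<integral>\<^sup>+(x::'a). 0 \<partial>lborel)" unfolding grad_int_def
    by (intro nn_integral_cong_AE) (auto elim!: eventually_mono)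
  then show ?thesis by simp
qed

text \<open>The flux has derivative 0, hence is constant, and the energy of the gradient is then the
  integral of a pure exponential, infinite unless the constant is 0. This settles the case in which
  the product of the integrals could be \<open>0 * \<infinity> = 0\<close>.\<close>

lemma H2_lap_zero:
  fixes u f :: "'a::euclidean_space \<Rightarrow> real"
  assumes rad: "radial u" and H: "H2 \<alpha> \<beta> u V f" and \<alpha>: "real DIM('a) - 2 * \<alpha> > 0" and \<beta>: "real DIM('a) - \<beta> > 0"
    and z: "lap_int \<alpha> f = 0"
  shows "AE x in lborel. V x = 0"
proof -
  define m where "m = (real DIM('a) + 2 * \<alpha>) / 2"
  obtain F G where P: "primitive_of F G" and [measurable]: "F \<in> borel_measurable borel"
    and i: "integrable lborel (\<lambda>s. (F s)\<^sup>2 * exp (- (2 * m * s)))"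
    and le: "ennreal (sphere_area TYPE('a) * (\<integral>s. (F s)\<^sup>2 * exp (- (2 * m * s)) \<partial>lborel)) \<le> lap_int \<alpha> f"
    and V: "AE x in lborel. V x = flux_field G x"
    unfolding m_def by (rule H2_flux_profile[OF rad H \<alpha> \<beta>]) blast
  have cG: "continuous_on UNIV G" by (rule primitive_of_continuous[OF P])
  have Gm: "G \<in> borel_measurable borel" by (rule borel_measurable_continuous_onI[OF cG])
  have "sphere_area TYPE('a) * (\<integral>s. (F s)\<^sup>2 * exp (- (2 * m * s)) \<partial>lborel) \<le> 0" using le z by (simp add: ennreal_eq_0_iff)
  then have "(\<integral>s. (F s)\<^sup>2 * exp (- (2 * m * s)) \<partial>lborel) \<le> 0"
    using sphere_area_pos[where 'a='a] by (simp add: mult_le_0_iff)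
  moreover have "0 \<le> (\<integral>s. (F s)\<^sup>2 * exp (- (2 * m * s)) \<partial>lborel)" by (intro integral_nonneg_AE AE_I2) auto
  ultimately have "(\<integral>s. (F s)\<^sup>2 * exp (- (2 * m * s)) \<partial>lborel) = 0" by linarith
  then have "AE s in lborel. (F s)\<^sup>2 * exp (- (2 * m * s)) = 0"
    using integral_nonneg_eq_0_iff_AE[OF i] by simp
  then have F0: "AE s in lborel. F s = 0" by eventually_elim simp
  have G0: "G s = G 0" for s
  proof -
    have z: "(LBINT s:{a..b}. F s) = 0" for a b
      unfolding set_lebesgue_integral_def by (rule integral_eq_zero_AE, use F0 in eventually_elim) simp
    show ?thesis using primitive_ofD(2)[OF P, of 0 s] primitive_ofD(2)[OF P, of s 0] z by (cases "0 \<le> s") auto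
  qed
  have fin: "grad_int 2 \<beta> V < \<infinity>" by (rule H2E[OF H \<alpha> \<beta>]) blast
  have "G 0 = 0"
  proof (rule ccontr)
    assume g: "G 0 \<noteq> 0"
    let ?k = "2 * (1 - real DIM('a) + 2 * 0) - \<beta> + real DIM('a)"
    have "grad_int 2 \<beta> V = ennreal (sphere_area TYPE('a)) *
      (\<integral>\<^sup>+s. ennreal (\<bar>G s * exp (- (2 * 0 * s))\<bar> powr 2 * exp (?k * s)) \<partial>lborel)"
      by (rule grad_int_flux_field[OF V Gm])
    also have "(\<integral>\<^sup>+s. ennreal (\<bar>G s * exp (- (2 * 0 * s))\<bar> powr 2 * exp (?k * s)) \<partial>lborel)
        = (\<integral>\<^sup>+s. ennreal (\<bar>G 0\<bar> powr 2) * ennreal (exp (?k * s)) \<partial>lborel)"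
      by (intro nn_integral_cong) (subst G0, simp add: ennreal_mult'[symmetric])
    also have "\<dots> = \<infinity>" using g by (simp add: nn_integral_cmult nn_integral_exp_infinite ennreal_mult_eq_top_iff)
    finally show False using fin sphere_area_pos[where 'a='a] by (simp add: ennreal_mult_eq_top_iff)
  qed
  then have "flux_field G x = 0" for x :: 'a using G0 by (simp add: flux_field_def)
  with V show ?thesis by simp
qed

text \<open>\<open>one_dim_estimate\<close>, expressed by integrals over the space. The value of
  \<open>L\<close> is the one for which the exponents of the two gradient integrals become those of
  \<open>Y\<close> and \<open>h\<close>, as \<open>e1\<close> and \<open>e2\<close> record. The last
  conclusion singles out the trivial profile, so that later one may divide by
  \<open>B\<close>.\<close>

lemma H2_radial_estimate:
  fixes u f :: "'a::euclidean_space \<Rightarrow> real"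
  assumes rad: "radial u" and H: "H2 \<alpha> \<beta> u V f" and \<alpha>: "real DIM('a) - 2 * \<alpha> > 0" and \<beta>: "real DIM('a) - \<beta> > 0"
    and t: "t \<ge> 2" and L0: "L \<noteq> 0" and L: "L = real DIM('a) - (1 + \<alpha> + \<beta> / 2) + t * (1 + 2 * \<alpha>)"
    and fin: "grad_int (2 * (t - 1)) \<beta> V < \<infinity>"
  defines "m \<equiv> (real DIM('a) + 2 * \<alpha>) / 2"
  defines "\<omega> \<equiv> sphere_area TYPE('a)"
  obtains F G :: "real \<Rightarrow> real" and I0 B D :: real where "primitive_of F G" "F \<in> borel_measurable borel"
    "AE x in lborel. V x = flux_field G x"
    "ennreal (\<omega> * I0) \<le> lap_int \<alpha> f" "lap_int \<alpha> f \<le> ennreal (\<omega> * I0) \<Longrightarrow> AE x in lborel. f x = flux_div F x"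
    "grad_int (2 * (t - 1)) \<beta> V = ennreal (\<omega> * B)" "grad_int t (1 + \<alpha> + \<beta> / 2) V = ennreal (\<omega> * D)"
    "0 \<le> I0" "0 \<le> B" "0 \<le> D"
    "\<And>\<tau>. 0 \<le> I0 - 2 * \<tau> * (L / t) * D + \<tau>\<^sup>2 * B"
    "\<And>\<tau>. (\<integral>\<^sup>+s. ennreal (((F s - 2 * m * G s) * exp (- (m * s)) + \<tau> * (sgn (G s * exp (- (2 * m * s))) *
        \<bar>G s * exp (- (2 * m * s))\<bar> powr (t - 1) * exp ((L - m) * s)))\<^sup>2) \<partial>lborel)
      \<le> ennreal (I0 - 2 * \<tau> * (L / t) * D + \<tau>\<^sup>2 * B)"
    "B = 0 \<or> D = 0 \<Longrightarrow> G = (\<lambda>s. 0)"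
proof -
  let ?n = "real DIM('a)"
  have \<omega>: "\<omega> > 0" by (simp add: \<omega>_def sphere_area_pos)
  show ?thesis
  proof (rule H2_flux_profile[OF rad H \<alpha> \<beta>, folded m_def \<omega>_def], goal_cases)
    case (1 F G C)
    note P = 1(1) and Fm = 1(2) and V = 1(9)
    have cG: "continuous_on UNIV G" by (rule primitive_of_continuous[OF P])
    have Gm[measurable]: "G \<in> borel_measurable borel" by (rule borel_measurable_continuous_onI[OF cG])
    define q where "q s = G s * exp (- (2 * m * s))" for s
    define Y where "Y s = sgn (q s) * \<bar>q s\<bar> powr (t - 1) * exp ((L - m) * s)" for s
    define h where "h s = \<bar>q s\<bar> powr t * exp (L * s)" for s
    have qm[measurable]: "q \<in> borel_measurable borel" unfolding q_def[abs_def] by measurable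
    have Ym[measurable]: "Y \<in> borel_measurable borel" unfolding Y_def[abs_def] by measurable
    have Y2: "(Y s)\<^sup>2 = \<bar>q s\<bar> powr (2 * (t - 1)) * exp (2 * (L - m) * s)" for s
    proof -
      have "(exp ((L - m) * s))\<^sup>2 = exp (2 * (L - m) * s)" by (simp add: power2_eq_square exp_add[symmetric] algebra_simps)
      then show ?thesis by (simp add: Y_def power_mult_distrib[of "_ * _"] sgn_abs_powr_sq)
    qed
    have e1: "2 * (t - 1) * (1 - ?n + 2 * m) - \<beta> + ?n = 2 * (L - m)" unfolding L m_def by (simp add: field_simps)
    have e2: "t * (1 - ?n + 2 * m) - (1 + \<alpha> + \<beta> / 2) + ?n = L" unfolding L m_def by (simp add: field_simps)
    have gB: "grad_int (2 * (t - 1)) \<beta> V = ennreal \<omega> * (\<integral>\<^sup>+s. ennreal ((Y s)\<^sup>2) \<partial>lborel)"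
      unfolding grad_int_flux_field[OF V Gm, of _ _ m] e1 \<omega>_def Y2 q_def ..
    have gD: "grad_int t (1 + \<alpha> + \<beta> / 2) V = ennreal \<omega> * (\<integral>\<^sup>+s. ennreal (h s) \<partial>lborel)"
      unfolding grad_int_flux_field[OF V Gm, of _ _ m] e2 \<omega>_def h_def q_def ..
    have "(\<integral>\<^sup>+s. ennreal ((Y s)\<^sup>2) \<partial>lborel) < \<infinity>"
      using fin \<omega> unfolding gB by (auto simp: ennreal_mult_less_top)
    then have IY: "integrable lborel (\<lambda>s. (Y s)\<^sup>2)" by (subst integrable_iff_bounded) simp
    note est = one_dim_estimate[OF t L0 P Fm 1(3) 1(6-8), folded q_def, folded Y_def h_def, OF _ _ IY]
    have hint: "integrable lborel h" unfolding h_def[abs_def]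
      by (rule est(1)[unfolded h_def]) auto
    define I0 where "I0 = (\<integral>s. (F s)\<^sup>2 * exp (- (2 * m * s)) \<partial>lborel)"
    define B where "B = (\<integral>s. (Y s)\<^sup>2 \<partial>lborel)"
    define D where "D = (\<integral>s. h s \<partial>lborel)"
    have nn: "0 \<le> I0" "0 \<le> B" "0 \<le> D" unfolding I0_def B_def D_def
      by (auto intro!: integral_nonneg_AE AE_I2 simp: h_def)
    have nB: "(\<integral>\<^sup>+s. ennreal ((Y s)\<^sup>2) \<partial>lborel) = ennreal B"
      unfolding B_def by (intro nn_integral_eq_integral IY AE_I2) simp
    have nD: "(\<integral>\<^sup>+s. ennreal (h s) \<partial>lborel) = ennreal D"
      unfolding D_def by (intro nn_integral_eq_integral hint AE_I2) (simp add: h_def)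
    have zero: "G = (\<lambda>s. 0)" if "B = 0 \<or> D = 0"
    proof -
      have "AE s in lborel. G s = 0"
      proof (cases "B = 0")
        case True
        then have "AE s in lborel. (Y s)\<^sup>2 = 0" using integral_nonneg_eq_0_iff_AE[OF IY] by (simp add: B_def)
        then show ?thesis by eventually_elim (auto simp: Y_def q_def sgn_zero_iff)
      next
        case False
        have "AE s in lborel. 0 \<le> h s" by (simp add: h_def)
        then have "AE s in lborel. h s = 0" using integral_nonneg_eq_0_iff_AE[OF hint] that False unfolding D_def by blast
        then show ?thesis by eventually_elim (auto simp: h_def q_def)
      qed
      \<comment> \<open>The zero set of the continuous \<open>G\<close> is closed and of full
        measure, hence the whole line.\<close>
      then have "AE s in lebesgue. G s = 0" by (rule AE_completion)
      then have "G s = 0" for s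
        using continuous_on_subset[OF cG] mem_closed_if_AE_lebesgue_open[of UNIV "{s. G s = 0}" s]
          closed_Collect_eq[OF cG continuous_on_const[of UNIV 0]] by simp
      then show ?thesis by blast
    qed
    show ?case
    proof (rule that[of F G I0 B D])
      show "primitive_of F G" "F \<in> borel_measurable borel" "AE x in lborel. V x = flux_field G x" by fact+
      show "ennreal (\<omega> * I0) \<le> lap_int \<alpha> f" using 1(4) unfolding I0_def .
      show "lap_int \<alpha> f \<le> ennreal (\<omega> * I0) \<Longrightarrow> AE x in lborel. f x = flux_div F x" using 1(5) unfolding I0_def .
      show "grad_int (2 * (t - 1)) \<beta> V = ennreal (\<omega> * B)" unfolding gB nB using \<omega> nn by (simp add: ennreal_mult)
      show "grad_int t (1 + \<alpha> + \<beta> / 2) V = ennreal (\<omega> * D)" unfolding gD nD using \<omega> nn by (simp add: ennreal_mult)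
      show "0 \<le> I0" "0 \<le> B" "0 \<le> D" by (fact nn)+
      show "0 \<le> I0 - 2 * \<tau> * (L / t) * D + \<tau>\<^sup>2 * B" for \<tau>
        unfolding I0_def B_def D_def by (rule est(3)) auto
      show "(\<integral>\<^sup>+s. ennreal (((F s - 2 * m * G s) * exp (- (m * s)) + \<tau> * (sgn (G s * exp (- (2 * m * s))) *
        \<bar>G s * exp (- (2 * m * s))\<bar> powr (t - 1) * exp ((L - m) * s)))\<^sup>2) \<partial>lborel)
        \<le> ennreal (I0 - 2 * \<tau> * (L / t) * D + \<tau>\<^sup>2 * B)" for \<tau>
        unfolding I0_def B_def D_def q_def[symmetric] Y_def[symmetric] by (rule est(2)) auto
      show "B = 0 \<or> D = 0 \<Longrightarrow> G = (\<lambda>s. 0)" by (rule zero)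
    qed
  qed
qed

text \<open>The convention \<open>0 * \<infinity> = 0\<close> forces the case distinction: if
  \<open>lap_int\<close> is 0, the gradient vanishes by \<open>H2_lap_zero\<close>, and otherwise an
  infinite gradient integral makes the right-hand side infinite. In the remaining case the
  discriminant in \<open>\<tau>\<close> gives the inequality for the averages, and replacing
  \<open>?\<omega> * I0\<close> by \<open>lap_int\<close> only enlarges the right-hand side.\<close>

lemma radial_inequality:
  fixes u f :: "'a::euclidean_space \<Rightarrow> real"
  assumes rad: "radial u" and H: "H2 \<alpha> \<beta> u V f" and \<alpha>: "real DIM('a) - 2 * \<alpha> > 0" and \<beta>: "real DIM('a) - \<beta> > 0"
    and t: "t \<ge> 2" and L: "L = real DIM('a) - (1 + \<alpha> + \<beta> / 2) + t * (1 + 2 * \<alpha>)"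
  shows "ennreal ((L / t)\<^sup>2) * (grad_int t (1 + \<alpha> + \<beta> / 2) V)\<^sup>2 \<le> lap_int \<alpha> f * grad_int (2 * (t - 1)) \<beta> V"
proof -
  consider "L = 0" | "lap_int \<alpha> f = 0" | "L \<noteq> 0" "lap_int \<alpha> f \<noteq> 0" "grad_int (2 * (t - 1)) \<beta> V = \<infinity>"
    | "L \<noteq> 0" "grad_int (2 * (t - 1)) \<beta> V < \<infinity>"
    by (metis infinity_ennreal_def top.not_eq_extremum)
  then show ?thesis
  proof cases
    case 2
    from grad_int_zero_field[OF H2_lap_zero[OF rad H \<alpha> \<beta> 2]] show ?thesis by simp
  next
    case 3 then show ?thesis by (simp add: ennreal_mult_top)
  next
    case 4
    let ?\<omega> = "sphere_area TYPE('a)"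
    have \<omega>: "?\<omega> > 0" by (rule sphere_area_pos)
    show ?thesis
    proof (rule H2_radial_estimate[OF rad H \<alpha> \<beta> t 4(1) L 4(2)], goal_cases)
      case (1 F G I0 B D)
      have "((L / t) * D)\<^sup>2 = (- ((L / t) * D))\<^sup>2" by (rule power2_minus[symmetric])
      also have "\<dots> \<le> I0 * B"
        using 1(11) 1(9) by (intro quadratic_nonneg_imp) (auto simp: mult_ac)
      finally have "?\<omega>\<^sup>2 * ((L / t) * D)\<^sup>2 \<le> ?\<omega>\<^sup>2 * (I0 * B)" by (rule mult_left_mono) simp
      then have le: "(L / t)\<^sup>2 * (?\<omega> * D)\<^sup>2 \<le> (?\<omega> * I0) * (?\<omega> * B)"
        by (simp add: power_mult_distrib power2_eq_square mult_ac)
      have "ennreal ((L / t)\<^sup>2) * (grad_int t (1 + \<alpha> + \<beta> / 2) V)\<^sup>2 = ennreal ((L / t)\<^sup>2 * (?\<omega> * D)\<^sup>2)"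
      proof -
        have e: "(ennreal (?\<omega> * D))\<^sup>2 = ennreal ((?\<omega> * D)\<^sup>2)" using \<omega> 1(10) by (intro ennreal_power) auto
        show ?thesis unfolding 1(7) e by (simp add: ennreal_mult[symmetric])
      qed
      also have "\<dots> \<le> ennreal ((?\<omega> * I0) * (?\<omega> * B))" by (rule ennreal_leI[OF le])
      also have "\<dots> = ennreal (?\<omega> * I0) * ennreal (?\<omega> * B)" using \<omega> 1(8,9) by (intro ennreal_mult) auto
      also have "\<dots> \<le> lap_int \<alpha> f * grad_int (2 * (t - 1)) \<beta> V" unfolding 1(6) by (intro mult_right_mono 1(4)) simp
      finally show ?case .
    qed
  qed simp
qed

lemma primitive_of_cong_AE:
  assumes P: "primitive_of F G" and ae: "AE s in lborel. F s = K s" and [measurable]: "F \<in> borel_measurable borel" "K \<in> borel_measurable borel"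
  shows "primitive_of K G"
  unfolding primitive_of_def
proof (intro conjI allI impI)
  have c: "AE s in lborel. indicat_real {a..b} s *\<^sub>R F s = indicat_real {a..b} s *\<^sub>R K s" for a b
    using ae by eventually_elim simp
  show "set_integrable lborel {a..b} K" for a b
    using primitive_ofD(1)[OF P, of a b] integrable_cong_AE[OF _ _ c[of a b]] unfolding set_integrable_def by simp
  fix a b :: real assume "a \<le> b"
  have "(LBINT s:{a..b}. F s) = (LBINT s:{a..b}. K s)"
    unfolding set_lebesgue_integral_def by (rule integral_cong_AE[OF _ _ c]) auto
  then show "G b - G a = (LBINT s:{a..b}. K s)" using primitive_ofD(2)[OF P \<open>a \<le> b\<close>] by simp
qed

text \<open>Away from the trivial case, equality forces the integral of \<open>(X + \<tau> Y)\<^sup>2\<close> to vanish for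
  \<open>\<tau> = (L / t) D / B\<close>; this is a first order differential equation for \<open>q = G e\<^sup>-\<^sup>2\<^sup>m\<^sup>s\<close>.\<close>

lemma radial_equality:
  fixes u f :: "'a::euclidean_space \<Rightarrow> real"
  assumes rad: "radial u" and H: "H2 \<alpha> \<beta> u V f" and \<alpha>: "real DIM('a) - 2 * \<alpha> > 0" and \<beta>: "real DIM('a) - \<beta> > 0"
    and t: "t \<ge> 2" and L: "L = real DIM('a) - (1 + \<alpha> + \<beta> / 2) + t * (1 + 2 * \<alpha>)" and L0: "L > 0"
    and fin: "lap_int \<alpha> f * grad_int (2 * (t - 1)) \<beta> V < \<infinity>"
    and eq: "lap_int \<alpha> f * grad_int (2 * (t - 1)) \<beta> V = ennreal ((L / t)\<^sup>2) * (grad_int t (1 + \<alpha> + \<beta> / 2) V)\<^sup>2"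
    and V0: "\<not> (AE x in lborel. V x = 0)"
  defines "m \<equiv> (real DIM('a) + 2 * \<alpha>) / 2"
  obtains \<tau> q F G :: "_" where "\<tau> > 0" "AE x in lborel. V x = flux_field G x" "AE x in lborel. f x = flux_div F x"
    "\<And>s. G s = q s * exp (2 * m * s)" "\<And>s. (G has_real_derivative F s) (at s)"
    "\<And>s. (q has_real_derivative - \<tau> * (sgn (q s) * \<bar>q s\<bar> powr (t - 1)) * exp ((L - 2 * m) * s)) (at s)"
    "q \<noteq> (\<lambda>s. 0)" "grad_int (2 * (t - 1)) \<beta> V < \<infinity>"
proof -
  let ?\<omega> = "sphere_area TYPE('a)"
  have \<omega>: "?\<omega> > 0" by (rule sphere_area_pos)
  have lap0: "lap_int \<alpha> f \<noteq> 0" using H2_lap_zero[OF rad H \<alpha> \<beta>] V0 by blast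
  have lapf: "lap_int \<alpha> f < \<infinity>" by (rule H2E[OF H \<alpha> \<beta>]) blast
  have gf: "grad_int (2 * (t - 1)) \<beta> V < \<infinity>"
    using fin lap0 by (auto simp: ennreal_mult_less_top less_top[symmetric] ennreal_mult_top)
  have Ln: "L \<noteq> 0" using L0 by simp
  show ?thesis
  proof (rule H2_radial_estimate[OF rad H \<alpha> \<beta> t Ln L gf, folded m_def], goal_cases)
    case (1 F G I0 B D)
    note P = 1(1) and Fm[measurable] = 1(2) and V = 1(3)
    have cG: "continuous_on UNIV G" by (rule primitive_of_continuous[OF P])
    have [measurable]: "G \<in> borel_measurable borel" by (rule borel_measurable_continuous_onI[OF cG])
    have Gn: "G \<noteq> (\<lambda>s. 0)"
    proof
      assume "G = (\<lambda>s. 0)"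
      then have "flux_field G x = 0" for x :: 'a by (simp add: flux_field_def)
      then show False using V V0 by simp
    qed
    then have BD: "B > 0" "D > 0" using 1(13) 1(9,10) by (auto simp: less_le)
    define a where "a = enn2real (lap_int \<alpha> f)"
    have a: "lap_int \<alpha> f = ennreal a" "a \<ge> 0" using lapf by (auto simp: a_def)
    have "a * (?\<omega> * B) = (L / t)\<^sup>2 * (?\<omega> * D)\<^sup>2"
    proof -
      have "ennreal (a * (?\<omega> * B)) = ennreal ((L / t)\<^sup>2 * (?\<omega> * D)\<^sup>2)"
      proof -
        have e: "(ennreal (?\<omega> * D))\<^sup>2 = ennreal ((?\<omega> * D)\<^sup>2)" using \<omega> 1(10) by (intro ennreal_power) auto
        show ?thesis using eq unfolding a(1) 1(6,7) e using \<omega> 1(9,10) a(2) by (simp add: ennreal_mult[symmetric])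
      qed
      then show ?thesis using \<omega> 1(9,10) a(2) by (subst (asm) ennreal_inj) auto
    qed
    then have "?\<omega> * (a * B) = ?\<omega> * (?\<omega> * ((L / t) * D)\<^sup>2)" by (simp add: power_mult_distrib power2_eq_square mult_ac)
    then have aB: "a * B = ?\<omega> * ((L / t) * D)\<^sup>2" using \<omega> mult_left_cancel[of ?\<omega>] by simp
    \<comment> \<open>The chain from the discriminant through \<open>?\<omega> * I0 \<le> a\<close>
      closes up with the equality \<open>aB\<close>. So averaging has lost nothing, and
      \<open>f\<close> is radial.\<close>
    have "(- ((L / t) * D))\<^sup>2 \<le> I0 * B" using 1(11) 1(9) by (intro quadratic_nonneg_imp) (auto simp: mult_ac)
    then have q1: "((L / t) * D)\<^sup>2 \<le> I0 * B" by simp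
    have oI: "?\<omega> * I0 \<le> a" using 1(4) \<omega> 1(8) a by simp
    have "a * B \<le> (?\<omega> * I0) * B" unfolding aB mult.assoc using q1 \<omega> by (intro mult_left_mono) auto
    then have aI: "a \<le> ?\<omega> * I0" using BD by simp
    then have f: "AE x in lborel. f x = flux_div F x" using 1(5) a by (simp add: ennreal_leI)
    \<comment> \<open>The minimiser of the quadratic in \<open>\<tau>\<close>, whose minimum is 0 in
      the case of equality.\<close>
    define \<tau> where "\<tau> = (L / t) * D / B"
    have \<tau>: "\<tau> > 0" unfolding \<tau>_def using BD L0 t by auto
    have "?\<omega> * (I0 * B) \<le> ?\<omega> * ((L / t) * D)\<^sup>2" using oI BD(1) mult_right_mono[OF oI, of B] unfolding aB[symmetric] by (simp add: mult.assoc)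
    then have q2: "I0 * B \<le> ((L / t) * D)\<^sup>2" using \<omega> by simp
    have "I0 - 2 * \<tau> * (L / t) * D + \<tau>\<^sup>2 * B = I0 - ((L / t) * D)\<^sup>2 / B"
      using BD by (simp add: \<tau>_def power2_eq_square field_simps)
    also have "\<dots> \<le> 0"
    proof -
      have "I0 \<le> ((L / t) * D)\<^sup>2 / B" using q2 BD(1) by (subst pos_le_divide_eq) auto
      then show ?thesis by simp
    qed
    finally have le0: "I0 - 2 * \<tau> * (L / t) * D + \<tau>\<^sup>2 * B \<le> 0" .
    define q where "q s = G s * exp (- (2 * m * s))" for s
    define Y where "Y s = sgn (q s) * \<bar>q s\<bar> powr (t - 1) * exp ((L - m) * s)" for s
    have cq: "continuous_on UNIV q" unfolding q_def[abs_def] by (intro continuous_intros cG)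
    have "continuous_on UNIV (\<lambda>s. sgn (q s) * \<bar>q s\<bar> powr (t - 1))"
      using continuous_on_compose2[OF continuous_sgn_abs_powr[of "t - 1"] cq] t by simp
    then have cY: "continuous_on UNIV Y" unfolding Y_def[abs_def]
      by (rule continuous_on_mult) (intro continuous_intros)
    have [measurable]: "q \<in> borel_measurable borel" "Y \<in> borel_measurable borel"
      using cq cY by (auto intro: borel_measurable_continuous_onI)
    have "(\<integral>\<^sup>+s. ennreal (((F s - 2 * m * G s) * exp (- (m * s)) + \<tau> * Y s)\<^sup>2) \<partial>lborel) \<le> 0"
      using 1(12)[of \<tau>] le0 unfolding q_def[symmetric] Y_def[symmetric] by (simp add: ennreal_neg)
    then have "(\<integral>\<^sup>+s. ennreal (((F s - 2 * m * G s) * exp (- (m * s)) + \<tau> * Y s)\<^sup>2) \<partial>lborel) = 0" by simp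
    then have "AE s in lborel. ennreal (((F s - 2 * m * G s) * exp (- (m * s)) + \<tau> * Y s)\<^sup>2) = 0"
      by (subst (asm) nn_integral_0_iff_AE) auto
    then have Fae: "AE s in lborel. F s = 2 * m * G s - \<tau> * Y s * exp (m * s)"
    proof eventually_elim
      case (elim s)
      then have "(F s - 2 * m * G s) * exp (- (m * s)) + \<tau> * Y s = 0" by (simp add: ennreal_eq_0_iff)
      then have "((F s - 2 * m * G s) * exp (- (m * s)) + \<tau> * Y s) * exp (m * s) = 0" by simp
      then have "(F s - 2 * m * G s) * (exp (- (m * s)) * exp (m * s)) + \<tau> * Y s * exp (m * s) = 0"
        by (simp add: distrib_right mult.assoc)
      then show ?case by (simp add: exp_add[symmetric])
    qed
    \<comment> \<open>A continuous representative of \<open>F\<close>. With it \<open>G\<close> is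
      continuously differentiable, and the equation, so far known almost everywhere, holds at every
      point.\<close>
    define K where "K s = 2 * m * G s - \<tau> * Y s * exp (m * s)" for s
    have cK: "continuous_on UNIV K" unfolding K_def[abs_def] by (intro continuous_intros cG cY)
    have Km: "K \<in> borel_measurable borel" by (rule borel_measurable_continuous_onI[OF cK])
    have FK: "AE s in lborel. F s = K s" using Fae by (simp only: K_def)
    have PK: "primitive_of K G" by (rule primitive_of_cong_AE[OF P FK Fm Km])
    have Gd: "(G has_real_derivative K s) (at s)" for s by (rule primitive_of_imp_DERIV[OF PK cK])
    have fK: "AE x in lborel. f x = flux_div K x"
      using f AE_polar[OF FK, where 'a='a] by eventually_elim (simp add: flux_div_def)
    have qd: "(q has_real_derivative - \<tau> * (sgn (q s) * \<bar>q s\<bar> powr (t - 1)) * exp ((L - 2 * m) * s)) (at s)" for s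
    proof -
      have e: "exp ((L - m) * s) * exp (m * s) * exp (- (2 * m * s)) = exp ((L - 2 * m) * s)"
        by (simp add: exp_add[symmetric] algebra_simps)
      have "(q has_real_derivative K s * exp (- (2 * m * s)) + exp (- (2 * m * s)) * (- (2 * m)) * G s) (at s)"
        unfolding q_def[abs_def] by (auto intro!: derivative_eq_intros Gd)
      also have "K s * exp (- (2 * m * s)) + exp (- (2 * m * s)) * (- (2 * m)) * G s
          = - \<tau> * (sgn (q s) * \<bar>q s\<bar> powr (t - 1)) * (exp ((L - m) * s) * exp (m * s) * exp (- (2 * m * s)))"
        by (simp add: K_def Y_def algebra_simps)
      finally show ?thesis unfolding e .
    qed
    have Gq: "G s = q s * exp (2 * m * s)" for s by (simp add: q_def mult.assoc exp_add[symmetric])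
    have qn: "q \<noteq> (\<lambda>s. 0)" using Gn Gq by (auto simp: fun_eq_iff)
    show ?case by (rule that[OF \<tau> V fK Gq Gd qd qn gf])
  qed
qed

section \<open>The extremal profile\<close>

text \<open>At \<open>s = ln r\<close>, and up to the factor \<open>r\<^sup>1\<^sup>+\<^sup>2\<^sup>\<alpha>\<close>, this is the integrand of \<open>U1\<close> and \<open>U2\<close>.\<close>

definition extremal :: "real \<Rightarrow> real \<Rightarrow> real \<Rightarrow> real" where
  "extremal t \<delta> s = (if t = 2 then exp (- (exp (\<delta> * s) / \<delta>))
     else (1 + (t - 2) * (exp (\<delta> * s) / \<delta>)) powr (1 / (2 - t)))"

lemma extremal_base_pos: "t \<ge> 2 \<Longrightarrow> \<delta> > 0 \<Longrightarrow> 1 + (t - 2) * (exp (\<delta> * s) / \<delta>) > (0::real)"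
  by (intro add_pos_nonneg) auto

lemma extremal_pos: "t \<ge> 2 \<Longrightarrow> \<delta> > 0 \<Longrightarrow> extremal t \<delta> s > 0"
  using extremal_base_pos[of t \<delta> s] by (auto simp: extremal_def)

lemma extremal_le_1:
  assumes "t \<ge> 2" "\<delta> > 0"
  shows "extremal t \<delta> s \<le> 1"
proof (cases "t = 2")
  case True then show ?thesis using assms by (simp add: extremal_def)
next
  case False
  have "(1 + (t - 2) * (exp (\<delta> * s) / \<delta>)) powr (1 / (2 - t)) \<le> (1 + (t - 2) * (exp (\<delta> * s) / \<delta>)) powr 0"
    using assms False by (intro powr_mono) (auto simp: divide_nonpos_neg)
  then show ?thesis using False extremal_base_pos[OF assms, of s] by (simp add: extremal_def)
qed

text \<open>For \<open>t \<noteq> 2\<close> the equation is of Bernoulli type: the power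
  \<open>2 - t\<close> of a positive solution is affine in \<open>e^(\<delta> s)\<close>, which is
  the origin of the formula. The factor \<open>\<tau>\<close> of the equality case is normalised to
  1.\<close>

lemma extremal_DERIV:
  assumes t: "t \<ge> 2" and \<delta>: "\<delta> > 0"
  shows "(extremal t \<delta> has_real_derivative - (extremal t \<delta> s powr (t - 1) * exp (\<delta> * s))) (at s)"
proof (cases "t = 2")
  case True
  then show ?thesis using \<delta> unfolding extremal_def[abs_def]
    by (auto intro!: derivative_eq_intros simp: field_simps)
next
  case False
  let ?b = "\<lambda>s. 1 + (t - 2) * (exp (\<delta> * s) / \<delta>)"
  have b: "?b s > 0" by (rule extremal_base_pos[OF t \<delta>])
  have d: "(?b has_real_derivative (t - 2) * exp (\<delta> * s)) (at s)"
    using \<delta> by (auto intro!: derivative_eq_intros)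
  have e: "1 / (2 - t) - 1 = 1 / (2 - t) * (t - 1)" using False by (simp add: field_simps)
  have "((\<lambda>s. ?b s powr (1 / (2 - t))) has_real_derivative 1 / (2 - t) * ?b s powr (1 / (2 - t) - 1) * ((t - 2) * exp (\<delta> * s))) (at s)"
    by (rule DERIV_chain2[OF has_real_derivative_powr[OF b] d])
  moreover have "1 / (2 - t) * ?b s powr (1 / (2 - t) - 1) * ((t - 2) * exp (\<delta> * s)) = - (?b s powr (1 / (2 - t) * (t - 1)) * exp (\<delta> * s))"
  proof -
    have "1 / (2 - t) * (t - 2) = - 1" using False by (simp add: field_simps)
    then have "1 / (2 - t) * X * ((t - 2) * Z) = - (X * Z)" for X Z :: real
      by (metis (no_types, opaque_lifting) mult.assoc mult.commute mult_minus1)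
    then show ?thesis unfolding e .
  qed
  ultimately show ?thesis using False by (simp add: extremal_def[abs_def] powr_powr)
qed

lemma extremal_ck: "t \<ge> 2 \<Longrightarrow> \<delta> > 0 \<Longrightarrow> ck_on k UNIV (extremal t \<delta>)"
proof -
  assume t: "t \<ge> 2" and \<delta>: "\<delta> > 0"
  have x: "ck_on k UNIV (\<lambda>s. exp (\<delta> * s))"
  proof -
    have "ck_on k UNIV (\<lambda>s. \<delta> * s)" by (intro ck_on_mult ck_on_const ck_on_ident)
    then show ?thesis by (rule ck_on_compose[OF ck_on_exp[of k UNIV]]) auto
  qed
  show ?thesis
  proof (cases "t = 2")
    case True
    have "ck_on k UNIV (\<lambda>s. (- 1 / \<delta>) * exp (\<delta> * s))" by (intro ck_on_mult ck_on_const x)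
    then have "ck_on k UNIV (\<lambda>s. exp ((- 1 / \<delta>) * exp (\<delta> * s)))" by (rule ck_on_compose[OF ck_on_exp[of k UNIV]]) auto
    then show ?thesis using True by (simp add: extremal_def[abs_def])
  next
    case False
    have "ck_on k UNIV (\<lambda>s. 1 + ((t - 2) * (1 / \<delta>)) * exp (\<delta> * s))" by (intro ck_on_add ck_on_mult ck_on_const x)
    moreover have "(\<lambda>s. 1 + ((t - 2) * (1 / \<delta>)) * exp (\<delta> * s)) ` UNIV \<subseteq> {0<..}"
      using extremal_base_pos[OF t \<delta>] by auto
    ultimately have "ck_on k UNIV (\<lambda>s. (1 + ((t - 2) * (1 / \<delta>)) * exp (\<delta> * s)) powr (1 / (2 - t)))"
      by (intro ck_on_compose[OF ck_on_powr])
    then show ?thesis using False by (simp add: extremal_def[abs_def])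
  qed
qed

lemma linear_ode_solution:
  fixes q a A :: "real \<Rightarrow> real"
  assumes q: "\<And>s. (q has_real_derivative a s * q s) (at s)" and A: "\<And>s. (A has_real_derivative a s) (at s)"
  obtains c where "\<And>s. q s = c * exp (A s)"
proof -
  have "((\<lambda>s. q s * exp (- A s)) has_real_derivative 0) (at s)" for s
    by (auto intro!: derivative_eq_intros q A simp: algebra_simps)
  then have "q s * exp (- A s) = q 0 * exp (- A 0)" for s by (intro DERIV_isconst_all) auto
  then have "q s * (exp (- A s) * exp (A s)) = (q 0 * exp (- A 0)) * exp (A s)" for s
    by (metis mult.assoc)
  then have "q s = (q 0 * exp (- A 0)) * exp (A s)" for s
    by (metis exp_minus_inverse mult.commute mult_1)
  then show ?thesis by (rule that)
qed

text \<open>For \<open>t > 2\<close> the substitution \<open>Q = |q|^(2 - t)\<close> gives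
  \<open>Q = K + (t - 2) \<tau> e^(\<delta> s) / \<delta>\<close>. Positivity of \<open>Q\<close> at
  minus infinity excludes \<open>K < 0\<close>; for \<open>K = 0\<close> the solution is a pure
  exponential, which \<open>fin\<close> excludes; for \<open>K > 0\<close> the constants are
  absorbed in a factor and a translation.\<close>

lemma extremal_ode_unique:
  fixes q :: "real \<Rightarrow> real"
  assumes t: "t \<ge> 2" and \<delta>: "\<delta> > 0" and \<tau>: "\<tau> > 0"
    and q: "\<And>s. (q has_real_derivative - \<tau> * (sgn (q s) * \<bar>q s\<bar> powr (t - 1)) * exp (\<delta> * s)) (at s)"
    and q0: "q \<noteq> (\<lambda>s. 0)"
    and fin: "(\<integral>\<^sup>+s. ennreal (\<bar>q s\<bar> powr p * exp (\<sigma> * s)) \<partial>lborel) < \<infinity>"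
  obtains c \<mu> where "\<mu> > 0" "\<And>s. q s = c * extremal t \<delta> (s + ln \<mu>)"
proof (cases "t = 2")
  case True
  have "(q has_real_derivative (- \<tau> * exp (\<delta> * s)) * q s) (at s)" for s
  proof -
    have "sgn (q s) * \<bar>q s\<bar> powr (t - 1) = q s" using True by (cases "q s = 0") (auto simp: sgn_if)
    then show ?thesis using q[of s] by (simp add: mult_ac)
  qed
  moreover have "((\<lambda>s. - \<tau> * (exp (\<delta> * s) / \<delta>)) has_real_derivative - \<tau> * exp (\<delta> * s)) (at s)" for s
    using \<delta> by (auto intro!: derivative_eq_intros)
  ultimately obtain c where c: "\<And>s. q s = c * exp (- \<tau> * (exp (\<delta> * s) / \<delta>))"
    by (rule linear_ode_solution) blast
  \<comment> \<open>The translation by \<open>ln \<mu>\<close> multiplies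
    \<open>e^(\<delta> s)\<close> by \<open>\<tau>\<close>.\<close>
  define \<mu> where "\<mu> = exp (ln \<tau> / \<delta>)"
  have "exp (\<delta> * (s + ln \<mu>)) = \<tau> * exp (\<delta> * s)" for s
    using \<delta> \<tau> by (simp add: \<mu>_def distrib_left exp_add)
  then have "q s = c * extremal t \<delta> (s + ln \<mu>)" for s using True c by (simp add: extremal_def)
  then show ?thesis by (intro that[of \<mu> c]) (auto simp: \<mu>_def)
next
  case False
  then have t2: "t > 2" using t by simp
  have cq: "continuous_on UNIV q" using q by (auto intro!: continuous_at_imp_continuous_on DERIV_isCont)
  \<comment> \<open>Read as a linear equation \<open>q' = a q\<close>, the equation shows that
    \<open>q\<close> is a nonzero multiple of an exponential and so never vanishes; only then may
    the negative power \<open>2 - t\<close> be taken.\<close>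
  define a where "a s = - \<tau> * \<bar>q s\<bar> powr (t - 2) * exp (\<delta> * s)" for s
  have ca: "continuous_on UNIV a" unfolding a_def[abs_def] using t2
    by (intro continuous_intros continuous_on_powr' cq) auto
  have ai: "set_integrable lborel {x..y} a" for x y
    by (rule borel_integrable_atLeastAtMost'[OF continuous_on_subset[OF ca]]) auto
  obtain A where A: "primitive_of a A" by (rule primitive_of_exists[OF ai])
  have Ad: "(A has_real_derivative a s) (at s)" for s by (rule primitive_of_imp_DERIV[OF A ca])
  have "(q has_real_derivative a s * q s) (at s)" for s
  proof -
    have "sgn (q s) * \<bar>q s\<bar> powr (t - 1) = q s * \<bar>q s\<bar> powr (t - 2)"
    proof (cases "q s = 0")
      case False
      then have "\<bar>q s\<bar> powr (t - 1) = \<bar>q s\<bar> * \<bar>q s\<bar> powr (t - 2)"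
        using powr_add[of "\<bar>q s\<bar>" 1 "t - 2"] by simp
      then show ?thesis by (simp add: sgn_if)
    qed simp
    then show ?thesis using q[of s] by (simp add: a_def mult_ac)
  qed
  then obtain c where c: "\<And>s. q s = c * exp (A s)" by (rule linear_ode_solution[OF _ Ad]) blast
  have c0: "c \<noteq> 0" using q0 c by auto
  have qn: "\<bar>q s\<bar> > 0" for s using c[of s] c0 by simp
  define Q where "Q s = \<bar>c\<bar> powr (2 - t) * exp ((2 - t) * A s)" for s
  have Qq: "Q s = \<bar>q s\<bar> powr (2 - t)" for s
    using c0 by (simp add: Q_def c abs_mult powr_mult powr_def[of "exp _"])
  have qQ: "\<bar>q s\<bar> = Q s powr (1 / (2 - t))" for s
    unfolding Qq using qn[of s] t2 by (simp add: powr_powr)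
  have "((\<lambda>s. Q s - (t - 2) * \<tau> * (exp (\<delta> * s) / \<delta>)) has_real_derivative 0) (at s)" for s
  proof -
    have "Q s * ((2 - t) * a s) = (t - 2) * \<tau> * exp (\<delta> * s) * (\<bar>q s\<bar> powr (2 - t) * \<bar>q s\<bar> powr (t - 2))"
      unfolding Qq a_def by (simp add: algebra_simps)
    also have "\<bar>q s\<bar> powr (2 - t) * \<bar>q s\<bar> powr (t - 2) = 1" using qn[of s] by (simp add: powr_add[symmetric])
    finally have e: "Q s * ((2 - t) * a s) = (t - 2) * \<tau> * exp (\<delta> * s)" by simp
    have "(Q has_real_derivative Q s * ((2 - t) * a s)) (at s)"
      unfolding Q_def[abs_def] by (auto intro!: derivative_eq_intros Ad)
    then have "(Q has_real_derivative (t - 2) * \<tau> * exp (\<delta> * s)) (at s)" unfolding e .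
    then show ?thesis using \<delta> by (auto intro!: derivative_eq_intros)
  qed
  then have "Q s - (t - 2) * \<tau> * (exp (\<delta> * s) / \<delta>) = Q 0 - (t - 2) * \<tau> * (exp (\<delta> * 0) / \<delta>)" for s
    by (intro DERIV_isconst_all) auto
  then obtain K where K: "\<And>s. Q s = K + (t - 2) * \<tau> * (exp (\<delta> * s) / \<delta>)" by (metis diff_add_cancel)
  have Qp: "Q s > 0" for s using c0 by (simp add: Q_def)
  have Kpos: "K > 0"
  proof (rule ccontr)
    assume "\<not> K > 0"
    then consider "K < 0" | "K = 0" by linarith
    then show False
    proof cases
      case 1
      have "((\<lambda>s. K + (t - 2) * \<tau> * (exp (\<delta> * s) / \<delta>)) \<longlongrightarrow> K + (t - 2) * \<tau> * (0 / \<delta>)) at_bot"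
      proof (intro tendsto_intros)
        show "((\<lambda>s. exp (\<delta> * s)) \<longlongrightarrow> 0) at_bot" using \<delta> by real_asymp
      qed (use \<delta> in auto)
      then have "((\<lambda>s. K + (t - 2) * \<tau> * (exp (\<delta> * s) / \<delta>)) \<longlongrightarrow> K) at_bot" by simp
      from order_tendstoD(2)[OF this 1] obtain s where "K + (t - 2) * \<tau> * (exp (\<delta> * s) / \<delta>) < 0"
        by (auto simp: eventually_at_bot_linorder)
      then show False using Qp[of s] K[of s] by simp
    next
      case 2
      let ?C = "((t - 2) * \<tau> / \<delta>) powr (1 / (2 - t))"
      have C: "?C > 0" using t2 \<tau> \<delta> by simp
      have "\<bar>q s\<bar> = ?C * exp (\<delta> / (2 - t) * s)" for s
      proof -
        have "Q s = ((t - 2) * \<tau> / \<delta>) * exp (\<delta> * s)" using K[of s] 2 by simp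
        then have "\<bar>q s\<bar> = ?C * exp (\<delta> * s) powr (1 / (2 - t))" using qQ[of s] t2 \<tau> \<delta> powr_mult[of "(t - 2) * \<tau> / \<delta>" "exp (\<delta> * s)" "1 / (2 - t)"] by metis
        then show ?thesis by (simp add: powr_def[of "exp _"] mult_ac)
      qed
      then have "\<bar>q s\<bar> powr p * exp (\<sigma> * s) = ?C powr p * exp ((p * (\<delta> / (2 - t)) + \<sigma>) * s)" for s
        using C by (simp add: powr_mult powr_def[of "exp _"] exp_add[symmetric] algebra_simps)
      then have "(\<integral>\<^sup>+s. ennreal (\<bar>q s\<bar> powr p * exp (\<sigma> * s)) \<partial>lborel)
          = (\<integral>\<^sup>+s. ennreal (?C powr p) * ennreal (exp ((p * (\<delta> / (2 - t)) + \<sigma>) * s)) \<partial>lborel)"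
        by (intro nn_integral_cong) (simp add: ennreal_mult')
      also have "\<dots> = \<infinity>" using C by (simp add: nn_integral_cmult nn_integral_exp_infinite ennreal_mult_eq_top_iff)
      finally show False using fin by simp
    qed
  qed
  define \<mu> where "\<mu> = exp (ln (\<tau> / K) / \<delta>)"
  have e: "exp (\<delta> * (s + ln \<mu>)) = \<tau> / K * exp (\<delta> * s)" for s
    using \<delta> \<tau> Kpos by (simp add: \<mu>_def distrib_left exp_add)
  have "q s = (sgn c * K powr (1 / (2 - t))) * extremal t \<delta> (s + ln \<mu>)" for s
  proof -
    have "Q s = K * (1 + (t - 2) * (exp (\<delta> * (s + ln \<mu>)) / \<delta>))"
    proof -
      have "K * (1 + (t - 2) * (\<tau> / K * X / \<delta>)) = K + (t - 2) * \<tau> * (X / \<delta>)" for X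
        using Kpos \<delta> by (simp add: field_simps)
      then show ?thesis unfolding e using K[of s] by simp
    qed
    then have "\<bar>q s\<bar> = K powr (1 / (2 - t)) * extremal t \<delta> (s + ln \<mu>)"
      using qQ[of s] Kpos False extremal_base_pos[OF t \<delta>, of "s + ln \<mu>"] by (simp add: powr_mult extremal_def)
    moreover have "q s = sgn c * \<bar>q s\<bar>" using c[of s] by (simp add: abs_mult sgn_if)
    ultimately show ?thesis by (metis mult.assoc)
  qed
  then show ?thesis by (intro that[of \<mu>]) (auto simp: \<mu>_def)
qed

lemma log_radial_calculus:
  fixes v :: "'a::euclidean_space \<Rightarrow> real"
  assumes v: "\<And>y. y \<noteq> 0 \<Longrightarrow> v y = w (ln (norm y))"
    and w: "\<And>s. (w has_real_derivative G s * exp ((2 - real DIM('a)) * s)) (at s)"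
    and G: "\<And>s. (G has_real_derivative F s) (at s)"
    and x: "x \<noteq> 0"
  shows "(v has_derivative (\<lambda>h. flux_field G x \<bullet> h)) (at x)" "grad v x = flux_field G x"
    "laplacian v x = flux_div F x"
proof -
  let ?n = "real DIM('a)"
  have vd: "(v has_derivative (\<lambda>h. flux_field G y \<bullet> h)) (at y)" if y: "y \<noteq> 0" for y
  proof -
    let ?s = "ln (norm y)"
    have "((\<lambda>y. w (ln (norm y))) has_derivative (\<lambda>h. ((G ?s * exp ((2 - ?n) * ?s) / (norm y)\<^sup>2) *\<^sub>R y) \<bullet> h)) (at y)"
      by (rule log_radial_has_derivative[OF y w])
    also have "G ?s * exp ((2 - ?n) * ?s) / (norm y)\<^sup>2 = G ?s * exp (- (?n * ?s))"
      unfolding norm_sq_eq_exp[OF y] times_divide_eq_right[symmetric] exp_diff[symmetric] by (simp add: algebra_simps)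
    also have "\<dots> *\<^sub>R y = flux_field G y" by (simp add: flux_field_def)
    finally show ?thesis
      by (rule has_derivative_transform_within_open[where s = "- {0}"]) (use y v in auto)
  qed
  show "(v has_derivative (\<lambda>h. flux_field G x \<bullet> h)) (at x)" "grad v x = flux_field G x"
    using vd[OF x] grad_eqI(1)[OF vd[OF x]] by auto
  define k where "k s = G s * exp (- (?n * s))" for s
  let ?s = "ln (norm x)" and ?k' = "(F (ln (norm x)) - ?n * G (ln (norm x))) * exp (- (?n * ln (norm x)))"
  have k: "(k has_real_derivative ?k') (at ?s)"
    unfolding k_def[abs_def] by (auto intro!: derivative_eq_intros G simp: algebra_simps)
  have kd: "((\<lambda>y. k (ln (norm y))) has_derivative (\<lambda>h. ((?k' / (norm x)\<^sup>2) *\<^sub>R x) \<bullet> h)) (at x)"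
    by (rule log_radial_has_derivative[OF x k])
  have pd: "partial_deriv b (partial_deriv b v) x = ?k' / (norm x)\<^sup>2 * (x \<bullet> b) * (x \<bullet> b) + k ?s" if b: "b \<in> Basis" for b
  proof -
    have "((\<lambda>y. k (ln (norm y)) * (y \<bullet> b)) has_derivative (\<lambda>h. ((?k' / (norm x)\<^sup>2 * (x \<bullet> b)) *\<^sub>R x + k ?s *\<^sub>R b) \<bullet> h)) (at x)"
      by (rule has_derivative_eq_rhs, rule has_derivative_mult[OF kd])
        (auto intro!: derivative_eq_intros ext simp: inner_add_left inner_add_right inner_commute)
    then have "(partial_deriv b v has_derivative (\<lambda>h. ((?k' / (norm x)\<^sup>2 * (x \<bullet> b)) *\<^sub>R x + k ?s *\<^sub>R b) \<bullet> h)) (at x)"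
      by (rule has_derivative_transform_within_open[where s = "- {0}"])
        (use x grad_eqI(2)[OF vd] in \<open>auto simp: flux_field_def k_def\<close>)
    from grad_eqI(2)[OF this, of b] show ?thesis using b by (simp add: inner_add_left inner_Basis)
  qed
  have "laplacian v x = (\<Sum>b\<in>Basis. ?k' / (norm x)\<^sup>2 * ((x \<bullet> b) * (x \<bullet> b)) + k ?s)"
    unfolding laplacian_def by (intro sum.cong refl) (simp add: pd)
  also have "\<dots> = ?k' / (norm x)\<^sup>2 * (x \<bullet> x) + ?n * k ?s"
    unfolding sum.distrib sum_distrib_left[symmetric] euclidean_inner[of x x, symmetric] by simp
  also have "\<dots> = ?k' + ?n * k ?s" using x by (simp add: power2_norm_eq_inner[symmetric])
  finally show "laplacian v x = flux_div F x" by (simp add: flux_div_def k_def algebra_simps)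
qed

text \<open>For \<open>t = 2\<close> the decay is faster than any exponential. For
  \<open>t > 2\<close> it has the rate \<open>\<delta> / (t - 2)\<close>, and this is the
  restriction on \<open>N\<close>.\<close>

lemma extremal_decay:
  assumes t: "t \<ge> 2" and \<delta>: "\<delta> > 0" and N: "N > 0" "t > 2 \<Longrightarrow> N * (t - 2) \<le> \<delta>"
  obtains C where "C > 0" "\<And>s. extremal t \<delta> s \<le> C * exp (- (N * s))"
proof (cases "t = 2")
  case True
  have "extremal t \<delta> s \<le> exp (N / \<delta> * (ln N - 1)) * exp (- (N * s))" for s
  proof -
    \<comment> \<open>The bound \<open>ln y \<le> y - 1\<close> at
      \<open>y = e^(\<delta> s) / N\<close> has equality where
      \<open>N s - e^(\<delta> s) / \<delta>\<close> is largest, so it yields the optimal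
      constant.\<close>
    have "ln (exp (\<delta> * s) / N) \<le> exp (\<delta> * s) / N - 1" by (rule ln_le_minus_one) (use N in auto)
    then have "\<delta> * s \<le> exp (\<delta> * s) / N - 1 + ln N" using N by (simp add: ln_div)
    then have "N / \<delta> * (\<delta> * s) \<le> N / \<delta> * (exp (\<delta> * s) / N - 1 + ln N)" using N \<delta> by (intro mult_left_mono) auto
    also have "\<dots> = exp (\<delta> * s) / \<delta> + N / \<delta> * (ln N - 1)" using N \<delta> by (simp add: field_simps)
    also have "N / \<delta> * (\<delta> * s) = N * s" using \<delta> by simp
    finally have "- (exp (\<delta> * s) / \<delta>) \<le> N / \<delta> * (ln N - 1) + - (N * s)" by linarith
    then show ?thesis using True by (simp add: extremal_def exp_add[symmetric] del: mult_minus_right)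
  qed
  then show ?thesis by (rule that[rotated]) simp
next
  case False
  then have t2: "t > 2" using t by simp
  let ?C = "((t - 2) / \<delta>) powr (1 / (2 - t))"
  have C: "?C > 0" using t2 \<delta> by simp
  show ?thesis
  proof (rule that)
    show "?C + 1 > 0" using C by linarith
    fix s :: real
    show "extremal t \<delta> s \<le> (?C + 1) * exp (- (N * s))"
    proof (cases "s \<le> 0")
      case True
      have "extremal t \<delta> s \<le> 1 * exp (- (N * s))" using extremal_le_1[OF t \<delta>, of s] N True
        by (intro order_trans[OF extremal_le_1[OF t \<delta>]]) (auto simp: mult_nonneg_nonpos)
      also have "\<dots> \<le> (?C + 1) * exp (- (N * s))" using C by (intro mult_right_mono) auto
      finally show ?thesis .
    next
      case s: False
      have "extremal t \<delta> s \<le> ((t - 2) / \<delta> * exp (\<delta> * s)) powr (1 / (2 - t))"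
        using False t2 \<delta> by (simp add: extremal_def) (intro powr_mono2', auto simp: divide_nonpos_neg)
      also have "\<dots> = ?C * exp (\<delta> * s * (1 / (2 - t)))"
        using powr_mult[of "(t - 2) / \<delta>" "exp (\<delta> * s)" "1 / (2 - t)"] by (simp add: powr_def[of "exp _"])
      also have "\<dots> \<le> (?C + 1) * exp (- (N * s))"
      proof (intro mult_mono)
        have "N \<le> \<delta> / (t - 2)" using N(2)[OF t2] t2 by (simp add: field_simps)
        then have "N * s \<le> \<delta> / (t - 2) * s" using s by (intro mult_right_mono) auto
        moreover have "\<delta> * s * (1 / (2 - t)) = - (\<delta> / (t - 2) * s)" using t2 by (simp add: field_simps)
        ultimately show "exp (\<delta> * s * (1 / (2 - t))) \<le> exp (- (N * s))" by simp
      qed (use C in auto)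
      finally show ?thesis .
    qed
  qed
qed

lemma integrable_two_sided_exp:
  fixes f :: "real \<Rightarrow> real"
  assumes f: "f \<in> borel_measurable borel" and a: "a > 0" and b: "b > 0"
    and left: "\<And>s. \<bar>f s\<bar> \<le> A * exp (a * s)" and right: "\<And>s. \<bar>f s\<bar> \<le> B * exp (- (b * s))"
  shows "integrable lborel f" "(f \<longlongrightarrow> 0) at_top" "(f \<longlongrightarrow> 0) at_bot"
proof -
  have i1: "set_integrable lborel {..0} (\<lambda>s. A * exp (a * s))"
  proof (intro set_integrable_mult_right)
    have "(\<integral>\<^sup>+s. ennreal (indicator {..0} s * exp (a * s)) \<partial>lborel) < \<infinity>"
      using nn_integral_exp_atMost[OF a, of 0] by (simp add: indicator_mult_ennreal mult.commute)
    then show "set_integrable lborel {..0} (\<lambda>s. exp (a * s))"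
      unfolding set_integrable_def by (intro integrableI_nonneg) auto
  qed
  have i2: "set_integrable lborel {0..} (\<lambda>s. B * exp (- (b * s)))"
  proof (intro set_integrable_mult_right)
    have "(\<integral>\<^sup>+s. ennreal (indicator {0..} s * exp (- (b * s))) \<partial>lborel) < \<infinity>"
      using nn_integral_exp_atLeast[OF b, of 0] by (simp add: indicator_mult_ennreal mult.commute)
    then show "set_integrable lborel {0..} (\<lambda>s. exp (- (b * s)))"
      unfolding set_integrable_def by (intro integrableI_nonneg) auto
  qed
  show "integrable lborel f"
  proof (rule Bochner_Integration.integrable_bound[OF Bochner_Integration.integrable_add[OF i1[unfolded set_integrable_def] i2[unfolded set_integrable_def]]])
    show "AE s in lborel. norm (f s) \<le> norm (indicator {..0} s *\<^sub>R (A * exp (a * s)) + indicator {0..} s *\<^sub>R (B * exp (- (b * s))))"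
    proof (intro AE_I2)
      fix s :: real
      have "0 \<le> A * exp (a * s)" "0 \<le> B * exp (- (b * s))" using left[of s] right[of s] by linarith+
      then show "norm (f s) \<le> norm (indicator {..0} s *\<^sub>R (A * exp (a * s)) + indicator {0..} s *\<^sub>R (B * exp (- (b * s))))"
        using left[of s] right[of s] by (cases "s \<le> 0"; cases "s \<ge> 0") auto
    qed
  qed (use f in auto)
  have "((\<lambda>s. B * exp (- (b * s))) \<longlongrightarrow> 0) at_top" using b by real_asymp
  then show "(f \<longlongrightarrow> 0) at_top" by (rule Lim_null_comparison[rotated]) (use right in auto)
  have "((\<lambda>s. A * exp (a * s)) \<longlongrightarrow> 0) at_bot" using a by real_asymp
  then show "(f \<longlongrightarrow> 0) at_bot" by (rule Lim_null_comparison[rotated]) (use left in auto)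
qed

lemma extremal_continuous: "t \<ge> 2 \<Longrightarrow> \<delta> > 0 \<Longrightarrow> continuous_on UNIV (extremal t \<delta>)"
  using extremal_ck[of t \<delta> 0] by simp

text \<open>At minus infinity the profile is bounded by 1 and \<open>\<sigma> > 0\<close> gives the
  decay; at plus infinity the rate \<open>\<delta> / (t - 2)\<close> of the profile has to beat
  \<open>\<sigma> / p\<close>.\<close>

lemma extremal_weight:
  assumes t: "t \<ge> 2" and \<delta>: "\<delta> > 0" and p: "p > 0" and \<sigma>: "\<sigma> > 0" "t > 2 \<Longrightarrow> \<sigma> * (t - 2) < p * \<delta>"
  shows "integrable lborel (\<lambda>s. extremal t \<delta> s powr p * exp (\<sigma> * s))"
    "((\<lambda>s. extremal t \<delta> s powr p * exp (\<sigma> * s)) \<longlongrightarrow> 0) at_top"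
    "((\<lambda>s. extremal t \<delta> s powr p * exp (\<sigma> * s)) \<longlongrightarrow> 0) at_bot"
proof -
  \<comment> \<open>For \<open>t = 2\<close> every rate is available, and one above
    \<open>\<sigma> / p\<close> is taken.\<close>
  define N where "N = (if t = 2 then \<sigma> / p + 1 else \<delta> / (t - 2))"
  have N: "N > 0" "t > 2 \<Longrightarrow> N * (t - 2) \<le> \<delta>" "\<sigma> < p * N"
    using t \<delta> p \<sigma> by (auto simp: N_def field_simps add_pos_pos)
  obtain C where C: "C > 0" "\<And>s. extremal t \<delta> s \<le> C * exp (- (N * s))" by (rule extremal_decay[OF t \<delta> N(1,2)]) auto
  have ep: "extremal t \<delta> s > 0" for s by (rule extremal_pos[OF t \<delta>])
  have m[measurable]: "extremal t \<delta> \<in> borel_measurable borel"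
    using extremal_continuous[OF t \<delta>] by (rule borel_measurable_continuous_onI)
  have 1: "\<bar>extremal t \<delta> s powr p * exp (\<sigma> * s)\<bar> \<le> 1 * exp (\<sigma> * s)" for s
  proof -
    have "extremal t \<delta> s powr p \<le> 1 powr p" using p ep[of s] extremal_le_1[OF t \<delta>, of s] by (intro powr_mono2) auto
    then show ?thesis by (auto simp: abs_mult)
  qed
  have 2: "\<bar>extremal t \<delta> s powr p * exp (\<sigma> * s)\<bar> \<le> C powr p * exp (- ((p * N - \<sigma>) * s))" for s
  proof -
    have "extremal t \<delta> s powr p \<le> (C * exp (- (N * s))) powr p" using p ep[of s] C by (intro powr_mono2) auto
    also have "\<dots> = C powr p * exp (- (N * s) * p)" by (simp add: powr_mult powr_def[of "exp _"] mult_ac)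
    finally have "extremal t \<delta> s powr p * exp (\<sigma> * s) \<le> C powr p * exp (- (N * s) * p) * exp (\<sigma> * s)" by (intro mult_right_mono) auto
    also have "\<dots> = C powr p * exp (- ((p * N - \<sigma>) * s))" by (simp add: exp_add[symmetric] algebra_simps)
    finally show ?thesis by (simp add: abs_mult)
  qed
  have "p * N - \<sigma> > 0" using N by simp
  from integrable_two_sided_exp[OF _ \<sigma>(1) this 1 2]
  show "integrable lborel (\<lambda>s. extremal t \<delta> s powr p * exp (\<sigma> * s))"
    "((\<lambda>s. extremal t \<delta> s powr p * exp (\<sigma> * s)) \<longlongrightarrow> 0) at_top"
    "((\<lambda>s. extremal t \<delta> s powr p * exp (\<sigma> * s)) \<longlongrightarrow> 0) at_bot" by auto
qed

lemma integral_deriv_eq_0: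
  fixes h h' :: "real \<Rightarrow> real"
  assumes h: "\<And>s. (h has_real_derivative h' s) (at s)" and c: "continuous_on UNIV h'" and i: "integrable lborel h'"
    and lim: "(h \<longlongrightarrow> 0) at_top" "(h \<longlongrightarrow> 0) at_bot"
  shows "(\<integral>s. h' s \<partial>lborel) = 0"
proof -
  have "(LBINT x=-\<infinity>..\<infinity>. h' x) = 0 - 0"
  proof (rule interval_integral_FTC_integrable)
    show "(h has_vector_derivative h' x) (at x)" for x using h by (simp add: has_real_derivative_iff_has_vector_derivative)
    show "isCont h' x" for x using c by (simp add: continuous_on_eq_continuous_at)
    show "set_integrable lborel (einterval (-\<infinity>) \<infinity>) h'" using i by (simp add: set_integrable_def)
    show "((h \<circ> real_of_ereal) \<longlongrightarrow> 0) (at_right (-\<infinity>))" "((h \<circ> real_of_ereal) \<longlongrightarrow> 0) (at_left \<infinity>)"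
      using lim by (simp_all add: ereal_tendsto_simps)
  qed simp
  then show ?thesis by (simp add: interval_lebesgue_integral_def set_lebesgue_integral_def)
qed

text \<open>Two exact derivatives are integrated. That of \<open>\<epsilon>^t e^(L s)\<close> gives
  \<open>t B = L D\<close>. That of \<open>\<epsilon>^2 e^(2 m s)\<close>, multiplied by
  \<open>2 m\<close>, is the difference between the integrands of the Laplacian term and of
  \<open>B\<close>, so these two integrals agree. Together this is equality for the profile of
  \<open>U\<close>.\<close>

lemma extremal_identities:
  assumes t: "t \<ge> 2" and \<delta>: "\<delta> > 0" and m: "m > 0" "m * (t - 2) < \<delta>"
  defines "\<epsilon> \<equiv> extremal t \<delta>" and "L \<equiv> 2 * m + \<delta>"
  defines "B \<equiv> \<integral>s. \<epsilon> s powr (2 * (t - 1)) * exp (2 * (L - m) * s) \<partial>lborel"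
    and "D \<equiv> \<integral>s. \<epsilon> s powr t * exp (L * s) \<partial>lborel"
    and "F \<equiv> \<lambda>s. (\<epsilon> s powr (t - 1) * exp (\<delta> * s) - 2 * m * \<epsilon> s) * exp (2 * m * s)"
  shows "t * B = L * D" "integrable lborel (\<lambda>s. (F s)\<^sup>2 * exp (- (2 * m * s)))"
    "(\<integral>s. (F s)\<^sup>2 * exp (- (2 * m * s)) \<partial>lborel) = B" "D > 0"
proof -
  note ew = extremal_weight[OF t \<delta>, folded \<epsilon>_def]
  have e1: "L > 0" "2 * (L - m) > 0" "2 * m > 0" using m \<delta> by (auto simp: L_def)
  \<comment> \<open>For \<open>t > 2\<close> the condition of \<open>extremal_weight\<close>
    reduces, for each of the three weights, to \<open>m * (t - 2) < \<delta>\<close>.\<close>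
  have iB: "integrable lborel (\<lambda>s. \<epsilon> s powr (2 * (t - 1)) * exp (2 * (L - m) * s))"
    by (rule ew(1)) (use t e1 m in \<open>auto simp: L_def algebra_simps\<close>)
  have iD: "integrable lborel (\<lambda>s. \<epsilon> s powr t * exp (L * s))"
    and lD: "((\<lambda>s. \<epsilon> s powr t * exp (L * s)) \<longlongrightarrow> 0) at_top" "((\<lambda>s. \<epsilon> s powr t * exp (L * s)) \<longlongrightarrow> 0) at_bot"
    by (rule ew; use t e1 m in \<open>auto simp: L_def algebra_simps\<close>)+
  have iP: "integrable lborel (\<lambda>s. \<epsilon> s powr 2 * exp (2 * m * s))"
    and lP: "((\<lambda>s. \<epsilon> s powr 2 * exp (2 * m * s)) \<longlongrightarrow> 0) at_top" "((\<lambda>s. \<epsilon> s powr 2 * exp (2 * m * s)) \<longlongrightarrow> 0) at_bot"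
    by (rule ew; use t e1 m in \<open>auto simp: L_def algebra_simps\<close>)+
  have ep: "\<epsilon> s > 0" for s using extremal_pos[OF t \<delta>] by (simp add: \<epsilon>_def)
  have ed: "(\<epsilon> has_real_derivative - (\<epsilon> s powr (t - 1) * exp (\<delta> * s))) (at s)" for s
    using extremal_DERIV[OF t \<delta>] by (simp add: \<epsilon>_def)
  have ec: "continuous_on UNIV \<epsilon>" using extremal_continuous[OF t \<delta>] by (simp add: \<epsilon>_def)
  have pc: "continuous_on UNIV (\<lambda>s. \<epsilon> s powr p)" for p
    using ep by (intro continuous_intros ec) (metis less_irrefl)
  have pd: "((\<lambda>s. \<epsilon> s powr p) has_real_derivative - (p * (\<epsilon> s powr (p + t - 2) * exp (\<delta> * s)))) (at s)" for p s
  proof -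
    have "\<epsilon> s powr (p - 1) * \<epsilon> s powr (t - 1) = \<epsilon> s powr (p + t - 2)" by (simp add: powr_add[symmetric] algebra_simps)
    then have e: "p * \<epsilon> s powr (p - 1) * - (\<epsilon> s powr (t - 1) * exp (\<delta> * s)) = - (p * (\<epsilon> s powr (p + t - 2) * exp (\<delta> * s)))"
      by (metis mult.assoc mult_minus_right)
    show ?thesis using DERIV_chain2[OF has_real_derivative_powr[OF ep] ed, of p s] unfolding e .
  qed
  have 1: "((\<lambda>s. \<epsilon> s powr t * exp (L * s)) has_real_derivative
      L * (\<epsilon> s powr t * exp (L * s)) - t * (\<epsilon> s powr (2 * (t - 1)) * exp (2 * (L - m) * s))) (at s)" for s
    by (rule DERIV_cong, rule DERIV_mult[OF pd]) (auto intro!: derivative_eq_intros simp: L_def exp_add[symmetric] algebra_simps)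
  have "(\<integral>s. L * (\<epsilon> s powr t * exp (L * s)) - t * (\<epsilon> s powr (2 * (t - 1)) * exp (2 * (L - m) * s)) \<partial>lborel) = 0"
    by (rule integral_deriv_eq_0[OF 1 _ _ lD]) (intro continuous_intros pc Bochner_Integration.integrable_diff integrable_mult_right iB iD)+
  then show "t * B = L * D" using iB iD by (simp add: B_def D_def)
  have 2: "((\<lambda>s. \<epsilon> s powr 2 * exp (2 * m * s)) has_real_derivative
      2 * m * (\<epsilon> s powr 2 * exp (2 * m * s)) - 2 * (\<epsilon> s powr t * exp (L * s))) (at s)" for s
    by (rule DERIV_cong, rule DERIV_mult[OF pd]) (auto intro!: derivative_eq_intros simp: L_def exp_add[symmetric] algebra_simps)
  have P: "(\<integral>s. 2 * m * (\<epsilon> s powr 2 * exp (2 * m * s)) - 2 * (\<epsilon> s powr t * exp (L * s)) \<partial>lborel) = 0"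
    by (rule integral_deriv_eq_0[OF 2 _ _ lP]) (intro continuous_intros pc Bochner_Integration.integrable_diff integrable_mult_right iP iD)+
  have F: "(F s)\<^sup>2 * exp (- (2 * m * s)) = \<epsilon> s powr (2 * (t - 1)) * exp (2 * (L - m) * s)
      + 2 * m * (2 * m * (\<epsilon> s powr 2 * exp (2 * m * s)) - 2 * (\<epsilon> s powr t * exp (L * s)))" for s
  proof -
    have a: "\<epsilon> s powr (2 * (t - 1)) = (\<epsilon> s powr (t - 1))\<^sup>2" "\<epsilon> s powr 2 = (\<epsilon> s)\<^sup>2" "\<epsilon> s powr t = \<epsilon> s powr (t - 1) * \<epsilon> s"
      using ep[of s] powr_add[of "\<epsilon> s" "t - 1" 1] by (simp_all add: power2_eq_square powr_add[symmetric] powr_numeral)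
    have b: "exp (2 * (L - m) * s) = (exp (\<delta> * s))\<^sup>2 * exp (2 * m * s)" "exp (L * s) = exp (\<delta> * s) * exp (2 * m * s)"
      "exp (- (2 * m * s)) * exp (2 * m * s) = 1"
      by (simp_all add: L_def power2_eq_square exp_add[symmetric] algebra_simps)
    have "(F s)\<^sup>2 * exp (- (2 * m * s)) = (\<epsilon> s powr (t - 1) * exp (\<delta> * s) - 2 * m * \<epsilon> s)\<^sup>2 * exp (2 * m * s)
        * (exp (- (2 * m * s)) * exp (2 * m * s))"
      by (simp add: F_def power2_eq_square mult_ac)
    then show ?thesis unfolding a b by (simp add: power2_eq_square algebra_simps)
  qed
  have iF: "integrable lborel (\<lambda>s. 2 * m * (2 * m * (\<epsilon> s powr 2 * exp (2 * m * s)) - 2 * (\<epsilon> s powr t * exp (L * s))))"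
    by (intro Bochner_Integration.integrable_diff integrable_mult_right iP iD)
  show "integrable lborel (\<lambda>s. (F s)\<^sup>2 * exp (- (2 * m * s)))" unfolding F
    by (rule Bochner_Integration.integrable_add[OF iB iF])
  have "(\<integral>s. (F s)\<^sup>2 * exp (- (2 * m * s)) \<partial>lborel) = B + 2 * m * 0"
    unfolding F B_def by (subst Bochner_Integration.integral_add[OF iB iF]) (simp only: integral_mult_right_zero P)
  then show "(\<integral>s. (F s)\<^sup>2 * exp (- (2 * m * s)) \<partial>lborel) = B" by simp
  have "D \<noteq> 0"
  proof
    assume "D = 0"
    then have "AE s in (lborel :: real measure). \<epsilon> s powr t * exp (L * s) = 0" unfolding D_def
      by (subst (asm) integral_nonneg_eq_0_iff_AE[OF iD]) auto
    moreover have "\<epsilon> s powr t * exp (L * s) \<noteq> 0" for s using ep[of s] by simp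
    ultimately have "AE s in (lborel :: real measure). False" by (auto elim!: eventually_mono)
    then show False by (simp add: eventually_False ae_filter_eq_bot_iff)
  qed
  then show "D > 0" unfolding D_def by (metis (no_types, lifting) Bochner_Integration.integral_nonneg exp_ge_zero less_eq_real_def mult_nonneg_nonneg powr_ge_zero)
qed

section \<open>The functions \<open>U1\<close> and \<open>U2\<close>\<close>

lemma tail_integral_DERIV:
  fixes g :: "real \<Rightarrow> real"
  assumes c: "continuous_on {0<..} g" and i: "\<And>a. a > 0 \<Longrightarrow> set_integrable lborel {a..} g" and r: "r > 0"
  shows "((\<lambda>r. LBINT x:{r..}. g x) has_real_derivative - g r) (at r)"
proof -
  let ?a = "r / 2" and ?b = "r + 1"
  have e: "(LBINT x:{y..}. g x) = integral {y..?b} g + (LBINT x:{?b<..}. g x)" if y: "y \<in> {?a..?b}" for y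
  proof -
    have y0: "y > 0" using y r by auto
    have u: "{y..} = {y..?b} \<union> {?b<..}" using y by auto
    have s: "set_integrable lborel {y..?b} g" "set_integrable lborel {?b<..} g"
      by (rule set_integrable_subset[OF i[OF y0]]; use y in auto)+
    have "(LBINT x:{y..}. g x) = (LBINT x:{y..?b}. g x) + (LBINT x:{?b<..}. g x)"
      unfolding u by (rule set_integral_Un[OF _ s]) auto
    then show ?thesis using set_borel_integral_eq_integral(2)[OF s(1)] by simp
  qed
  have "((\<lambda>y. integral {y..?b} g) has_real_derivative - g r) (at r within {?a..?b})"
    using r by (intro integral_has_real_derivative' continuous_on_subset[OF c]) auto
  then have "((\<lambda>y. integral {y..?b} g + (LBINT x:{?b<..}. g x)) has_real_derivative - g r) (at r within {?a..?b})"
    by (auto intro!: derivative_eq_intros)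
  moreover have "at r within {?a..?b} = at r" using r by (intro at_within_interior) auto
  ultimately have "((\<lambda>y. integral {y..?b} g + (LBINT x:{?b<..}. g x)) has_real_derivative - g r) (at r)" by simp
  then show ?thesis
    by (rule has_field_derivative_transform_within_open[where S = "{?a<..<?b}"]) (use r e in auto)
qed

lemma set_integrable_powr_atLeast:
  fixes e a :: real
  assumes "e < -1" "a > 0"
  shows "set_integrable lborel {a..} (\<lambda>x. x powr e)"
proof -
  have "(\<lambda>x. x powr e) absolutely_integrable_on {a..}"
    using has_integral_powr_to_inf[OF assms] by (intro nonnegative_absolutely_integrable_1) (auto simp: integrable_on_def)
  then have "integrable lebesgue (\<lambda>x. indicat_real {a..} x *\<^sub>R (x powr e))" by (simp add: set_integrable_def)
  then show ?thesis unfolding set_integrable_def by (subst (asm) integrable_completion) auto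
qed

lemma borel_measurable_off_0:
  fixes f g :: "'a::euclidean_space \<Rightarrow> 'b::topological_space"
  assumes [measurable]: "g \<in> borel_measurable borel" and fg: "\<And>x. x \<noteq> 0 \<Longrightarrow> f x = g x"
  shows "f \<in> borel_measurable borel"
proof -
  have "f = (\<lambda>x. if x = 0 then f 0 else g x)" using fg by auto
  also have "\<dots> \<in> borel_measurable borel" by measurable
  finally show ?thesis .
qed

lemma AE_nonzero: "AE x in lborel. (x::'a::euclidean_space) \<noteq> 0"
  by (rule AE_lborel_singleton)

text \<open>Both cases of the theorem at once. \<open>m > 0\<close> stands for
  \<open>n + 2 \<alpha> > 0\<close>, and \<open>m * (t - 2) < \<delta>\<close> is the upper bound on
  \<open>n - \<beta>\<close>; \<open>tail\<close> makes the integral that defines \<open>U\<close>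
  converge at infinity when \<open>t > 2\<close>.\<close>

locale extremal_function =
  fixes t \<alpha> \<beta> m \<delta> L :: real and U :: "'a::euclidean_space \<Rightarrow> real"
  assumes t: "t \<ge> 2"
    and \<delta>_def: "\<delta> = (1 + 2 * \<alpha>) * (t - 2) + 1 + \<alpha> - \<beta> / 2" and \<delta>: "\<delta> > 0"
    and tail: "t < 3 + \<alpha> - \<beta> / 2"
    and m_eq: "2 * m = real DIM('a) + 2 * \<alpha>" and m: "m > 0" "m * (t - 2) < \<delta>"
    and L_def: "L = 2 * m + \<delta>"
    and U_def: "U = (if t = 2 then U1 \<alpha> \<beta> else U2 t \<alpha> \<beta>)"
begin

lemma U_profile:
  obtains w where "\<And>y. y \<noteq> 0 \<Longrightarrow> U y = w (ln (norm y))"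
    "\<And>s. (w has_real_derivative - (extremal t \<delta> s * exp ((2 + 2 * \<alpha>) * s))) (at s)"
proof -
  define g where "g r = r powr (1 + 2 * \<alpha>) *
    (if t = 2 then exp (- (r powr \<delta> / \<delta>)) else (1 + (t - 2) * (r powr \<delta> / \<delta>)) powr (1 / (2 - t)))" for r
  have g: "g r = r powr (1 + 2 * \<alpha>) * extremal t \<delta> (ln r)" if "r > 0" for r
    using that by (simp add: g_def extremal_def powr_def)
  have Ug: "U y = (LBINT r:{norm y..}. g r)" for y
  proof (cases "t = 2")
    case True
    then have "\<delta> = 1 + \<alpha> - \<beta> / 2" by (simp add: \<delta>_def)
    then show ?thesis using True by (simp add: U_def U1_def g_def)
  next
    case False
    then show ?thesis by (simp add: U_def U2_def g_def \<delta>_def)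
  qed
  have c: "continuous_on {0<..} g"
  proof -
    have "continuous_on {0<..} (\<lambda>r. r powr (1 + 2 * \<alpha>) * extremal t \<delta> (ln r))"
      by (intro continuous_intros continuous_on_compose2[OF extremal_continuous[OF t \<delta>]]) auto
    then show ?thesis by (rule continuous_on_eq) (use g in auto)
  qed
  have i: "set_integrable lborel {a..} g" if a: "a > 0" for a
  proof -
    \<comment> \<open>The integrand has to decay faster than \<open>1 / r\<close>. For
      \<open>t = 2\<close> every rate is at hand; for \<open>t > 2\<close> the rate is
      \<open>\<delta> / (t - 2) = 1 + 2 \<alpha> + (1 + \<alpha> - \<beta> / 2) / (t - 2)\<close>,
      and \<open>tail\<close> makes the last quotient exceed 1.\<close>
    define N where "N = (if t = 2 then \<bar>2 + 2 * \<alpha>\<bar> + 1 else \<delta> / (t - 2))"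
    have N: "N > 0" "t > 2 \<Longrightarrow> N * (t - 2) \<le> \<delta>" using t \<delta> by (auto simp: N_def)
    have N2: "1 + 2 * \<alpha> - N < -1"
    proof (cases "t = 2")
      case False
      then have "N = 1 + 2 * \<alpha> + (1 + \<alpha> - \<beta> / 2) / (t - 2)" using t by (simp add: N_def \<delta>_def field_simps)
      moreover have "(1 + \<alpha> - \<beta> / 2) / (t - 2) > 1" using False t tail by (simp add: field_simps)
      ultimately show ?thesis by simp
    qed (simp add: N_def)
    obtain C where C: "C > 0" "\<And>s. extremal t \<delta> s \<le> C * exp (- (N * s))" by (rule extremal_decay[OF t \<delta> N]) auto
    have gb: "\<bar>g r\<bar> \<le> C * r powr (1 + 2 * \<alpha> - N)" if r: "r > 0" for r
    proof -
      have "g r \<le> r powr (1 + 2 * \<alpha>) * (C * exp (- (N * ln r)))" unfolding g[OF r] by (intro mult_left_mono C) auto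
      also have "exp (- (N * ln r)) = r powr (- N)" using r by (simp add: powr_def)
      also have "r powr (1 + 2 * \<alpha>) * (C * r powr (- N)) = C * r powr (1 + 2 * \<alpha> - N)" using powr_add[of r "1 + 2 * \<alpha>" "- N"] by simp
      finally show ?thesis using g[OF r] extremal_pos[OF t \<delta>, of "ln r"] by (simp add: less_imp_le)
    qed
    have "set_integrable lborel {a..} (\<lambda>r. C * r powr (1 + 2 * \<alpha> - N))"
      by (intro set_integrable_mult_right set_integrable_powr_atLeast[OF N2 a])
    then show ?thesis unfolding set_integrable_def
    proof (rule Bochner_Integration.integrable_bound)
      have "(\<lambda>x. if x \<in> {a..} then g x else 0) \<in> borel_measurable borel"
        by (rule borel_measurable_continuous_on_if) (use a in \<open>auto intro!: continuous_on_subset[OF c]\<close>)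
      moreover have "(\<lambda>x. indicat_real {a..} x *\<^sub>R g x) = (\<lambda>x. if x \<in> {a..} then g x else 0)" by (auto simp: indicator_def)
      ultimately show "(\<lambda>x. indicat_real {a..} x *\<^sub>R g x) \<in> borel_measurable lborel" by simp
      show "AE x in lborel. norm (indicat_real {a..} x *\<^sub>R g x) \<le> norm (indicat_real {a..} x *\<^sub>R (C * x powr (1 + 2 * \<alpha> - N)))"
        using gb a C by (intro AE_I2) (auto simp: indicator_def abs_mult)
    qed
  qed
  show ?thesis
  proof (rule that[of "\<lambda>s. LBINT r:{exp s..}. g r"])
    show "U y = (LBINT r:{exp (ln (norm y))..}. g r)" if "y \<noteq> 0" for y using that Ug by simp
    fix s :: real
    have "((\<lambda>s. LBINT r:{exp s..}. g r) has_real_derivative - g (exp s) * exp s) (at s)"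
      by (rule DERIV_chain2[OF tail_integral_DERIV[OF c i] DERIV_exp]) auto
    moreover have "- g (exp s) * exp s = - (extremal t \<delta> s * exp ((2 + 2 * \<alpha>) * s))"
      by (simp add: g powr_def exp_add[symmetric] algebra_simps)
    ultimately show "((\<lambda>s. LBINT r:{exp s..}. g r) has_real_derivative - (extremal t \<delta> s * exp ((2 + 2 * \<alpha>) * s))) (at s)" by simp
  qed
qed

lemma U_radial: "radial U"
  by (auto simp: radial_def U_def U1_def U2_def)

text \<open>A dilation by \<open>e^l\<close> shifts \<open>s\<close> by \<open>l\<close>. The minus
  sign in \<open>C\<close> is that of the derivative of a tail integral, and the exponent
  \<open>2 + 2 \<alpha>\<close> exceeds that of the integrand by one because
  \<open>dr = e^s ds\<close>.\<close>

lemma U_scaled: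
  fixes c l :: real
  assumes C: "C = - (c * exp ((2 + 2 * \<alpha>) * l))"
    and G: "G = (\<lambda>s. C * extremal t \<delta> (s + l) * exp (2 * m * s))"
    and F: "\<And>s. (G has_real_derivative F s) (at s)" and x: "x \<noteq> 0"
  shows "((\<lambda>y. c * U (exp l *\<^sub>R y)) has_derivative (\<lambda>h. flux_field G x \<bullet> h)) (at x)"
    "grad (\<lambda>y. c * U (exp l *\<^sub>R y)) x = flux_field G x" "laplacian (\<lambda>y. c * U (exp l *\<^sub>R y)) x = flux_div F x"
proof -
  obtain w where w: "\<And>y. y \<noteq> 0 \<Longrightarrow> U y = w (ln (norm y))"
    "\<And>s. (w has_real_derivative - (extremal t \<delta> s * exp ((2 + 2 * \<alpha>) * s))) (at s)" by (rule U_profile) blast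
  have 1: "c * U (exp l *\<^sub>R y) = c * w (ln (norm y) + l)" if "y \<noteq> 0" for y
    using that w(1)[of "exp l *\<^sub>R y"] by (simp add: ln_mult add.commute)
  have e: "exp ((2 + 2 * \<alpha>) * (s + l)) = exp ((2 + 2 * \<alpha>) * l) * (exp (2 * m * s) * exp ((2 - real DIM('a)) * s))" for s
  proof -
    have "(2 + 2 * \<alpha>) * (s + l) = (2 + 2 * \<alpha>) * l + (2 * m * s + (2 - real DIM('a)) * s)" unfolding m_eq by (simp add: algebra_simps)
    then show ?thesis by (simp only: exp_add)
  qed
  have 2: "((\<lambda>s. c * w (s + l)) has_real_derivative G s * exp ((2 - real DIM('a)) * s)) (at s)" for s
  proof -
    have "((\<lambda>s. w (s + l)) has_real_derivative - (extremal t \<delta> (s + l) * exp ((2 + 2 * \<alpha>) * (s + l))) * 1) (at s)"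
      by (rule DERIV_chain2[OF w(2)]) (auto intro!: derivative_eq_intros)
    from DERIV_cmult[OF this, of c] show ?thesis unfolding G C e by (simp add: mult_ac)
  qed
  note r = log_radial_calculus[where v = "\<lambda>y. c * U (exp l *\<^sub>R y)", OF 1 2 F x]
  show "((\<lambda>y. c * U (exp l *\<^sub>R y)) has_derivative (\<lambda>h. flux_field G x \<bullet> h)) (at x)" by (rule r(1))
  show "grad (\<lambda>y. c * U (exp l *\<^sub>R y)) x = flux_field G x" by (rule r(2))
  show "laplacian (\<lambda>y. c * U (exp l *\<^sub>R y)) x = flux_div F x" by (rule r(3))
qed

definition G\<^sub>U :: "real \<Rightarrow> real" where "G\<^sub>U s = - (extremal t \<delta> s * exp (2 * m * s))"

definition F\<^sub>U :: "real \<Rightarrow> real" where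
  "F\<^sub>U s = (extremal t \<delta> s powr (t - 1) * exp (\<delta> * s) - 2 * m * extremal t \<delta> s) * exp (2 * m * s)"

lemma G\<^sub>U_DERIV: "(G\<^sub>U has_real_derivative F\<^sub>U s) (at s)"
  unfolding G\<^sub>U_def[abs_def] F\<^sub>U_def
  by (auto intro!: derivative_eq_intros extremal_DERIV[OF t \<delta>] simp: algebra_simps)

lemma G\<^sub>U_ck: "ck_on k UNIV G\<^sub>U"
proof -
  have "ck_on k UNIV (\<lambda>s. 2 * m * s)" by (intro ck_on_mult ck_on_const ck_on_ident)
  then have "ck_on k UNIV (\<lambda>s. exp (2 * m * s))" by (rule ck_on_compose[OF ck_on_exp[of k UNIV]]) auto
  then have "ck_on k UNIV (\<lambda>s. (-1) * (extremal t \<delta> s * exp (2 * m * s)))"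
    by (intro ck_on_mult ck_on_const extremal_ck[OF t \<delta>])
  then show ?thesis by (simp add: G\<^sub>U_def[abs_def])
qed

lemma F\<^sub>U_continuous: "continuous_on UNIV F\<^sub>U"
proof -
  have "extremal t \<delta> s \<noteq> 0" for s using extremal_pos[OF t \<delta>, of s] by simp
  then show ?thesis unfolding F\<^sub>U_def[abs_def] by (intro continuous_intros extremal_continuous[OF t \<delta>]) auto
qed

lemma U_calculus:
  assumes "x \<noteq> 0"
  shows "(U has_derivative (\<lambda>h. flux_field G\<^sub>U x \<bullet> h)) (at x)" "grad U x = flux_field G\<^sub>U x" "laplacian U x = flux_div F\<^sub>U x"
  using U_scaled[where c = 1 and l = 0, OF refl _ G\<^sub>U_DERIV assms] by (auto simp: G\<^sub>U_def[abs_def])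

lemma G\<^sub>U_F\<^sub>U_measurable [measurable]: "G\<^sub>U \<in> borel_measurable borel" "F\<^sub>U \<in> borel_measurable borel"
  using G\<^sub>U_ck[of 0] F\<^sub>U_continuous by (auto intro: borel_measurable_continuous_onI)

lemma U_measurable: "U \<in> borel_measurable borel" "grad U \<in> borel_measurable borel" "laplacian U \<in> borel_measurable borel"
proof -
  obtain w where w: "\<And>y. y \<noteq> 0 \<Longrightarrow> U y = w (ln (norm y))"
    "\<And>s. (w has_real_derivative - (extremal t \<delta> s * exp ((2 + 2 * \<alpha>) * s))) (at s)" by (rule U_profile) blast
  have "continuous_on UNIV w" by (intro continuous_at_imp_continuous_on ballI DERIV_isCont[OF w(2)])
  then have [measurable]: "w \<in> borel_measurable borel" by (rule borel_measurable_continuous_onI)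
  show "U \<in> borel_measurable borel" by (rule borel_measurable_off_0[OF _ w(1)]) measurable
  show "grad U \<in> borel_measurable borel" by (rule borel_measurable_off_0[OF _ U_calculus(2)]) measurable
  show "laplacian U \<in> borel_measurable borel" by (rule borel_measurable_off_0[OF _ U_calculus(3)]) measurable
qed

lemma AE_U: "AE x in lborel. grad U x = flux_field G\<^sub>U x" "AE x in lborel. laplacian U x = flux_div F\<^sub>U x"
  using AE_nonzero[where 'a='a] by (eventually_elim; use U_calculus in auto)+

definition D\<^sub>U :: real where "D\<^sub>U = (\<integral>s. extremal t \<delta> s powr t * exp (L * s) \<partial>lborel)"

lemma D\<^sub>U_pos: "D\<^sub>U > 0"
  unfolding D\<^sub>U_def by (rule extremal_identities(4)[OF t \<delta> m, folded L_def])

lemma L_pos: "L > 0" using m \<delta> by (simp add: L_def)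

lemma exponents: "2 * (t - 1) * (1 - real DIM('a) + 2 * m) - \<beta> + real DIM('a) = 2 * (L - m)"
  "t * (1 - real DIM('a) + 2 * m) - (1 + \<alpha> + \<beta> / 2) + real DIM('a) = L"
proof -
  have n: "real DIM('a) = 2 * m - 2 * \<alpha>" using m_eq by simp
  show "2 * (t - 1) * (1 - real DIM('a) + 2 * m) - \<beta> + real DIM('a) = 2 * (L - m)"
    "t * (1 - real DIM('a) + 2 * m) - (1 + \<alpha> + \<beta> / 2) + real DIM('a) = L"
    unfolding n L_def \<delta>_def by (simp_all add: field_simps)
qed

lemma G\<^sub>U_abs: "\<bar>G\<^sub>U s * exp (- (2 * m * s))\<bar> = extremal t \<delta> s"
  using extremal_pos[OF t \<delta>, of s] by (simp add: G\<^sub>U_def exp_minus_inverse mult.assoc)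

lemma weights_integrable:
  "integrable lborel (\<lambda>s. extremal t \<delta> s powr (2 * (t - 1)) * exp (2 * (L - m) * s))"
  "integrable lborel (\<lambda>s. extremal t \<delta> s powr t * exp (L * s))"
  "integrable lborel (\<lambda>s. (G\<^sub>U s)\<^sup>2 * exp (- (2 * m * s)))"
proof -
  show "integrable lborel (\<lambda>s. extremal t \<delta> s powr (2 * (t - 1)) * exp (2 * (L - m) * s))"
    by (rule extremal_weight(1)[OF t \<delta>]) (use t m \<delta> in \<open>auto simp: L_def algebra_simps\<close>)
  show "integrable lborel (\<lambda>s. extremal t \<delta> s powr t * exp (L * s))"
    by (rule extremal_weight(1)[OF t \<delta>]) (use t m \<delta> in \<open>auto simp: L_def algebra_simps\<close>)
  have "integrable lborel (\<lambda>s. extremal t \<delta> s powr 2 * exp (2 * m * s))"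
    by (rule extremal_weight(1)[OF t \<delta>]) (use t m \<delta> in \<open>auto simp: L_def algebra_simps\<close>)
  moreover have "extremal t \<delta> s powr 2 * exp (2 * m * s) = (G\<^sub>U s)\<^sup>2 * exp (- (2 * m * s))" for s
    using extremal_pos[OF t \<delta>, of s]
    by (simp add: G\<^sub>U_def power_mult_distrib power2_eq_square powr_numeral exp_minus_inverse mult.assoc)
  ultimately show "integrable lborel (\<lambda>s. (G\<^sub>U s)\<^sup>2 * exp (- (2 * m * s)))" by simp
qed

text \<open>The profile of \<open>U\<close> satisfies \<open>X = - \<tau> Y\<close> with
  \<open>\<tau> = 1\<close>, so the first two integrals coincide; \<open>extremal_identities\<close>
  expresses them by the third.\<close>

lemma U_integrals:
  "lap_int \<alpha> (laplacian U) = ennreal (sphere_area TYPE('a) * (L / t * D\<^sub>U))"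
  "grad_int (2 * (t - 1)) \<beta> (grad U) = ennreal (sphere_area TYPE('a) * (L / t * D\<^sub>U))"
  "grad_int t (1 + \<alpha> + \<beta> / 2) (grad U) = ennreal (sphere_area TYPE('a) * D\<^sub>U)"
proof -
  let ?B = "\<integral>s. extremal t \<delta> s powr (2 * (t - 1)) * exp (2 * (L - m) * s) \<partial>lborel"
  note id = extremal_identities[OF t \<delta> m, folded L_def, folded D\<^sub>U_def F\<^sub>U_def]
  have B: "?B = L / t * D\<^sub>U" using id(1) t by (simp add: field_simps)
  have \<omega>: "sphere_area TYPE('a) \<ge> 0" using sphere_area_pos[where 'a='a] by simp
  have "lap_int \<alpha> (laplacian U) = ennreal (sphere_area TYPE('a)) * ennreal ?B"
    unfolding lap_int_flux_div[OF AE_U(2) G\<^sub>U_F\<^sub>U_measurable(2)] m_eq[symmetric] id(3)[symmetric]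
    by (subst nn_integral_eq_integral[OF id(2)]) auto
  then show "lap_int \<alpha> (laplacian U) = ennreal (sphere_area TYPE('a) * (L / t * D\<^sub>U))"
    unfolding B by (subst ennreal_mult'[OF \<omega>])
  have "grad_int (2 * (t - 1)) \<beta> (grad U) = ennreal (sphere_area TYPE('a)) * ennreal ?B"
    unfolding grad_int_flux_field[OF AE_U(1) G\<^sub>U_F\<^sub>U_measurable(1), where m=m] exponents G\<^sub>U_abs
    by (subst nn_integral_eq_integral[OF weights_integrable(1)]) auto
  then show "grad_int (2 * (t - 1)) \<beta> (grad U) = ennreal (sphere_area TYPE('a) * (L / t * D\<^sub>U))"
    unfolding B by (subst ennreal_mult'[OF \<omega>])
  have "grad_int t (1 + \<alpha> + \<beta> / 2) (grad U) = ennreal (sphere_area TYPE('a)) * ennreal D\<^sub>U"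
    unfolding grad_int_flux_field[OF AE_U(1) G\<^sub>U_F\<^sub>U_measurable(1), where m=m] exponents G\<^sub>U_abs D\<^sub>U_def
    by (subst nn_integral_eq_integral[OF weights_integrable(2)]) auto
  then show "grad_int t (1 + \<alpha> + \<beta> / 2) (grad U) = ennreal (sphere_area TYPE('a) * D\<^sub>U)"
    using \<omega> by (simp add: ennreal_mult')
qed

lemma U_attains:
  "0 < grad_int t (1 + \<alpha> + \<beta> / 2) (grad U)"
  "lap_int \<alpha> (laplacian U) * grad_int (2 * (t - 1)) \<beta> (grad U) = ennreal ((L / t)\<^sup>2) * (grad_int t (1 + \<alpha> + \<beta> / 2) (grad U))\<^sup>2"
proof -
  have p: "0 < sphere_area TYPE('a)" "0 < D\<^sub>U" "0 < L / t" using sphere_area_pos[where 'a='a] D\<^sub>U_pos L_pos t by auto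
  then show "0 < grad_int t (1 + \<alpha> + \<beta> / 2) (grad U)" by (simp add: U_integrals)
  show "lap_int \<alpha> (laplacian U) * grad_int (2 * (t - 1)) \<beta> (grad U) = ennreal ((L / t)\<^sup>2) * (grad_int t (1 + \<alpha> + \<beta> / 2) (grad U))\<^sup>2"
  proof -
    define X where "X = sphere_area TYPE('a) * D\<^sub>U"
    have X: "X \<ge> 0" "L / t \<ge> 0" using p by (simp_all add: X_def)
    have e1: "sphere_area TYPE('a) * (L / t * D\<^sub>U) = L / t * X" by (simp add: X_def)
    have e2: "ennreal (L / t * X) * ennreal (L / t * X) = ennreal ((L / t)\<^sup>2) * (ennreal X)\<^sup>2"
      using X by (simp only: ennreal_power ennreal_mult[symmetric] mult_nonneg_nonneg zero_le_power2) (simp add: power2_eq_square mult_ac)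
    show ?thesis unfolding U_integrals e1 X_def[symmetric] by (rule e2)
  qed
qed

end

section \<open>Approximation of the extremal\<close>

text \<open>Constancy to the left of \<open>a\<close>, rather than vanishing, suffices for
  smoothness at the origin, because the function is then constant in \<open>x \<bullet> x\<close>
  near 0. The approximations of \<open>U\<close> are of this kind.\<close>

lemma log_radial_test_function:
  fixes p :: "real \<Rightarrow> real"
  assumes ck: "\<And>j. ck_on j UNIV p" and left: "\<And>s. s \<le> a \<Longrightarrow> p s = c" and right: "\<And>s. s \<ge> b \<Longrightarrow> p s = 0"
  obtains \<phi> :: "'a::euclidean_space \<Rightarrow> real" where
    "test_function \<phi>" "radial \<phi>" "\<And>x. x \<noteq> 0 \<Longrightarrow> \<phi> x = p (ln (norm x))"
proof -
  define \<Phi> where "\<Phi> y = (if y \<le> 0 then c else p (ln y / 2))" for y :: real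
  have \<Phi>0: "\<Phi> y = c" if "y < exp (2 * a)" for y
  proof (cases "y \<le> 0")
    case False
    then have "ln y < 2 * a" using that by (metis exp_less_cancel_iff exp_ln not_le)
    then show ?thesis using left[of "ln y / 2"] by (simp add: \<Phi>_def)
  qed (simp add: \<Phi>_def)
  have \<Phi>ck: "ck_on k UNIV \<Phi>" for k
  proof -
    have "ck_on k {0<..} (\<lambda>y. p ((1 / 2) * ln y))"
      by (intro ck_on_mult ck_on_compose[OF ck] ck_on_const ck_on_ln) auto
    then have 1: "ck_on k {0<..} \<Phi>" by (rule ck_on_cong[rotated]) (auto simp: \<Phi>_def)
    have 2: "ck_on k {..<exp (2 * a)} \<Phi>"
      by (rule ck_on_cong[OF _ ck_on_const[of k _ c]]) (auto simp: \<Phi>0)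
    have "UNIV = {0<..} \<union> {..<exp (2 * a)}"
    proof -
      have "x < exp (2 * a)" if "\<not> 0 < x" for x :: real using that exp_gt_zero[of "2 * a"] by linarith
      then show ?thesis by auto
    qed
    then show ?thesis using ck_on_Un[OF _ _ 1 2] by simp
  qed
  define \<phi> where "\<phi> x = \<Phi> (x \<bullet> x)" for x :: 'a
  have e: "\<phi> x = p (ln (norm x))" if "x \<noteq> 0" for x
  proof -
    have "\<not> x \<bullet> x \<le> 0" using that by (simp add: not_le)
    moreover have "ln (x \<bullet> x) / 2 = ln (norm x)" using that by (simp add: dot_square_norm ln_realpow)
    ultimately show ?thesis by (simp only: \<phi>_def \<Phi>_def if_False)
  qed
  show ?thesis
  proof (rule that[of \<phi>])
    show "test_function \<phi>"
    proof (rule test_functionI[where R = "exp b"])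
      show "C_k k \<phi>" for k unfolding \<phi>_def[abs_def] by (rule C_k_compose[OF \<Phi>ck C_k_norm_sq])
      fix x :: 'a assume x: "norm x > exp b"
      then have x0: "x \<noteq> 0" using exp_gt_zero[of b] by auto
      have "ln (norm x) > b" using x x0 by (metis exp_less_cancel_iff exp_ln zero_less_norm_iff)
      then show "\<phi> x = 0" using e[OF x0] right by simp
    qed
    show "radial \<phi>" by (simp add: radial_def \<phi>_def dot_square_norm)
    show "\<And>x. x \<noteq> 0 \<Longrightarrow> \<phi> x = p (ln (norm x))" by (rule e)
  qed
qed

text \<open>The transition layers keep width 1 while moving out to \<open>{- (k + 1)..- k}\<close>
  and \<open>{k..k + 1}\<close>, so one \<open>M\<close> bounds all derivatives. Boundedness in the
  variable \<open>s\<close> suffices, since the flux of \<open>U\<close> is itself square integrable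
  with the weight of the Laplacian.\<close>

lemma cutoff_sequence:
  obtains \<eta> \<eta>' :: "nat \<Rightarrow> real \<Rightarrow> real" and M where
    "\<And>j k. ck_on j UNIV (\<eta> k)" "\<And>k s. (\<eta> k has_real_derivative \<eta>' k s) (at s)" "\<And>k. continuous_on UNIV (\<eta>' k)"
    "\<And>k s. 0 \<le> \<eta> k s" "\<And>k s. \<eta> k s \<le> 1" "\<And>k s. s \<notin> {- (real k + 1)<..<real k + 1} \<Longrightarrow> \<eta> k s = 0"
    "\<And>k s. \<bar>\<eta>' k s\<bar> \<le> M" "\<And>s. (\<lambda>k. \<eta> k s) \<longlonglongrightarrow> 1" "\<And>s. (\<lambda>k. \<eta>' k s) \<longlonglongrightarrow> 0"
proof -
  obtain \<sigma> where \<sigma>ck: "\<And>x. x \<in> UNIV \<Longrightarrow> (step has_real_derivative \<sigma> x) (at x)" "ck_on 0 UNIV \<sigma>"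
    using ck_on_step[of "Suc 0"] by (rule ck_on_SucE) blast
  have \<sigma>: "\<And>x. (step has_real_derivative \<sigma> x) (at x)" "continuous_on UNIV \<sigma>" using \<sigma>ck by simp_all
  have \<sigma>0: "\<sigma> x = 0" if "x < 0 \<or> x > 1" for x
  proof -
    have "(step has_real_derivative 0) (at x)"
    proof (cases "x < 0")
      case True
      have "((\<lambda>x. 0) has_real_derivative 0) (at x)" by simp
      then show ?thesis by (rule has_field_derivative_transform_within_open[where S = "{..<0}"]) (use True in \<open>auto simp: step_0\<close>)
    next
      case False
      have "((\<lambda>x. 1) has_real_derivative 0) (at x)" by simp
      then show ?thesis by (rule has_field_derivative_transform_within_open[where S = "{1<..}"]) (use False that in \<open>auto simp: step_1\<close>)
    qed
    then show ?thesis using \<sigma>(1) DERIV_unique by blast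
  qed
  have \<sigma>1: "\<sigma> x = 0" if "norm x > 1" for x by (rule \<sigma>0) (use that in \<open>auto simp: abs_if split: if_splits\<close>)
  obtain M where M: "\<And>x. norm (\<sigma> x) \<le> M"
    by (rule compact_support_bounded[where R = 1, OF \<sigma>(2) \<sigma>1]) (assumption | rule that; assumption)+
  define \<eta> where "\<eta> k = plateau 1 (- (real k + 1)) (real k + 1)" for k
  define \<eta>' where "\<eta>' k s = \<sigma> (s + (real k + 1)) * step (real k + 1 - s) - step (s + (real k + 1)) * \<sigma> (real k + 1 - s)" for k s
  have \<eta>_eq: "\<eta> k = (\<lambda>s. step (s + (real k + 1)) * step (real k + 1 - s))" for k
    unfolding \<eta>_def plateau_def mult_1 diff_minus_eq_add by simp
  have d: "(\<eta> k has_real_derivative \<eta>' k s) (at s)" for k s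
  proof -
    have "((\<lambda>s. step (s + (real k + 1))) has_real_derivative \<sigma> (s + (real k + 1)) * 1) (at s)"
      by (rule DERIV_chain2[OF \<sigma>(1)]) (auto intro!: derivative_eq_intros)
    moreover have "((\<lambda>s. step (real k + 1 - s)) has_real_derivative \<sigma> (real k + 1 - s) * (-1)) (at s)"
      by (rule DERIV_chain2[OF \<sigma>(1)]) (auto intro!: derivative_eq_intros)
    ultimately have "((\<lambda>s. step (s + (real k + 1)) * step (real k + 1 - s)) has_real_derivative \<eta>' k s) (at s)"
      by (rule DERIV_cong[OF DERIV_mult]) (simp add: \<eta>'_def)
    then show ?thesis by (simp only: \<eta>_eq)
  qed
  have b: "\<bar>\<eta>' k s\<bar> \<le> 2 * M" for k s
  proof -
    have "\<bar>\<sigma> x * step y\<bar> \<le> M" for x y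
      using mult_mono[OF M[of x], of "step y" 1] step_range[of y] M[of x] by (auto simp: abs_mult)
    from this[of "s + (real k + 1)" "real k + 1 - s"] this[of "real k + 1 - s" "s + (real k + 1)"]
    show ?thesis unfolding \<eta>'_def by (simp add: mult.commute)
  qed
  have l: "eventually (\<lambda>k. \<eta> k s = 1 \<and> \<eta>' k s = 0) sequentially" for s
  proof -
    have "eventually (\<lambda>k. real k > \<bar>s\<bar>) sequentially" using filterlim_real_sequentially by (simp add: filterlim_at_top_dense)
    then show ?thesis
    proof eventually_elim
      case (elim k)
      then have g: "s + (real k + 1) > 1" "real k + 1 - s > 1" by auto
      show ?case using g \<sigma>0[OF disjI2[OF g(1)]] \<sigma>0[OF disjI2[OF g(2)]] by (simp add: \<eta>_eq \<eta>'_def step_1)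
    qed
  qed
  show ?thesis
  proof (rule that[of \<eta> \<eta>' "2 * M"])
    show "ck_on j UNIV (\<eta> k)" for j k unfolding \<eta>_def by (rule ck_on_plateau)
    show "continuous_on UNIV (\<eta>' k)" for k unfolding \<eta>'_def[abs_def]
      by (intro continuous_intros continuous_on_compose2[OF \<sigma>(2)] continuous_on_compose2[OF ck_on_step[of 0, simplified]]) auto
    show "0 \<le> \<eta> k s" "\<eta> k s \<le> 1" for k s unfolding \<eta>_def by (rule plateau_range)+
    show "\<eta> k s = 0" if "s \<notin> {- (real k + 1)<..<real k + 1}" for k s
      unfolding \<eta>_def by (rule plateau_eq_0) (use that in auto)
    show "(\<lambda>k. \<eta> k s) \<longlonglongrightarrow> 1" "(\<lambda>k. \<eta>' k s) \<longlonglongrightarrow> 0" for s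
      by (rule tendsto_eventually, use l[of s] in \<open>auto elim: eventually_mono\<close>)+
  qed (use d b in auto)
qed

lemma grad_int_tendsto:
  fixes V :: "nat \<Rightarrow> 'a::euclidean_space \<Rightarrow> 'a" and V' W :: "'a \<Rightarrow> 'a"
  assumes V: "\<And>k. AE x in lborel. V k x = flux_field (H k) x" "AE x in lborel. V' x = flux_field H' x"
      "AE x in lborel. W x = flux_field G x"
    and m[measurable]: "\<And>k. H k \<in> borel_measurable borel" "H' \<in> borel_measurable borel" "G \<in> borel_measurable borel"
    and bd: "\<And>k s. \<bar>H k s\<bar> \<le> \<bar>G s\<bar>" and lim: "\<And>s. (\<lambda>k. H k s) \<longlonglongrightarrow> H' s" and p: "p > 0"
    and fin: "grad_int p a W < \<infinity>"
  shows "(\<lambda>k. grad_int p a (V k)) \<longlonglongrightarrow> grad_int p a V'"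
proof -
  let ?E = "\<lambda>s. exp ((p * (1 - real DIM('a)) - a + real DIM('a)) * s)"
  let ?w = "\<lambda>G s. \<bar>G s\<bar> powr p * ?E s"
  have e: "grad_int p a V = ennreal (sphere_area TYPE('a)) * (\<integral>\<^sup>+s. ennreal (?w G s) \<partial>lborel)"
    if "AE x in lborel. V x = flux_field G x" "G \<in> borel_measurable borel" for V :: "'a \<Rightarrow> 'a" and G
    using grad_int_flux_field[OF that, where m=0] by simp
  have f: "(\<integral>\<^sup>+s. ennreal (?w G s) \<partial>lborel) < \<infinity>"
    using fin sphere_area_pos[where 'a='a] unfolding e[OF V(3) m(3)] by (auto simp: ennreal_mult_less_top)
  have "(\<lambda>k. \<integral>\<^sup>+s. ennreal (?w (H k) s) \<partial>lborel) \<longlonglongrightarrow> (\<integral>\<^sup>+s. ennreal (?w H' s) \<partial>lborel)"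
  proof (rule nn_integral_dominated_convergence[where w = "\<lambda>s. ennreal (?w G s)"])
    show "AE s in lborel. ennreal (?w (H k) s) \<le> ennreal (?w G s)" for k
      using bd p by (intro AE_I2 ennreal_leI mult_right_mono powr_mono2) auto
    show "AE s in lborel. (\<lambda>k. ennreal (?w (H k) s)) \<longlonglongrightarrow> ennreal (?w H' s)"
      using p by (intro AE_I2 tendsto_ennrealI tendsto_mult_right tendsto_powr' tendsto_rabs lim tendsto_const) auto
  qed (use f in auto)
  then show ?thesis unfolding e[OF V(1) m(1)] e[OF V(2) m(2)] using sphere_area_pos[where 'a='a] by (intro tendsto_mult_ennreal tendsto_const) auto
qed

lemma lap_int_tendsto:
  fixes f :: "nat \<Rightarrow> 'a::euclidean_space \<Rightarrow> real" and f' :: "'a \<Rightarrow> real"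
  assumes f: "\<And>k. AE x in lborel. f k x = flux_div (H k) x" "AE x in lborel. f' x = flux_div H' x"
    and m[measurable]: "\<And>k. H k \<in> borel_measurable borel" "H' \<in> borel_measurable borel"
    and bd: "\<And>k s. \<bar>H k s\<bar> \<le> K s" and lim: "\<And>s. (\<lambda>k. H k s) \<longlonglongrightarrow> H' s"
    and K: "integrable lborel (\<lambda>s. (K s)\<^sup>2 * exp (- ((real DIM('a) + 2 * \<alpha>) * s)))"
  shows "(\<lambda>k. lap_int \<alpha> (f k)) \<longlonglongrightarrow> lap_int \<alpha> f'"
proof -
  let ?w = "\<lambda>G s. (G s)\<^sup>2 * exp (- ((real DIM('a) + 2 * \<alpha>) * s))"
  have "(\<lambda>k. \<integral>\<^sup>+s. ennreal (?w (H k) s) \<partial>lborel) \<longlonglongrightarrow> (\<integral>\<^sup>+s. ennreal (?w H' s) \<partial>lborel)"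
  proof (rule nn_integral_dominated_convergence[where w = "\<lambda>s. ennreal (?w K s)"])
    show "AE s in lborel. ennreal (?w (H k) s) \<le> ennreal (?w K s)" for k
    proof (intro AE_I2 ennreal_leI mult_right_mono)
      show "(H k s)\<^sup>2 \<le> (K s)\<^sup>2" for s using power_mono[OF bd[of k s], of 2] by simp
    qed auto
    show "AE s in lborel. (\<lambda>k. ennreal (?w (H k) s)) \<longlonglongrightarrow> ennreal (?w H' s)"
      by (intro AE_I2 tendsto_ennrealI tendsto_mult_right tendsto_power lim)
    show "(\<integral>\<^sup>+s. ennreal (?w K s) \<partial>lborel) < \<infinity>"
      by (subst nn_integral_eq_integral[OF K]) auto
  qed (use borel_measurable_integrable[OF K] in auto)
  then show ?thesis unfolding lap_int_flux_div[OF f(1) m(1)] lap_int_flux_div[OF f(2) m(2)]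
    using sphere_area_pos[where 'a='a] by (intro tendsto_mult_ennreal tendsto_const) auto
qed

lemma weak_gradientI:
  fixes u :: "'a::euclidean_space \<Rightarrow> real"
  assumes d: "\<And>x. x \<noteq> 0 \<Longrightarrow> (u has_derivative (\<lambda>h. W x \<bullet> h)) (at x)" and c: "continuous_on (-{0}) W"
  shows "weak_gradient u W"
  unfolding weak_gradient_def
proof (intro conjI allI impI ballI)
  fix K :: "'a set" assume K: "compact K \<and> 0 \<notin> K"
  then have s: "K \<subseteq> -{0}" by auto
  have "continuous_on (-{0}) u" by (intro continuous_at_imp_continuous_on ballI has_derivative_continuous[OF d]) simp
  then show "set_integrable lborel K u" "set_integrable lborel K W"
    unfolding set_integrable_def using K c by (metis borel_integrable_compact continuous_on_subset s)+
next
  fix \<phi> :: "'a \<Rightarrow> real" and b :: 'a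
  assume \<phi>: "test_function \<phi> \<and> 0 \<notin> closure {x. \<phi> x \<noteq> 0}" and b: "b \<in> Basis"
  show "(\<integral>x. u x * partial_deriv b \<phi> x \<partial>lborel) = - (\<integral>x. (W x \<bullet> b) * \<phi> x \<partial>lborel)"
    by (rule punctured_integration_by_parts(3)[OF d c _ _ b]) (use \<phi> in auto)
qed

lemma test_function_H2:
  fixes \<phi> :: "'a::euclidean_space \<Rightarrow> real"
  assumes "test_function \<phi>"
  shows "H2 \<alpha> \<beta> \<phi> (grad \<phi>) (laplacian \<phi>)"
  unfolding H2_def
proof (intro conjI exI[of _ "\<lambda>k. \<phi>"])
  show "weak_gradient \<phi> (grad \<phi>)"
    by (rule weak_gradientI[OF test_functionD(3)[OF assms] continuous_on_subset[OF test_function_continuous(1)[OF assms]]]) auto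
qed (use assms test_function_measurable[OF assms] in \<open>auto simp: H2_norm_sq_def lap_int_def grad_int_def\<close>)

context extremal_function begin

lemma U_H2I:
  assumes \<phi>: "\<And>k::nat. test_function (\<phi> k)"
    and "(\<lambda>k. lap_int \<alpha> (\<lambda>x. laplacian (\<phi> k) x - laplacian U x)) \<longlonglongrightarrow> 0"
    and "(\<lambda>k. grad_int 2 \<beta> (\<lambda>x. grad (\<phi> k) x - grad U x)) \<longlonglongrightarrow> 0"
  shows "H2 \<alpha> \<beta> U (grad U) (laplacian U)"
  unfolding H2_def
proof (intro conjI exI[of _ \<phi>])
  show "weak_gradient U (grad U)"
  proof (rule weak_gradientI)
    show "(U has_derivative (\<lambda>h. grad U x \<bullet> h)) (at x)" if "x \<noteq> 0" for x using U_calculus(1,2)[OF that] by simp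
    have cl: "continuous_on (-{0}) (\<lambda>x::'a. ln (norm x))" by (intro continuous_intros) auto
    have "continuous_on UNIV G\<^sub>U" using G\<^sub>U_ck[of 0] by simp
    from continuous_on_compose2[OF this cl]
    have "continuous_on (-{0}) (flux_field G\<^sub>U :: 'a \<Rightarrow> 'a)" unfolding flux_field_def[abs_def]
      by (intro continuous_intros cl) auto
    then show "continuous_on (-{0}) (grad U)" by (rule continuous_on_eq) (auto simp: U_calculus(2))
  qed
  show "(\<lambda>k. H2_norm_sq \<alpha> \<beta> (\<lambda>x. grad (\<phi> k) x - grad U x) (\<lambda>x. laplacian (\<phi> k) x - laplacian U x)) \<longlonglongrightarrow> 0"
    unfolding H2_norm_sq_def using tendsto_add[OF assms(2,3)] by simp
qed (use \<phi> U_measurable in auto)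

text \<open>The flux \<open>G\<^sub>U\<close> is cut off, not \<open>U\<close>. The flux and the
  divergence of the gradient of \<open>\<phi> k\<close> are then \<open>G\<^sub>U \<eta>\<close> and
  \<open>F\<^sub>U \<eta> + G\<^sub>U \<eta>'\<close>, dominated by fixed functions, and dominated
  convergence works in each integral separately, also for those that do not enter the norm of
  \<open>H2\<close>.\<close>

lemma U_approximation:
  obtains \<phi> :: "nat \<Rightarrow> 'a \<Rightarrow> real" where "\<And>k. test_function (\<phi> k)" "\<And>k. radial (\<phi> k)"
    "\<And>p a. p > 0 \<Longrightarrow> grad_int p a (grad U) < \<infinity> \<Longrightarrow> (\<lambda>k. grad_int p a (grad (\<phi> k))) \<longlonglongrightarrow> grad_int p a (grad U)"
    "\<And>p a. p > 0 \<Longrightarrow> grad_int p a (grad U) < \<infinity> \<Longrightarrow> (\<lambda>k. grad_int p a (\<lambda>x. grad (\<phi> k) x - grad U x)) \<longlonglongrightarrow> 0"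
    "(\<lambda>k. lap_int \<alpha> (laplacian (\<phi> k))) \<longlonglongrightarrow> lap_int \<alpha> (laplacian U)"
    "(\<lambda>k. lap_int \<alpha> (\<lambda>x. laplacian (\<phi> k) x - laplacian U x)) \<longlonglongrightarrow> 0"
proof -
  obtain \<eta> \<eta>' M where \<eta>: "\<And>j k. ck_on j UNIV (\<eta> k)" "\<And>k s. (\<eta> k has_real_derivative \<eta>' k s) (at s)" "\<And>k::nat. continuous_on UNIV (\<eta>' k)"
    "\<And>k s. 0 \<le> \<eta> k s" "\<And>k s. \<eta> k s \<le> 1" "\<And>k s. s \<notin> {- (real k + 1)<..<real k + 1} \<Longrightarrow> \<eta> k s = 0"
    "\<And>k s. \<bar>\<eta>' k s\<bar> \<le> M" "\<And>s. (\<lambda>k. \<eta> k s) \<longlonglongrightarrow> 1" "\<And>s. (\<lambda>k. \<eta>' k s) \<longlonglongrightarrow> 0"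
    by (rule cutoff_sequence) (rule that; assumption)
  let ?n = "real DIM('a)"
  \<comment> \<open>The derivative in \<open>s\<close> of a radial function with flux
    \<open>G\<^sub>U s * \<eta> k s\<close>; integrating it gives the profile of
    \<open>\<phi> k\<close>.\<close>
  define y where "y k s = (G\<^sub>U s * \<eta> k s) * exp ((2 - ?n) * s)" for k s
  have yck: "ck_on j UNIV (y k)" for j k
  proof -
    have "ck_on j UNIV (\<lambda>s. (2 - ?n) * s)" by (intro ck_on_mult ck_on_const ck_on_ident)
    then have "ck_on j UNIV (\<lambda>s. exp ((2 - ?n) * s))" by (rule ck_on_compose[OF ck_on_exp[of j UNIV]]) auto
    then show ?thesis unfolding y_def[abs_def] by (intro ck_on_mult G\<^sub>U_ck \<eta>(1))
  qed
  have "\<exists>\<phi> :: 'a \<Rightarrow> real. test_function \<phi> \<and> radial \<phi> \<and> (\<exists>w. (\<forall>x. x \<noteq> 0 \<longrightarrow> \<phi> x = w (ln (norm x)))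
      \<and> (\<forall>s. (w has_real_derivative y k s) (at s)))" for k
  proof -
    have yc: "continuous_on UNIV (y k)" using yck[of 0] by simp
    have yi: "set_integrable lborel {a..b} (y k)" for a b
      by (rule borel_integrable_atLeastAtMost'[OF continuous_on_subset[OF yc]]) auto
    obtain H where H: "primitive_of (y k) H" by (rule primitive_of_exists[OF yi])
    let ?b = "real k + 1"
    \<comment> \<open>The constant of integration makes the profile vanish on the right; on the left
      it is merely constant.\<close>
    define p where "p s = H s - H ?b" for s
    have pd: "(p has_real_derivative y k s) (at s)" for s
      unfolding p_def[abs_def] using primitive_of_imp_DERIV[OF H yc] by (auto intro!: derivative_eq_intros)
    have const: "H s' - H s = 0" if "s \<le> s'" "s \<ge> ?b \<or> s' \<le> - ?b" for s s'
    proof -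
      have "\<eta> k r = 0" if "r \<in> {s..s'}" for r using \<eta>(6)[of r k] that \<open>s \<ge> ?b \<or> s' \<le> - ?b\<close> by auto
      then have "(LBINT r:{s..s'}. y k r) = (LBINT r:{s..s'}. 0)"
        by (intro set_lebesgue_integral_cong) (auto simp: y_def)
      then show ?thesis using primitive_ofD(2)[OF H that(1)] by (simp add: set_lebesgue_integral_def)
    qed
    have pck: "ck_on j UNIV p" for j by (rule ck_on_Suc_imp, rule ck_on_SucI[OF pd yck])
    have l: "p s = p (- ?b)" if "s \<le> - ?b" for s using const[of s "- ?b"] that by (simp add: p_def)
    have r: "p s = 0" if "s \<ge> ?b" for s using const[of ?b s] that by (simp add: p_def)
    obtain \<phi> :: "'a \<Rightarrow> real" where "test_function \<phi>" "radial \<phi>" "\<And>x. x \<noteq> 0 \<Longrightarrow> \<phi> x = p (ln (norm x))"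
      by (rule log_radial_test_function[where a = "- ?b" and b = ?b, OF pck l r]) (assumption | rule that; assumption)+
    then show ?thesis using pd by blast
  qed
  then obtain \<phi> :: "nat \<Rightarrow> 'a \<Rightarrow> real" and w where \<phi>: "\<And>k. test_function (\<phi> k)" "\<And>k. radial (\<phi> k)"
    "\<And>k x. x \<noteq> 0 \<Longrightarrow> \<phi> k x = w k (ln (norm x))" "\<And>k s. (w k has_real_derivative y k s) (at s)"
    by metis
  define G where "G k s = G\<^sub>U s * \<eta> k s" for k s
  define F where "F k s = F\<^sub>U s * \<eta> k s + G\<^sub>U s * \<eta>' k s" for k s
  have Gd: "(G k has_real_derivative F k s) (at s)" for k s
    unfolding G_def[abs_def] F_def by (rule DERIV_cong[OF DERIV_mult[OF G\<^sub>U_DERIV \<eta>(2)]]) (simp add: mult.commute)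
  have wd: "(w k has_real_derivative G k s * exp ((2 - ?n) * s)) (at s)" for k s using \<phi>(4)[of k s] by (simp add: y_def G_def)
  have calc: "grad (\<phi> k) x = flux_field (G k) x" "laplacian (\<phi> k) x = flux_div (F k) x" if "x \<noteq> 0" for k x
    using log_radial_calculus(2,3)[OF \<phi>(3) wd Gd that] by auto
  have mm[measurable]: "\<eta> k \<in> borel_measurable borel" "\<eta>' k \<in> borel_measurable borel" for k
    using \<eta>(1)[of 0 k] \<eta>(3)[of k] by (auto intro: borel_measurable_continuous_onI)
  have mb: "G k \<in> borel_measurable borel" "F k \<in> borel_measurable borel" "(\<lambda>s. G k s - G\<^sub>U s) \<in> borel_measurable borel"
    "(\<lambda>s. F k s - F\<^sub>U s) \<in> borel_measurable borel" for k
    unfolding G_def[abs_def] F_def[abs_def] by measurable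
  have ae: "AE x in lborel. grad (\<phi> k) x = flux_field (G k) x" "AE x in lborel. laplacian (\<phi> k) x = flux_div (F k) x"
    "AE x in lborel. grad (\<phi> k) x - grad U x = flux_field (\<lambda>s. G k s - G\<^sub>U s) x"
    "AE x in lborel. laplacian (\<phi> k) x - laplacian U x = flux_div (\<lambda>s. F k s - F\<^sub>U s) x" for k
    using AE_nonzero[where 'a='a] by (eventually_elim; simp add: calc U_calculus(2,3) flux_field_def flux_div_def algebra_simps)+
  have bG: "\<bar>G k s\<bar> \<le> \<bar>G\<^sub>U s\<bar>" "\<bar>G k s - G\<^sub>U s\<bar> \<le> \<bar>G\<^sub>U s\<bar>" for k s
  proof -
    have "G k s - G\<^sub>U s = G\<^sub>U s * (\<eta> k s - 1)" by (simp add: G_def algebra_simps)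
    then show "\<bar>G k s\<bar> \<le> \<bar>G\<^sub>U s\<bar>" "\<bar>G k s - G\<^sub>U s\<bar> \<le> \<bar>G\<^sub>U s\<bar>"
      using \<eta>(4)[of k s] \<eta>(5)[of k s] by (auto simp: G_def abs_mult intro!: mult_left_le)
  qed
  define K where "K s = \<bar>F\<^sub>U s\<bar> + M * \<bar>G\<^sub>U s\<bar>" for s
  have bF: "\<bar>F k s\<bar> \<le> K s" "\<bar>F k s - F\<^sub>U s\<bar> \<le> K s" for k s
  proof -
    have e: "F k s - F\<^sub>U s = F\<^sub>U s * (\<eta> k s - 1) + G\<^sub>U s * \<eta>' k s" by (simp add: F_def algebra_simps)
    have 1: "\<bar>F\<^sub>U s * \<eta> k s\<bar> \<le> \<bar>F\<^sub>U s\<bar>" "\<bar>F\<^sub>U s * (\<eta> k s - 1)\<bar> \<le> \<bar>F\<^sub>U s\<bar>"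
      using \<eta>(4)[of k s] \<eta>(5)[of k s] by (auto simp: abs_mult intro!: mult_left_le)
    have 2: "\<bar>G\<^sub>U s * \<eta>' k s\<bar> \<le> M * \<bar>G\<^sub>U s\<bar>" using mult_right_mono[OF \<eta>(7)[of k s], of "\<bar>G\<^sub>U s\<bar>"] by (simp add: abs_mult mult.commute)
    show "\<bar>F k s\<bar> \<le> K s" using abs_triangle_ineq[of "F\<^sub>U s * \<eta> k s" "G\<^sub>U s * \<eta>' k s"] 1 2 unfolding F_def K_def by linarith
    show "\<bar>F k s - F\<^sub>U s\<bar> \<le> K s"
      using abs_triangle_ineq[of "F\<^sub>U s * (\<eta> k s - 1)" "G\<^sub>U s * \<eta>' k s"] 1 2 unfolding e K_def by linarith
  qed
  have lG: "(\<lambda>k. G k s) \<longlonglongrightarrow> G\<^sub>U s" "(\<lambda>k. G k s - G\<^sub>U s) \<longlonglongrightarrow> 0" for s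
  proof -
    have "(\<lambda>k. G k s) \<longlonglongrightarrow> G\<^sub>U s * 1" unfolding G_def by (intro tendsto_mult_left \<eta>(8))
    then show "(\<lambda>k. G k s) \<longlonglongrightarrow> G\<^sub>U s" by simp
    then show "(\<lambda>k. G k s - G\<^sub>U s) \<longlonglongrightarrow> 0" by (simp add: LIM_zero)
  qed
  have lF: "(\<lambda>k. F k s) \<longlonglongrightarrow> F\<^sub>U s" "(\<lambda>k. F k s - F\<^sub>U s) \<longlonglongrightarrow> 0" for s
  proof -
    have "(\<lambda>k. F k s) \<longlonglongrightarrow> F\<^sub>U s * 1 + G\<^sub>U s * 0" unfolding F_def by (intro tendsto_add tendsto_mult_left \<eta>(8,9))
    then show "(\<lambda>k. F k s) \<longlonglongrightarrow> F\<^sub>U s" by simp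
    then show "(\<lambda>k. F k s - F\<^sub>U s) \<longlonglongrightarrow> 0" by (simp add: LIM_zero)
  qed
  have iK: "integrable lborel (\<lambda>s. (K s)\<^sup>2 * exp (- ((?n + 2 * \<alpha>) * s)))"
  proof (rule Bochner_Integration.integrable_bound)
    show "integrable lborel (\<lambda>s. 2 * ((F\<^sub>U s)\<^sup>2 * exp (- (2 * m * s))) + 2 * M\<^sup>2 * ((G\<^sub>U s)\<^sup>2 * exp (- (2 * m * s))))"
      using extremal_identities(2)[OF t \<delta> m] weights_integrable(3)
      unfolding F\<^sub>U_def[symmetric] by (intro Bochner_Integration.integrable_add integrable_mult_right)
    show "(\<lambda>s. (K s)\<^sup>2 * exp (- ((?n + 2 * \<alpha>) * s))) \<in> borel_measurable lborel" unfolding K_def[abs_def] by measurable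
    show "AE s in lborel. norm ((K s)\<^sup>2 * exp (- ((?n + 2 * \<alpha>) * s)))
        \<le> norm (2 * ((F\<^sub>U s)\<^sup>2 * exp (- (2 * m * s))) + 2 * M\<^sup>2 * ((G\<^sub>U s)\<^sup>2 * exp (- (2 * m * s))))"
    proof (intro AE_I2)
      fix s :: real
      have "(K s)\<^sup>2 \<le> 2 * (F\<^sub>U s)\<^sup>2 + 2 * M\<^sup>2 * (G\<^sub>U s)\<^sup>2"
        using sum_squares_bound[of "\<bar>F\<^sub>U s\<bar>" "M * \<bar>G\<^sub>U s\<bar>"] by (simp add: K_def power2_sum power_mult_distrib)
      from mult_right_mono[OF this, of "exp (- (2 * m * s))"]
      show "norm ((K s)\<^sup>2 * exp (- ((?n + 2 * \<alpha>) * s)))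
        \<le> norm (2 * ((F\<^sub>U s)\<^sup>2 * exp (- (2 * m * s))) + 2 * M\<^sup>2 * ((G\<^sub>U s)\<^sup>2 * exp (- (2 * m * s))))"
        unfolding m_eq[symmetric] by (simp add: algebra_simps)
    qed
  qed
  have z: "AE x in lborel. (0::'a) = flux_field (\<lambda>s. 0) x" "AE x in lborel. 0 = flux_div (\<lambda>s. 0) (x::'a)"
    by (simp_all add: flux_field_def flux_div_def)
  have z2: "grad_int p a (\<lambda>x::'a. 0) = 0" "lap_int \<alpha> (\<lambda>x::'a. 0) = 0" for p a
    by (simp_all add: grad_int_def lap_int_def)
  show ?thesis
  proof (rule that[OF \<phi>(1,2)])
    fix p a :: real assume p: "p > 0" and fin: "grad_int p a (grad U) < \<infinity>"
    show "(\<lambda>k. grad_int p a (grad (\<phi> k))) \<longlonglongrightarrow> grad_int p a (grad U)"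
      by (rule grad_int_tendsto[OF ae(1) AE_U(1) AE_U(1) mb(1) G\<^sub>U_F\<^sub>U_measurable(1) G\<^sub>U_F\<^sub>U_measurable(1) bG(1) lG(1) p fin])
    show "(\<lambda>k. grad_int p a (\<lambda>x. grad (\<phi> k) x - grad U x)) \<longlonglongrightarrow> 0"
      using grad_int_tendsto[OF ae(3) z(1) AE_U(1) mb(3) _ G\<^sub>U_F\<^sub>U_measurable(1) bG(2) lG(2) p fin] by (simp add: z2)
  next
    show "(\<lambda>k. lap_int \<alpha> (laplacian (\<phi> k))) \<longlonglongrightarrow> lap_int \<alpha> (laplacian U)"
      by (rule lap_int_tendsto[OF ae(2) AE_U(2) mb(2) G\<^sub>U_F\<^sub>U_measurable(2) bF(1) lF(1) iK])
    show "(\<lambda>k. lap_int \<alpha> (\<lambda>x. laplacian (\<phi> k) x - laplacian U x)) \<longlonglongrightarrow> 0"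
      using lap_int_tendsto[OF ae(4) z(2) mb(4) _ bF(2) lF(2) iK] by (simp add: z2)
  qed
qed

end

section \<open>Sharpness and uniqueness\<close>

lemma weighted_compact_finite:
  fixes g :: "'a::euclidean_space \<Rightarrow> real"
  assumes K: "compact K" "0 \<notin> K" and g: "continuous_on K g"
  shows "(\<integral>\<^sup>+x. ennreal ((indicator K x * g x)\<^sup>2 * norm x powr p) \<partial>lborel) < \<infinity>"
proof -
  have "continuous_on K (\<lambda>x. (g x)\<^sup>2 * norm x powr p)"
    using K by (intro continuous_intros g) auto
  then have "integrable lborel (\<lambda>x. indicator K x *\<^sub>R ((g x)\<^sup>2 * norm x powr p))" by (rule borel_integrable_compact[OF K(1)])
  moreover have "(\<lambda>x. indicator K x *\<^sub>R ((g x)\<^sup>2 * norm x powr p)) = (\<lambda>x. (indicator K x * g x)\<^sup>2 * norm x powr p)"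
    by (auto simp: indicator_def)
  ultimately have i: "integrable lborel (\<lambda>x. (indicator K x * g x)\<^sup>2 * norm x powr p)" by (simp only:)
  show ?thesis by (subst nn_integral_eq_integral[OF i]) auto
qed

lemma weighted_test_function_finite:
  fixes \<eta> :: "'a::euclidean_space \<Rightarrow> real"
  assumes t: "test_function \<eta>" and 0: "0 \<notin> closure {x. \<eta> x \<noteq> 0}"
  shows "(\<integral>\<^sup>+x. ennreal ((\<eta> x)\<^sup>2 * norm x powr p) \<partial>lborel) < \<infinity>"
proof -
  let ?K = "closure {x. \<eta> x \<noteq> 0}"
  have e: "indicator ?K x * \<eta> x = \<eta> x" for x
    using test_functionD(6)[OF t, of x] by (cases "x \<in> ?K") simp_all
  have "compact ?K" using t by (simp add: test_function_def)
  from weighted_compact_finite[OF this 0 continuous_on_subset[OF test_functionD(2)[OF t] subset_UNIV], of p]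
  show ?thesis unfolding e .
qed

text \<open>The Laplacian is closable: if the gradients of \<open>\<phi> k\<close> tend to 0, one
  integration by parts shows that their Laplacians, paired with a test function supported away from
  the origin, tend to 0 as well. This covers the zero element in the uniqueness statement.\<close>

lemma H2_gradient_zero:
  fixes u f :: "'a::euclidean_space \<Rightarrow> real"
  assumes H: "H2 \<alpha> \<beta> u V f" and \<alpha>: "real DIM('a) - 2 * \<alpha> > 0" and \<beta>: "real DIM('a) - \<beta> > 0"
    and V: "AE x in lborel. V x = 0"
  shows "AE x in lborel. f x = 0"
proof -
  obtain \<phi> where t: "\<And>k::nat. test_function (\<phi> k)" and
    l: "(\<lambda>k. lap_int \<alpha> (\<lambda>x. laplacian (\<phi> k) x - f x)) \<longlonglongrightarrow> 0"
    "(\<lambda>k. grad_int 2 \<beta> (\<lambda>x. grad (\<phi> k) x - V x)) \<longlonglongrightarrow> 0"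
    and fin: "lap_int \<alpha> f < \<infinity>" and [measurable]: "f \<in> borel_measurable borel"
    by (rule H2E[OF H \<alpha> \<beta>]) blast
  have [measurable]: "grad (\<phi> k) \<in> borel_measurable borel" "laplacian (\<phi> k) \<in> borel_measurable borel" for k
    using test_function_measurable[OF t] by auto
  have pm: "partial_deriv b (\<phi> k) \<in> borel_measurable borel" if "b \<in> Basis" for b k
    using test_function_measurable(1)[OF test_function_partial(1)[OF t that]] .
  have l2: "(\<lambda>k. \<integral>\<^sup>+x. ennreal (\<bar>partial_deriv b (\<phi> k) x - 0\<bar>\<^sup>2 / norm x powr \<beta>) \<partial>lborel) \<longlonglongrightarrow> 0" if b: "b \<in> Basis" for b
  proof (rule tendsto_sandwich[OF always_eventually always_eventually tendsto_const l(2)]; intro allI)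
    fix k
    have "(\<integral>\<^sup>+x. ennreal (\<bar>partial_deriv b (\<phi> k) x - 0\<bar>\<^sup>2 / norm x powr \<beta>) \<partial>lborel) \<le> grad_int 2 \<beta> (grad (\<phi> k))"
      unfolding grad_int_2 using Basis_le_norm[OF b]
      by (intro nn_integral_mono ennreal_leI divide_right_mono power_mono) (auto simp: grad_inner_Basis[OF b, symmetric])
    also have "\<dots> = grad_int 2 \<beta> (\<lambda>x. grad (\<phi> k) x - V x)"
      unfolding grad_int_def by (rule nn_integral_cong_AE, use V in eventually_elim) simp
    finally show "(\<integral>\<^sup>+x. ennreal (\<bar>partial_deriv b (\<phi> k) x - 0\<bar>\<^sup>2 / norm x powr \<beta>) \<partial>lborel) \<le> grad_int 2 \<beta> (\<lambda>x. grad (\<phi> k) x - V x)" .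
  qed simp
  show ?thesis
  proof (rule fundamental_lemma_punctured)
    fix K :: "'a set" assume K: "compact K" "0 \<notin> K"
    then have "K \<in> sets borel" by (simp add: borel_compact)
    then have [measurable]: "indicat_real K \<in> borel_measurable borel" by simp
    have "integrable lborel (\<lambda>x. f x * indicat_real K x)"
      using weighted_compact_finite[OF K, of "\<lambda>x. 1" "2 * \<alpha>"] fin unfolding lap_int_def
      by (intro weighted_integrable[where p = "2 * \<alpha>"]) auto
    then show "set_integrable lborel K f" by (simp add: set_integrable_def mult.commute)
  next
    fix \<eta> :: "'a \<Rightarrow> real" assume \<eta>: "test_function \<eta>" and 0: "0 \<notin> closure {x. \<eta> x \<noteq> 0}"
    have [measurable]: "\<eta> \<in> borel_measurable borel" by (rule test_function_measurable(1)[OF \<eta>])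
    note w = weighted_test_function_finite[OF \<eta> 0, of "2 * \<alpha>"]
    have L1: "(\<lambda>k. \<integral>x. laplacian (\<phi> k) x * \<eta> x \<partial>lborel) \<longlonglongrightarrow> (\<integral>x. f x * \<eta> x \<partial>lborel)"
    proof (rule weighted_tendsto[OF _ _ _ l(1)[unfolded lap_int_def] w])
      show "integrable lborel (\<lambda>x. f x * \<eta> x)"
        using w fin unfolding lap_int_def by (intro weighted_integrable[where p = "2 * \<alpha>"]) auto
      show "integrable lborel (\<lambda>x. laplacian (\<phi> k) x * \<eta> x)" for k
        using w test_function_int_finite(1)[OF t \<alpha>] unfolding lap_int_def by (intro weighted_integrable[where p = "2 * \<alpha>"]) auto
    qed auto
    have ibp: "integrable lborel (\<lambda>x. partial_deriv b (partial_deriv b (\<phi> k)) x * \<eta> x)"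
      "integrable lborel (\<lambda>x. partial_deriv b (\<phi> k) x * partial_deriv b \<eta> x)"
      "(\<integral>x. partial_deriv b (\<phi> k) x * partial_deriv b \<eta> x \<partial>lborel) = - (\<integral>x. partial_deriv b (partial_deriv b (\<phi> k)) x * \<eta> x \<partial>lborel)"
      if b: "b \<in> Basis" for b k
    proof -
      have tp: "test_function (partial_deriv b (\<phi> k))" by (rule test_function_partial(1)[OF t b])
      note p = punctured_integration_by_parts[OF test_functionD(3)[OF tp] continuous_on_subset[OF test_function_continuous(1)[OF tp]] \<eta> 0 b,
          unfolded grad_inner_Basis[OF b]]
      show "integrable lborel (\<lambda>x. partial_deriv b (partial_deriv b (\<phi> k)) x * \<eta> x)"
        "integrable lborel (\<lambda>x. partial_deriv b (\<phi> k) x * partial_deriv b \<eta> x)"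
        "(\<integral>x. partial_deriv b (\<phi> k) x * partial_deriv b \<eta> x \<partial>lborel) = - (\<integral>x. partial_deriv b (partial_deriv b (\<phi> k)) x * \<eta> x \<partial>lborel)"
        using p by auto
    qed
    have e: "(\<integral>x. laplacian (\<phi> k) x * \<eta> x \<partial>lborel) = (\<Sum>b\<in>Basis. - (\<integral>x. partial_deriv b (\<phi> k) x * partial_deriv b \<eta> x \<partial>lborel))" for k
      unfolding laplacian_def sum_distrib_right using ibp by (subst Bochner_Integration.integral_sum) auto
    have "(\<lambda>k. \<Sum>b\<in>Basis. - (\<integral>x. partial_deriv b (\<phi> k) x * partial_deriv b \<eta> x \<partial>lborel)) \<longlonglongrightarrow> (\<Sum>b\<in>(Basis :: 'a set). - (\<integral>x. 0 * partial_deriv b \<eta> x \<partial>lborel))"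
    proof (intro tendsto_sum tendsto_minus)
      fix b :: 'a assume b: "b \<in> Basis"
      note tp = test_function_partial[OF \<eta> b]
      show "(\<lambda>k. \<integral>x. partial_deriv b (\<phi> k) x * partial_deriv b \<eta> x \<partial>lborel) \<longlonglongrightarrow> (\<integral>x. 0 * partial_deriv b \<eta> x \<partial>lborel)"
        by (rule weighted_tendsto[OF _ _ _ l2[OF b] weighted_test_function_finite[OF tp(1)]])
          (use tp(2) 0 test_function_measurable(1)[OF tp(1)] pm[OF b] ibp(2)[OF b] in auto)
    qed
    then have "(\<lambda>k. \<integral>x. laplacian (\<phi> k) x * \<eta> x \<partial>lborel) \<longlonglongrightarrow> 0" unfolding e by simp
    from LIMSEQ_unique[OF L1 this] show "(\<integral>x. f x * \<eta> x \<partial>lborel) = 0" .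
  qed
qed

context extremal_function begin

text \<open>Membership of \<open>U\<close> in \<open>H2\<close> is not assumed, so the constant
  \<open>C\<close> is tested on the approximating test functions and the inequality passes to the
  limit in all three integrals. Equality for \<open>U\<close>, with a positive and finite gradient
  term to cancel, bounds \<open>C\<close>.\<close>

lemma U_sharp:
  assumes \<beta>: "real DIM('a) - \<beta> > 0"
    and C: "\<And>(u :: 'a \<Rightarrow> real) V f. radial u \<Longrightarrow> H2 \<alpha> \<beta> u V f \<Longrightarrow>
      lap_int \<alpha> f * grad_int (2 * (t - 1)) \<beta> V \<ge> ennreal C * (grad_int t (1 + \<alpha> + \<beta> / 2) V)\<^sup>2"
  shows "C \<le> (L / t)\<^sup>2"
proof (cases "C \<le> 0")
  case True
  then show ?thesis using zero_le_power2[of "L / t"] by linarith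
next
  case False
  let ?X = "sphere_area TYPE('a) * D\<^sub>U"
  have X: "?X > 0" using sphere_area_pos[where 'a='a] D\<^sub>U_pos by simp
  obtain \<phi> :: "nat \<Rightarrow> 'a \<Rightarrow> real" where \<phi>: "\<And>k. test_function (\<phi> k)" "\<And>k. radial (\<phi> k)"
    "\<And>p a. p > 0 \<Longrightarrow> grad_int p a (grad U) < \<infinity> \<Longrightarrow> (\<lambda>k. grad_int p a (grad (\<phi> k))) \<longlonglongrightarrow> grad_int p a (grad U)"
    "(\<lambda>k. lap_int \<alpha> (laplacian (\<phi> k))) \<longlonglongrightarrow> lap_int \<alpha> (laplacian U)"
    by (rule U_approximation) (rule that; assumption)
  have l1: "(\<lambda>k. grad_int (2 * (t - 1)) \<beta> (grad (\<phi> k))) \<longlonglongrightarrow> grad_int (2 * (t - 1)) \<beta> (grad U)"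
    by (rule \<phi>(3), use t in simp, unfold U_integrals, simp)
  have l2: "(\<lambda>k. grad_int t (1 + \<alpha> + \<beta> / 2) (grad (\<phi> k))) \<longlonglongrightarrow> grad_int t (1 + \<alpha> + \<beta> / 2) (grad U)"
    by (rule \<phi>(3), use t in simp, unfold U_integrals, simp)
  have l3: "(\<lambda>k. lap_int \<alpha> (laplacian (\<phi> k)) * grad_int (2 * (t - 1)) \<beta> (grad (\<phi> k)))
      \<longlonglongrightarrow> lap_int \<alpha> (laplacian U) * grad_int (2 * (t - 1)) \<beta> (grad U)"
    unfolding U_integrals using \<phi>(4) l1 unfolding U_integrals by (intro tendsto_mult_ennreal) auto
  have l4: "(\<lambda>k. ennreal C * (grad_int t (1 + \<alpha> + \<beta> / 2) (grad (\<phi> k)) * grad_int t (1 + \<alpha> + \<beta> / 2) (grad (\<phi> k))))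
      \<longlonglongrightarrow> ennreal C * (grad_int t (1 + \<alpha> + \<beta> / 2) (grad U) * grad_int t (1 + \<alpha> + \<beta> / 2) (grad U))"
    by (intro tendsto_mult_ennreal tendsto_const l2) (use X in \<open>auto simp: U_integrals ennreal_mult[symmetric]\<close>)
  have "ennreal C * (grad_int t (1 + \<alpha> + \<beta> / 2) (grad U) * grad_int t (1 + \<alpha> + \<beta> / 2) (grad U))
      \<le> lap_int \<alpha> (laplacian U) * grad_int (2 * (t - 1)) \<beta> (grad U)"
    by (rule LIMSEQ_le[OF l4 l3]) (use C[OF \<phi>(2) test_function_H2[OF \<phi>(1)]] in \<open>auto simp: power2_eq_square\<close>)
  then have "ennreal C * (ennreal ?X * ennreal ?X) \<le> ennreal ((L / t)\<^sup>2) * (ennreal ?X * ennreal ?X)"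
    unfolding U_attains(2) U_integrals(3) power2_eq_square[of "ennreal _"] .
  then have "ennreal (C * (?X * ?X)) \<le> ennreal ((L / t)\<^sup>2 * (?X * ?X))"
    using False X by (simp only: ennreal_mult[symmetric] less_imp_le mult_nonneg_nonneg zero_le_power2 not_le)
  then have "C * (?X * ?X) \<le> (L / t)\<^sup>2 * (?X * ?X)" by (subst (asm) ennreal_le_iff) auto
  then show ?thesis using X by (simp only: mult_le_cancel_right_pos[OF mult_pos_pos[OF X X]])
qed

lemma U_in_H2:
  assumes "grad_int 2 \<beta> (grad U) < \<infinity>"
  shows "H2 \<alpha> \<beta> U (grad U) (laplacian U)"
proof (rule U_approximation, goal_cases)
  case (1 \<phi>)
  show ?case by (rule U_H2I[OF 1(1) 1(6) 1(4)]) (use assms in auto)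
qed

lemma L_eq: "L = real DIM('a) - (1 + \<alpha> + \<beta> / 2) + t * (1 + 2 * \<alpha>)" "L - 2 * m = \<delta>" "(real DIM('a) + 2 * \<alpha>) / 2 = m"
  unfolding m_eq[symmetric] using m_eq by (simp_all add: L_def \<delta>_def algebra_simps)

text \<open>\<open>radial_equality\<close> reduces the question to a differential equation, and
  \<open>extremal_ode_unique\<close> solves it; the finite gradient integral is the energy condition
  there. A zero gradient is the multiple with \<open>c = 0\<close>.\<close>

lemma U_unique:
  fixes u f :: "'a \<Rightarrow> real"
  assumes rad: "radial u" and H: "H2 \<alpha> \<beta> u V f" and \<alpha>: "real DIM('a) - 2 * \<alpha> > 0" and \<beta>: "real DIM('a) - \<beta> > 0"
    and fin: "lap_int \<alpha> f * grad_int (2 * (t - 1)) \<beta> V < \<infinity>"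
    and eq: "lap_int \<alpha> f * grad_int (2 * (t - 1)) \<beta> V = ennreal ((L / t)\<^sup>2) * (grad_int t (1 + \<alpha> + \<beta> / 2) V)\<^sup>2"
  obtains c \<mu> where "\<mu> > 0" "AE x in lborel. V x = grad (\<lambda>y. c * U (\<mu> *\<^sub>R y)) x \<and> f x = laplacian (\<lambda>y. c * U (\<mu> *\<^sub>R y)) x"
proof (cases "AE x in lborel. V x = 0")
  case True
  have f0: "AE x in lborel. f x = 0" by (rule H2_gradient_zero[OF H \<alpha> \<beta> True])
  have z: "((\<lambda>y::'a. 0 * U (1 *\<^sub>R y)) has_derivative (\<lambda>h. 0 \<bullet> h)) (at x)" for x by simp
  have p: "partial_deriv b (\<lambda>y::'a. 0 * U (1 *\<^sub>R y)) = (\<lambda>y. 0)" for b using grad_eqI(2)[OF z] by auto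
  have p0: "partial_deriv b (\<lambda>y::'a. 0) = (\<lambda>y. 0)" for b using p by simp
  have gz: "grad (\<lambda>y::'a. 0 * U (1 *\<^sub>R y)) x = 0" "laplacian (\<lambda>y::'a. 0 * U (1 *\<^sub>R y)) x = 0" for x
    using grad_eqI(1)[OF z] unfolding laplacian_def p p0 by auto
  have "AE x in lborel. V x = grad (\<lambda>y. 0 * U (1 *\<^sub>R y)) x \<and> f x = laplacian (\<lambda>y. 0 * U (1 *\<^sub>R y)) x"
    using True f0 by eventually_elim (simp only: gz)
  then show ?thesis by (rule that[rotated]) simp
next
  case False
  show ?thesis
  proof (rule radial_equality[OF rad H \<alpha> \<beta> t L_eq(1) L_pos fin eq False, unfolded L_eq(2,3)], goal_cases)
    case (1 \<tau> q F G)
    have G: "G s * exp (- (2 * m * s)) = q s" for s unfolding 1(4) by (simp add: exp_minus_inverse mult.assoc)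
    have "continuous_on UNIV G" using 1(5) by (auto intro!: continuous_at_imp_continuous_on DERIV_isCont)
    then have Gm: "G \<in> borel_measurable borel" by (rule borel_measurable_continuous_onI)
    have fq: "(\<integral>\<^sup>+s. ennreal (\<bar>q s\<bar> powr (2 * (t - 1)) * exp (2 * (L - m) * s)) \<partial>lborel) < \<infinity>"
      using 1(8) sphere_area_pos[where 'a='a] unfolding grad_int_flux_field[OF 1(2) Gm, where m=m] exponents G
      by (auto simp: ennreal_mult_less_top)
    obtain c \<mu> where \<mu>: "\<mu> > 0" and q: "\<And>s. q s = c * extremal t \<delta> (s + ln \<mu>)"
      by (rule extremal_ode_unique[OF t \<delta> 1(1) 1(6) 1(7) fq]) blast
    \<comment> \<open>Undoes the sign and the power of \<open>\<mu>\<close> that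
      \<open>U_scaled\<close> brings in, so that the flux constant of the dilated multiple is
      \<open>c\<close>.\<close>
    let ?c = "- c * exp (- ((2 + 2 * \<alpha>) * ln \<mu>))"
    have C: "c = - (?c * exp ((2 + 2 * \<alpha>) * ln \<mu>))" by (simp add: exp_minus_inverse mult.assoc exp_add[symmetric])
    have Ge: "G = (\<lambda>s. c * extremal t \<delta> (s + ln \<mu>) * exp (2 * m * s))" using 1(4) q by auto
    note U = U_scaled(2,3)[OF C Ge 1(5)]
    have "AE x in lborel. V x = grad (\<lambda>y. ?c * U (\<mu> *\<^sub>R y)) x \<and> f x = laplacian (\<lambda>y. ?c * U (\<mu> *\<^sub>R y)) x"
      using 1(2,3) AE_nonzero[where 'a='a]
    proof eventually_elim
      case (elim x)
      then show ?case using U[OF elim(3)] \<mu> by simp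
    qed
    then show ?case by (rule that[OF \<mu>])
  qed
qed

end

text \<open>The completion sees \<open>V\<close> and \<open>f\<close> only, so uniqueness is an
  identity for these two almost everywhere, with \<open>c = 0\<close> allowed for the zero element.
  Finiteness of the product excludes an equality between infinite values. For \<open>t > 2\<close>
  membership of \<open>U\<close> in \<open>H2\<close> carries a condition: the gradient decays like
  a power of \<open>|x|\<close>, and \<open>grad_int 2 \<beta> (grad U)\<close> may diverge under
  the given hypotheses. Sharpness and the equality for \<open>U\<close> are independent of that
  condition.\<close>

theorem theorem1p3:
  fixes t \<alpha> \<beta> \<gamma> n \<kappa> :: real and U :: "real ^ 'n \<Rightarrow> real"
  assumes n: "n = real CARD('n)"
    and t: "t \<ge> 2"
    and "n - 2 * \<alpha> > 0" and "n - \<beta> > 0" and "n - t * \<gamma> > 0"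
    and \<gamma>: "\<gamma> = (1 + \<alpha>) / t + \<beta> / (2 * t)"
    and \<kappa>: "\<kappa> = ((n + t * (1 + 2 * \<alpha> - \<gamma>)) / t)\<^sup>2"
    and U: "U = (if t = 2 then U1 \<alpha> \<beta> else U2 t \<alpha> \<beta>)"
  shows
    "(\<forall>(u :: real ^ 'n \<Rightarrow> real) V f. radial u \<and> H2 \<alpha> \<beta> u V f \<longrightarrow>
        lap_int \<alpha> f * grad_int (2 * (t - 1)) \<beta> V \<ge> ennreal \<kappa> * (grad_int t (t * \<gamma>) V)\<^sup>2)
     \<and>
     ((1 + 2 * \<alpha>) * (t - 2) + 1 + \<alpha> - \<beta> / 2 > 0 \<and>
      t < 3 + \<alpha> - \<beta> / 2 \<and>
      n + 2 * \<alpha> > 0 \<and>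
      (t > 2 \<longrightarrow> n - \<beta> < 2 * (t - 1) / (t - 2) * (1 + \<alpha> - \<beta> / 2))
      \<longrightarrow>
        \<comment> \<open>sharpness\<close>
        (\<forall>C :: real.
           (\<forall>(u :: real ^ 'n \<Rightarrow> real) V f. radial u \<and> H2 \<alpha> \<beta> u V f \<longrightarrow>
              lap_int \<alpha> f * grad_int (2 * (t - 1)) \<beta> V \<ge> ennreal C * (grad_int t (t * \<gamma>) V)\<^sup>2)
           \<longrightarrow> C \<le> \<kappa>)
        \<and>
        \<comment> \<open>\<open>U\<close> attains the constant\<close>
        radial U \<and>
        lap_int \<alpha> (laplacian U) < \<infinity> \<and>
        grad_int (2 * (t - 1)) \<beta> (grad U) < \<infinity> \<and>
        0 < grad_int t (t * \<gamma>) (grad U) \<and> grad_int t (t * \<gamma>) (grad U) < \<infinity> \<and>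
        lap_int \<alpha> (laplacian U) * grad_int (2 * (t - 1)) \<beta> (grad U)
          = ennreal \<kappa> * (grad_int t (t * \<gamma>) (grad U))\<^sup>2 \<and>
        (t = 2 \<or> grad_int 2 \<beta> (grad U) < \<infinity> \<longrightarrow> H2 \<alpha> \<beta> U (grad U) (laplacian U))
        \<and>
        \<comment> \<open>only dilations and multiples of \<open>U\<close> attain it\<close>
        (\<forall>(u :: real ^ 'n \<Rightarrow> real) V f.
           radial u \<and> H2 \<alpha> \<beta> u V f \<and>
           lap_int \<alpha> f * grad_int (2 * (t - 1)) \<beta> V < \<infinity> \<and>
           lap_int \<alpha> f * grad_int (2 * (t - 1)) \<beta> V = ennreal \<kappa> * (grad_int t (t * \<gamma>) V)\<^sup>2
           \<longrightarrow> (\<exists>c \<mu> :: real. \<mu> > 0 \<and>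
                 (AE x in lborel. V x = grad (\<lambda>y. c * U (\<mu> *\<^sub>R y)) x \<and>
                                  f x = laplacian (\<lambda>y. c * U (\<mu> *\<^sub>R y)) x))))"
proof -
  have t0: "t > 0" using t by simp
  define L where "L = n - (1 + \<alpha> + \<beta> / 2) + t * (1 + 2 * \<alpha>)"
  have dim: "real DIM(real ^ 'n) = n" using n by simp
  have t\<gamma>: "t * \<gamma> = 1 + \<alpha> + \<beta> / 2" unfolding \<gamma> using t0 by (simp add: field_simps)
  have "n + t * (1 + 2 * \<alpha> - \<gamma>) = L" unfolding right_diff_distrib t\<gamma> L_def by simp
  then have \<kappa>L: "\<kappa> = (L / t)\<^sup>2" unfolding \<kappa> by simp
  have \<alpha>: "real DIM(real ^ 'n) - 2 * \<alpha> > 0" and \<beta>: "real DIM(real ^ 'n) - \<beta> > 0"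
    and L: "L = real DIM(real ^ 'n) - (1 + \<alpha> + \<beta> / 2) + t * (1 + 2 * \<alpha>)"
    using assms(3,4) unfolding dim L_def by auto
  have ext: "extremal_function t \<alpha> \<beta> ((n + 2 * \<alpha>) / 2) ((1 + 2 * \<alpha>) * (t - 2) + 1 + \<alpha> - \<beta> / 2) L U"
    if "(1 + 2 * \<alpha>) * (t - 2) + 1 + \<alpha> - \<beta> / 2 > 0" "t < 3 + \<alpha> - \<beta> / 2" "n + 2 * \<alpha> > 0"
      "t > 2 \<longrightarrow> n - \<beta> < 2 * (t - 1) / (t - 2) * (1 + \<alpha> - \<beta> / 2)"
  proof
    \<comment> \<open>This is the bound on \<open>n - \<beta>\<close>, multiplied by
      \<open>(t - 2) / 2\<close> and rearranged.\<close>
    show "(n + 2 * \<alpha>) / 2 * (t - 2) < (1 + 2 * \<alpha>) * (t - 2) + 1 + \<alpha> - \<beta> / 2"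
    proof (cases "t = 2")
      case False
      then have t2: "t - 2 > 0" using t by simp
      have "(n - \<beta>) * (t - 2) < 2 * (t - 1) / (t - 2) * (1 + \<alpha> - \<beta> / 2) * (t - 2)"
        using that(4) t2 by (intro mult_strict_right_mono) auto
      also have "\<dots> = 2 * (t - 1) * (1 + \<alpha> - \<beta> / 2)" using t2 by simp
      finally show ?thesis by (simp add: field_simps)
    qed (use that in simp)
  qed (use that t U dim in \<open>auto simp: L_def algebra_simps\<close>)
  show ?thesis
    unfolding t\<gamma> \<kappa>L
  proof (rule conjI[OF _ impI], goal_cases)
    case 1
    show ?case by (blast intro: radial_inequality[OF _ _ \<alpha> \<beta> t L])
  next
    case 2
    interpret extremal_function t \<alpha> \<beta> "(n + 2 * \<alpha>) / 2" "(1 + 2 * \<alpha>) * (t - 2) + 1 + \<alpha> - \<beta> / 2" L U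
      by (rule ext) (use 2 in auto)
    have fin: "grad_int (2 * (t - 1)) \<beta> (grad U) < \<infinity>" unfolding U_integrals by simp
    show ?case
    proof (intro conjI allI impI, goal_cases)
      case (1 C)
      then show ?case by (intro U_sharp[OF \<beta>]) blast
    next
      case 2
      show ?case by (rule U_radial)
    next
      case 3
      show ?case unfolding U_integrals by simp
    next
      case 4
      show ?case by (rule fin)
    next
      case 5
      show ?case by (rule U_attains)
    next
      case 6
      show ?case unfolding U_integrals by simp
    next
      case 7
      show ?case by (rule U_attains)
    next
      case 8
      \<comment> \<open>For \<open>t = 2\<close> the exponent \<open>2 * (t - 1)\<close> is 2, so
        this integral is already known to be finite.\<close>
      have "grad_int 2 \<beta> (grad U) < \<infinity>" if "t = 2" using fin that by simp
      with 8 show ?case by (intro U_in_H2) auto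
    next
      case (9 u V f)
      obtain c \<mu> where "\<mu> > 0" "AE x in lborel. V x = grad (\<lambda>y. c * U (\<mu> *\<^sub>R y)) x \<and> f x = laplacian (\<lambda>y. c * U (\<mu> *\<^sub>R y)) x"
        by (rule U_unique[OF _ _ \<alpha> \<beta>, of u V f]) (use 9 in auto)
      then show ?case by blast
    qed
  qed
qed

end
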